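(* Let $\mathcal J$ be an ideal on $\omega$. (1) The following conditions are equivalent: (a) $\mathcal J$ is extendable to a $P^+$-ideal (i.e. $\mathcal J\subseteq\mathcal J'$ for some $P^+$-ideal $\mathcal J'$ on $\omega$); (b) $\mathrm{Fin}^2\not\preceq^{\omega_1}_{\omega^\omega,1-1}\mathcal J$; (c) $\mathrm{Fin}^2\not\preceq^{\omega_1}_{\omega^\omega,\mathrm{Fin}-1}\mathcal J$; (d) $\mathrm{Fin}^2\not\preceq^{\omega_1}_{\omega^\omega,\omega^\omega}\mathcal J$. (2) Under CH, the conditions (a), (b), (c), (d) listed in (1) are equivalent to each of the following: (e) there is a P-point which is not a $\mathcal J$-point; (f) there is a P-point which is not a weak $\mathcal J$-ultrafilter; (g) there is a P-point which is not a $\mathcal J$-ultrafilter. (3) If $\mathcal J$ is Borel, then CH can be relaxed to the assumption $\mathfrak p=\mathfrak c$ in (2). (4) If $\mathcal J$ is Borel, then the following conditions are equivalent: (a) it is consistent that there exists a P-point which is not a $\mathcal J$-point (weak $\mathcal J$-ultrafilter, or $\mathcal J$-ultrafilter, respectively); (b) under CH, there exists a P-point which is not a $\mathcal J$-point (weak $\mathcal J$-ultrafilter, or $\mathcal J$-ultrafilter, respectively).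
   Context: An ideal on a set $X$ is a family of subsets of $X$ closed under finite unions and subsets, containing all finite subsets of $X$ and not containing $X$; $\mathcal J^+=\mathcal P(X)\setminus\mathcal J$. Borel refers to the topology of $\mathcal P(\omega)\cong\{0,1\}^\omega$. Ideals on countably infinite sets are regarded as ideals on $\omega$ via fixed bijections. $\mathrm{Fin}^2=\{A\subseteq\omega\times\omega:$ for all but finitely many $n$ the section $\{k:(n,k)\in A\}$ is finite$\}$. $\mathfrak c=2^{\aleph_0}$, and $\mathfrak p$ is the usual pseudointersection number. $\mathcal J$ is a $P^+$-ideal if for every decreasing sequence $(A_n)_{n\in\omega}$ of sets in $\mathcal J^+$ there is $A\in\mathcal J^+$, $A\subseteq A_0$, such that $A\cap(A_n\setminus A_{n+1})$ is finite for every $n$. For $\mathcal F\subseteq\omega^\omega$ and ideals $\mathcal I,\mathcal K$ on $\omega$, $\mathcal I\le_{\mathcal F}\mathcal K$ means that there is $f\in\mathcal F$ with $f^{-1}[B]\in\mathcal K$ for every $B\in\mathcal I$. $\mathrm{Fin}-1$ and $1-1$ denote the families of all finite-to-one, respectively one-to-one, functions $\omega\to\omega$. For an ideal $\mathcal K$ on $\omega$ and $\mathcal A\subseteq\mathcal P(\omega)$, $\mathcal K(\mathcal A)=\{B\subseteq\omega:\exists F\in[\mathcal A]^{<\omega}\ (B\setminus\bigcup F\in\mathcal K)\}$. $\mathcal I\preceq^{\omega_1}_{\mathcal F,\mathcal G}\mathcal J$ means: for each ideal $\mathcal J'$ on $\omega$ with $\mathcal J\le_{\mathcal G}\mathcal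 J'$ there is a countable $\mathcal A\subseteq\mathcal P(\omega)$ with $\omega\notin\mathcal J'(\mathcal A)$ and $\mathcal I\le_{\mathcal F}\mathcal J'(\mathcal A)$. Ultrafilters on $\omega$ contain all cofinite sets; $\mathcal U^*=\{\omega\setminus A:A\in\mathcal U\}$. $\mathcal U$ is a P-point if $\mathcal U^*$ is a P-ideal: for every countable $\mathcal A\subseteq\mathcal U^*$ there is $B\in\mathcal U$ with $A\cap B$ finite for all $A\in\mathcal A$. $\mathcal U$ is a $\mathcal J$-ultrafilter (weak $\mathcal J$-ultrafilter, $\mathcal J$-point) if $\mathcal J\not\le_{\mathcal F}\mathcal U^*$ for $\mathcal F=\omega^\omega$ ($\mathrm{Fin}-1$, $1-1$, respectively). "It is consistent that $\varphi$" means that $\varphi$ is consistent with ZFC, Borel ideals being understood through their Borel definitions (codes); "under CH, $\varphi$" means that CH implies $\varphi$.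
   Formalization: In (4), "consistent" means true in some countable transitive model of ZFC containing a Borel code of J, at least one such model is assumed to exist, and "under CH" means CH implies it in the universe and in every such model; for bare syntactic consistency (4) is undefined or false. *)

theory Defs
  imports "HOL-Analysis.Analysis" "HOL-Library.Nat_Bijection"
begin

unbundle cardinal_syntax

section \<open>Ideals\<close>

definition ideal_on :: "'a set \<Rightarrow> 'a set set \<Rightarrow> bool" where
  "ideal_on X J \<longleftrightarrow>
     (\<forall>A\<in>J. A \<subseteq> X) \<and>
     (\<forall>A\<in>J. \<forall>B\<in>J. A \<union> B \<in> J) \<and>
     (\<forall>A\<in>J. \<forall>B. B \<subseteq> A \<longrightarrow> B \<in> J) \<and>
     (\<forall>A. finite A \<and> A \<subseteq> X \<longrightarrow> A \<in> J) \<and>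
     X \<notin> J"

abbreviation ideal :: "nat set set \<Rightarrow> bool" where
  "ideal \<equiv> ideal_on UNIV"

definition Fin2 :: "(nat \<times> nat) set set" where
  "Fin2 = {A. finite {n. infinite {k. (n, k) \<in> A}}}"

text \<open>The copy of \<^const>\<open>Fin2\<close> on the natural numbers, along the bijection \<^const>\<open>prod_encode\<close>.\<close>

definition Fin2_nat :: "nat set set" where
  "Fin2_nat = (\<lambda>A. prod_encode ` A) ` Fin2"

definition P_plus_ideal :: "nat set set \<Rightarrow> bool" where
  "P_plus_ideal J \<longleftrightarrow> ideal J \<and>
     (\<forall>A :: nat \<Rightarrow> nat set. (\<forall>n. A n \<notin> J) \<and> (\<forall>n. A (Suc n) \<subseteq> A n) \<longrightarrow>
        (\<exists>B. B \<notin> J \<and> B \<subseteq> A 0 \<and> (\<forall>n. finite (B \<inter> (A n - A (Suc n))))))"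

definition extendable_to_P_plus :: "nat set set \<Rightarrow> bool" where
  "extendable_to_P_plus J \<longleftrightarrow> (\<exists>J'. P_plus_ideal J' \<and> J \<subseteq> J')"

text \<open>The families \<open>1-1\<close> and \<open>Fin-1\<close>; the family of all functions is \<^const>\<open>UNIV\<close>.\<close>

definition one_one :: "(nat \<Rightarrow> nat) set" where
  "one_one = {f. inj f}"

definition fin_one :: "(nat \<Rightarrow> nat) set" where
  "fin_one = {f. \<forall>y. finite (f -` {y})}"

definition ideal_le :: "(nat \<Rightarrow> nat) set \<Rightarrow> nat set set \<Rightarrow> nat set set \<Rightarrow> bool" where
  "ideal_le F I K \<longleftrightarrow> (\<exists>f\<in>F. \<forall>B\<in>I. f -` B \<in> K)"

definition ideal_adjoin :: "nat set set \<Rightarrow> nat set set \<Rightarrow> nat set set" where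
  "ideal_adjoin K \<A> = {B. \<exists>F. finite F \<and> F \<subseteq> \<A> \<and> B - \<Union>F \<in> K}"

definition preceq_omega1 ::
  "(nat \<Rightarrow> nat) set \<Rightarrow> (nat \<Rightarrow> nat) set \<Rightarrow> nat set set \<Rightarrow> nat set set \<Rightarrow> bool" where
  "preceq_omega1 F G I J \<longleftrightarrow>
     (\<forall>J'. ideal J' \<and> ideal_le G J J' \<longrightarrow>
        (\<exists>\<A> :: nat set set. countable \<A> \<and> UNIV \<notin> ideal_adjoin J' \<A> \<and>
           ideal_le F I (ideal_adjoin J' \<A>)))"

section \<open>Ultrafilters\<close>

definition ultrafilter :: "nat set set \<Rightarrow> bool" where
  "ultrafilter U \<longleftrightarrow>
     {} \<notin> U \<and>
     (\<forall>A\<in>U. \<forall>B. A \<subseteq> B \<longrightarrow> B \<in> U) \<and>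
     (\<forall>A\<in>U. \<forall>B\<in>U. A \<inter> B \<in> U) \<and>
     (\<forall>A. A \<in> U \<or> - A \<in> U) \<and>
     (\<forall>A. finite A \<longrightarrow> - A \<in> U)"

definition dual_ideal :: "nat set set \<Rightarrow> nat set set" where
  "dual_ideal U = {- A | A. A \<in> U}"

definition P_point :: "nat set set \<Rightarrow> bool" where
  "P_point U \<longleftrightarrow> ultrafilter U \<and>
     (\<forall>\<A>. countable \<A> \<and> \<A> \<subseteq> dual_ideal U \<longrightarrow> (\<exists>B\<in>U. \<forall>A\<in>\<A>. finite (A \<inter> B)))"

definition J_ultrafilter :: "nat set set \<Rightarrow> nat set set \<Rightarrow> bool" where
  "J_ultrafilter J U \<longleftrightarrow> ultrafilter U \<and> \<not> ideal_le UNIV J (dual_ideal U)"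

definition weak_J_ultrafilter :: "nat set set \<Rightarrow> nat set set \<Rightarrow> bool" where
  "weak_J_ultrafilter J U \<longleftrightarrow> ultrafilter U \<and> \<not> ideal_le fin_one J (dual_ideal U)"

definition J_point :: "nat set set \<Rightarrow> nat set set \<Rightarrow> bool" where
  "J_point J U \<longleftrightarrow> ultrafilter U \<and> \<not> ideal_le one_one J (dual_ideal U)"

section \<open>Cardinal hypotheses\<close>

definition CH :: bool where
  "CH \<longleftrightarrow> (\<forall>X :: nat set set. countable X \<or> (\<exists>f. bij_betw f X (UNIV :: nat set set)))"

text \<open>Witnesses for the pseudointersection number: families with the strong finite
  intersection property that have no infinite pseudointersection.\<close>

definition sfip_no_pseudointersection :: "nat set set \<Rightarrow> bool" where
  "sfip_no_pseudointersection F \<longleftrightarrow>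
     (\<forall>G. finite G \<and> G \<subseteq> F \<longrightarrow> infinite (\<Inter>G)) \<and>
     \<not> (\<exists>B. infinite B \<and> (\<forall>A\<in>F. finite (B - A)))"

definition pseudointersection_number :: "nat set rel" where
  "pseudointersection_number =
     |SOME F. sfip_no_pseudointersection F \<and>
        (\<forall>G. sfip_no_pseudointersection G \<longrightarrow> |F| \<le>o |G| )|"

definition p_eq_c :: bool where
  "p_eq_c \<longleftrightarrow> (pseudointersection_number, |UNIV :: nat set set| ) \<in> ordIso"

section \<open>Borel families and Borel codes\<close>

text \<open>Identifying a set with its characteristic function, \<open>\<P>(\<omega>)\<close> carries the product topology of
  \<^typ>\<open>nat \<Rightarrow> bool\<close>.\<close>

definition borel_family :: "nat set set \<Rightarrow> bool" where
  "borel_family J \<longleftrightarrow> {h :: nat \<Rightarrow> bool. Collect h \<in> J} \<in> sets borel"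

text \<open>A Borel code is a pair \<open>(L, R)\<close> of binary relations on \<open>\<omega>\<close>. The natural numbers are the nodes,
  \<open>(n, m) \<in> R\<close> means that \<open>m\<close> is a child of \<open>n\<close>, and node \<open>n\<close> stands for the set
  \<open>D\<^sub>n = \<Union>{{A. k \<in> A} | k. (n, k) \<in> L} \<union> \<Union>{\<P>(\<omega>) \<setminus> D\<^sub>m | m. (n, m) \<in> R}\<close>.
  The coded set is \<open>D\<^sub>0\<close>. The set \<open>T\<close> below is \<open>{n. A \<in> D\<^sub>n}\<close>; it is unique by well-foundedness.\<close>

type_synonym borel_code = "nat rel \<times> nat rel"

definition is_borel_code :: "borel_code \<Rightarrow> bool" where
  "is_borel_code c \<longleftrightarrow> wf ((snd c)\<inverse>)"

definition code_eval :: "borel_code \<Rightarrow> nat set \<Rightarrow> nat set \<Rightarrow> bool" where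
  "code_eval c A T \<longleftrightarrow>
     (\<forall>n. n \<in> T \<longleftrightarrow> (\<exists>k\<in>A. (n, k) \<in> fst c) \<or> (\<exists>m. (n, m) \<in> snd c \<and> m \<notin> T))"

definition coded_family :: "borel_code \<Rightarrow> nat set set" where
  "coded_family c = {A. \<exists>T. code_eval c A T \<and> 0 \<in> T}"

lemma code_eval_ex1:
  assumes "is_borel_code c"
  shows "\<exists>!T. code_eval c A T"
proof -
  have wf: "wf ((snd c)\<inverse>)"
    using assms by (simp add: is_borel_code_def)
  define H where "H = (\<lambda>P n. (\<exists>k\<in>A. (n, k) \<in> fst c) \<or> (\<exists>m. (n, m) \<in> snd c \<and> \<not> P m))"
  define T where "T = Collect (wfrec ((snd c)\<inverse>) H)"
  have "wfrec ((snd c)\<inverse>) H n = H (wfrec ((snd c)\<inverse>) H) n" for n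
    by (subst wfrec[OF wf]) (auto simp: H_def cut_apply)
  then have T: "code_eval c A T"
    unfolding code_eval_def T_def mem_Collect_eq H_def by blast
  have "T1 = T2" if 1: "code_eval c A T1" and 2: "code_eval c A T2" for T1 T2
  proof -
    have "n \<in> T1 \<longleftrightarrow> n \<in> T2" for n
    proof (induction n rule: wf_induct_rule[OF wf])
      case (1 n)
      have "m \<in> T1 \<longleftrightarrow> m \<in> T2" if "(n, m) \<in> snd c" for m
        using 1 that by simp
      then show ?case
        using \<open>code_eval c A T1\<close> \<open>code_eval c A T2\<close> unfolding code_eval_def by blast
    qed
    then show ?thesis by blast
  qed
  with T show ?thesis by blast
qed

lemma coded_family_iff:
  assumes "is_borel_code c" "code_eval c A T"
  shows "A \<in> coded_family c \<longleftrightarrow> 0 \<in> T"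
proof -
  have "T' = T" if "code_eval c A T'" for T'
    using code_eval_ex1[OF assms(1), of A] assms(2) that by blast
  then show ?thesis
    unfolding coded_family_def mem_Collect_eq using assms(2) by blast
qed

lemma coded_family_Union_Compl:
  fixes c :: "nat \<Rightarrow> borel_code"
  assumes c: "\<And>i. is_borel_code (c i)"
  obtains d where "is_borel_code d" "coded_family d = (\<Union>i. - coded_family (c i))"
proof -
  define e where "e = (\<lambda>i n. Suc (prod_encode (i, n)))"
  have e_inj [simp]: "e i n = e j m \<longleftrightarrow> i = j \<and> n = m" for i j n m
    by (simp add: e_def)
  have e_0 [simp]: "e i n \<noteq> 0" "0 \<noteq> e i n" for i n
    by (simp_all add: e_def)
  have e_cases: "x = 0 \<or> (\<exists>i n. x = e i n)" for x
  proof (cases x)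
    case (Suc y)
    obtain i n where "prod_decode y = (i, n)" by (cases "prod_decode y")
    then have "y = prod_encode (i, n)" by (metis prod_decode_inverse)
    with Suc show ?thesis by (auto simp: e_def)
  qed simp
  define L where "L = {(e i n, k) | i n k. (n, k) \<in> fst (c i)}"
  define R where "R = {(0, e i 0) | i. True} \<union> {(e i n, e i m) | i n m. (n, m) \<in> snd (c i)}"
  define d where "d = (L, R)"
  have d: "is_borel_code d"
    unfolding is_borel_code_def
  proof (rule wfUNIVI)
    fix P x
    assume "\<forall>x. (\<forall>y. (y, x) \<in> (snd d)\<inverse> \<longrightarrow> P y) \<longrightarrow> P x"
    then have step: "P x" if "\<And>y. (x, y) \<in> R \<Longrightarrow> P y" for x
      using that by (simp add: d_def)
    have P_e: "P (e i n)" for i n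
    proof -
      have wf: "wf ((snd (c i))\<inverse>)" using c by (simp add: is_borel_code_def)
      show ?thesis
      proof (induction n rule: wf_induct_rule[OF wf])
        case (1 n)
        show ?case
        proof (rule step)
          fix y assume "(e i n, y) \<in> R"
          then obtain m where "y = e i m" "(n, m) \<in> snd (c i)"
            by (auto simp: R_def)
          with 1 show "P y" by simp
        qed
      qed
    qed
    have "P 0"
      by (rule step) (use P_e in \<open>auto simp: R_def\<close>)
    with P_e show "P x" using e_cases[of x] by blast
  qed
  have "A \<in> coded_family d \<longleftrightarrow> (\<exists>i. A \<notin> coded_family (c i))" for A
  proof -
    obtain T where T: "code_eval d A T" using code_eval_ex1[OF d] by blast
    have unf: "x \<in> T \<longleftrightarrow> (\<exists>k\<in>A. (x, k) \<in> L) \<or> (\<exists>m. (x, m) \<in> R \<and> m \<notin> T)" for x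
      using T[unfolded code_eval_def d_def fst_conv snd_conv] by (rule spec)
    have ev: "code_eval (c i) A {n. e i n \<in> T}" for i
      unfolding code_eval_def
    proof
      fix n
      have "e i n \<in> T \<longleftrightarrow> (\<exists>k\<in>A. (e i n, k) \<in> L) \<or> (\<exists>m. (e i n, m) \<in> R \<and> m \<notin> T)"
        by (rule unf)
      also have "\<dots> \<longleftrightarrow> (\<exists>k\<in>A. (n, k) \<in> fst (c i)) \<or> (\<exists>m. (n, m) \<in> snd (c i) \<and> e i m \<notin> T)"
        unfolding L_def R_def by auto
      finally show "n \<in> {n. e i n \<in> T} \<longleftrightarrow>
          (\<exists>k\<in>A. (n, k) \<in> fst (c i)) \<or> (\<exists>m. (n, m) \<in> snd (c i) \<and> m \<notin> {n. e i n \<in> T})"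
        unfolding mem_Collect_eq .
    qed
    have "0 \<in> T \<longleftrightarrow> (\<exists>k\<in>A. (0, k) \<in> L) \<or> (\<exists>m. (0, m) \<in> R \<and> m \<notin> T)"
      by (rule unf)
    also have "\<dots> \<longleftrightarrow> (\<exists>i. e i 0 \<notin> T)"
      unfolding L_def R_def by auto
    finally show ?thesis
      using coded_family_iff[OF d T] coded_family_iff[OF c ev] by simp
  qed
  then have "coded_family d = (\<Union>i. - coded_family (c i))" by (intro set_eqI) simp
  with d show ?thesis by (rule that)
qed

definition coded_sets :: "nat set set set" where
  "coded_sets = {coded_family c | c. is_borel_code c}"

lemma coded_sets_Union_Compl:
  assumes "\<And>i :: nat. B i \<in> coded_sets"
  shows "(\<Union>i. - B i) \<in> coded_sets"
proof -
  have "\<forall>i. \<exists>c. is_borel_code c \<and> B i = coded_family c"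
    using assms unfolding coded_sets_def by blast
  then obtain c where c: "\<And>i. is_borel_code (c i)" "\<And>i. B i = coded_family (c i)"
    by metis
  obtain d where "is_borel_code d" "coded_family d = (\<Union>i. - coded_family (c i))"
    using coded_family_Union_Compl[of c] c(1) by blast
  then show ?thesis
    unfolding coded_sets_def c(2) by (metis (mono_tags, lifting) mem_Collect_eq)
qed

lemma coded_sets_Compl: "B \<in> coded_sets \<Longrightarrow> - B \<in> coded_sets"
  using coded_sets_Union_Compl[of "\<lambda>_. B"] by simp

lemma coded_sets_Union: "(\<And>i :: nat. B i \<in> coded_sets) \<Longrightarrow> (\<Union>i. B i) \<in> coded_sets"
  using coded_sets_Union_Compl[of "\<lambda>i. - B i", OF coded_sets_Compl]
  by (simp only: double_complement)

lemma coded_sets_Inter: "(\<And>i :: nat. B i \<in> coded_sets) \<Longrightarrow> (\<Inter>i. B i) \<in> coded_sets"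
  using coded_sets_Compl[OF coded_sets_Union_Compl[of B]]
  by (simp only: Compl_UN double_complement)

lemma coded_sets_subbasic: "{A. k \<in> A} \<in> coded_sets"
proof -
  have c: "is_borel_code ({(0, k)}, {})" by (simp add: is_borel_code_def)
  have "code_eval ({(0, k)}, {}) A (if k \<in> A then {0} else {})" for A
    by (simp add: code_eval_def)
  from coded_family_iff[OF c this] have "coded_family ({(0, k)}, {}) = {A. k \<in> A}"
    by (intro set_eqI) simp
  then show ?thesis
    unfolding coded_sets_def mem_Collect_eq using c by (intro exI[of _ "({(0, k)}, {})"]) simp
qed

lemma coded_sets_empty: "{} \<in> coded_sets"
proof -
  have c: "is_borel_code ({}, {})" by (simp add: is_borel_code_def)
  have "code_eval ({}, {}) A {}" for A by (simp add: code_eval_def)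
  from coded_family_iff[OF c this] have "coded_family ({}, {}) = {}"
    by (intro set_eqI) simp
  then show ?thesis
    unfolding coded_sets_def mem_Collect_eq using c by (intro exI[of _ "({}, {})"]) simp
qed

lemma coded_sets_open:
  assumes U: "open (U :: (nat \<Rightarrow> bool) set)"
  shows "{A. (\<lambda>k. k \<in> A) \<in> U} \<in> coded_sets"
proof -
  define B where "B = (\<lambda>i k. if k < length (list_decode i)
     then (if list_decode i ! k = 0 then {A. k \<in> A} else - {A. k \<in> A}) else (UNIV :: nat set set))"
  define C where "C = (\<lambda>i. \<Inter>k. B i k)"
  define D where "D = (\<lambda>i. if C i \<subseteq> {A. (\<lambda>k. k \<in> A) \<in> U} then C i else {})"
  have "B i k \<in> coded_sets" for i k
    using coded_sets_subbasic[of k] coded_sets_Compl[of "{A. k \<in> A}"]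
      coded_sets_Compl[OF coded_sets_empty]
    by (simp add: B_def)
  then have "C i \<in> coded_sets" for i
    unfolding C_def by (rule coded_sets_Inter)
  then have "D i \<in> coded_sets" for i
    by (simp add: D_def coded_sets_empty)
  then have "(\<Union>i. D i) \<in> coded_sets" by (rule coded_sets_Union)
  moreover have "(\<Union>i. D i) = {A. (\<lambda>k. k \<in> A) \<in> U}"
  proof (intro equalityI subsetI)
    fix A assume "A \<in> {A. (\<lambda>k. k \<in> A) \<in> U}"
    then have "(\<lambda>k. k \<in> A) \<in> U" by simp
    moreover have "openin (product_topology (\<lambda>i. euclidean) UNIV) U"
      using U by (simp add: open_fun_def)
    ultimately obtain X where X: "(\<lambda>k. k \<in> A) \<in> (\<Pi>\<^sub>E i\<in>UNIV. X i)"
        "finite {i. X i \<noteq> topspace (euclidean :: bool topology)}" "(\<Pi>\<^sub>E i\<in>UNIV. X i) \<subseteq> U"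
      using product_topology_open_contains_basis[of "\<lambda>i. euclidean" UNIV U "\<lambda>k. k \<in> A"] by metis
    from X(2) obtain N where N: "\<And>i. X i \<noteq> UNIV \<Longrightarrow> i < N"
      by (auto simp: finite_nat_set_iff_bounded)
    define i where "i = list_encode (map (\<lambda>k. if k \<in> A then 0 else 1) [0..<N])"
    have Ci: "C i = {A'. \<forall>k<N. k \<in> A' \<longleftrightarrow> k \<in> A}"
      unfolding C_def B_def i_def by (auto split: if_splits)
    have "C i \<subseteq> {A. (\<lambda>k. k \<in> A) \<in> U}"
    proof
      fix A' assume A': "A' \<in> C i"
      have "(k \<in> A') \<in> X k" for k
        using N[of k] A' X(1) unfolding Ci PiE_UNIV_domain by (cases "k < N") (auto simp: Pi_iff)
      then show "A' \<in> {A. (\<lambda>k. k \<in> A) \<in> U}" using X(3) by (auto simp: PiE_UNIV_domain)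
    qed
    moreover have "A \<in> C i" unfolding Ci by simp
    ultimately show "A \<in> (\<Union>i. D i)" unfolding D_def by auto
  qed (auto simp: D_def split: if_splits)
  ultimately show ?thesis by simp
qed

lemma borel_family_coded_family:
  assumes c: "is_borel_code c"
  shows "borel_family (coded_family c)"
proof -
  have wf: "wf ((snd c)\<inverse>)" using c by (simp add: is_borel_code_def)
  define T where "T = (\<lambda>A. THE T. code_eval c A T)"
  have T: "code_eval c A (T A)" for A
    unfolding T_def by (rule theI'[OF code_eval_ex1[OF c]])
  have sub: "{h :: nat \<Rightarrow> bool. h k} \<in> sets borel" for k
  proof -
    have "continuous_on UNIV (\<lambda>h :: nat \<Rightarrow> bool. h k)"
      by (rule continuous_on_product_coordinates)
    then have "open ((\<lambda>h :: nat \<Rightarrow> bool. h k) -` {True})"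
      by (rule open_vimage[rotated]) (rule open_discrete)
    moreover have "(\<lambda>h :: nat \<Rightarrow> bool. h k) -` {True} = {h. h k}" by auto
    ultimately show ?thesis by (metis borel_open)
  qed
  have "{h :: nat \<Rightarrow> bool. n \<in> T (Collect h)} \<in> sets borel" for n
  proof (induction n rule: wf_induct_rule[OF wf])
    case (1 n)
    have "n \<in> T (Collect h) \<longleftrightarrow>
        (\<exists>k. h k \<and> (n, k) \<in> fst c) \<or> (\<exists>m. (n, m) \<in> snd c \<and> m \<notin> T (Collect h))" for h
      using T[of "Collect h"] unfolding code_eval_def by blast
    then have "{h :: nat \<Rightarrow> bool. n \<in> T (Collect h)} =
       (\<Union>k\<in>{k. (n, k) \<in> fst c}. {h. h k}) \<union>
       (\<Union>m\<in>{m. (n, m) \<in> snd c}. - {h. m \<in> T (Collect h)})"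
      by blast
    also have "\<dots> \<in> sets borel"
      using 1 by (intro sets.Un sets.countable_UN'' borel_comp sub) auto
    finally show ?case .
  qed
  from this[of 0] show ?thesis
    unfolding borel_family_def coded_family_iff[OF c T] .
qed

text \<open>The Borel families are exactly the coded ones.\<close>

theorem borel_family_iff_coded:
  "borel_family J \<longleftrightarrow> (\<exists>c. is_borel_code c \<and> coded_family c = J)"
proof
  assume "borel_family J"
  then have "{h :: nat \<Rightarrow> bool. Collect h \<in> J} \<in> sigma_sets UNIV {S. open S}"
    by (simp add: borel_family_def sets_borel)
  moreover have "{A. (\<lambda>k. k \<in> A) \<in> S} \<in> coded_sets"
    if "S \<in> sigma_sets UNIV {S :: (nat \<Rightarrow> bool) set. open S}" for S
    using that
  proof induction
    case (Basic a)
    then show ?case using coded_sets_open by simp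
  next
    case Empty
    then show ?case using coded_sets_empty by simp
  next
    case (Compl a)
    have "{A. (\<lambda>k. k \<in> A) \<in> UNIV - a} = - {A. (\<lambda>k. k \<in> A) \<in> a}" by auto
    then show ?case using coded_sets_Compl[OF Compl.IH] by simp
  next
    case (Union a)
    have "{A. (\<lambda>k. k \<in> A) \<in> (\<Union>i. a i)} = (\<Union>i. {A. (\<lambda>k. k \<in> A) \<in> a i})" by auto
    then show ?case using coded_sets_Union[OF Union.IH] by simp
  qed
  ultimately have "{A. (\<lambda>k. k \<in> A) \<in> {h. Collect h \<in> J}} \<in> coded_sets"
    by blast
  then have "J \<in> coded_sets" by simp
  then show "\<exists>c. is_borel_code c \<and> coded_family c = J"
    unfolding coded_sets_def mem_Collect_eq by metis
next
  assume "\<exists>c. is_borel_code c \<and> coded_family c = J"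
  then obtain c where "is_borel_code c" "coded_family c = J" by (elim exE conjE)
  then show "borel_family J" using borel_family_coded_family[of c] by simp
qed

section \<open>Models of set theory\<close>

text \<open>First-order formulas of set theory, needed for the two axiom schemata only. Variables are
  de Bruijn indices.\<close>

datatype fm = Mem nat nat | Eq nat nat | Neg fm | Conj fm fm | All fm

primrec sat :: "('m \<Rightarrow> 'm \<Rightarrow> bool) \<Rightarrow> (nat \<Rightarrow> 'm) \<Rightarrow> fm \<Rightarrow> bool" where
  "sat E v (Mem i j) \<longleftrightarrow> E (v i) (v j)"
| "sat E v (Eq i j) \<longleftrightarrow> v i = v j"
| "sat E v (Neg p) \<longleftrightarrow> \<not> sat E v p"
| "sat E v (Conj p q) \<longleftrightarrow> sat E v p \<and> sat E v q"
| "sat E v (All p) \<longleftrightarrow> (\<forall>x. sat E (case_nat x v) p)"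

text \<open>In the following locale every quantifier over \<^typ>\<open>'m\<close> ranges over the elements of a
  structure \<open>('m, \<epsilon>)\<close> for the language of set theory, so that (apart from \<open>zfc\<close>,
  \<open>is_numeral\<close> and \<open>represents\<close>) the notions below are the interpretations in that structure
  of the corresponding first-order formulas.\<close>

locale set_structure =
  fixes mem :: "'m \<Rightarrow> 'm \<Rightarrow> bool"  (infix "\<epsilon>" 50)
begin

definition sub :: "'m \<Rightarrow> 'm \<Rightarrow> bool" where
  "sub a b \<longleftrightarrow> (\<forall>x. x \<epsilon> a \<longrightarrow> x \<epsilon> b)"

definition is_empty :: "'m \<Rightarrow> bool" where
  "is_empty a \<longleftrightarrow> (\<forall>x. \<not> x \<epsilon> a)"

definition is_upair :: "'m \<Rightarrow> 'm \<Rightarrow> 'm \<Rightarrow> bool" where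
  "is_upair p x y \<longleftrightarrow> (\<forall>z. z \<epsilon> p \<longleftrightarrow> z = x \<or> z = y)"

text \<open>Kuratowski pairs: \<open>p = {{x}, {x, y}}\<close>.\<close>

definition is_opair :: "'m \<Rightarrow> 'm \<Rightarrow> 'm \<Rightarrow> bool" where
  "is_opair p x y \<longleftrightarrow> (\<forall>z. z \<epsilon> p \<longleftrightarrow> is_upair z x x \<or> is_upair z x y)"

definition is_succ :: "'m \<Rightarrow> 'm \<Rightarrow> bool" where
  "is_succ s x \<longleftrightarrow> (\<forall>z. z \<epsilon> s \<longleftrightarrow> z \<epsilon> x \<or> z = x)"

definition is_inter :: "'m \<Rightarrow> 'm \<Rightarrow> 'm \<Rightarrow> bool" where
  "is_inter c a b \<longleftrightarrow> (\<forall>z. z \<epsilon> c \<longleftrightarrow> z \<epsilon> a \<and> z \<epsilon> b)"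

definition is_diff :: "'m \<Rightarrow> 'm \<Rightarrow> 'm \<Rightarrow> bool" where
  "is_diff c a b \<longleftrightarrow> (\<forall>z. z \<epsilon> c \<longleftrightarrow> z \<epsilon> a \<and> \<not> z \<epsilon> b)"

definition is_Union :: "'m \<Rightarrow> 'm \<Rightarrow> bool" where
  "is_Union u a \<longleftrightarrow> (\<forall>z. z \<epsilon> u \<longleftrightarrow> (\<exists>x. x \<epsilon> a \<and> z \<epsilon> x))"

definition is_power :: "'m \<Rightarrow> 'm \<Rightarrow> bool" where
  "is_power p a \<longleftrightarrow> (\<forall>x. x \<epsilon> p \<longleftrightarrow> sub x a)"

definition is_inductive :: "'m \<Rightarrow> bool" where
  "is_inductive a \<longleftrightarrow>
     (\<exists>e. is_empty e \<and> e \<epsilon> a) \<and> (\<forall>x. x \<epsilon> a \<longrightarrow> (\<exists>s. is_succ s x \<and> s \<epsilon> a))"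

definition is_omega :: "'m \<Rightarrow> bool" where
  "is_omega w \<longleftrightarrow> is_inductive w \<and> (\<forall>v. is_inductive v \<longrightarrow> sub w v)"

definition zfc :: bool where
  "zfc \<longleftrightarrow>
     \<comment> \<open>extensionality\<close>
     (\<forall>x y. (\<forall>z. z \<epsilon> x \<longleftrightarrow> z \<epsilon> y) \<longrightarrow> x = y) \<and>
     \<comment> \<open>foundation\<close>
     (\<forall>x. (\<exists>y. y \<epsilon> x) \<longrightarrow> (\<exists>y. y \<epsilon> x \<and> \<not> (\<exists>z. z \<epsilon> x \<and> z \<epsilon> y))) \<and>
     \<comment> \<open>pairing\<close>
     (\<forall>x y. \<exists>p. is_upair p x y) \<and>
     \<comment> \<open>union\<close>
     (\<forall>a. \<exists>u. is_Union u a) \<and>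
     \<comment> \<open>power set\<close>
     (\<forall>a. \<exists>p. is_power p a) \<and>
     \<comment> \<open>infinity\<close>
     (\<exists>a. is_inductive a) \<and>
     \<comment> \<open>choice\<close>
     (\<forall>a. (\<forall>x. x \<epsilon> a \<longrightarrow> (\<exists>z. z \<epsilon> x)) \<and>
          (\<forall>x y. x \<epsilon> a \<and> y \<epsilon> a \<and> x \<noteq> y \<longrightarrow> \<not> (\<exists>z. z \<epsilon> x \<and> z \<epsilon> y)) \<longrightarrow>
          (\<exists>c. \<forall>x. x \<epsilon> a \<longrightarrow> (\<exists>!z. z \<epsilon> x \<and> z \<epsilon> c))) \<and>
     \<comment> \<open>separation schema\<close>
     (\<forall>p v a. \<exists>b. \<forall>x. x \<epsilon> b \<longleftrightarrow> x \<epsilon> a \<and> sat (\<epsilon>) (case_nat x v) p) \<and>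
     \<comment> \<open>replacement schema\<close>
     (\<forall>p v a. (\<forall>x. x \<epsilon> a \<longrightarrow> (\<exists>!y. sat (\<epsilon>) (case_nat x (case_nat y v)) p)) \<longrightarrow>
        (\<exists>b. \<forall>y. y \<epsilon> b \<longleftrightarrow> (\<exists>x. x \<epsilon> a \<and> sat (\<epsilon>) (case_nat x (case_nat y v)) p)))"

definition related :: "'m \<Rightarrow> 'm \<Rightarrow> 'm \<Rightarrow> bool" where
  "related f x y \<longleftrightarrow> (\<exists>p. p \<epsilon> f \<and> is_opair p x y)"

definition is_map :: "'m \<Rightarrow> 'm \<Rightarrow> 'm \<Rightarrow> bool" where
  "is_map f a b \<longleftrightarrow>
     (\<forall>p. p \<epsilon> f \<longrightarrow> (\<exists>x y. x \<epsilon> a \<and> y \<epsilon> b \<and> is_opair p x y)) \<and>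
     (\<forall>x. x \<epsilon> a \<longrightarrow> (\<exists>!y. related f x y))"

definition is_inj_map :: "'m \<Rightarrow> 'm \<Rightarrow> 'm \<Rightarrow> bool" where
  "is_inj_map f a b \<longleftrightarrow> is_map f a b \<and>
     (\<forall>x x' y. related f x y \<and> related f x' y \<longrightarrow> x = x')"

definition is_bij_map :: "'m \<Rightarrow> 'm \<Rightarrow> 'm \<Rightarrow> bool" where
  "is_bij_map f a b \<longleftrightarrow> is_inj_map f a b \<and> (\<forall>y. y \<epsilon> b \<longrightarrow> (\<exists>x. related f x y))"

definition is_finite :: "'m \<Rightarrow> bool" where
  "is_finite a \<longleftrightarrow> (\<exists>w n f. is_omega w \<and> n \<epsilon> w \<and> is_bij_map f a n)"

definition is_countable :: "'m \<Rightarrow> bool" where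
  "is_countable a \<longleftrightarrow> (\<exists>w f. is_omega w \<and> is_inj_map f a w)"

definition satisfies_CH :: bool where
  "satisfies_CH \<longleftrightarrow>
     (\<forall>w p x. is_omega w \<and> is_power p w \<and> sub x p \<longrightarrow>
        is_countable x \<or> (\<exists>f. is_bij_map f x p))"

text \<open>From here on the parameter \<open>w\<close> stands for the \<open>\<omega>\<close> of the structure.\<close>

definition is_ultrafilter :: "'m \<Rightarrow> 'm \<Rightarrow> bool" where
  "is_ultrafilter w u \<longleftrightarrow>
     (\<forall>a. a \<epsilon> u \<longrightarrow> sub a w) \<and>
     (\<forall>a. is_empty a \<longrightarrow> \<not> a \<epsilon> u) \<and>
     (\<forall>a b. a \<epsilon> u \<and> sub a b \<and> sub b w \<longrightarrow> b \<epsilon> u) \<and>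
     (\<forall>a b c. a \<epsilon> u \<and> b \<epsilon> u \<and> is_inter c a b \<longrightarrow> c \<epsilon> u) \<and>
     (\<forall>a b. sub a w \<and> is_diff b w a \<longrightarrow> a \<epsilon> u \<or> b \<epsilon> u) \<and>
     (\<forall>a b. sub a w \<and> is_finite a \<and> is_diff b w a \<longrightarrow> b \<epsilon> u)"

definition in_dual :: "'m \<Rightarrow> 'm \<Rightarrow> 'm \<Rightarrow> bool" where
  "in_dual w u a \<longleftrightarrow> (\<exists>b. b \<epsilon> u \<and> is_diff a w b)"

definition is_P_point :: "'m \<Rightarrow> 'm \<Rightarrow> bool" where
  "is_P_point w u \<longleftrightarrow> is_ultrafilter w u \<and>
     (\<forall>s. is_countable s \<and> (\<forall>a. a \<epsilon> s \<longrightarrow> in_dual w u a) \<longrightarrow>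
        (\<exists>b. b \<epsilon> u \<and> (\<forall>a c. a \<epsilon> s \<and> is_inter c a b \<longrightarrow> is_finite c)))"

definition is_preimage :: "'m \<Rightarrow> 'm \<Rightarrow> 'm \<Rightarrow> 'm \<Rightarrow> bool" where
  "is_preimage w d f b \<longleftrightarrow> (\<forall>x. x \<epsilon> d \<longleftrightarrow> x \<epsilon> w \<and> (\<exists>y. y \<epsilon> b \<and> related f x y))"

definition any_map :: "'m \<Rightarrow> 'm \<Rightarrow> bool" where
  "any_map w f \<longleftrightarrow> is_map f w w"

definition fin_one_map :: "'m \<Rightarrow> 'm \<Rightarrow> bool" where
  "fin_one_map w f \<longleftrightarrow> is_map f w w \<and>
     (\<forall>y s d. y \<epsilon> w \<and> is_upair s y y \<and> is_preimage w d f s \<longrightarrow> is_finite d)"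

definition one_one_map :: "'m \<Rightarrow> 'm \<Rightarrow> bool" where
  "one_one_map w f \<longleftrightarrow> is_inj_map f w w"

text \<open>The structure's own evaluation of the Borel code \<open>(l, r)\<close>; compare
  \<^const>\<open>code_eval\<close> and \<^const>\<open>coded_family\<close>.\<close>

definition in_coded_family :: "'m \<Rightarrow> 'm \<Rightarrow> 'm \<Rightarrow> 'm \<Rightarrow> bool" where
  "in_coded_family w l r a \<longleftrightarrow> sub a w \<and>
     (\<exists>t. sub t w \<and>
        (\<forall>n. n \<epsilon> w \<longrightarrow>
           (n \<epsilon> t \<longleftrightarrow> (\<exists>k. k \<epsilon> a \<and> related l n k) \<or>
                     (\<exists>m. m \<epsilon> w \<and> related r n m \<and> \<not> m \<epsilon> t))) \<and>
        (\<exists>z. is_empty z \<and> z \<epsilon> t))"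

text \<open>\<open>J \<le>\<^sub>\<F> U\<^sup>*\<close> for the ideal \<open>J\<close> coded by \<open>(l, r)\<close>, where \<open>F w f\<close> says that \<open>f \<in> \<F>\<close>.\<close>

definition code_le_dual :: "('m \<Rightarrow> 'm \<Rightarrow> bool) \<Rightarrow> 'm \<Rightarrow> 'm \<Rightarrow> 'm \<Rightarrow> 'm \<Rightarrow> bool" where
  "code_le_dual F w l r u \<longleftrightarrow>
     (\<exists>f. F w f \<and>
        (\<forall>b. in_coded_family w l r b \<longrightarrow> (\<exists>d. is_preimage w d f b \<and> in_dual w u d)))"

definition P_point_not_J_ultrafilter :: "'m \<Rightarrow> 'm \<Rightarrow> bool" where
  "P_point_not_J_ultrafilter l r \<longleftrightarrow>
     (\<exists>w u. is_omega w \<and> is_P_point w u \<and> code_le_dual any_map w l r u)"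

definition P_point_not_weak_J_ultrafilter :: "'m \<Rightarrow> 'm \<Rightarrow> bool" where
  "P_point_not_weak_J_ultrafilter l r \<longleftrightarrow>
     (\<exists>w u. is_omega w \<and> is_P_point w u \<and> code_le_dual fin_one_map w l r u)"

definition P_point_not_J_point :: "'m \<Rightarrow> 'm \<Rightarrow> bool" where
  "P_point_not_J_point l r \<longleftrightarrow>
     (\<exists>w u. is_omega w \<and> is_P_point w u \<and> code_le_dual one_one_map w l r u)"

text \<open>The element \<open>x\<close> is the \<open>n\<close>-th von Neumann numeral of the structure, for an actual natural
  number \<open>n\<close>; and the element \<open>r\<close> is the copy in the structure of an actual relation \<open>R\<close>.\<close>

primrec is_numeral :: "nat \<Rightarrow> 'm \<Rightarrow> bool" where
  "is_numeral 0 x \<longleftrightarrow> is_empty x"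
| "is_numeral (Suc n) x \<longleftrightarrow> (\<exists>y. is_numeral n y \<and> is_succ x y)"

definition represents :: "nat rel \<Rightarrow> 'm \<Rightarrow> bool" where
  "represents R r \<longleftrightarrow>
     (\<forall>p. p \<epsilon> r \<longleftrightarrow> (\<exists>m n. (m, n) \<in> R \<and> (\<exists>x y. is_numeral m x \<and> is_numeral n y \<and> is_opair p x y)))"

end

section \<open>Consistency of statements about a Borel code\<close>

text \<open>A countable transitive model of ZFC containing the Borel code \<open>c\<close>. By the Mostowski collapse
  these are, up to isomorphism, the well-founded models \<open>(\<nat>, E)\<close> of ZFC that have elements \<open>l, r\<close>
  representing the components of \<open>c\<close>. By the Loewenheim-Skolem theorem, restricting to countable
  models does not change which first-order statements about \<open>c\<close> hold in some, or in all, transitive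
  set models containing \<open>c\<close>.\<close>

definition ctm_with_code ::
  "borel_code \<Rightarrow> (nat \<Rightarrow> nat \<Rightarrow> bool) \<Rightarrow> nat \<Rightarrow> nat \<Rightarrow> bool" where
  "ctm_with_code c E l r \<longleftrightarrow>
     wfp E \<and> set_structure.zfc E \<and>
     set_structure.represents E (fst c) l \<and> set_structure.represents E (snd c) r"

text \<open>A statement \<open>\<phi>\<close> about the Borel set coded by \<open>c\<close> is consistent with ZFC if it holds in some
  transitive model containing \<open>c\<close>. Transitivity is what makes the code keep its meaning: a recursive
  code, for instance, may define an entirely different set in a model with nonstandard integers.\<close>

definition consistent_with_ZFC ::
  "((nat \<Rightarrow> nat \<Rightarrow> bool) \<Rightarrow> nat \<Rightarrow> nat \<Rightarrow> bool) \<Rightarrow> borel_code \<Rightarrow> bool" where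
  "consistent_with_ZFC \<phi> c \<longleftrightarrow> (\<exists>E l r. ctm_with_code c E l r \<and> \<phi> E l r)"

definition CH_implies_in_models ::
  "((nat \<Rightarrow> nat \<Rightarrow> bool) \<Rightarrow> nat \<Rightarrow> nat \<Rightarrow> bool) \<Rightarrow> borel_code \<Rightarrow> bool" where
  "CH_implies_in_models \<phi> c \<longleftrightarrow>
     (\<forall>E l r. ctm_with_code c E l r \<and> set_structure.satisfies_CH E \<longrightarrow> \<phi> E l r)"

end

(*
  (1) If J is contained in a P+ ideal K and f maps the Fin^2 sets into K(A), a pseudointersection, positive
  for K, of the complements of the members of A and of the fibres of f has an image in Fin^2, which is absurd. Conversely,
  if J' refutes the preorder, then J' is a P+ ideal: a decreasing sequence without a pseudointersection
  would itself be the countable family A. Images of P+ ideals under maps are P+ ideals.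

  (2) The dual ideal of a P-point is P+. Under CH, a tower of sets positive for the P+ ideal, of length omega_1,
  that decides all sequences of sets generates a P-point.

  (3), (4) For an ideal with a Borel code c, extendability to a P+ ideal is equivalent to the existence of a
  witness: a function x from which a P+ ideal KI c x is defined arithmetically. If J is contained in the P+
  ideal K and U is an ultrafilter disjoint from K, call a finite approximation to a member of J alive if it has, with
  respect to U, large extensions forever (a largest fixed point); the root must be dead, since otherwise a
  pseudointersection of the large sets would be outside of J and yet the union of two sets in J. A witness
  records why approximations are dead. Positivity for KI c x has finite certificates, so chains of fewer
  than p positive sets have positive pseudointersections. Witnesses are the branches of a tree that belongs
  to every transitive model containing c, so they exist in one such model if and only if they exist in all of
  them and in the universe. A P-point of a model that is not a J-ultrafilter there gives a witness by the
  same fixed point, and in a model of CH a witness gives a P-point. Models of CH are obtained by forcing over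
  a given countable one with countable partial functions from omega_1 to the reals, which adds no reals.
*)
theory Submission
  imports Defs
begin

section \<open>Definability with parameters\<close>

text \<open>The overview leaves open how reasons for death can be recorded so that they never run in
  a circle. Instead of by ordinal ranks, deaths are measured by the nodes of one tree
  \<open>treeS c\<close> of finite lists, computed from the code alone: liveness is a property of
  pairs of a node n and an approximation s, and the reason for the death of (n, s) names a child of
  n. The tree has to be well-founded, so that chains of deaths end and every set of the family
  becomes small for the witness; and it has to be tall enough for the root to die. Both follow from
  one choice: \<open>treeS c\<close> consists of the finite approximations to a proof that the root
  is alive, together with a set outside of the family, where liveness is taken relative to
  \<open>treeS c\<close> itself. An infinite branch would be such a proof, and at the same time a
  path along which the proof can be followed forever, which would put its set into the ideal. Hence
  there is no branch, hence no proof, and the root is dead. The argument takes place in the universe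
  and so applies to the liveness computed in any model.\<close>

primrec rename_fm :: "(nat \<Rightarrow> nat) \<Rightarrow> fm \<Rightarrow> fm" where
  "rename_fm r (Mem i j) = Mem (r i) (r j)"
| "rename_fm r (Eq i j) = Eq (r i) (r j)"
| "rename_fm r (Neg p) = Neg (rename_fm r p)"
| "rename_fm r (Conj p q) = Conj (rename_fm r p) (rename_fm r q)"
| "rename_fm r (All p) = All (rename_fm (case_nat 0 (\<lambda>i. Suc (r i))) p)"

lemma sat_rename_fm: "sat E v (rename_fm r p) \<longleftrightarrow> sat E (\<lambda>i. v (r i)) p"
proof (induction p arbitrary: r v)
  case (All p)
  have "(\<lambda>i. case_nat x v (case_nat 0 (\<lambda>i. Suc (r i)) i)) = case_nat x (\<lambda>i. v (r i))" for x
    by (auto split: nat.split)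
  then show ?case using All by simp
qed auto

text \<open>The variables at even positions are the arguments, those at odd positions the parameters.\<close>

definition merge :: "(nat \<Rightarrow> 'm) \<Rightarrow> (nat \<Rightarrow> 'm) \<Rightarrow> nat \<Rightarrow> 'm" where
  "merge e v i = (if even i then e (i div 2) else v (i div 2))"

named_theorems dfn

context set_structure
begin

text \<open>Predicates stay HOL predicates on assignments; the formula exists only behind the
  quantifier. The closure rules collected in \<open>dfn\<close> then provide instances of the two
  schemata by following the structure of a predicate, without any formula being written down. The
  parameters form an infinite sequence of their own, so that no arity has to be fixed.\<close>

definition Dfn :: "((nat \<Rightarrow> 'm) \<Rightarrow> bool) \<Rightarrow> bool" where
  "Dfn P \<longleftrightarrow> (\<exists>p v. \<forall>e. P e \<longleftrightarrow> sat mem (merge e v) p)"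

definition Trm :: "((nat \<Rightarrow> 'm) \<Rightarrow> 'm) \<Rightarrow> bool" where
  "Trm t \<longleftrightarrow> Dfn (\<lambda>e. e 0 = t (\<lambda>i. e (Suc i)))"

lemma Dfn_not [dfn]: "Dfn P \<Longrightarrow> Dfn (\<lambda>e. \<not> P e)"
  unfolding Dfn_def by (elim exE, rule_tac x="Neg p" in exI, rule_tac x=v in exI) simp

lemma Dfn_conj [dfn]:
  assumes "Dfn P" "Dfn Q" shows "Dfn (\<lambda>e. P e \<and> Q e)"
proof -
  from assms obtain p v q u where p: "\<And>e. P e \<longleftrightarrow> sat mem (merge e v) p"
    and q: "\<And>e. Q e \<longleftrightarrow> sat mem (merge e u) q"
    unfolding Dfn_def by (elim exE) (rule that, blast+)
  \<comment> \<open>In \<open>merge v u\<close> the k-th entry of \<open>v\<close> has index 2k and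
    the k-th entry of \<open>u\<close> has index 2k + 1; as parameters they stand at positions 4k +
    1 and 4k + 3.\<close>
  define r where "r = (\<lambda>i. if even i then i else Suc (4 * (i div 2)))"
  define s where "s = (\<lambda>i. if even i then i else Suc (4 * (i div 2) + 2))"
  have parity_cases: thesis if "\<And>k. i = 2 * k \<Longrightarrow> thesis" "\<And>k. i = Suc (2 * k) \<Longrightarrow> thesis" for i :: nat and thesis
    using that by (cases "even i") (auto elim!: evenE oddE)
  have 1: "(\<lambda>i. merge e (merge v u) (r i)) = merge e v" for e
    by (rule ext, rule_tac i=i in parity_cases) (auto simp: merge_def r_def)
  have 2: "(\<lambda>i. merge e (merge v u) (s i)) = merge e u" for e
    by (rule ext, rule_tac i=i in parity_cases) (auto simp: merge_def s_def)
  show ?thesis unfolding Dfn_def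
    by (rule exI[of _ "Conj (rename_fm r p) (rename_fm s q)"], rule exI[of _ "merge v u"])
      (simp add: sat_rename_fm 1 2 p q)
qed

lemma Dfn_rename:
  assumes "Dfn P" shows "Dfn (\<lambda>e. P (\<lambda>i. e (r i)))"
proof -
  from assms obtain p v where p: "\<And>e. P e \<longleftrightarrow> sat mem (merge e v) p"
    unfolding Dfn_def by (elim exE) blast
  define s where "s = (\<lambda>i. if even i then 2 * r (i div 2) else i)"
  have "(\<lambda>i. merge e v (s i)) = merge (\<lambda>i. e (r i)) v" for e
    by (rule ext) (simp add: merge_def s_def)
  then show ?thesis unfolding Dfn_def
    by (intro exI[of _ "rename_fm s p"] exI[of _ v]) (simp add: sat_rename_fm p)
qed

lemma Dfn_all_aux:
  assumes "Dfn P" shows "Dfn (\<lambda>e. \<forall>x. P (case_nat x e))"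
proof -
  from assms obtain p v where p: "\<And>e. P e \<longleftrightarrow> sat mem (merge e v) p"
    unfolding Dfn_def by (elim exE) blast
  \<comment> \<open>Position 0 is the bound variable. Once it is put in front of
    \<open>merge e v\<close>, the argument from position 2k + 2 is found at 2k + 1 and the parameter
    from position 2k + 1 at 2k + 2.\<close>
  define s where "s = (\<lambda>i::nat. if i = 0 then 0 else if even i then i - 1 else Suc i)"
  have "case_nat x (merge e v) (s i) = merge (case_nat x e) v i" for e x i
  proof (cases "i = 0")
    case False
    then obtain j where j: "i = Suc j" by (cases i) auto
    show ?thesis
    proof (cases "even i")
      case True
      then obtain l where l: "i = 2 * l" by (rule evenE)
      with j obtain k where k: "i = 2 * Suc k" by (cases l) auto
      then have "s i = Suc (2 * k)" by (simp add: s_def)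
      then show ?thesis using k by (simp add: merge_def)
    next
      case False
      then obtain k where k: "i = Suc (2 * k)" by (auto elim: oddE)
      then have "s i = Suc (Suc (2 * k))" by (simp add: s_def)
      then show ?thesis using k by (simp add: merge_def)
    qed
  qed (simp add: s_def merge_def)
  then have "(\<lambda>i. case_nat x (merge e v) (s i)) = merge (case_nat x e) v" for e x by auto
  then show ?thesis unfolding Dfn_def
    by (intro exI[of _ "All (rename_fm s p)"] exI[of _ v]) (simp add: sat_rename_fm p)
qed

lemma Dfn_all [dfn]:
  assumes "Dfn (\<lambda>e. P (\<lambda>i. e (Suc i)) (e 0))" shows "Dfn (\<lambda>e. \<forall>x. P e x)"
  using Dfn_all_aux[where P="\<lambda>e. P (\<lambda>i. e (Suc i)) (e 0)", OF assms] unfolding nat.case .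

lemma Dfn_ex [dfn]:
  assumes "Dfn (\<lambda>e. P (\<lambda>i. e (Suc i)) (e 0))" shows "Dfn (\<lambda>e. \<exists>x. P e x)"
proof -
  have "Dfn (\<lambda>e. \<not> (\<forall>x. \<not> P e x))" by (rule Dfn_not, rule Dfn_all, rule Dfn_not, rule assms)
  then show ?thesis unfolding not_all not_not .
qed

lemma Dfn_disj [dfn]: "Dfn P \<Longrightarrow> Dfn Q \<Longrightarrow> Dfn (\<lambda>e. P e \<or> Q e)"
proof -
  assume "Dfn P" "Dfn Q"
  then have "Dfn (\<lambda>e. \<not> (\<not> P e \<and> \<not> Q e))" by (intro Dfn_not Dfn_conj)
  then show ?thesis unfolding de_Morgan_conj not_not .
qed

lemma Dfn_imp [dfn]: "Dfn P \<Longrightarrow> Dfn Q \<Longrightarrow> Dfn (\<lambda>e. P e \<longrightarrow> Q e)"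
  unfolding imp_conv_disj by (intro Dfn_disj Dfn_not)

lemma Dfn_iff [dfn]: "Dfn P \<Longrightarrow> Dfn Q \<Longrightarrow> Dfn (\<lambda>e. P e \<longleftrightarrow> Q e)"
  unfolding iff_conv_conj_imp by (intro Dfn_conj Dfn_imp)

lemma Dfn_var_eq: "Dfn (\<lambda>e. e i = e j)"
  unfolding Dfn_def by (intro exI[of _ "Eq (2 * i) (2 * j)"] exI) (simp add: merge_def)

lemma Dfn_var_mem: "Dfn (\<lambda>e. e i \<epsilon> e j)"
  unfolding Dfn_def by (intro exI[of _ "Mem (2 * i) (2 * j)"] exI) (simp add: merge_def)

text \<open>\<open>Q\<close> may be any proposition of the metatheory: being true or false once and
  for all, it is defined by a tautology or by its negation.\<close>

lemma Dfn_const [dfn]: "Dfn (\<lambda>e. Q)"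
proof -
  have "Dfn (\<lambda>e. (e 0 = e 0) = Q)"
    using Dfn_var_eq[of 0 0] Dfn_not[OF Dfn_var_eq[of 0 0]] by (cases Q) simp_all
  then show ?thesis by simp
qed

lemma Trm_var [dfn]: "Trm (\<lambda>e. e i)"
  unfolding Trm_def by (rule Dfn_var_eq)

lemma Trm_const [dfn]: "Trm (\<lambda>e. c)"
  unfolding Trm_def Dfn_def
  by (intro exI[of _ "Eq 0 1"] exI[of _ "\<lambda>_. c"]) (simp add: merge_def)

text \<open>The language has no function symbols, so a term is substituted by quantifying over its
  value.\<close>

lemma Dfn_subst:
  assumes "Dfn (\<lambda>e. P (e 0) (\<lambda>i. e (Suc i)))" "Trm t"
  shows "Dfn (\<lambda>e. P (t e) e)"
proof -
  have "Dfn (\<lambda>e. \<exists>y. y = t e \<and> P y e)"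
    by (rule Dfn_ex, rule Dfn_conj, rule assms(2)[unfolded Trm_def], rule assms(1))
  then show ?thesis by simp
qed

lemma Dfn_sub1:
  assumes "Dfn (\<lambda>e. P (e 0))" "Trm t" shows "Dfn (\<lambda>e. P (t e))"
  using Dfn_subst[of "\<lambda>x e. P x", OF assms] .

lemma Dfn_sub2:
  assumes P: "Dfn (\<lambda>e. P (e 0) (e 1))" and t: "Trm t" "Trm u" shows "Dfn (\<lambda>e. P (t e) (u e))"
proof -
  have "Dfn (\<lambda>e. P (e 1) (e 0))"
    using Dfn_rename[OF P, of "case_nat 1 (\<lambda>_. 0)"] by simp
  then have "Dfn (\<lambda>e. P (e 0) (u e))"
    using Dfn_subst[of "\<lambda>x e. P (e 0) x" u] t by simp
  then have "Dfn (\<lambda>e. P (e 0) (u (\<lambda>i. e (Suc i))))"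
  proof -
    have "Dfn (\<lambda>e. P (e 0) (e 1))" by (rule P)
    have *: "Trm (\<lambda>e. u (\<lambda>i. e (Suc i)))"
      using t(2) Dfn_rename[of "\<lambda>e. e 0 = u (\<lambda>i. e (Suc i))" "case_nat 0 (\<lambda>i. Suc (Suc i))"]
      unfolding Trm_def by simp
    show ?thesis using Dfn_subst[of "\<lambda>x e. P (e 0) x", OF _ *] \<open>Dfn (\<lambda>e. P (e 1) (e 0))\<close> by simp
  qed
  then show ?thesis using Dfn_subst[of "\<lambda>x e. P x (u e)", OF _ t(1)] by simp
qed

lemma Trm_Suc:
  assumes "Trm u" shows "Trm (\<lambda>e. u (\<lambda>i. e (Suc i)))"
  using assms Dfn_rename[of "\<lambda>e. e 0 = u (\<lambda>i. e (Suc i))" "case_nat 0 (\<lambda>i. Suc (Suc i))"]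
  unfolding Trm_def by simp

lemma Dfn_sub3:
  assumes P: "Dfn (\<lambda>e. P (e 0) (e 1) (e 2))" and t: "Trm t" "Trm u" "Trm s"
  shows "Dfn (\<lambda>e. P (t e) (u e) (s e))"
proof -
  have "Dfn (\<lambda>e. \<exists>x. x = t e \<and> (\<exists>y. y = u e \<and> (\<exists>z. z = s e \<and> P x y z)))"
    apply (rule Dfn_ex, rule Dfn_conj)
     apply (rule t(1)[unfolded Trm_def])
    apply (rule Dfn_ex, rule Dfn_conj)
     apply (rule Trm_Suc[OF t(2), unfolded Trm_def])
    apply (rule Dfn_ex, rule Dfn_conj)
     apply (rule Trm_Suc[OF Trm_Suc[OF t(3)], unfolded Trm_def])
    using Dfn_rename[OF P, of "\<lambda>i. 2 - i"] by (simp add: numeral_2_eq_2)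
  then show ?thesis by simp
qed

lemma Dfn_eq [dfn]: "Trm t \<Longrightarrow> Trm u \<Longrightarrow> Dfn (\<lambda>e. t e = u e)"
  by (rule Dfn_sub2[where P="(=)"]) (rule Dfn_var_eq)

lemma Dfn_mem [dfn]: "Trm t \<Longrightarrow> Trm u \<Longrightarrow> Dfn (\<lambda>e. t e \<epsilon> u e)"
  by (rule Dfn_sub2[where P="(\<epsilon>)"]) (rule Dfn_var_mem)

lemma Trm_sub1:
  assumes "Dfn (\<lambda>e. e 0 = F (e 1))" "Trm t" shows "Trm (\<lambda>e. F (t e))"
  unfolding Trm_def
  using Dfn_sub2[of "\<lambda>x y. x = F y", OF assms(1) Trm_var[of 0] Trm_Suc[OF assms(2)]] .

lemma Trm_sub2:
  assumes "Dfn (\<lambda>e. e 0 = F (e 1) (e 2))" "Trm t" "Trm u" shows "Trm (\<lambda>e. F (t e) (u e))"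
  unfolding Trm_def
  using Dfn_sub3[of "\<lambda>x y z. x = F y z", OF assms(1) Trm_var[of 0] Trm_Suc[OF assms(2)] Trm_Suc[OF assms(3)]] .

lemma Dfn_ball [dfn]: "Dfn (\<lambda>e. e 0 \<in> A) \<Longrightarrow> Dfn (\<lambda>e. P (\<lambda>i. e (Suc i)) (e 0)) \<Longrightarrow> Dfn (\<lambda>e. \<forall>x\<in>A. P e x)"
  unfolding Ball_def by (rule Dfn_all, rule Dfn_imp)

lemma Dfn_bex [dfn]: "Dfn (\<lambda>e. e 0 \<in> A) \<Longrightarrow> Dfn (\<lambda>e. P (\<lambda>i. e (Suc i)) (e 0)) \<Longrightarrow> Dfn (\<lambda>e. \<exists>x\<in>A. P e x)"
  unfolding Bex_def by (rule Dfn_ex, rule Dfn_conj)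

lemma Dfn_ex1 [dfn]:
  assumes "Dfn (\<lambda>e. P (\<lambda>i. e (Suc i)) (e 0))" shows "Dfn (\<lambda>e. \<exists>!x. P e x)"
proof -
  have "Dfn (\<lambda>e. P (\<lambda>i. e (Suc (Suc i))) (e 0))"
    using Dfn_rename[OF assms, of "case_nat 0 (\<lambda>i. Suc (Suc i))"] by simp
  then show ?thesis
    unfolding Ex1_def by (intro Dfn_ex Dfn_conj Dfn_all Dfn_imp Dfn_eq Trm_var assms)
qed

lemma Dfn_sub [dfn]: "Trm t \<Longrightarrow> Trm u \<Longrightarrow> Dfn (\<lambda>e. sub (t e) (u e))"
  by (rule Dfn_sub2[where P=sub]) (unfold sub_def, intro dfn)

lemma Dfn_is_empty [dfn]: "Trm t \<Longrightarrow> Dfn (\<lambda>e. is_empty (t e))"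
  by (rule Dfn_sub1[where P=is_empty]) (unfold is_empty_def, intro dfn)

lemma Dfn_is_upair [dfn]: "Trm t \<Longrightarrow> Trm u \<Longrightarrow> Trm s \<Longrightarrow> Dfn (\<lambda>e. is_upair (t e) (u e) (s e))"
  by (rule Dfn_sub3[where P=is_upair]) (unfold is_upair_def, intro dfn)

lemma Dfn_is_opair [dfn]: "Trm t \<Longrightarrow> Trm u \<Longrightarrow> Trm s \<Longrightarrow> Dfn (\<lambda>e. is_opair (t e) (u e) (s e))"
  by (rule Dfn_sub3[where P=is_opair]) (unfold is_opair_def, intro dfn)

lemma Dfn_is_succ [dfn]: "Trm t \<Longrightarrow> Trm u \<Longrightarrow> Dfn (\<lambda>e. is_succ (t e) (u e))"
  by (rule Dfn_sub2[where P=is_succ]) (unfold is_succ_def, intro dfn)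

end

section \<open>Sets in a transitive model\<close>

locale zfc_model = set_structure +
  assumes wf_mem: "wfp mem" and zfc: zfc
begin

definition elts :: "'a \<Rightarrow> 'a set" where "elts a = {x. x \<epsilon> a}"

text \<open>Sets of the model are handled as the HOL sets of their members. The way back,
  \<open>mk\<close>, is meaningful for small sets only.\<close>

definition small :: "'a set \<Rightarrow> bool" where "small X \<longleftrightarrow> (\<exists>a. elts a = X)"

definition mk :: "'a set \<Rightarrow> 'a" where "mk X = (THE a. elts a = X)"

lemma in_elts [simp]: "x \<in> elts a \<longleftrightarrow> x \<epsilon> a"
  by (simp add: elts_def)

lemma small_elts [simp, intro]: "small (elts a)"
  by (auto simp: small_def)

lemma elts_eq [simp]: "elts a = elts b \<longleftrightarrow> a = b"
proof
  have "\<forall>x y. (\<forall>z. z \<epsilon> x \<longleftrightarrow> z \<epsilon> y) \<longrightarrow> x = y" using zfc unfolding zfc_def by (elim conjE)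
  then show "elts a = elts b \<Longrightarrow> a = b" unfolding set_eq_iff in_elts by simp
qed simp

lemma eq_iff_mem: "a = b \<longleftrightarrow> (\<forall>x. x \<epsilon> a \<longleftrightarrow> x \<epsilon> b)"
  using elts_eq[of a b] by (simp add: set_eq_iff)

lemma mk_elts [simp]: "mk (elts a) = a"
  by (simp add: mk_def)

lemma mkI: "elts a = X \<Longrightarrow> mk X = a"
  by auto

lemma elts_mk: "small X \<Longrightarrow> elts (mk X) = X"
  by (auto simp: small_def)

lemma mem_mk: "small X \<Longrightarrow> x \<epsilon> mk X \<longleftrightarrow> x \<in> X"
  using elts_mk[of X] in_elts[of x "mk X"] by simp

lemma mk_eq_iff: "small X \<Longrightarrow> a = mk X \<longleftrightarrow> (\<forall>x. x \<epsilon> a \<longleftrightarrow> x \<in> X)"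
  unfolding eq_iff_mem[of a] by (simp add: mem_mk)

lemma mem_wf: "wf {(x, y). x \<epsilon> y}"
  using wf_mem by (simp add: wfp_def)

lemma mem_induct [case_names step]: "(\<And>x. (\<And>y. y \<epsilon> x \<Longrightarrow> P y) \<Longrightarrow> P x) \<Longrightarrow> P x"
  using wfp_induct_rule[OF wf_mem, of P x] by blast

lemma mem_irrefl [simp]: "\<not> x \<epsilon> x"
  by (rule mem_induct[where P="\<lambda>x. \<not> x \<epsilon> x"]) blast

lemma mem_asym: "x \<epsilon> y \<Longrightarrow> \<not> y \<epsilon> x"
  using mem_induct[where P="\<lambda>x. \<forall>y. \<not> (x \<epsilon> y \<and> y \<epsilon> x)"] by blast

lemma Dfn_elts [dfn]: "Trm t \<Longrightarrow> Trm u \<Longrightarrow> Dfn (\<lambda>e. t e \<in> elts (u e))"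
  unfolding in_elts by (rule Dfn_mem)

lemma Dfn_small: "small A \<Longrightarrow> Trm t \<Longrightarrow> Dfn (\<lambda>e. t e \<in> A)"
  unfolding small_def by (elim exE, hypsubst, rule Dfn_elts) (auto intro: dfn)

lemma small_sep:
  assumes "small A" "Dfn (\<lambda>e. P (e 0))" shows "small {x \<in> A. P x}"
proof -
  obtain a where a: "A = elts a" using assms(1) by (auto simp: small_def)
  obtain p v where p: "\<And>e. P (e 0) \<longleftrightarrow> sat mem (merge e v) p"
    using assms(2) unfolding Dfn_def by (elim exE) blast
  have sep: "\<forall>p v a. \<exists>b. \<forall>x. x \<epsilon> b \<longleftrightarrow> x \<epsilon> a \<and> sat mem (case_nat x v) p"
    using zfc unfolding zfc_def by (elim conjE)
  \<comment> \<open>\<open>P\<close> reads argument 0 only, so the other arguments may all be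
    \<open>a\<close>; this brings the merged assignment into the form that the schema asks
    for.\<close>
  define u where "u = (\<lambda>i. merge (\<lambda>_. a) v (Suc i))"
  have "P x \<longleftrightarrow> sat mem (case_nat x u) (rename_fm (\<lambda>i. if i \<noteq> 0 \<and> even i then 2 else i) p)" for x
  proof -
    have "(\<lambda>i. case_nat x u (if i \<noteq> 0 \<and> even i then 2 else i)) = merge (case_nat x (\<lambda>_. a)) v"
    proof
      fix i show "case_nat x u (if i \<noteq> 0 \<and> even i then 2 else i) = merge (case_nat x (\<lambda>_. a)) v i"
      proof (cases "i = 0")
        case False
        have "i div 2 \<noteq> 0" if "even i" using that False by (auto elim!: evenE)
        then show ?thesis using False
          by (cases i; cases "i div 2") (auto simp: u_def merge_def numeral_2_eq_2)
      qed (simp add: merge_def)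
    qed
    then show ?thesis using p[of "case_nat x (\<lambda>_. a)"] by (simp add: sat_rename_fm)
  qed
  note P = this
  from sep[THEN spec, THEN spec, THEN spec, of a u "rename_fm (\<lambda>i. if i \<noteq> 0 \<and> even i then 2 else i) p"]
  obtain b where "\<forall>x. x \<epsilon> b \<longleftrightarrow> x \<epsilon> a \<and> sat mem (case_nat x u) (rename_fm (\<lambda>i. if i \<noteq> 0 \<and> even i then 2 else i) p)" ..
  then have "elts b = {x \<in> A. P x}" unfolding P[symmetric] set_eq_iff a by simp
  then show ?thesis unfolding small_def ..
qed

lemma small_subset:
  assumes "small A" "B \<subseteq> A" "Dfn (\<lambda>e. e 0 \<in> B)" shows "small B"
proof -
  have "{x \<in> A. x \<in> B} = B" using assms(2) by blast
  moreover have "small {x \<in> A. x \<in> B}" by (rule small_sep[OF assms(1,3)])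
  ultimately show ?thesis by metis
qed

lemma small_upair: "small {x, y}"
proof -
  have "\<forall>x y. \<exists>p. is_upair p x y" using zfc unfolding zfc_def by (elim conjE)
  then have "\<exists>p. is_upair p x y" by simp
  then obtain p where "is_upair p x y" ..
  then have "elts p = {x, y}" unfolding is_upair_def set_eq_iff by simp
  then show ?thesis unfolding small_def ..
qed

lemma small_sing: "small {x}" using small_upair[of x x] by simp

lemma small_Union:
  assumes "small A" shows "small (\<Union>x\<in>A. elts x)"
proof -
  have "\<forall>a. \<exists>u. is_Union u a" using zfc unfolding zfc_def by (elim conjE)
  then have "\<exists>u. is_Union u (mk A)" ..
  then obtain u where "is_Union u (mk A)" ..
  then have "elts u = (\<Union>x\<in>A. elts x)" unfolding is_Union_def by (auto simp: mem_mk assms)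
  then show ?thesis unfolding small_def ..
qed

lemma small_Pow:
  assumes "small A" shows "small {x. elts x \<subseteq> A}"
proof -
  have "\<forall>a. \<exists>p. is_power p a" using zfc unfolding zfc_def by (elim conjE)
  then have "\<exists>p. is_power p (mk A)" ..
  then obtain p where "is_power p (mk A)" ..
  then have "elts p = {x. elts x \<subseteq> A}" unfolding is_power_def sub_def subset_iff by (auto simp: mem_mk assms)
  then show ?thesis unfolding small_def ..
qed

lemma small_Un: "small A \<Longrightarrow> small B \<Longrightarrow> small (A \<union> B)"
  using small_Union[OF small_upair[of "mk A" "mk B"]] by (simp add: elts_mk)

lemma small_insert: "small A \<Longrightarrow> small (insert x A)"
  using small_Un[OF small_sing[of x]] by simp

lemma small_empty: "small {}"
proof -
  have "small {y \<in> {x}. False}" for x by (rule small_sep[OF small_sing], rule Dfn_const)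
  then show ?thesis unfolding Collect_conj_eq Collect_const if_False Int_empty_right .
qed

lemma small_finite: "finite A \<Longrightarrow> small A"
  by (induction A rule: finite_induct) (auto intro: small_empty small_insert)

lemma small_Int:
  assumes "small A" "small B" shows "small (A \<inter> B)"
proof -
  have "Dfn (\<lambda>e. e 0 \<in> A \<inter> B)" unfolding Int_iff by (intro dfn Dfn_small assms)
  then show ?thesis by (rule small_subset[OF assms(1) Int_lower1])
qed

lemma small_Diff:
  assumes "small A" "small B" shows "small (A - B)"
proof -
  have "Dfn (\<lambda>e. e 0 \<in> A - B)" unfolding Diff_iff by (intro dfn Dfn_small assms)
  then show ?thesis by (rule small_subset[OF assms(1) Diff_subset])
qed

lemma small_repl:
  assumes A: "small A" and R: "Dfn (\<lambda>e. R (e 0) (e 1))"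
    and fn: "\<And>x y z. x \<in> A \<Longrightarrow> R x y \<Longrightarrow> R x z \<Longrightarrow> y = z"
  shows "small {y. \<exists>x\<in>A. R x y}"
proof -
  \<comment> \<open>The schema demands a value at every member, so \<open>A\<close> is first cut
    down to the domain of the partial function \<open>R\<close>.\<close>
  define A' where "A' = {x \<in> A. \<exists>y. R x y}"
  have A': "small A'" unfolding A'_def
    by (rule small_sep[OF A], intro dfn Dfn_sub2[where P=R, OF R])
  have un: "\<exists>!y. R x y" if "x \<in> A'" for x using that fn unfolding A'_def by blast
  obtain p v where p: "\<And>e. R (e 0) (e 1) \<longleftrightarrow> sat mem (merge e v) p"
    using R unfolding Dfn_def by (elim exE) blast
  define r where "r = (\<lambda>i::nat. if i = 0 then 0 else if even i then 1 else 2 + i div 2)"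
  have sat: "sat mem (case_nat x (case_nat y v)) (rename_fm r p) \<longleftrightarrow> R x y" for x y
  proof -
    have "(\<lambda>i. case_nat x (case_nat y v) (r i)) = merge (case_nat x (\<lambda>_. y)) v"
    proof
      fix i show "case_nat x (case_nat y v) (r i) = merge (case_nat x (\<lambda>_. y)) v i"
        by (cases "i = 0") (auto simp: r_def merge_def elim!: evenE oddE split: nat.split)
    qed
    then show ?thesis using p[of "case_nat x (\<lambda>_. y)"] by (simp add: sat_rename_fm)
  qed
  have repl: "\<forall>p v a. (\<forall>x. x \<epsilon> a \<longrightarrow> (\<exists>!y. sat mem (case_nat x (case_nat y v)) p)) \<longrightarrow>
        (\<exists>b. \<forall>y. y \<epsilon> b \<longleftrightarrow> (\<exists>x. x \<epsilon> a \<and> sat mem (case_nat x (case_nat y v)) p))"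
    using zfc unfolding zfc_def by (elim conjE)
  have "\<exists>b. \<forall>y. y \<epsilon> b \<longleftrightarrow> (\<exists>x. x \<epsilon> mk A' \<and> R x y)"
    using repl[rule_format, of "mk A'" v "rename_fm r p"] un unfolding sat by (simp add: mem_mk A')
  then obtain b where "\<And>y. y \<epsilon> b \<longleftrightarrow> (\<exists>x. x \<epsilon> mk A' \<and> R x y)" by blast
  then have "elts b = {y. \<exists>x\<in>A. R x y}" by (auto simp: mem_mk A') (auto simp: A'_def)
  then show ?thesis unfolding small_def ..
qed

lemma small_image:
  assumes "small A" "Dfn (\<lambda>e. e 0 = F (e 1))" shows "small (F ` A)"
proof -
  have "Dfn (\<lambda>e. e 1 = F (e 0))" using Dfn_rename[OF assms(2), of "case_nat 1 (\<lambda>_. 0)"] by simp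
  from small_repl[of A "\<lambda>x y. y = F x", OF assms(1) this]
  have "small {y. \<exists>x\<in>A. y = F x}" by simp
  moreover have "{y. \<exists>x\<in>A. y = F x} = F ` A" by auto
  ultimately show ?thesis by simp
qed

lemma small_UN:
  assumes "small A" "Dfn (\<lambda>e. e 0 = F (e 1))" shows "small (\<Union>x\<in>A. elts (F x))"
  using small_Union[OF small_image[OF assms]] by simp

definition upr :: "'a \<Rightarrow> 'a \<Rightarrow> 'a" where "upr x y = mk {x, y}"
definition opr :: "'a \<Rightarrow> 'a \<Rightarrow> 'a" where "opr x y = upr (upr x x) (upr x y)"

lemma elts_upr [simp]: "elts (upr x y) = {x, y}"
  by (simp add: upr_def elts_mk small_upair)

lemma mem_upr [simp]: "z \<epsilon> upr x y \<longleftrightarrow> z = x \<or> z = y"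
  unfolding in_elts[symmetric] elts_upr by simp

lemma is_upair_iff: "is_upair p x y \<longleftrightarrow> p = upr x y"
  unfolding is_upair_def eq_iff_mem[of p "upr x y"] by simp

lemma is_opair_iff: "is_opair p x y \<longleftrightarrow> p = opr x y"
  unfolding is_opair_def is_upair_iff opr_def eq_iff_mem[of p "upr _ _"] by simp

lemma upr_eq: "upr x y = upr z w \<longleftrightarrow> {x, y} = {z, w}"
  using elts_eq[of "upr x y" "upr z w"] by simp

lemma opr_eq [simp]: "opr x y = opr z w \<longleftrightarrow> x = z \<and> y = w"
  unfolding opr_def upr_eq doubleton_eq_iff by auto

lemma Trm_opr [dfn]: "Trm t \<Longrightarrow> Trm u \<Longrightarrow> Trm (\<lambda>e. opr (t e) (u e))"
  by (rule Trm_sub2[where F=opr]) (unfold is_opair_iff[symmetric], intro dfn)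

text \<open>The pairs lie in the double power set of the union, from which the product is
  separated.\<close>

lemma small_Times: assumes A: "small A" and B: "small B" shows "small {opr x y | x y. x \<in> A \<and> y \<in> B}"
proof -
  have "small {p. elts p \<subseteq> {q. elts q \<subseteq> A \<union> B}}" (is "small ?X") by (intro small_Pow small_Un A B)
  moreover have "{opr x y | x y. x \<in> A \<and> y \<in> B} \<subseteq> ?X" by (auto simp: opr_def)
  moreover have "Dfn (\<lambda>e. e 0 \<in> {opr x y | x y. x \<in> A \<and> y \<in> B})"
    unfolding mem_Collect_eq by (intro dfn Dfn_small A B)
  ultimately show ?thesis by (rule small_subset)
qed

lemma opr_elts:
  assumes "opr x y \<epsilon> f"
  shows "x \<in> (\<Union>q\<in>(\<Union>p\<in>elts f. elts p). elts q)"
    "y \<in> (\<Union>q\<in>(\<Union>p\<in>elts f. elts p). elts q)"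
proof -
  from assms have "upr x y \<in> (\<Union>p\<in>elts f. elts p)" by (intro UN_I[of "opr x y"]) (simp_all add: opr_def)
  note * = UN_I[OF this]
  show "x \<in> (\<Union>q\<in>(\<Union>p\<in>elts f. elts p). elts q)" by (rule *) simp
  show "y \<in> (\<Union>q\<in>(\<Union>p\<in>elts f. elts p). elts q)" by (rule *) simp
qed

lemma small_Domain: "small {x. \<exists>y. opr x y \<epsilon> f}"
  by (rule small_subset[of "\<Union>q\<in>(\<Union>p\<in>elts f. elts p). elts q"], intro small_Union small_elts,
      rule subsetI, unfold mem_Collect_eq, elim exE, erule opr_elts(1), intro dfn)

lemma small_Range: "small {y. \<exists>x. opr x y \<epsilon> f}"
  by (rule small_subset[of "\<Union>q\<in>(\<Union>p\<in>elts f. elts p). elts q"], intro small_Union small_elts,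
      rule subsetI, unfold mem_Collect_eq, elim exE, erule opr_elts(2), intro dfn)

subsection \<open>Recursion along a definable well-founded relation\<close>

text \<open>\<open>y = f x\<close> holds exactly if (x, y) belongs to some attempt \<open>h\<close>:
  a set that is closed under predecessors and obeys the recursion locally (\<open>att\<close>). Any
  two attempts agree with \<open>f\<close> by induction, so the work lies in showing that every
  \<open>x\<close> is reached by one.\<close>

lemma Dfn_recursion:
  fixes R :: "'a \<Rightarrow> 'a \<Rightarrow> bool"
  assumes wf: "wfp R" and R: "Dfn (\<lambda>e. R (e 0) (e 1))" and R_small: "\<And>x. small {y. R y x}"
    and G: "Dfn (\<lambda>e. e 0 = G (e 1) (e 2))"
    and f: "\<And>x. f x = G x (mk {opr y (f y) | y. R y x})"
  shows "Dfn (\<lambda>e. e 0 = f (e 1))"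
proof -
  define restr where "restr h x s \<longleftrightarrow> (\<forall>p. p \<epsilon> s \<longleftrightarrow> (\<exists>z w. p = opr z w \<and> R z x \<and> p \<epsilon> h))" for h x s
  define att where "att h \<longleftrightarrow> (\<forall>x y. opr x y \<epsilon> h \<longrightarrow> (\<forall>z. R z x \<longrightarrow> (\<exists>w. opr z w \<epsilon> h)) \<and>
     (\<exists>s. restr h x s \<and> y = G x s))" for h
  note R' = Dfn_sub2[where P=R, OF R] and G' = Trm_sub2[where F=G, OF G]
  have restr_Dfn: "Trm t \<Longrightarrow> Trm u \<Longrightarrow> Trm s \<Longrightarrow> Dfn (\<lambda>e. restr (t e) (u e) (s e))" for t u s
    by (rule Dfn_sub3[where P=restr]) (unfold restr_def, intro dfn R')
  have att_Dfn: "Trm t \<Longrightarrow> Dfn (\<lambda>e. att (t e))" for t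
    by (rule Dfn_sub1[where P=att]) (unfold att_def, intro dfn R' G' restr_Dfn)
  have att_f: "y = f x" if "att h" "opr x y \<epsilon> h" for h x y
    using wf that(2)
  proof (induction x arbitrary: y rule: wfp_induct_rule)
    case (less x)
    from \<open>att h\<close> less.prems obtain s where s: "restr h x s" "y = G x s"
      and cl: "\<And>z. R z x \<Longrightarrow> \<exists>w. opr z w \<epsilon> h" unfolding att_def by blast
    have 1: "w = f z" if "R z x" "opr z w \<epsilon> h" for z w using less.IH that by simp
    have "p \<epsilon> s \<longleftrightarrow> (\<exists>z. p = opr z (f z) \<and> R z x)" for p
    proof
      assume "p \<epsilon> s"
      then obtain z w where "p = opr z w" "R z x" "p \<epsilon> h" using s(1) unfolding restr_def by blast
      then show "\<exists>z. p = opr z (f z) \<and> R z x" using 1 by auto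
    next
      assume "\<exists>z. p = opr z (f z) \<and> R z x"
      then obtain z where z: "p = opr z (f z)" "R z x" by auto
      with cl obtain w where "opr z w \<epsilon> h" by auto
      then have "p \<epsilon> h" using 1 z by auto
      then show "p \<epsilon> s" using s(1) z unfolding restr_def by blast
    qed
    then have "elts s = {opr z (f z) | z. R z x}" by auto
    then have "s = mk {opr z (f z) | z. R z x}" by (rule mkI[symmetric])
    then show ?case using s(2) f[of x] by simp
  qed
  \<comment> \<open>Attempts at the predecessors of \<open>x\<close> have to be glued together, but
    replacement cannot choose among them. The intersection of all attempts at \<open>z\<close> is a
    canonical one, definable from \<open>z\<close>. Collection would also do, but its proof below
    uses recursion.\<close>
  define m where "m z = mk {p. \<forall>h. att h \<and> (\<exists>w. opr z w \<epsilon> h) \<longrightarrow> p \<epsilon> h}" for z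
  have m_mem: "p \<epsilon> m z \<longleftrightarrow> (\<forall>h. att h \<and> (\<exists>w. opr z w \<epsilon> h) \<longrightarrow> p \<epsilon> h)"
    if ex: "\<exists>h w. att h \<and> opr z w \<epsilon> h" for p z
  proof -
    obtain h w where h: "att h" "opr z w \<epsilon> h" using ex by blast
    have "{p. \<forall>h. att h \<and> (\<exists>w. opr z w \<epsilon> h) \<longrightarrow> p \<epsilon> h} \<subseteq> elts h"
      using h by auto
    then have "small {p. \<forall>h. att h \<and> (\<exists>w. opr z w \<epsilon> h) \<longrightarrow> p \<epsilon> h}"
      by (rule small_subset[OF small_elts]) (unfold mem_Collect_eq, intro dfn att_Dfn)
    then show ?thesis unfolding m_def by (simp add: mem_mk)
  qed
  have att_I: "att h" if val: "\<And>x y. opr x y \<epsilon> h \<Longrightarrow> y = f x"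
    and cl: "\<And>x y z. opr x y \<epsilon> h \<Longrightarrow> R z x \<Longrightarrow> opr z (f z) \<epsilon> h" for h
    unfolding att_def
  proof (intro allI impI conjI)
    fix x y assume xy: "opr x y \<epsilon> h"
    show "\<exists>w. opr z w \<epsilon> h" if "R z x" for z using cl[OF xy that] by blast
    have "small {p \<in> elts h. \<exists>z w. p = opr z w \<and> R z x}" by (rule small_sep[OF small_elts], intro dfn R')
    moreover have "{p \<in> elts h. \<exists>z w. p = opr z w \<and> R z x} = {opr z (f z) | z. R z x}"
      using cl[OF xy] val by auto
    ultimately have sm: "small {opr z (f z) | z. R z x}" by simp
    have "restr h x (mk {opr z (f z) | z. R z x})"
      unfolding restr_def using val cl[OF xy] by (auto simp: mem_mk sm)
    moreover have "y = G x (mk {opr z (f z) | z. R z x})" using val[OF xy] f[of x] by simp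
    ultimately show "\<exists>s. restr h x s \<and> y = G x s" by (intro exI conjI)
  qed
  have ex: "\<exists>h. att h \<and> opr x (f x) \<epsilon> h" for x
    using wf
  proof (induction x rule: wfp_induct_rule)
    case (less x)
    have m: "p \<epsilon> m z \<longleftrightarrow> (\<forall>h. att h \<and> (\<exists>w. opr z w \<epsilon> h) \<longrightarrow> p \<epsilon> h)" if "R z x" for p z
      using m_mem less[OF that] by blast
    have m_in: "opr z (f z) \<epsilon> m z" if "R z x" for z
      unfolding m[OF that]
    proof (intro allI impI, elim conjE exE)
      fix h w assume "att h" "opr z w \<epsilon> h"
      then show "opr z (f z) \<epsilon> h" using att_f[of h z w] by simp
    qed
    have m_val: "w = f v" if zx: "R z x" and vw: "opr v w \<epsilon> m z" for z v w
    proof -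
      obtain h where h: "att h" "opr z (f z) \<epsilon> h" using less[OF zx] by auto
      then have "opr v w \<epsilon> h" using vw unfolding m[OF zx] by auto
      then show ?thesis by (rule att_f[OF h(1)])
    qed
    have m_cl: "opr u (f u) \<epsilon> m z" if "R z x" "opr v w \<epsilon> m z" "R u v" for z v w u
    proof -
      have "opr u (f u) \<epsilon> h" if h: "att h" "\<exists>w. opr z w \<epsilon> h" for h
      proof -
        have "opr v w \<epsilon> h" using h \<open>opr v w \<epsilon> m z\<close> unfolding m[OF \<open>R z x\<close>] by auto
        then obtain w' where w': "opr u w' \<epsilon> h" using h(1) \<open>R u v\<close> unfolding att_def by blast
        then show ?thesis using att_f[OF h(1) w'] by simp
      qed
      then show ?thesis unfolding m[OF that(1)] by simp
    qed
    define Z where "Z = {p. \<exists>z. R z x \<and> p \<epsilon> m z}"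
    have m_eq: "q = m z \<longleftrightarrow> (\<forall>p. p \<epsilon> q \<longleftrightarrow> (\<forall>h. att h \<and> (\<exists>w. opr z w \<epsilon> h) \<longrightarrow> p \<epsilon> h))"
      if "R z x" for q z unfolding eq_iff_mem[of q] m[OF that] ..
    have "small {q. \<exists>z\<in>{z. R z x}. R z x \<and> (\<forall>p. p \<epsilon> q \<longleftrightarrow> (\<forall>h. att h \<and> (\<exists>w. opr z w \<epsilon> h) \<longrightarrow> p \<epsilon> h))}"
      by (rule small_repl[OF R_small], intro dfn att_Dfn R') (subst eq_iff_mem, simp)
    moreover have "{q. \<exists>z\<in>{z. R z x}. R z x \<and> (\<forall>p. p \<epsilon> q \<longleftrightarrow> (\<forall>h. att h \<and> (\<exists>w. opr z w \<epsilon> h) \<longrightarrow> p \<epsilon> h))} = m ` {z. R z x}"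
      unfolding image_def by (auto simp flip: m_eq)
    ultimately have "small (\<Union>q\<in>m ` {z. R z x}. elts q)" by (intro small_Union) simp
    moreover have "(\<Union>q\<in>m ` {z. R z x}. elts q) = Z" by (auto simp: Z_def)
    ultimately have Z: "small (insert (opr x (f x)) Z)" by (simp add: small_insert)
    define H where "H = mk (insert (opr x (f x)) Z)"
    have H: "p \<epsilon> H \<longleftrightarrow> p = opr x (f x) \<or> (\<exists>z. R z x \<and> p \<epsilon> m z)" for p
      using mem_mk[OF Z] by (auto simp: H_def Z_def)
    have "att H"
    proof (rule att_I)
      fix u y assume "opr u y \<epsilon> H"
      then show "y = f u" unfolding H by (auto dest: m_val)
    next
      fix u y z assume *: "opr u y \<epsilon> H" "R z u"
      then show "opr z (f z) \<epsilon> H"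
        unfolding H by (auto intro: m_in dest: m_cl)
    qed
    then show ?case using H[of "opr x (f x)"] by auto
  qed
  have "y = f x \<longleftrightarrow> (\<exists>h. att h \<and> opr x y \<epsilon> h)" for x y using ex[of x] att_f[of _ x y] by auto
  then show ?thesis by (simp only:) (intro dfn att_Dfn)
qed

lemma definable_recursion:
  fixes R :: "'a \<Rightarrow> 'a \<Rightarrow> bool"
  assumes wf: "wfp R" and R: "Dfn (\<lambda>e. R (e 0) (e 1))" and R_small: "\<And>x. small {y. R y x}"
    and G: "Dfn (\<lambda>e. e 0 = G (e 1) (e 2))"
  obtains f where "\<And>x. f x = G x (mk {opr y (f y) | y. R y x})" "Dfn (\<lambda>e. e 0 = f (e 1))"
proof -
  define f where "f = wfrec {(x, y). R x y} (\<lambda>f x. G x (mk {opr y (f y) | y. R y x}))"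
  have "f x = G x (mk {opr y (f y) | y. R y x})" for x
  proof -
    have wf': "wf {(x, y). R x y}" using wf by (simp add: wfp_def)
    have "{opr y (cut f {(x, y). R x y} x y) | y. R y x} = {opr y (f y) | y. R y x}"
      by (intro Collect_cong ex_cong1) (auto simp: cut_apply)
    then show ?thesis unfolding f_def by (subst wfrec[OF wf']) simp
  qed
  then show ?thesis using that[of f] Dfn_recursion[of R G f, OF wf R R_small G] by blast
qed

text \<open>Where \<open>f\<close> is not single-valued at \<open>x\<close> the value is the empty
  set; application is thus total and definable without side conditions.\<close>

definition app :: "'a \<Rightarrow> 'a \<Rightarrow> 'a" where
  "app f x = (if \<exists>!y. opr x y \<epsilon> f then THE y. opr x y \<epsilon> f else mk {})"

lemma app_eq:
  assumes "opr x y \<epsilon> f" "\<And>z. opr x z \<epsilon> f \<Longrightarrow> z = y" shows "app f x = y"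
proof -
  have "\<exists>!y. opr x y \<epsilon> f" using assms by (rule ex1I)
  then have "app f x = (THE y. opr x y \<epsilon> f)" unfolding app_def by (rule if_P)
  also have "\<dots> = y" using assms by (rule the_equality)
  finally show ?thesis .
qed

lemma Trm_app [dfn]: "Trm t \<Longrightarrow> Trm u \<Longrightarrow> Trm (\<lambda>e. app (t e) (u e))"
proof (rule Trm_sub2[where F=app])
  have "z = app f x \<longleftrightarrow> ((\<exists>!y. opr x y \<epsilon> f) \<and> opr x z \<epsilon> f) \<or> (\<not> (\<exists>!y. opr x y \<epsilon> f) \<and> z = mk {})" for z f x
  proof (cases "\<exists>!y. opr x y \<epsilon> f")
    case True
    have "opr x (app f x) \<epsilon> f" unfolding app_def if_P[OF True] by (rule theI'[OF True])
    with True show ?thesis by auto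
  next
    case False
    then show ?thesis by (simp only: app_def if_False) simp
  qed
  then show "Dfn (\<lambda>e. e 0 = app (e 1) (e 2))" by (simp only:) (intro dfn)
qed

definition lam :: "'a set \<Rightarrow> ('a \<Rightarrow> 'a) \<Rightarrow> 'a" where
  "lam A F = mk {opr x (F x) | x. x \<in> A}"

lemma mem_lam:
  assumes "small {opr x (F x) | x. x \<in> A}" shows "p \<epsilon> lam A F \<longleftrightarrow> (\<exists>x\<in>A. p = opr x (F x))"
  using assms by (auto simp: lam_def mem_mk)

lemma app_lam:
  assumes "small {opr x (F x) | x. x \<in> A}" "x \<in> A" shows "app (lam A F) x = F x"
  by (rule app_eq) (auto simp: mem_lam assms)

lemma small_lam:
  assumes "small A" "Dfn (\<lambda>e. e 0 = F (e 1))" shows "small {opr x (F x) | x. x \<in> A}"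
proof -
  have "small ((\<lambda>x. opr x (F x)) ` A)"
    by (rule small_image[OF assms(1)], intro dfn Trm_sub1[where F=F, OF assms(2)])
  moreover have "(\<lambda>x. opr x (F x)) ` A = {opr x (F x) | x. x \<in> A}" by auto
  ultimately show ?thesis by simp
qed

lemma mem_recursion:
  assumes G: "Dfn (\<lambda>e. e 0 = G (e 1) (e 2))"
  obtains f where "\<And>x. f x = G x (lam (elts x) f)" "Dfn (\<lambda>e. e 0 = f (e 1))"
    "\<And>x. small {opr y (f y) | y. y \<in> elts x}"
proof -
  have sm: "\<And>x. small {y. y \<epsilon> x}" using small_elts unfolding elts_def .
  obtain f where f: "\<And>x. f x = G x (mk {opr y (f y) | y. y \<epsilon> x})" "Dfn (\<lambda>e. e 0 = f (e 1))"
    by (rule definable_recursion[OF wf_mem Dfn_var_mem sm G], rule that)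
  show ?thesis
  proof (rule that[of f])
    show "f x = G x (lam (elts x) f)" for x unfolding lam_def in_elts by (rule f(1))
    show "small {opr y (f y) | y. y \<in> elts x}" for x by (rule small_lam[OF small_elts f(2)])
  qed (rule f(2))
qed

end

section \<open>Natural numbers and reals of a model\<close>

text \<open>The value 0 beyond the end of the list.\<close>

definition nthl :: "nat list \<Rightarrow> nat \<Rightarrow> nat" where
  "nthl l i = (if i < length l then l ! i else 0)"

context zfc_model
begin

lemma mem_elts: "elts a = A \<Longrightarrow> x \<epsilon> a \<longleftrightarrow> x \<in> A"
  by auto

lemma Dfn_is_inductive [dfn]: "Trm t \<Longrightarrow> Dfn (\<lambda>e. is_inductive (t e))"
  by (rule Dfn_sub1[where P=is_inductive]) (unfold is_inductive_def, intro dfn)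

definition suc :: "'a \<Rightarrow> 'a" where "suc x = mk (insert x (elts x))"

lemma elts_suc [simp]: "elts (suc x) = insert x (elts x)"
  unfolding suc_def by (rule elts_mk, rule small_insert, rule small_elts)

lemma mem_suc [simp]: "y \<epsilon> suc x \<longleftrightarrow> y = x \<or> y \<epsilon> x"
  by (simp add: mem_elts[OF elts_suc])

lemma is_succ_iff: "is_succ s x \<longleftrightarrow> s = suc x"
  unfolding is_succ_def eq_iff_mem[of s] by auto

lemma Trm_suc [dfn]: "Trm t \<Longrightarrow> Trm (\<lambda>e. suc (t e))"
  by (rule Trm_sub1[where F=suc]) (unfold is_succ_iff[symmetric], intro dfn)

definition emp :: 'a where "emp = mk {}"

lemma elts_emp [simp]: "elts emp = {}" by (simp add: emp_def elts_mk small_empty)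

lemma mem_emp [simp]: "\<not> x \<epsilon> emp" by (simp add: mem_elts[OF elts_emp])

lemma is_empty_iff: "is_empty x \<longleftrightarrow> x = emp"
  unfolding is_empty_def eq_iff_mem[of x] by simp

primrec num :: "nat \<Rightarrow> 'a" where
  "num 0 = emp"
| "num (Suc n) = suc (num n)"

lemma is_numeral_iff: "is_numeral n x \<longleftrightarrow> x = num n"
  by (induction n arbitrary: x) (auto simp: is_empty_iff is_succ_iff)

lemma elts_num: "elts (num n) = num ` {..<n}"
  by (induction n) (auto simp: lessThan_Suc)

lemma num_mem_less: "m < n \<Longrightarrow> num m \<epsilon> num n"
  by (auto simp: mem_elts[OF elts_num])

lemma num_eq [simp]: "num m = num n \<longleftrightarrow> m = n"
  by (metis linorder_neqE_nat mem_irrefl num_mem_less)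

lemma num_mem [simp]: "num m \<epsilon> num n \<longleftrightarrow> m < n"
  by (auto simp: mem_elts[OF elts_num])

lemma num_mem_inductive: "is_inductive v \<Longrightarrow> num n \<epsilon> v"
  by (induction n) (auto simp: is_inductive_def is_empty_iff is_succ_iff)

text \<open>This is where the well-foundedness of the model enters arithmetic: its natural numbers
  are the actual ones.\<close>

lemma num_minimal:
  assumes "\<And>v. is_inductive v \<Longrightarrow> x \<epsilon> v" "is_inductive w" shows "x \<in> range num"
  using assms(1)
proof (induction x rule: mem_induct)
  case (step x)
  have "small {y \<in> elts w. \<forall>v. is_inductive v \<longrightarrow> y \<epsilon> v}" by (rule small_sep[OF small_elts], intro dfn)
  moreover have "small {x}" by (rule small_sing)
  ultimately have sm: "small ({y \<in> elts w. \<forall>v. is_inductive v \<longrightarrow> y \<epsilon> v} - {x})" by (rule small_Diff)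
  \<comment> \<open>If \<open>x\<close> were not standard, removing it from the intersection of all
    inductive sets would leave an inductive set: when \<open>suc y = x\<close>, the induction
    hypothesis makes \<open>y\<close> standard and hence \<open>x\<close> as well.\<close>
  define u where "u = mk ({y \<in> elts w. \<forall>v. is_inductive v \<longrightarrow> y \<epsilon> v} - {x})"
  have u: "y \<epsilon> u \<longleftrightarrow> (\<forall>v. is_inductive v \<longrightarrow> y \<epsilon> v) \<and> y \<noteq> x" for y
    unfolding u_def mem_mk[OF sm] using assms(2) by auto
  show ?case
  proof (rule ccontr)
    assume n: "x \<notin> range num"
    have "is_inductive u" unfolding is_inductive_def is_empty_iff is_succ_iff
    proof (intro conjI allI impI)
      show "\<exists>e. e = emp \<and> e \<epsilon> u" using rangeI[of num 0] n num_mem_inductive[of _ 0] by (auto simp: u)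
      fix y assume y: "y \<epsilon> u"
      have "suc y \<epsilon> v" if "is_inductive v" for v
        using y that unfolding u by (auto simp: is_inductive_def is_succ_iff)
      moreover have "suc y \<noteq> x"
      proof
        assume "suc y = x"
        then have "y \<in> range num" using step.IH[of y] y by (auto simp: u)
        then show False using n \<open>suc y = x\<close> rangeI[of num "Suc _"] by auto
      qed
      ultimately show "\<exists>s. s = suc y \<and> s \<epsilon> u" by (simp add: u)
    qed
    then have "x \<epsilon> u" by (rule step.prems)
    then show False by (simp add: u)
  qed
qed

lemma small_range_num: "small (range num)"
proof -
  have "\<exists>a. is_inductive a" using zfc unfolding zfc_def by (elim conjE)
  then obtain a where a: "is_inductive a" ..
  have "{x \<in> elts a. \<forall>v. is_inductive v \<longrightarrow> x \<epsilon> v} = range num"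
    using num_mem_inductive num_minimal[OF _ a] a by auto
  moreover have "small {x \<in> elts a. \<forall>v. is_inductive v \<longrightarrow> x \<epsilon> v}" by (rule small_sep[OF small_elts], intro dfn)
  ultimately show ?thesis by simp
qed

definition omg :: 'a where "omg = mk (range num)"

lemma elts_omg [simp]: "elts omg = range num" by (simp add: omg_def elts_mk small_range_num)

lemma mem_omg: "x \<epsilon> omg \<longleftrightarrow> (\<exists>n. x = num n)"
  by (auto simp: mem_elts[OF elts_omg])

lemma is_inductive_omg: "is_inductive omg"
  unfolding is_inductive_def is_empty_iff is_succ_iff mem_omg by (metis num.simps)

lemma is_omega_iff: "is_omega w \<longleftrightarrow> w = omg"
proof
  assume w: "is_omega w"
  have "x \<epsilon> w \<longleftrightarrow> x \<epsilon> omg" for x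
    using w is_inductive_omg num_mem_inductive unfolding is_omega_def sub_def by (auto simp: mem_omg)
  then show "w = omg" unfolding eq_iff_mem[of w] by simp
next
  assume "w = omg"
  then show "is_omega w"
    using is_inductive_omg num_mem_inductive unfolding is_omega_def sub_def by (auto simp: mem_omg)
qed

subsection \<open>Definability of relations and functions on the natural numbers\<close>

text \<open>Outside the natural numbers of the model \<open>nm\<close> takes the value 0.\<close>

definition nm :: "'a \<Rightarrow> nat" where
  "nm x = (if x \<in> range num then inv num x else 0)"

lemma nm_num [simp]: "nm (num n) = n"
  by (simp add: nm_def inv_f_f inj_def)

lemma num_nm: "x \<epsilon> omg \<Longrightarrow> num (nm x) = x"
  by (auto simp: mem_omg)

definition NTrm :: "((nat \<Rightarrow> 'a) \<Rightarrow> nat) \<Rightarrow> bool" where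
  "NTrm t \<longleftrightarrow> Trm (\<lambda>e. num (t e))"

lemma Trm_num [dfn]: "NTrm t \<Longrightarrow> Trm (\<lambda>e. num (t e))"
  by (simp only: NTrm_def)

lemma NTrm_nm [dfn]: "Trm t \<Longrightarrow> NTrm (\<lambda>e. nm (t e))"
  unfolding NTrm_def
proof (rule Trm_sub1[where F="\<lambda>x. num (nm x)"])
  have "y = num (nm x) \<longleftrightarrow> (x \<epsilon> omg \<and> y = x) \<or> (\<not> x \<epsilon> omg \<and> y = num 0)" for x y
  proof (cases "x \<epsilon> omg")
    case False
    then have "nm x = 0" by (simp add: nm_def mem_omg image_iff)
    with False show ?thesis by simp
  qed (auto simp: mem_omg)
  then show "Dfn (\<lambda>e. e 0 = num (nm (e 1)))" by (simp only:) (intro dfn)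
qed

lemma NTrm_const [dfn]: "NTrm (\<lambda>e. c)"
  unfolding NTrm_def by (intro dfn)

lemma NTrm_shift: "NTrm t \<Longrightarrow> NTrm (\<lambda>e. t (\<lambda>i. e (Suc i)))"
  unfolding NTrm_def by (rule Trm_Suc)

lemma Dfn_shift: "Dfn P \<Longrightarrow> Dfn (\<lambda>e. P (\<lambda>i. e (Suc i)))"
  by (rule Dfn_rename)

text \<open>Since \<open>nm\<close> maps the model onto the natural numbers, a quantifier over
  numbers is one over all elements. This lets arithmetic predicates of the universe count as
  predicates of the model.\<close>

lemma Dfn_all_nat [dfn]:
  assumes "Dfn (\<lambda>e. P (\<lambda>i. e (Suc i)) (nm (e 0)))" shows "Dfn (\<lambda>e. \<forall>n. P e n)"
proof -
  have "(\<forall>n. P e n) \<longleftrightarrow> (\<forall>x. P e (nm x))" for e by (metis nm_num)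
  then show ?thesis by (simp only:) (intro dfn assms)
qed

lemma Dfn_ex_nat [dfn]:
  assumes "Dfn (\<lambda>e. P (\<lambda>i. e (Suc i)) (nm (e 0)))" shows "Dfn (\<lambda>e. \<exists>n. P e n)"
proof -
  have "(\<exists>n. P e n) \<longleftrightarrow> (\<exists>x. P e (nm x))" for e by (metis nm_num)
  then show ?thesis by (simp only:) (intro dfn assms)
qed

lemma Dfn_nat_eq [dfn]:
  assumes "NTrm t" "NTrm u" shows "Dfn (\<lambda>e. t e = u e)"
  unfolding num_eq[symmetric] by (intro dfn assms)

lemma Dfn_nat_less [dfn]:
  assumes "NTrm t" "NTrm u" shows "Dfn (\<lambda>e. t e < u e)"
  unfolding num_mem[symmetric] by (intro dfn assms)

lemma Dfn_nat_le [dfn]: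
  assumes "NTrm t" "NTrm u" shows "Dfn (\<lambda>e. t e \<le> u e)"
  unfolding linorder_not_less[symmetric] by (intro dfn assms)

lemma NTrm_sub1:
  assumes "Dfn (\<lambda>e. nm (e 0) = F (nm (e 1)))" "NTrm t" shows "NTrm (\<lambda>e. F (t e))"
proof -
  have "Trm (\<lambda>e. num (F (nm (num (t e)))))"
  proof (rule Trm_sub1[where F="\<lambda>x. num (F (nm x))"])
    have "y = num (F (nm x)) \<longleftrightarrow> y \<epsilon> omg \<and> nm y = F (nm x)" for x y by (auto simp: mem_omg)
    then show "Dfn (\<lambda>e. e 0 = num (F (nm (e 1))))" by (simp only:) (intro dfn assms(1))
  qed (intro dfn assms)
  then show ?thesis by (simp only: NTrm_def nm_num)
qed

lemma NTrm_sub2: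
  assumes "Dfn (\<lambda>e. nm (e 0) = F (nm (e 1)) (nm (e 2)))" "NTrm t" "NTrm u" shows "NTrm (\<lambda>e. F (t e) (u e))"
proof -
  have "Trm (\<lambda>e. num (F (nm (num (t e))) (nm (num (u e)))))"
  proof (rule Trm_sub2[where F="\<lambda>x y. num (F (nm x) (nm y))"])
    have "z = num (F (nm x) (nm y)) \<longleftrightarrow> z \<epsilon> omg \<and> nm z = F (nm x) (nm y)" for x y z by (auto simp: mem_omg)
    then show "Dfn (\<lambda>e. e 0 = num (F (nm (e 1)) (nm (e 2))))" by (simp only:) (intro dfn assms(1))
  qed (intro dfn assms)+
  then show ?thesis by (simp only: NTrm_def nm_num)
qed

lemma NTrm_Suc [dfn]: "NTrm t \<Longrightarrow> NTrm (\<lambda>e. Suc (t e))"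
  unfolding NTrm_def num.simps by (rule Trm_suc)

text \<open>Primitive recursion: a value is certified by a finite approximation of the graph, which always
  is an element of the model.\<close>

lemma NTrm_primrec:
  assumes F0: "\<And>p. F p 0 = A p" and FS: "\<And>p n. F p (Suc n) = H p n (F p n)"
    and A: "\<And>t. NTrm t \<Longrightarrow> NTrm (\<lambda>e. A (t e))"
    and H: "\<And>t u s. NTrm t \<Longrightarrow> NTrm u \<Longrightarrow> NTrm s \<Longrightarrow> NTrm (\<lambda>e. H (t e) (u e) (s e))"
    and t: "NTrm t" "NTrm u"
  shows "NTrm (\<lambda>e. F (t e) (u e))"
proof (rule NTrm_sub2[where F=F, OF _ t])
  define loc where "loc h p \<longleftrightarrow> (\<forall>i y. opr (num i) (num y) \<epsilon> h \<longrightarrow>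
     (i = 0 \<and> y = A p) \<or> (\<exists>j z. i = Suc j \<and> opr (num j) (num z) \<epsilon> h \<and> y = H p j z))" for h p
  have 1: "y = F p n" if loc: "loc h p" and ny: "opr (num n) (num y) \<epsilon> h" for h p n y
    using ny
  proof (induction n arbitrary: y)
    case 0
    then show ?case using loc[unfolded loc_def, rule_format, of 0 y] F0[of p] by simp
  next
    case (Suc n)
    then obtain z where "opr (num n) (num z) \<epsilon> h" "y = H p n z"
      using loc[unfolded loc_def, rule_format, of "Suc n" y] by auto
    then show ?case using Suc.IH[of z] FS[of p n] by simp
  qed
  have 2: "\<exists>h. loc h p \<and> opr (num n) (num (F p n)) \<epsilon> h" for p n
  proof -
    define h where "h = mk ((\<lambda>i. opr (num i) (num (F p i))) ` {..n})"
    have h: "x \<epsilon> h \<longleftrightarrow> (\<exists>i\<le>n. x = opr (num i) (num (F p i)))" for x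
      unfolding h_def by (subst mem_mk[OF small_finite]) auto
    have "loc h p" unfolding loc_def h
    proof (intro allI impI)
      fix i y assume "\<exists>i'\<le>n. opr (num i) (num y) = opr (num i') (num (F p i'))"
      then have iy: "i \<le> n" "y = F p i" by auto
      show "i = 0 \<and> y = A p \<or> (\<exists>j z. i = Suc j \<and> (\<exists>i\<le>n. opr (num j) (num z) = opr (num i) (num (F p i))) \<and> y = H p j z)"
      proof (cases i)
        case 0
        then show ?thesis using iy F0[of p] by simp
      next
        case (Suc j)
        then have "j \<le> n" "y = H p j (F p j)" using iy FS[of p j] by simp_all
        then show ?thesis using Suc by (intro disjI2 exI[of _ j] exI[of _ "F p j"]) auto
      qed
    qed
    moreover have "opr (num n) (num (F p n)) \<epsilon> h" unfolding h by (rule exI[of _ n]) simp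
    ultimately show ?thesis by (intro exI conjI)
  qed
  have "nm y = F p n \<longleftrightarrow> (\<exists>h. loc h p \<and> opr (num n) (num (nm y)) \<epsilon> h)" for y p n
  proof
    assume "nm y = F p n"
    then show "\<exists>h. loc h p \<and> opr (num n) (num (nm y)) \<epsilon> h" using 2[of p n] by simp
  next
    assume "\<exists>h. loc h p \<and> opr (num n) (num (nm y)) \<epsilon> h"
    then show "nm y = F p n" by (elim exE conjE) (rule 1)
  qed
  then show "Dfn (\<lambda>e. nm (e 0) = F (nm (e 1)) (nm (e 2)))"
    unfolding loc_def by (simp only:) (intro dfn A H)
qed

lemma NTrm_add [dfn]: "NTrm t \<Longrightarrow> NTrm u \<Longrightarrow> NTrm (\<lambda>e. t e + u e)"
  by (rule NTrm_primrec[where F="(+)" and A="\<lambda>p. p" and H="\<lambda>p n y. Suc y"]) (auto intro: NTrm_Suc)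

lemma NTrm_mult [dfn]: "NTrm t \<Longrightarrow> NTrm u \<Longrightarrow> NTrm (\<lambda>e. t e * u e)"
  by (rule NTrm_primrec[where F="(*)" and A="\<lambda>p. 0" and H="\<lambda>p n y. p + y"]) (auto intro: dfn)

lemma NTrm_Least [dfn]:
  assumes "Dfn (\<lambda>e. P (\<lambda>i. e (Suc i)) (nm (e 0)))" shows "NTrm (\<lambda>e. LEAST n. P e n)"
proof -
  \<comment> \<open>If nothing satisfies the predicate, \<open>LEAST\<close> has an unspecified but
    fixed value, which the second disjunct names.\<close>
  have eq: "x = num (LEAST n. P e n) \<longleftrightarrow> x \<epsilon> omg \<and>
      ((P e (nm x) \<and> (\<forall>z. z < nm x \<longrightarrow> \<not> P e z)) \<or> ((\<forall>z. \<not> P e z) \<and> nm x = (LEAST n. False)))" for x e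
  proof (cases "\<exists>n. P e n")
    case True
    have "m = (LEAST n. P e n) \<longleftrightarrow> P e m \<and> (\<forall>z. z < m \<longrightarrow> \<not> P e z)" for m
      using True LeastI_ex[OF True] not_less_Least[of _ "P e"] by (metis linorder_neqE_nat)
    moreover have "x = num (LEAST n. P e n) \<longleftrightarrow> x \<epsilon> omg \<and> nm x = (LEAST n. P e n)" by (auto simp: mem_omg)
    ultimately show ?thesis using True by auto
  next
    case False
    then have "P e = (\<lambda>_. False)" by auto
    then show ?thesis by (auto simp: mem_omg)
  qed
  have *: "Dfn (\<lambda>e. P (\<lambda>i. e (r i)) (nm (e (s 0))))" for r s
    using Dfn_rename[OF assms, of "case_nat (s 0) r"] by simp
  show ?thesis unfolding NTrm_def Trm_def eq
    using *[of "\<lambda>i. Suc i" "\<lambda>i. 0"] *[of "\<lambda>i. Suc (Suc i)" "\<lambda>i. 0"]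
    by (intro dfn) simp_all
qed

lemma NTrm_if [dfn]: 
  assumes "Dfn P" "NTrm t" "NTrm u" shows "NTrm (\<lambda>e. if P e then t e else u e)"
proof -
  have eq: "x = num (if P e then t e else u e) \<longleftrightarrow> (P e \<and> x = num (t e)) \<or> (\<not> P e \<and> x = num (u e))" for x e
    by simp
  show ?thesis unfolding NTrm_def Trm_def eq by (intro dfn Dfn_shift NTrm_shift assms)
qed

lemma NTrm_diff [dfn]: "NTrm t \<Longrightarrow> NTrm u \<Longrightarrow> NTrm (\<lambda>e. t e - u e)"
proof (rule NTrm_sub2[where F="(-)"])
  have "x = y - z \<longleftrightarrow> (y < z \<and> x = 0) \<or> (\<not> y < z \<and> x + z = y)" for x y z :: nat by auto
  then show "Dfn (\<lambda>e. nm (e 0) = nm (e 1) - nm (e 2))" by (simp only:) (intro dfn)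
qed

lemma NTrm_prod_encode [dfn]: "NTrm t \<Longrightarrow> NTrm u \<Longrightarrow> NTrm (\<lambda>e. prod_encode (t e, u e))"
proof (rule NTrm_sub2[where F="\<lambda>x y. prod_encode (x, y)"])
  \<comment> \<open>Doubling removes the division by 2 from the triangular numbers.\<close>
  have "x = prod_encode (y, z) \<longleftrightarrow> x + x = (y + z) * Suc (y + z) + (y + y)" for x y z :: nat
  proof -
    have "even ((y + z) * Suc (y + z))" by simp
    then obtain k where k: "(y + z) * Suc (y + z) = 2 * k" by (rule evenE)
    show ?thesis unfolding prod_encode_def triangle_def split_conv k by auto
  qed
  then show "Dfn (\<lambda>e. nm (e 0) = prod_encode (nm (e 1), nm (e 2)))" by (simp only:) (intro dfn)
qed

lemma NTrm_fst [dfn]: "NTrm t \<Longrightarrow> NTrm (\<lambda>e. fst (prod_decode (t e)))"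
proof (rule NTrm_sub1[where F="\<lambda>x. fst (prod_decode x)"])
  have "x = fst (prod_decode y) \<longleftrightarrow> (\<exists>z. y = prod_encode (x, z))" for x y
    by (metis fst_conv prod.collapse prod_decode_inverse prod_encode_inverse)
  then show "Dfn (\<lambda>e. nm (e 0) = fst (prod_decode (nm (e 1))))" by (simp only:) (intro dfn)
qed

lemma NTrm_snd [dfn]: "NTrm t \<Longrightarrow> NTrm (\<lambda>e. snd (prod_decode (t e)))"
proof (rule NTrm_sub1[where F="\<lambda>x. snd (prod_decode x)"])
  have "x = snd (prod_decode y) \<longleftrightarrow> (\<exists>z. y = prod_encode (z, x))" for x y
    by (metis snd_conv prod.collapse prod_decode_inverse prod_encode_inverse)
  then show "Dfn (\<lambda>e. nm (e 0) = snd (prod_decode (nm (e 1))))" by (simp only:) (intro dfn)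
qed

subsection \<open>Lists\<close>

definition LTrm :: "((nat \<Rightarrow> 'a) \<Rightarrow> nat list) \<Rightarrow> bool" where
  "LTrm t \<longleftrightarrow> NTrm (\<lambda>e. list_encode (t e))"

lemma NTrm_list_encode [dfn]: "LTrm t \<Longrightarrow> NTrm (\<lambda>e. list_encode (t e))"
  by (simp only: LTrm_def)

lemma LTrm_list_decode [dfn]: "NTrm t \<Longrightarrow> LTrm (\<lambda>e. list_decode (t e))"
  by (simp only: LTrm_def list_decode_inverse)

lemma LTrm_const [dfn]: "LTrm (\<lambda>e. c)"
  unfolding LTrm_def by (intro dfn)

lemma Dfn_all_list [dfn]:
  assumes "Dfn (\<lambda>e. P (\<lambda>i. e (Suc i)) (list_decode (nm (e 0))))" shows "Dfn (\<lambda>e. \<forall>n. P e n)"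
proof -
  have "(\<forall>n. P e n) \<longleftrightarrow> (\<forall>x. P e (list_decode (nm x)))" for e by (metis nm_num list_encode_inverse)
  then show ?thesis by (simp only:) (intro dfn assms)
qed

lemma Dfn_ex_list [dfn]:
  assumes "Dfn (\<lambda>e. P (\<lambda>i. e (Suc i)) (list_decode (nm (e 0))))" shows "Dfn (\<lambda>e. \<exists>n. P e n)"
proof -
  have "(\<exists>n. P e n) \<longleftrightarrow> (\<exists>x. P e (list_decode (nm x)))" for e by (metis nm_num list_encode_inverse)
  then show ?thesis by (simp only:) (intro dfn assms)
qed

lemma Dfn_list_eq [dfn]:
  assumes "LTrm t" "LTrm u" shows "Dfn (\<lambda>e. t e = u e)"
  unfolding list_encode_eq[symmetric] by (intro dfn assms)

text \<open>On codes, dropping is a primitive recursion, as a nonempty list is coded by the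
  successor of a pair. Length and entries of a list are then read off from
  \<open>drop\<close>.\<close>

lemma list_decode_drop:
  "list_encode (drop (Suc n) (list_decode p)) =
    (let c = list_encode (drop n (list_decode p)) in if c = 0 then 0 else snd (prod_decode (c - 1)))"
proof (cases "drop n (list_decode p)")
  case Nil
  then show ?thesis by simp
next
  case (Cons x xs)
  then have "drop (Suc n) (list_decode p) = xs" by (metis drop_Suc list.sel(3) tl_drop)
  with Cons show ?thesis by (simp add: Let_def)
qed

lemma NTrm_drop: "NTrm t \<Longrightarrow> NTrm u \<Longrightarrow> NTrm (\<lambda>e. list_encode (drop (u e) (list_decode (t e))))"
  by (rule NTrm_primrec[where F="\<lambda>p n. list_encode (drop n (list_decode p))" and A="\<lambda>p. p"
      and H="\<lambda>p n c. if c = 0 then 0 else snd (prod_decode (c - 1))"])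
    (simp, unfold list_decode_drop Let_def, rule refl, assumption, intro dfn, assumption+)

lemma LTrm_drop [dfn]:
  assumes "LTrm t" "NTrm u" shows "LTrm (\<lambda>e. drop (u e) (t e))"
  using NTrm_drop[of "\<lambda>e. list_encode (t e)" u] assms unfolding LTrm_def by simp

lemma LTrm_shift: "LTrm t \<Longrightarrow> LTrm (\<lambda>e. t (\<lambda>i. e (Suc i)))"
  unfolding LTrm_def by (rule NTrm_shift)

lemma NTrm_length [dfn]:
  assumes "LTrm t" shows "NTrm (\<lambda>e. length (t e))"
proof -
  have "length (t e) = (LEAST n. drop n (t e) = [])" for e
    by (simp add: Least_equality[symmetric])
  then show ?thesis by (simp only:) (intro dfn LTrm_shift assms)
qed

lemma NTrm_nthl [dfn]: "LTrm t \<Longrightarrow> NTrm u \<Longrightarrow> NTrm (\<lambda>e. nthl (t e) (u e))"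
proof -
  assume *: "LTrm t" "NTrm u"
  have eq: "nthl (t e) (u e) = (if u e < length (t e)
     then fst (prod_decode (list_encode (drop (u e) (t e)) - 1)) else 0)" for e
    by (simp add: nthl_def Cons_nth_drop_Suc[symmetric])
  show ?thesis unfolding eq by (intro dfn *)
qed

text \<open>The sets of natural numbers that the model knows. \<open>st\<close> gives the element
  for such a set, and \<open>rl\<close> reads a set off from any element whatever, so that
  quantifiers over \<open>Rl\<close> become quantifiers over the model.\<close>

definition Rl :: "nat set set" where "Rl = {X. small (num ` X)}"

definition st :: "nat set \<Rightarrow> 'a" where "st X = mk (num ` X)"

definition rl :: "'a \<Rightarrow> nat set" where "rl a = {n. num n \<epsilon> a}"

lemma rl_in_Rl [simp, intro]: "rl a \<in> Rl"
proof -
  have "num ` rl a = elts a \<inter> elts omg" by (auto simp: rl_def)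
  then show ?thesis unfolding Rl_def by (simp only: mem_Collect_eq) (intro small_Int small_elts)
qed

lemma elts_st: "X \<in> Rl \<Longrightarrow> elts (st X) = num ` X"
  by (simp add: Rl_def st_def elts_mk)

lemma mem_st: "X \<in> Rl \<Longrightarrow> x \<epsilon> st X \<longleftrightarrow> (\<exists>n\<in>X. x = num n)"
  by (auto simp: mem_elts[OF elts_st])

lemma rl_st [simp]: "X \<in> Rl \<Longrightarrow> rl (st X) = X"
  by (auto simp: rl_def mem_st)

lemma st_eq [simp]: "X \<in> Rl \<Longrightarrow> Y \<in> Rl \<Longrightarrow> st X = st Y \<longleftrightarrow> X = Y"
  using rl_st by metis

lemma sub_st_omg: "X \<in> Rl \<Longrightarrow> sub (st X) omg"
  by (auto simp: sub_def mem_st mem_omg)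

lemma st_rl: "sub a omg \<Longrightarrow> st (rl a) = a"
  unfolding eq_iff_mem[of "st (rl a)"] by (auto simp: mem_st[OF rl_in_Rl] mem_omg sub_def) (auto simp: rl_def)

lemma Rl_I:
  assumes "Dfn (\<lambda>e. P (nm (e 0)))" shows "{n. P n} \<in> Rl"
proof -
  have "num ` {n. P n} = {x \<in> elts omg. P (nm x)}" by auto
  moreover have "small {x \<in> elts omg. P (nm x)}" by (rule small_sep[OF small_elts assms])
  ultimately show ?thesis by (simp add: Rl_def)
qed

lemma Dfn_mem_rl [dfn]:
  assumes "NTrm t" "Trm u" shows "Dfn (\<lambda>e. t e \<in> rl (u e))"
  unfolding rl_def mem_Collect_eq by (intro dfn assms)

lemma Dfn_mem_Rl: 
  assumes "X \<in> Rl" "NTrm t" shows "Dfn (\<lambda>e. t e \<in> X)"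
proof -
  have "Dfn (\<lambda>e. t e \<in> rl (st X))" by (intro dfn assms(2))
  then show ?thesis by (simp only: rl_st[OF assms(1)])
qed

lemma Dfn_bex_Rl [dfn]:
  assumes "Dfn (\<lambda>e. P (\<lambda>i. e (Suc i)) (rl (e 0)))" shows "Dfn (\<lambda>e. \<exists>X\<in>Rl. P e X)"
proof -
  have "(\<exists>X\<in>Rl. P e X) \<longleftrightarrow> (\<exists>x. P e (rl x))" for e using rl_st rl_in_Rl by metis
  then show ?thesis by (simp only:) (intro dfn assms)
qed

lemma Trm_st:
  assumes "Dfn (\<lambda>e. nm (e 0) \<in> A (\<lambda>i. e (Suc i)))" "\<And>e. A e \<in> Rl" shows "Trm (\<lambda>e. st (A e))"
proof -
  have *: "x = st (A e) \<longleftrightarrow> (\<forall>y. y \<epsilon> x \<longleftrightarrow> y \<epsilon> omg \<and> nm y \<in> A e)" for x e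
    unfolding eq_iff_mem[of x] mem_st[OF assms(2)] by (auto simp: mem_omg)
  have "Dfn (\<lambda>e. nm (e 0) \<in> A (\<lambda>i. e (Suc (Suc i))))"
    using Dfn_rename[OF assms(1), of "case_nat 0 (\<lambda>i. Suc (Suc i))"] by simp
  then show ?thesis unfolding Trm_def * by (intro dfn)
qed

lemma Rl_finite: "finite X \<Longrightarrow> X \<in> Rl"
  by (simp add: Rl_def small_finite)

lemma Rl_empty [simp]: "{} \<in> Rl" by (simp add: Rl_finite)

lemma Rl_UNIV [simp]: "UNIV \<in> Rl" by (simp add: Rl_def small_range_num)

lemma Rl_Int: "X \<in> Rl \<Longrightarrow> Y \<in> Rl \<Longrightarrow> X \<inter> Y \<in> Rl"
  by (simp add: Rl_def image_Int inj_def small_Int)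

lemma Rl_Diff: "X \<in> Rl \<Longrightarrow> Y \<in> Rl \<Longrightarrow> X - Y \<in> Rl"
  by (simp add: Rl_def image_set_diff inj_def small_Diff)

lemma Rl_Compl: "X \<in> Rl \<Longrightarrow> - X \<in> Rl"
  using Rl_Diff[OF Rl_UNIV, of X] by (simp add: Compl_eq_Diff_UNIV)

end

section \<open>Ordinals, choice and collection in a model\<close>

context zfc_model
begin

lemma Dfn_the:
  assumes R: "Dfn (\<lambda>e. R (e 0) (e 1))"
  shows "Dfn (\<lambda>e. e 0 = (if \<exists>!y. R y (e 1) then THE y. R y (e 1) else emp))"
proof -
  have "z = (if \<exists>!y. R y x then THE y. R y x else emp) \<longleftrightarrow>
    ((\<exists>!y. R y x) \<and> R z x) \<or> (\<not> (\<exists>!y. R y x) \<and> z = emp)" for x z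
  proof (cases "\<exists>!y. R y x")
    case True
    then have "R (THE y. R y x) x" by (rule theI')
    with True show ?thesis by auto
  qed simp
  then show ?thesis by (simp only:) (intro dfn Dfn_sub2[where P=R, OF R])
qed

lemma Trm_mk:
  assumes "Dfn (\<lambda>e. e 0 \<in> A (\<lambda>i. e (Suc i)))" "\<And>e. small (A e)" shows "Trm (\<lambda>e. mk (A e))"
proof -
  have *: "x = mk (A e) \<longleftrightarrow> (\<forall>y. y \<epsilon> x \<longleftrightarrow> y \<in> A e)" for x e
    using mk_eq_iff[OF assms(2)] .
  have "Dfn (\<lambda>e. e 0 \<in> A (\<lambda>i. e (Suc (Suc i))))"
    using Dfn_rename[OF assms(1), of "case_nat 0 (\<lambda>i. Suc (Suc i))"] by simp
  then show ?thesis unfolding Trm_def * by (intro dfn)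
qed

text \<open>Transitive sets of transitive sets; since membership is well-founded, these are the
  ordinals of the model.\<close>

definition Ord :: "'a \<Rightarrow> bool" where
  "Ord a \<longleftrightarrow> (\<forall>x y. x \<epsilon> a \<and> y \<epsilon> x \<longrightarrow> y \<epsilon> a) \<and> (\<forall>x y z. x \<epsilon> a \<and> y \<epsilon> x \<and> z \<epsilon> y \<longrightarrow> z \<epsilon> x)"

lemma Dfn_Ord [dfn]: "Trm t \<Longrightarrow> Dfn (\<lambda>e. Ord (t e))"
  by (rule Dfn_sub1[where P=Ord]) (unfold Ord_def, intro dfn)

lemma Ord_mem: "Ord a \<Longrightarrow> x \<epsilon> a \<Longrightarrow> Ord x"
  unfolding Ord_def by metis

lemma Ord_trans: "Ord a \<Longrightarrow> x \<epsilon> a \<Longrightarrow> y \<epsilon> x \<Longrightarrow> y \<epsilon> a"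
  unfolding Ord_def by metis

lemma Ord_linear:
  assumes "Ord a" "Ord b" shows "a \<epsilon> b \<or> a = b \<or> b \<epsilon> a"
  using assms
proof (induction a arbitrary: b rule: mem_induct)
  case (step a)
  note IHa = step.IH
  show ?case using step.prems(2)
  proof (induction b rule: mem_induct)
    case (step b)
    have *: "\<And>y. y \<epsilon> b \<Longrightarrow> a \<epsilon> y \<or> a = y \<or> y \<epsilon> a"
      using step.IH Ord_mem[OF step.prems] by simp
    have **: "\<And>x. x \<epsilon> a \<Longrightarrow> x \<epsilon> b \<or> x = b \<or> b \<epsilon> x"
      using IHa Ord_mem[OF \<open>Ord a\<close>] step.prems by simp
    show ?case
    proof (rule ccontr)
      assume n: "\<not> (a \<epsilon> b \<or> a = b \<or> b \<epsilon> a)"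
      have "y \<epsilon> a" if "y \<epsilon> b" for y using *[OF that] Ord_trans[OF step.prems that] n that by auto
      moreover have "x \<epsilon> b" if "x \<epsilon> a" for x using **[OF that] Ord_trans[OF \<open>Ord a\<close> that] n that by auto
      ultimately have "a = b" unfolding eq_iff_mem[of a b] by auto
      with n show False by simp
    qed
  qed
qed

lemma Ord_I: "(\<And>x y. x \<epsilon> a \<Longrightarrow> y \<epsilon> x \<Longrightarrow> y \<epsilon> a) \<Longrightarrow> (\<And>x. x \<epsilon> a \<Longrightarrow> Ord x) \<Longrightarrow> Ord a"
  unfolding Ord_def by metis

text \<open>The Burali-Forti argument.\<close>

lemma not_small_Ord: "\<not> small {x. Ord x}"
proof
  assume sm: "small {x. Ord x}"
  have "Ord (mk {x. Ord x})"
    by (rule Ord_I) (auto simp: mem_mk sm intro: Ord_mem)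
  then have "mk {x. Ord x} \<epsilon> mk {x. Ord x}" using mem_mk[OF sm, of "mk {x. Ord x}"] by auto
  then show False using mem_irrefl by auto
qed

text \<open>\<open>P\<close> is arbitrary and not only definable, because the model is well-founded
  from outside. The proof of choice in generic extensions relies on this.\<close>

lemma Ord_least:
  assumes "Ord a" "P a" shows "\<exists>!b. Ord b \<and> P b \<and> (\<forall>c. c \<epsilon> b \<longrightarrow> \<not> P c)"
proof -
  have "Ord a \<longrightarrow> P a \<longrightarrow> (\<exists>b. Ord b \<and> P b \<and> (\<forall>c. c \<epsilon> b \<longrightarrow> \<not> P c))"
  proof (induction a rule: mem_induct)
    case (step a)
    show ?case
    proof (intro impI)
      assume a: "Ord a" "P a"
      show "\<exists>b. Ord b \<and> P b \<and> (\<forall>c. c \<epsilon> b \<longrightarrow> \<not> P c)"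
      proof (cases "\<exists>c. c \<epsilon> a \<and> P c")
        case True
        then obtain c where c: "c \<epsilon> a" "P c" by (elim exE conjE)
        from step[OF c(1), THEN mp, THEN mp, OF Ord_mem[OF a(1) c(1)] c(2)] show ?thesis .
      next
        case False
        then show ?thesis by (intro exI[of _ a] conjI a) simp
      qed
    qed
  qed
  from this[THEN mp, THEN mp, OF assms]
  obtain b where b: "Ord b" "P b" "\<forall>c. c \<epsilon> b \<longrightarrow> \<not> P c" by (elim exE conjE)
  show ?thesis
  proof (rule ex1I)
    show "Ord b \<and> P b \<and> (\<forall>c. c \<epsilon> b \<longrightarrow> \<not> P c)" by (intro conjI b)
    fix b' assume b': "Ord b' \<and> P b' \<and> (\<forall>c. c \<epsilon> b' \<longrightarrow> \<not> P c)"
    from Ord_linear[OF conjunct1[OF b'] b(1)] show "b' = b"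
      using b(2,3) b' by (elim disjE) simp_all
  qed
qed

lemma Ord_upper_bound:
  assumes S: "small S" "\<And>x. x \<in> S \<Longrightarrow> Ord x"
  obtains b where "Ord b" "\<And>x. x \<in> S \<Longrightarrow> x \<epsilon> b"
proof -
  have sm: "small (S \<union> (\<Union>x\<in>S. elts x))" by (intro small_Un small_Union S)
  have "Ord (mk (S \<union> (\<Union>x\<in>S. elts x)))"
    by (rule Ord_I) (auto simp: mem_mk sm dest: S(2) intro: Ord_mem Ord_trans)
  then show ?thesis by (rule that) (simp add: mem_mk sm)
qed

subsection \<open>Choice\<close>

lemma choice:
  assumes A: "small A" "\<And>x. x \<in> A \<Longrightarrow> \<exists>y. y \<epsilon> x"
  obtains ch where "Dfn (\<lambda>e. e 0 = ch (e 1))" "\<And>x. x \<in> A \<Longrightarrow> ch x \<epsilon> x"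
proof -
  \<comment> \<open>Replacing \<open>x\<close> by the product of its singleton with \<open>x\<close>
    makes the members of the family pairwise disjoint.\<close>
  define B where "B x = {opr x y | y. y \<epsilon> x}" for x
  have B: "small (B x)" for x
  proof -
    have "small (opr x ` elts x)" by (rule small_image[OF small_elts], intro dfn)
    moreover have "opr x ` elts x = B x" unfolding B_def by auto
    ultimately show ?thesis by simp
  qed
  have mB: "p \<epsilon> mk (B x) \<longleftrightarrow> (\<exists>y. y \<epsilon> x \<and> p = opr x y)" for p x
    using mem_mk[OF B] by (auto simp: B_def)
  have "small ((\<lambda>x. mk (B x)) ` A)"
    by (rule small_image[OF A(1)], unfold mk_eq_iff[OF B], unfold B_def mem_Collect_eq, intro dfn)
  then have a: "z \<epsilon> mk ((\<lambda>x. mk (B x)) ` A) \<longleftrightarrow> (\<exists>x\<in>A. z = mk (B x))" for z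
    by (subst mem_mk) auto
  have "\<forall>a. (\<forall>x. x \<epsilon> a \<longrightarrow> (\<exists>z. z \<epsilon> x)) \<and>
          (\<forall>x y. x \<epsilon> a \<and> y \<epsilon> a \<and> x \<noteq> y \<longrightarrow> \<not> (\<exists>z. z \<epsilon> x \<and> z \<epsilon> y)) \<longrightarrow>
          (\<exists>c. \<forall>x. x \<epsilon> a \<longrightarrow> (\<exists>!z. z \<epsilon> x \<and> z \<epsilon> c))"
    using zfc unfolding zfc_def by (elim conjE)
  note AC = this
  have p1: "\<forall>x. x \<epsilon> mk ((\<lambda>x. mk (B x)) ` A) \<longrightarrow> (\<exists>z. z \<epsilon> x)"
    unfolding a using A(2) by (auto simp: mB)
  have p2: "\<forall>x y. x \<epsilon> mk ((\<lambda>x. mk (B x)) ` A) \<and> y \<epsilon> mk ((\<lambda>x. mk (B x)) ` A) \<and> x \<noteq> y \<longrightarrow> \<not> (\<exists>z. z \<epsilon> x \<and> z \<epsilon> y)"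
    unfolding a by (auto simp: mB)
  obtain c where c0: "\<forall>x. x \<epsilon> mk ((\<lambda>x. mk (B x)) ` A) \<longrightarrow> (\<exists>!z. z \<epsilon> x \<and> z \<epsilon> c)"
    by (rule exE[OF AC[THEN spec, THEN mp, OF conjI[OF p1 p2]]], rule that)
  have c: "\<exists>!z. z \<epsilon> mk (B x) \<and> z \<epsilon> c" if "x \<in> A" for x
    by (rule c0[THEN spec, THEN mp], unfold a, rule bexI[OF refl that])
  have c': "\<exists>!y. y \<epsilon> x \<and> opr x y \<epsilon> c" if x: "x \<in> A" for x
  proof -
    obtain y where y: "y \<epsilon> x" "opr x y \<epsilon> c" using c[OF x] unfolding mB by auto
    have "y' = y" if "y' \<epsilon> x" "opr x y' \<epsilon> c" for y'
    proof -
      obtain w where w: "\<forall>v. v \<epsilon> mk (B x) \<and> v \<epsilon> c \<longrightarrow> v = w" using c[OF x] by (elim ex1E) (rule that)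
      have "opr x y' = w" by (rule w[THEN spec, THEN mp]) (simp add: mB that)
      moreover have "opr x y = w" by (rule w[THEN spec, THEN mp]) (simp add: mB y)
      ultimately have "opr x y' = opr x y" by (rule trans[OF _ sym])
      then show ?thesis unfolding opr_eq ..
    qed
    then show ?thesis by (intro ex1I[of _ y] conjI y, elim conjE)
  qed
  define ch where "ch x = (if \<exists>!y. y \<epsilon> x \<and> opr x y \<epsilon> c then THE y. y \<epsilon> x \<and> opr x y \<epsilon> c else emp)" for x
  show ?thesis
  proof (rule that)
    show "Dfn (\<lambda>e. e 0 = ch (e 1))" unfolding ch_def by (rule Dfn_the, intro dfn)
    show "ch x \<epsilon> x" if "x \<in> A" for x
      using theI'[OF c'[OF that]] unfolding ch_def if_P[OF c'[OF that]] by auto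
  qed
qed

lemma choice_subsets:
  assumes A: "small A"
  obtains ch where "Dfn (\<lambda>e. e 0 = ch (e 1))" "\<And>B. B \<subseteq> A \<Longrightarrow> small B \<Longrightarrow> B \<noteq> {} \<Longrightarrow> ch (mk B) \<in> B"
proof -
  have "small {x \<in> {x. elts x \<subseteq> A}. \<exists>y. y \<epsilon> x}" by (rule small_sep[OF small_Pow[OF A]], intro dfn)
  then obtain ch where ch: "Dfn (\<lambda>e. e 0 = ch (e 1))"
     "\<And>x. x \<in> {x \<in> {x. elts x \<subseteq> A}. \<exists>y. y \<epsilon> x} \<Longrightarrow> ch x \<epsilon> x" by (rule choice) auto
  show ?thesis
  proof (rule that[OF ch(1)])
    fix B assume B: "B \<subseteq> A" "small B" "B \<noteq> {}"
    then have "mk B \<in> {x \<in> {x. elts x \<subseteq> A}. \<exists>y. y \<epsilon> x}" by (auto simp: elts_mk mem_mk)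
    from ch(2)[OF this] show "ch (mk B) \<in> B" by (simp add: mem_mk B)
  qed
qed

text \<open>The classical proof of the well-ordering theorem. The choice function remains visible in
  the conclusion because a later use takes the least element of a set of ordinals and needs to know
  that the enumeration follows it.\<close>

lemma enumeration:
  assumes A: "small A"
    and ch: "Dfn (\<lambda>e. e 0 = ch (e 1))" "\<And>B. B \<subseteq> A \<Longrightarrow> small B \<Longrightarrow> B \<noteq> {} \<Longrightarrow> ch (mk B) \<in> B"
  obtains al F where "Ord al" "Dfn (\<lambda>e. e 0 = F (e 1))" "bij_betw F (elts al) A"
    "\<And>b. b \<epsilon> al \<Longrightarrow> F b = ch (mk (A - F ` elts b))" "\<And>b. small (A - F ` elts b)"
proof -
  define D where "D h = A - {y. \<exists>x. opr x y \<epsilon> h}" for h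
  have D: "small (D h)" for h unfolding D_def by (rule small_Diff[OF A small_Range])
  have D_Trm: "Trm t \<Longrightarrow> Trm (\<lambda>e. mk (D (t e)))" for t
    by (rule Trm_sub1[where F="\<lambda>h. mk (D h)"])
      (unfold mk_eq_iff[OF D], unfold D_def Diff_iff mem_Collect_eq, intro dfn Dfn_small A)
  \<comment> \<open>When \<open>A\<close> is exhausted the value is \<open>mk A\<close>, which is
    not a member of \<open>A\<close> and so signals the end.\<close>
  define G where "G x h = (if \<exists>y. y \<epsilon> mk (D h) then ch (mk (D h)) else mk A)" for x h :: 'a
  have "Dfn (\<lambda>e. e 0 = G (e 1) (e 2))"
  proof -
    have "z = G x h \<longleftrightarrow> ((\<exists>y. y \<epsilon> mk (D h)) \<and> z = ch (mk (D h))) \<or> (\<not> (\<exists>y. y \<epsilon> mk (D h)) \<and> z = mk A)" for x h z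
      by (cases "\<exists>y. y \<epsilon> mk (D h)") (simp_all add: G_def)
    then show ?thesis by (simp only:) (intro dfn D_Trm Trm_sub1[where F=ch, OF ch(1)])
  qed
  note GD = this
  obtain F where F: "\<And>x. F x = G x (lam (elts x) F)" "Dfn (\<lambda>e. e 0 = F (e 1))"
      "\<And>x. small {opr y (F y) | y. y \<in> elts x}" by (rule mem_recursion[of G, OF GD], rule that)
  have D_lam: "D (lam (elts x) F) = A - F ` elts x" for x
    unfolding D_def mem_lam[OF F(3)] by auto
  have mD: "y \<epsilon> mk (D (lam (elts x) F)) \<longleftrightarrow> y \<in> A - F ` elts x" for x y
    by (rule trans[OF mem_mk[OF D]]) (simp only: D_lam)
  have F_ch: "F x = ch (mk (A - F ` elts x))" if "A - F ` elts x \<noteq> {}" for x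
  proof -
    have ne: "\<exists>y. y \<epsilon> mk (D (lam (elts x) F))" using that unfolding mD by auto
    have "F x = ch (mk (D (lam (elts x) F)))" by (subst F(1)) (simp only: G_def if_P[OF ne])
    then show ?thesis by (simp only: D_lam)
  qed
  have F_sm: "small (A - F ` elts x)" for x using D[of "lam (elts x) F"] unfolding D_lam .
  have mAF: "mk A \<notin> A" using mem_mk[OF A, of "mk A"] by simp
  have F_in: "F x \<in> A - F ` elts x" if "A - F ` elts x \<noteq> {}" for x
  proof -
    have ne: "\<exists>y. y \<epsilon> mk (D (lam (elts x) F))" using that unfolding mD by auto
    have "F x = ch (mk (D (lam (elts x) F)))" by (subst F(1)) (simp only: G_def if_P[OF ne])
    moreover have "ch (mk (D (lam (elts x) F))) \<in> D (lam (elts x) F)"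
      by (rule ch(2)[OF _ D]) (use that D_lam in auto)
    ultimately show ?thesis by (simp only: D_lam)
  qed
  have F_out: "F x = mk A" if "A - F ` elts x = {}" for x
  proof -
    have ne: "\<not> (\<exists>y. y \<epsilon> mk (D (lam (elts x) F)))" unfolding mD that by simp
    show ?thesis by (subst F(1)) (simp only: G_def if_not_P[OF ne])
  qed
  have inj: "x = y" if "Ord x" "Ord y" "F x = F y" "F x \<in> A" for x y
  proof -
    have "F y \<in> A" using that(3,4) by simp
    then have ne: "A - F ` elts x \<noteq> {}" "A - F ` elts y \<noteq> {}" using F_out[of x] F_out[of y] that(4) mAF by auto
    have *: "F y \<notin> F ` elts y \<and> F x \<notin> F ` elts x"
      using F_in[OF ne(1)] F_in[OF ne(2)] by simp
    have "\<not> x \<epsilon> y" using * that(3) imageI[of x "elts y" F] by auto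
    moreover have "\<not> y \<epsilon> x" using * that(3) imageI[of y "elts x" F] by auto
    ultimately show ?thesis using Ord_linear[OF that(1,2)] by auto
  qed
  \<comment> \<open>Otherwise \<open>F\<close> would be injective from all ordinals into
    \<open>A\<close>, and replacement along its inverse would make the class of ordinals a
    set.\<close>
  have "\<exists>a. Ord a \<and> F a \<notin> A"
  proof (rule ccontr)
    assume n: "\<not> (\<exists>a. Ord a \<and> F a \<notin> A)"
    have "small {x. \<exists>y\<in>A. Ord x \<and> y = F x}"
      by (rule small_repl[OF A], intro dfn Trm_sub1[where F=F, OF F(2)], elim conjE, rule inj) auto
    moreover have "{x. \<exists>y\<in>A. Ord x \<and> y = F x} = {x. Ord x}" using n by auto
    ultimately show False using not_small_Ord by simp
  qed
  then obtain a where "Ord a" "F a \<notin> A" by auto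
  from Ord_least[OF this(1), of "\<lambda>a. F a \<notin> A", OF this(2)]
  obtain al where al: "Ord al" "F al \<notin> A" "\<And>c. c \<epsilon> al \<Longrightarrow> F c \<in> A" by auto
  have "inj_on F (elts al)"
  proof (rule inj_onI)
    fix x y assume *: "x \<in> elts al" "y \<in> elts al" "F x = F y"
    show "x = y" by (rule inj) (use * al Ord_mem[OF al(1)] in auto)
  qed
  moreover have "F ` elts al = A"
    using al F_in[of al] by auto
  ultimately have "bij_betw F (elts al) A" by (simp add: bij_betw_def)
  moreover have "F b = ch (mk (A - F ` elts b))" if b: "b \<epsilon> al" for b
  proof (rule F_ch, rule notI)
    assume "A - F ` elts b = {}"
    then have "F b = mk A" by (rule F_out)
    then show False using al(3)[OF b] mAF by simp
  qed
  ultimately show ?thesis using F_sm by (rule that[OF al(1) F(2)])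
qed

theorem Zermelo:
  assumes A: "small A"
  obtains al F where "Ord al" "Dfn (\<lambda>e. e 0 = F (e 1))" "bij_betw F (elts al) A"
proof -
  obtain ch where ch: "Dfn (\<lambda>e. e 0 = ch (e 1))" "\<And>B. B \<subseteq> A \<Longrightarrow> small B \<Longrightarrow> B \<noteq> {} \<Longrightarrow> ch (mk B) \<in> B"
    by (rule choice_subsets[OF A]) auto
  show ?thesis
  proof (rule enumeration[OF A ch(1), of thesis])
    fix B assume "B \<subseteq> A" "small B" "B \<noteq> {}"
    then show "ch (mk B) \<in> B" by (rule ch(2))
  next
    fix al F assume "Ord al" "Dfn (\<lambda>e. e 0 = F (e 1))" "bij_betw F (elts al) A"
    then show thesis by (rule that)
  qed
qed

subsection \<open>Collection\<close>

definition pw :: "'a \<Rightarrow> 'a" where "pw x = mk {y. elts y \<subseteq> elts x}"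

lemma mem_pw [simp]: "y \<epsilon> pw x \<longleftrightarrow> sub y x"
  unfolding pw_def by (subst mem_mk) (auto simp: small_Pow sub_def)

lemma is_power_iff: "is_power p a \<longleftrightarrow> p = pw a"
  unfolding is_power_def eq_iff_mem[of p] by simp

lemma Trm_pw [dfn]: "Trm t \<Longrightarrow> Trm (\<lambda>e. pw (t e))"
  by (rule Trm_sub1[where F=pw]) (unfold eq_iff_mem mem_pw, intro dfn)

text \<open>Scott's method: \<open>V x\<close> is the union of the power sets of the
  \<open>V u\<close> with \<open>u\<close> in \<open>x\<close>, every set is included in some
  \<open>V a\<close>, and for each \<open>x\<close> replacement picks the least ordinal
  \<open>a\<close> for which a value is included in \<open>V a\<close>.\<close>

theorem collection:
  assumes A: "small A" and R: "Dfn (\<lambda>e. R (e 0) (e 1))" and ex: "\<And>x. x \<in> A \<Longrightarrow> \<exists>y. R x y"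
  obtains B where "small B" "\<And>x. x \<in> A \<Longrightarrow> \<exists>y\<in>B. R x y"
proof -
  define U where "U h = {y. \<exists>u v. opr u v \<epsilon> h \<and> y \<epsilon> pw v}" for h
  have U: "small (U h)" for h
  proof -
    have "small (\<Union>v\<in>{v. \<exists>u. opr u v \<epsilon> h}. elts (pw v))" by (rule small_UN[OF small_Range], intro dfn)
    moreover have "(\<Union>v\<in>{v. \<exists>u. opr u v \<epsilon> h}. elts (pw v)) = U h"
      unfolding U_def set_eq_iff UN_iff mem_Collect_eq in_elts by blast
    ultimately show ?thesis by simp
  qed
  have UD: "Dfn (\<lambda>e. e 0 = mk (U (e 2)))"
    unfolding mk_eq_iff[OF U] unfolding U_def mem_Collect_eq by (intro dfn)
  obtain V where V: "\<And>x. V x = mk (U (lam (elts x) V))" "Dfn (\<lambda>e. e 0 = V (e 1))"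
      "\<And>x. small {opr y (V y) | y. y \<in> elts x}" by (rule mem_recursion[of "\<lambda>x h. mk (U h)", OF UD], rule that)
  have mV: "y \<epsilon> V x \<longleftrightarrow> (\<exists>u. u \<epsilon> x \<and> sub y (V u))" for x y
    by (subst V(1), subst mem_mk[OF U]) (auto simp: U_def mem_lam[OF V(3)])
  note V_Trm = Trm_sub1[where F=V, OF V(2)]
  have rank: "\<exists>a. Ord a \<and> sub y (V a)" for y
  proof (induction y rule: mem_induct)
    case (step y)
    define L where "L z a \<longleftrightarrow> Ord a \<and> sub z (V a) \<and> (\<forall>c. c \<epsilon> a \<longrightarrow> \<not> sub z (V c))" for z a
    have L1: "\<exists>!a. L z a" if z: "z \<epsilon> y" for z
    proof -
      obtain a where "Ord a" "sub z (V a)" using step[OF z] by auto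
      then show ?thesis unfolding L_def by (rule Ord_least)
    qed
    have LD: "Dfn (\<lambda>e. L (e 0) (e 1))" unfolding L_def by (intro dfn V_Trm)
    have L_un: "a = b" if "L z a" "L z b" for z a b
      using Ord_linear[of a b] that unfolding L_def by auto
    have "small {a. \<exists>z\<in>elts y. L z a}"
      by (rule small_repl[OF small_elts LD]) (rule L_un)
    then obtain b where b: "Ord b" "\<And>a. a \<in> {a. \<exists>z\<in>elts y. L z a} \<Longrightarrow> a \<epsilon> b"
      by (rule Ord_upper_bound) (auto simp: L_def)
    have "z \<epsilon> V b" if z: "z \<epsilon> y" for z
    proof -
      obtain a where a: "L z a" using L1[OF z] by auto
      have "a \<epsilon> b" by (rule b(2)) (use a z in auto)
      then show ?thesis unfolding mV using a by (auto simp: L_def)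
    qed
    then have "sub y (V b)" by (simp add: sub_def)
    with b(1) show ?case by auto
  qed
  define L where "L x a \<longleftrightarrow> Ord a \<and> (\<exists>y. sub y (V a) \<and> R x y) \<and> (\<forall>c. c \<epsilon> a \<longrightarrow> \<not> (\<exists>y. sub y (V c) \<and> R x y))" for x a
  have L1: "\<exists>!a. L x a" if x: "x \<in> A" for x
  proof -
    obtain y where y: "R x y" using ex[OF x] by auto
    obtain a where a: "Ord a" "sub y (V a)" using rank[of y] by auto
    show ?thesis unfolding L_def by (rule Ord_least[OF a(1)], rule exI[of _ y], rule conjI[OF a(2) y])
  qed
  have LD: "Dfn (\<lambda>e. L (e 0) (e 1))" unfolding L_def by (intro dfn V_Trm Dfn_sub2[where P=R, OF R])
  have L_un: "a = b" if "L z a" "L z b" for z a b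
    using Ord_linear[of a b] that unfolding L_def by auto
  have S: "small {a. \<exists>x\<in>A. L x a}"
    by (rule small_repl[OF A LD]) (rule L_un)
  have "small (\<Union>a\<in>{a. \<exists>x\<in>A. L x a}. elts (pw (V a)))"
    by (rule small_UN[OF S], intro dfn V_Trm)
  then show ?thesis
  proof (rule that)
    fix x assume x: "x \<in> A"
    obtain a where a: "L x a" using ex1_implies_ex[OF L1[OF x]] by (elim exE) (rule that)
    obtain y where y: "sub y (V a)" "R x y" using a unfolding L_def by (elim exE conjE)
    show "\<exists>y\<in>(\<Union>a\<in>{a. \<exists>x\<in>A. L x a}. elts (pw (V a))). R x y"
      by (rule bexI[of _ y], rule y(2), rule UN_I[of a]) (use a x y(1) in auto)
  qed
qed

subsection \<open>Recursion on the natural numbers and dependent choice\<close>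

lemma Trm_natrec:
  assumes F0: "F 0 = a" and FS: "\<And>n. F (Suc n) = H n (F n)"
    and H: "Dfn (\<lambda>e. e 0 = H (nm (e 1)) (e 2))"
  shows "NTrm t \<Longrightarrow> Trm (\<lambda>e. F (t e))"
proof -
  define loc where "loc h \<longleftrightarrow> (\<forall>i y. opr (num i) y \<epsilon> h \<longrightarrow>
     (i = 0 \<and> y = a) \<or> (\<exists>j z. i = Suc j \<and> opr (num j) z \<epsilon> h \<and> y = H j z))" for h
  have 1: "y = F n" if loc: "loc h" and ny: "opr (num n) y \<epsilon> h" for h n y
    using ny
  proof (induction n arbitrary: y)
    case 0
    then show ?case using loc[unfolded loc_def, rule_format, of 0 y] F0 by simp
  next
    case (Suc n)
    then obtain z where "opr (num n) z \<epsilon> h" "y = H n z"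
      using loc[unfolded loc_def, rule_format, of "Suc n" y] by auto
    then show ?case using Suc.IH[of z] FS[of n] by simp
  qed
  have 2: "\<exists>h. loc h \<and> opr (num n) (F n) \<epsilon> h" for n
  proof -
    define h where "h = mk ((\<lambda>i. opr (num i) (F i)) ` {..n})"
    have h: "x \<epsilon> h \<longleftrightarrow> (\<exists>i\<le>n. x = opr (num i) (F i))" for x
      unfolding h_def by (subst mem_mk[OF small_finite]) auto
    have "loc h" unfolding loc_def h
    proof (intro allI impI)
      fix i y assume "\<exists>i'\<le>n. opr (num i) y = opr (num i') (F i')"
      then have iy: "i \<le> n" "y = F i" by auto
      show "i = 0 \<and> y = a \<or> (\<exists>j z. i = Suc j \<and> (\<exists>i\<le>n. opr (num j) z = opr (num i) (F i)) \<and> y = H j z)"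
      proof (cases i)
        case 0
        then show ?thesis using iy F0 by simp
      next
        case (Suc j)
        then have "j \<le> n" "y = H j (F j)" using iy FS[of j] by simp_all
        then show ?thesis using Suc by (intro disjI2 exI[of _ j] exI[of _ "F j"]) auto
      qed
    qed
    moreover have "opr (num n) (F n) \<epsilon> h" unfolding h by (rule exI[of _ n]) simp
    ultimately show ?thesis by (intro exI conjI)
  qed
  have "y = F n \<longleftrightarrow> (\<exists>h. loc h \<and> opr (num n) y \<epsilon> h)" for y n
  proof
    assume "y = F n"
    then show "\<exists>h. loc h \<and> opr (num n) y \<epsilon> h" using 2[of n] by simp
  next
    assume "\<exists>h. loc h \<and> opr (num n) y \<epsilon> h"
    then show "y = F n" by (elim exE conjE) (rule 1)
  qed
  note eq = this
  have H': "Trm (\<lambda>e. H (u e) (v e))" if "NTrm u" "Trm v" for u v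
  proof -
    have "Trm (\<lambda>e. H (nm (num (u e))) (v e))"
      by (rule Trm_sub2[where F="\<lambda>x y. H (nm x) y"]) (intro dfn H that)+
    then show ?thesis by simp
  qed
  show "Trm (\<lambda>e. F (t e))" if "NTrm t"
    unfolding Trm_def eq loc_def by (intro dfn H' NTrm_shift that)
qed

text \<open>The last clause of the conclusion is the point: the sequence is definable and can
  therefore be used inside the model. A single choice function on the subsets of \<open>A\<close>
  turns the choices into a recursion.\<close>

lemma dependent_choice:
  assumes A: "small A" and R: "Dfn (\<lambda>e. R (nm (e 0)) (e 1) (e 2))" and a: "a \<in> A"
    and ex: "\<And>n x. x \<in> A \<Longrightarrow> \<exists>y\<in>A. R n x y"
  obtains F where "F 0 = a" "\<And>n. F n \<in> A" "\<And>n. R n (F n) (F (Suc n))" "\<And>t. NTrm t \<Longrightarrow> Trm (\<lambda>e. F (t e))"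
proof -
  obtain ch where ch: "Dfn (\<lambda>e. e 0 = ch (e 1))" "\<And>B. B \<subseteq> A \<Longrightarrow> small B \<Longrightarrow> B \<noteq> {} \<Longrightarrow> ch (mk B) \<in> B"
    by (rule choice_subsets[OF A]) auto
  have R': "Dfn (\<lambda>e. R (u e) (v e) (w e))" if "NTrm u" "Trm v" "Trm w" for u v w
  proof -
    have "Dfn (\<lambda>e. R (nm (num (u e))) (v e) (w e))"
      by (rule Dfn_sub3[where P="\<lambda>x y z. R (nm x) y z"]) (intro dfn R that)+
    then show ?thesis by simp
  qed
  define B where "B n x = {y \<in> A. R n x y}" for n x
  have B: "small (B n x)" for n x unfolding B_def by (rule small_sep[OF A]) (intro R' dfn)
  define F where "F = rec_nat a (\<lambda>n x. ch (mk (B n x)))"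
  have F: "F 0 = a" "\<And>n. F (Suc n) = ch (mk (B n (F n)))" by (simp_all add: F_def)
  have *: "F n \<in> A" for n
  proof (induction n)
    case (Suc n)
    have "ch (mk (B n (F n))) \<in> B n (F n)"
      by (rule ch(2)[OF _ B]) (use ex[OF Suc, of n] in \<open>auto simp: B_def\<close>)
    then show ?case by (simp only: F) (simp add: B_def)
  qed (simp add: F a)
  have "R n (F n) (F (Suc n))" for n
  proof -
    have "ch (mk (B n (F n))) \<in> B n (F n)"
      by (rule ch(2)[OF _ B]) (use ex[OF *, of n n] in \<open>auto simp: B_def\<close>)
    then show ?thesis by (simp only: F) (simp add: B_def)
  qed
  moreover have "Trm (\<lambda>e. F (t e))" if "NTrm t" for t
  proof (rule Trm_natrec[where F=F and H="\<lambda>n x. ch (mk (B n x))" and a=a, OF F _ that])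
    have "Trm (\<lambda>e. mk (B (nm (e 0)) (e 1)))"
      by (rule Trm_mk[OF _ B], unfold B_def mem_Collect_eq, intro dfn Dfn_small A R')
    then have "Trm (\<lambda>e. ch (mk (B (nm (e 0)) (e 1))))" by (rule Trm_sub1[where F=ch, OF ch(1)])
    then show "Dfn (\<lambda>e. e 0 = ch (mk (B (nm (e 1)) (e 2))))" unfolding Trm_def by (simp add: numeral_2_eq_2)
  qed
  ultimately show ?thesis by (intro that[of F] F(1) *)
qed

end

section \<open>Forcing\<close>

context set_structure
begin

text \<open>Freezes all arguments from position \<open>k\<close> on as parameters. It is needed for
  \<open>sat\<close> and \<open>forces\<close>, whose assignments are infinite while only finitely
  many entries vary.\<close>

lemma Dfn_param:
  assumes "Dfn P" shows "Dfn (\<lambda>e. P (\<lambda>i. if i < k then e i else c i))"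
proof -
  from assms obtain p v where p: "\<And>e. P e \<longleftrightarrow> sat mem (merge e v) p"
    unfolding Dfn_def by (elim exE) blast
  define r where "r j = (if even j then if j div 2 < k then j else Suc (2 * j) else Suc (2 * j))" for j :: nat
  have "merge e (merge c v) (r j) = merge (\<lambda>i. if i < k then e i else c i) v j" for e j
    by (simp add: r_def merge_def)
  then have "(\<lambda>j. merge e (merge c v) (r j)) = merge (\<lambda>i. if i < k then e i else c i) v" for e
    by (rule ext)
  then show ?thesis unfolding Dfn_def
    by (intro exI[of _ "rename_fm r p"] exI[of _ "merge c v"]) (simp add: sat_rename_fm p)
qed

end

locale forcing = zfc_model +
  fixes P :: "'a set" and le :: "'a \<Rightarrow> 'a \<Rightarrow> bool" (infix "\<sqsubseteq>" 50) and one :: 'a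
  assumes P_small: "small P"
    and le_Dfn: "Dfn (\<lambda>e. e 0 \<sqsubseteq> e 1)"
    and le_refl: "p \<in> P \<Longrightarrow> p \<sqsubseteq> p"
    and le_trans: "p \<sqsubseteq> q \<Longrightarrow> q \<sqsubseteq> r \<Longrightarrow> p \<sqsubseteq> r"
    and one: "one \<in> P" "p \<in> P \<Longrightarrow> p \<sqsubseteq> one"
begin

text \<open>Every element of the model is a name, with the members \<open>\<sigma>\<close> for the pairs
  \<open>(\<sigma>, s)\<close> in it that have \<open>s \<in> P\<close>.\<close>

lemma Dfn_le [dfn]: "Trm t \<Longrightarrow> Trm u \<Longrightarrow> Dfn (\<lambda>e. t e \<sqsubseteq> u e)"
  by (rule Dfn_sub2[where P=le, OF le_Dfn])

lemma Dfn_P [dfn]: "Trm t \<Longrightarrow> Dfn (\<lambda>e. t e \<in> P)"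
  by (rule Dfn_small[OF P_small])

lemma wf_dom: "wf {(t, x). \<exists>s. opr t s \<epsilon> x}"
proof (rule wf_subset[OF wf_trancl[OF mem_wf]])
  have "(t, x) \<in> {(x, y). x \<epsilon> y}\<^sup>+" if "opr t s \<epsilon> x" for t s x
  proof -
    have "(t, upr t s) \<in> {(x, y). x \<epsilon> y}" "(upr t s, opr t s) \<in> {(x, y). x \<epsilon> y}"
      by (simp_all add: opr_def)
    moreover have "(opr t s, x) \<in> {(x, y). x \<epsilon> y}" using that by simp
    ultimately show ?thesis by (meson trancl.intros)
  qed
  then show "{(t, x). \<exists>s. opr t s \<epsilon> x} \<subseteq> {(x, y). x \<epsilon> y}\<^sup>+" by auto
qed

lemma dom_induct [case_names step]:
  assumes "\<And>x. (\<And>t s. opr t s \<epsilon> x \<Longrightarrow> Q t) \<Longrightarrow> Q x" shows "Q x"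
  using wf_dom
proof (induction x rule: wf_induct_rule)
  case (less x)
  show ?case by (rule assms, rule less) auto
qed

section \<open>Forcing equality between names\<close>

definition pair_rel :: "'a \<Rightarrow> 'a \<Rightarrow> bool" where
  "pair_rel w z \<longleftrightarrow> (\<exists>x y t u s s'. z = opr x y \<and> w = opr t u \<and> opr t s \<epsilon> x \<and> opr u s' \<epsilon> y)"

text \<open>The conditions that force the two components of \<open>z\<close> to be equal, if
  \<open>h\<close> gives this for pairs of their members: below \<open>p\<close>, each member of one
  name is densely equal to a member of the other. Membership has been eliminated from the clause, so
  that one recursion suffices.\<close>

definition feq_step :: "'a \<Rightarrow> 'a \<Rightarrow> 'a set" where
  "feq_step z h = {p \<in> P. \<forall>x y. z = opr x y \<longrightarrow>
     (\<forall>t s q. opr t s \<epsilon> x \<and> s \<in> P \<and> q \<in> P \<and> q \<sqsubseteq> p \<and> q \<sqsubseteq> s \<longrightarrow>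
       (\<exists>r u v. r \<in> P \<and> r \<sqsubseteq> q \<and> v \<in> P \<and> opr u v \<epsilon> y \<and> r \<sqsubseteq> v \<and> r \<epsilon> app h (opr t u))) \<and>
     (\<forall>u v q. opr u v \<epsilon> y \<and> v \<in> P \<and> q \<in> P \<and> q \<sqsubseteq> p \<and> q \<sqsubseteq> v \<longrightarrow>
       (\<exists>r t s. r \<in> P \<and> r \<sqsubseteq> q \<and> s \<in> P \<and> opr t s \<epsilon> x \<and> r \<sqsubseteq> s \<and> r \<epsilon> app h (opr t u)))}"

lemma small_feq_step: "small (feq_step z h)"
  unfolding feq_step_def by (rule small_sep[OF P_small], intro dfn)

definition feq :: "'a \<Rightarrow> 'a" where
  "feq = (SOME f. (\<forall>z. f z = mk (feq_step z (mk {opr y (f y) | y. pair_rel y z}))) \<and> Dfn (\<lambda>e. e 0 = f (e 1)))"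

lemma wfp_pair_rel: "wfp pair_rel"
  unfolding wfp_def
\<comment> \<open>The first component alone decreases.\<close>
proof (rule wf_subset[OF wf_inv_image[OF wf_dom, of "\<lambda>z. THE x. \<exists>y. z = opr x y"]])
  show "{(x, y). pair_rel x y} \<subseteq> inv_image {(t, x). \<exists>s. opr t s \<epsilon> x} (\<lambda>z. THE x. \<exists>y. z = opr x y)"
  proof (rule subsetI, clarify)
    fix w z assume "pair_rel w z"
    then obtain x y t u s where "z = opr x y" "w = opr t u" "opr t s \<epsilon> x"
      unfolding pair_rel_def by (elim exE conjE)
    then show "(w, z) \<in> inv_image {(t, x). \<exists>s. opr t s \<epsilon> x} (\<lambda>z. THE x. \<exists>y. z = opr x y)"
      by auto
  qed
qed

lemma small_pair_rel: "small {w. pair_rel w z}"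
proof (cases "\<exists>x y. z = opr x y")
  case True
  then obtain x y where z: "z = opr x y" by auto
  have "small {opr t u | t u. t \<in> {t. \<exists>s. opr t s \<epsilon> x} \<and> u \<in> {u. \<exists>s. opr u s \<epsilon> y}}"
    by (rule small_Times[OF small_Domain small_Domain])
  moreover have "{opr t u | t u. t \<in> {t. \<exists>s. opr t s \<epsilon> x} \<and> u \<in> {u. \<exists>s. opr u s \<epsilon> y}} = {w. pair_rel w z}"
    unfolding pair_rel_def z by auto
  ultimately show ?thesis by simp
next
  case False
  then have "{w. pair_rel w z} = {}" unfolding pair_rel_def by auto
  then show ?thesis using small_empty by simp
qed

lemma feq:
  shows feq_rec: "feq z = mk (feq_step z (mk {opr y (feq y) | y. pair_rel y z}))"
    and feq_Dfn: "Dfn (\<lambda>e. e 0 = feq (e 1))"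
proof -
  have D1: "Dfn (\<lambda>e. pair_rel (e 0) (e 1))" unfolding pair_rel_def by (intro dfn)
  have D2: "Dfn (\<lambda>e. e 0 = mk (feq_step (e 1) (e 2)))"
    unfolding mk_eq_iff[OF small_feq_step] unfolding feq_step_def mem_Collect_eq by (intro dfn)
  have "\<exists>f. (\<forall>z. f z = mk (feq_step z (mk {opr y (f y) | y. pair_rel y z}))) \<and> Dfn (\<lambda>e. e 0 = f (e 1))"
    by (rule definable_recursion[of pair_rel "\<lambda>z h. mk (feq_step z h)", OF wfp_pair_rel D1 small_pair_rel D2],
        rule exI, rule conjI, rule allI)
  note * = someI_ex[OF this, folded feq_def]
  show "feq z = mk (feq_step z (mk {opr y (feq y) | y. pair_rel y z}))" by (rule conjunct1[OF *, THEN spec])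
  show "Dfn (\<lambda>e. e 0 = feq (e 1))" by (rule conjunct2[OF *])
qed

definition Feq :: "'a \<Rightarrow> 'a \<Rightarrow> 'a \<Rightarrow> bool" where "Feq p x y \<longleftrightarrow> p \<epsilon> feq (opr x y)"

lemma Dfn_Feq [dfn]: "Trm t \<Longrightarrow> Trm u \<Longrightarrow> Trm s \<Longrightarrow> Dfn (\<lambda>e. Feq (t e) (u e) (s e))"
  unfolding Feq_def by (intro dfn Trm_sub1[where F=feq, OF feq_Dfn])

lemma Feq_iff: "Feq p x y \<longleftrightarrow> p \<in> P \<and>
     (\<forall>t s q. opr t s \<epsilon> x \<and> s \<in> P \<and> q \<in> P \<and> q \<sqsubseteq> p \<and> q \<sqsubseteq> s \<longrightarrow>
       (\<exists>r u v. r \<in> P \<and> r \<sqsubseteq> q \<and> v \<in> P \<and> opr u v \<epsilon> y \<and> r \<sqsubseteq> v \<and> Feq r t u)) \<and>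
     (\<forall>u v q. opr u v \<epsilon> y \<and> v \<in> P \<and> q \<in> P \<and> q \<sqsubseteq> p \<and> q \<sqsubseteq> v \<longrightarrow>
       (\<exists>r t s. r \<in> P \<and> r \<sqsubseteq> q \<and> s \<in> P \<and> opr t s \<epsilon> x \<and> r \<sqsubseteq> s \<and> Feq r t u))"
proof -
  define h where "h = lam {w. pair_rel w (opr x y)} feq"
  have h_eq: "mk {opr w (feq w) | w. pair_rel w (opr x y)} = h" unfolding h_def lam_def by simp
  have app: "app h (opr t u) = feq (opr t u)" if "opr t s \<epsilon> x" "opr u v \<epsilon> y" for t s u v
    unfolding h_def
    by (rule app_lam[OF small_lam[OF small_pair_rel feq_Dfn]]) (use that in \<open>auto simp: pair_rel_def\<close>)
  have "Feq p x y \<longleftrightarrow> p \<in> feq_step (opr x y) h"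
    unfolding Feq_def feq_rec[of "opr x y"] h_eq by (rule mem_mk[OF small_feq_step])
  also have "\<dots> \<longleftrightarrow> p \<in> P \<and>
     (\<forall>t s q. opr t s \<epsilon> x \<and> s \<in> P \<and> q \<in> P \<and> q \<sqsubseteq> p \<and> q \<sqsubseteq> s \<longrightarrow>
       (\<exists>r u v. r \<in> P \<and> r \<sqsubseteq> q \<and> v \<in> P \<and> opr u v \<epsilon> y \<and> r \<sqsubseteq> v \<and> r \<epsilon> app h (opr t u))) \<and>
     (\<forall>u v q. opr u v \<epsilon> y \<and> v \<in> P \<and> q \<in> P \<and> q \<sqsubseteq> p \<and> q \<sqsubseteq> v \<longrightarrow>
       (\<exists>r t s. r \<in> P \<and> r \<sqsubseteq> q \<and> s \<in> P \<and> opr t s \<epsilon> x \<and> r \<sqsubseteq> s \<and> r \<epsilon> app h (opr t u)))"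
    unfolding feq_step_def by auto
  also have "\<dots> \<longleftrightarrow> p \<in> P \<and>
     (\<forall>t s q. opr t s \<epsilon> x \<and> s \<in> P \<and> q \<in> P \<and> q \<sqsubseteq> p \<and> q \<sqsubseteq> s \<longrightarrow>
       (\<exists>r u v. r \<in> P \<and> r \<sqsubseteq> q \<and> v \<in> P \<and> opr u v \<epsilon> y \<and> r \<sqsubseteq> v \<and> Feq r t u)) \<and>
     (\<forall>u v q. opr u v \<epsilon> y \<and> v \<in> P \<and> q \<in> P \<and> q \<sqsubseteq> p \<and> q \<sqsubseteq> v \<longrightarrow>
       (\<exists>r t s. r \<in> P \<and> r \<sqsubseteq> q \<and> s \<in> P \<and> opr t s \<epsilon> x \<and> r \<sqsubseteq> s \<and> Feq r t u))"
  proof -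
    have app': "r \<epsilon> app h (opr t u) \<longleftrightarrow> Feq r t u" if "opr t s \<epsilon> x" "opr u v \<epsilon> y" for r t s u v
      unfolding Feq_def app[OF that] ..
    show ?thesis
      by (intro conj_cong all_cong1 imp_cong ex_cong1 refl; elim conjE; rule app'; assumption)
  qed
  finally show ?thesis .
qed

lemma Feq_P: "Feq p x y \<Longrightarrow> p \<in> P" using Feq_iff by blast

lemma Feq_D1:
  "Feq p x y \<Longrightarrow> opr t s \<epsilon> x \<Longrightarrow> s \<in> P \<Longrightarrow> q \<in> P \<Longrightarrow> q \<sqsubseteq> p \<Longrightarrow> q \<sqsubseteq> s \<Longrightarrow>
     \<exists>r u v. r \<in> P \<and> r \<sqsubseteq> q \<and> v \<in> P \<and> opr u v \<epsilon> y \<and> r \<sqsubseteq> v \<and> Feq r t u"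
  by (subst (asm) Feq_iff) blast

lemma Feq_D2:
  "Feq p x y \<Longrightarrow> opr u v \<epsilon> y \<Longrightarrow> v \<in> P \<Longrightarrow> q \<in> P \<Longrightarrow> q \<sqsubseteq> p \<Longrightarrow> q \<sqsubseteq> v \<Longrightarrow>
     \<exists>r t s. r \<in> P \<and> r \<sqsubseteq> q \<and> s \<in> P \<and> opr t s \<epsilon> x \<and> r \<sqsubseteq> s \<and> Feq r t u"
  by (subst (asm) Feq_iff) blast

lemma Feq_I:
  assumes "p \<in> P"
    "\<And>t s q. opr t s \<epsilon> x \<Longrightarrow> s \<in> P \<Longrightarrow> q \<in> P \<Longrightarrow> q \<sqsubseteq> p \<Longrightarrow> q \<sqsubseteq> s \<Longrightarrow>
       \<exists>r u v. r \<in> P \<and> r \<sqsubseteq> q \<and> v \<in> P \<and> opr u v \<epsilon> y \<and> r \<sqsubseteq> v \<and> Feq r t u"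
    "\<And>u v q. opr u v \<epsilon> y \<Longrightarrow> v \<in> P \<Longrightarrow> q \<in> P \<Longrightarrow> q \<sqsubseteq> p \<Longrightarrow> q \<sqsubseteq> v \<Longrightarrow>
       \<exists>r t s. r \<in> P \<and> r \<sqsubseteq> q \<and> s \<in> P \<and> opr t s \<epsilon> x \<and> r \<sqsubseteq> s \<and> Feq r t u"
  shows "Feq p x y"
  unfolding Feq_iff[of p x y] by (intro conjI allI impI assms(1); elim conjE; rule assms; assumption)

lemma Feq_mono:
  assumes "Feq p x y" "q \<in> P" "q \<sqsubseteq> p" shows "Feq q x y"
proof (rule Feq_I[OF assms(2)])
  fix t s q' assume "opr t s \<epsilon> x" "s \<in> P" "q' \<in> P" "q' \<sqsubseteq> q" "q' \<sqsubseteq> s"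
  then show "\<exists>r u v. r \<in> P \<and> r \<sqsubseteq> q' \<and> v \<in> P \<and> opr u v \<epsilon> y \<and> r \<sqsubseteq> v \<and> Feq r t u"
    by (rule Feq_D1[OF assms(1) _ _ _ le_trans[OF _ assms(3)]])
next
  fix u v q' assume "opr u v \<epsilon> y" "v \<in> P" "q' \<in> P" "q' \<sqsubseteq> q" "q' \<sqsubseteq> v"
  then show "\<exists>r t s. r \<in> P \<and> r \<sqsubseteq> q' \<and> s \<in> P \<and> opr t s \<epsilon> x \<and> r \<sqsubseteq> s \<and> Feq r t u"
    by (rule Feq_D2[OF assms(1) _ _ _ le_trans[OF _ assms(3)]])
qed

lemma Feq_dense:
  assumes "p \<in> P" "\<And>q. q \<in> P \<Longrightarrow> q \<sqsubseteq> p \<Longrightarrow> \<exists>r\<in>P. r \<sqsubseteq> q \<and> Feq r x y" shows "Feq p x y"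
proof (rule Feq_I[OF assms(1)])
  fix t s q assume *: "opr t s \<epsilon> x" "s \<in> P" "q \<in> P" "q \<sqsubseteq> p" "q \<sqsubseteq> s"
  obtain r where r: "r \<in> P" "r \<sqsubseteq> q" "Feq r x y" using assms(2)[OF *(3,4)] by blast
  from Feq_D1[OF r(3) *(1,2) r(1) le_refl[OF r(1)] le_trans[OF r(2) *(5)]] le_trans[OF _ r(2)]
  show "\<exists>r u v. r \<in> P \<and> r \<sqsubseteq> q \<and> v \<in> P \<and> opr u v \<epsilon> y \<and> r \<sqsubseteq> v \<and> Feq r t u" by blast
next
  fix u v q assume *: "opr u v \<epsilon> y" "v \<in> P" "q \<in> P" "q \<sqsubseteq> p" "q \<sqsubseteq> v"
  obtain r where r: "r \<in> P" "r \<sqsubseteq> q" "Feq r x y" using assms(2)[OF *(3,4)] by blast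
  from Feq_D2[OF r(3) *(1,2) r(1) le_refl[OF r(1)] le_trans[OF r(2) *(5)]] le_trans[OF _ r(2)]
  show "\<exists>r t s. r \<in> P \<and> r \<sqsubseteq> q \<and> s \<in> P \<and> opr t s \<epsilon> x \<and> r \<sqsubseteq> s \<and> Feq r t u" by blast
qed

lemma Feq_refl: "p \<in> P \<Longrightarrow> Feq p x x"
proof (induction x arbitrary: p rule: dom_induct)
  case (step x)
  show ?case
  proof (rule Feq_I[OF step.prems])
    fix t s q assume *: "opr t s \<epsilon> x" "s \<in> P" "q \<in> P" "q \<sqsubseteq> s"
    show "\<exists>r u v. r \<in> P \<and> r \<sqsubseteq> q \<and> v \<in> P \<and> opr u v \<epsilon> x \<and> r \<sqsubseteq> v \<and> Feq r t u"
      by (rule exI[of _ q], rule exI[of _ t], rule exI[of _ s], intro conjI le_refl step.IH[OF *(1)] *)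
  next
    fix t s q assume *: "opr t s \<epsilon> x" "s \<in> P" "q \<in> P" "q \<sqsubseteq> s"
    show "\<exists>r u v. r \<in> P \<and> r \<sqsubseteq> q \<and> v \<in> P \<and> opr u v \<epsilon> x \<and> r \<sqsubseteq> v \<and> Feq r u t"
      by (rule exI[of _ q], rule exI[of _ t], rule exI[of _ s], intro conjI le_refl step.IH[OF *(1)] *)
  qed
qed

lemma Feq_sym: "Feq p x y \<Longrightarrow> Feq p y x"
proof (induction x arbitrary: p y rule: dom_induct)
  case (step x)
  show ?case
  proof (rule Feq_I[OF Feq_P[OF step.prems]])
    fix t s q assume "opr t s \<epsilon> y" "s \<in> P" "q \<in> P" "q \<sqsubseteq> p" "q \<sqsubseteq> s"
    from Feq_D2[OF step.prems this] show
      "\<exists>r u v. r \<in> P \<and> r \<sqsubseteq> q \<and> v \<in> P \<and> opr u v \<epsilon> x \<and> r \<sqsubseteq> v \<and> Feq r t u" using step.IH by blast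
  next
    fix u v q assume *: "opr u v \<epsilon> x" "v \<in> P" "q \<in> P" "q \<sqsubseteq> p" "q \<sqsubseteq> v"
    from Feq_D1[OF step.prems this] show
      "\<exists>r t s. r \<in> P \<and> r \<sqsubseteq> q \<and> s \<in> P \<and> opr t s \<epsilon> y \<and> r \<sqsubseteq> s \<and> Feq r t u" using step.IH[OF *(1)] by blast
  qed
qed

lemma Feq_trans_half:
  assumes IH: "\<And>t s p y z. opr t s \<epsilon> x \<Longrightarrow> Feq p t y \<Longrightarrow> Feq p y z \<Longrightarrow> Feq p t z"
    and xy: "Feq p x y" and yz: "Feq p y z"
    and *: "opr t s \<epsilon> x" "s \<in> P" "q \<in> P" "q \<sqsubseteq> p" "q \<sqsubseteq> s"
  shows "\<exists>r u v. r \<in> P \<and> r \<sqsubseteq> q \<and> v \<in> P \<and> opr u v \<epsilon> z \<and> r \<sqsubseteq> v \<and> Feq r t u"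
proof -
  obtain r u v where r: "r \<in> P" "r \<sqsubseteq> q" "v \<in> P" "opr u v \<epsilon> y" "r \<sqsubseteq> v" "Feq r t u"
    using Feq_D1[OF xy *] by blast
  obtain r' u' v' where r': "r' \<in> P" "r' \<sqsubseteq> r" "v' \<in> P" "opr u' v' \<epsilon> z" "r' \<sqsubseteq> v'" "Feq r' u u'"
    using Feq_D1[OF yz r(4,3,1) le_trans[OF r(2) *(4)] r(5)] by blast
  have "Feq r' t u'" by (rule IH[OF *(1) Feq_mono[OF r(6) r'(1,2)] r'(6)])
  then show ?thesis using r' le_trans[OF r'(2) r(2)] by blast
qed

lemma Feq_trans: "Feq p x y \<Longrightarrow> Feq p y z \<Longrightarrow> Feq p x z"
proof (induction x arbitrary: p y z rule: dom_induct)
  case (step x)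
  show ?case
  proof (rule Feq_I[OF Feq_P[OF step.prems(1)]])
    fix t s q assume *: "opr t s \<epsilon> x" "s \<in> P" "q \<in> P" "q \<sqsubseteq> p" "q \<sqsubseteq> s"
    show "\<exists>r u v. r \<in> P \<and> r \<sqsubseteq> q \<and> v \<in> P \<and> opr u v \<epsilon> z \<and> r \<sqsubseteq> v \<and> Feq r t u"
      by (rule Feq_trans_half[where x=x and p=p, OF _ step.prems *], rule step.IH; assumption)
  next
    fix u v q assume *: "opr u v \<epsilon> z" "v \<in> P" "q \<in> P" "q \<sqsubseteq> p" "q \<sqsubseteq> v"
    obtain r u' v' where r: "r \<in> P" "r \<sqsubseteq> q" "v' \<in> P" "opr u' v' \<epsilon> y" "r \<sqsubseteq> v'" "Feq r u' u"
      using Feq_D2[OF step.prems(2) *] by blast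
    obtain r' t s where r': "r' \<in> P" "r' \<sqsubseteq> r" "s \<in> P" "opr t s \<epsilon> x" "r' \<sqsubseteq> s" "Feq r' t u'"
      using Feq_D2[OF step.prems(1) r(4,3,1) le_trans[OF r(2) *(4)] r(5)] by blast
    have "Feq r' t u" by (rule step.IH[OF r'(4,6) Feq_mono[OF r(6) r'(1,2)]])
    then show "\<exists>r t s. r \<in> P \<and> r \<sqsubseteq> q \<and> s \<in> P \<and> opr t s \<epsilon> x \<and> r \<sqsubseteq> s \<and> Feq r t u"
      using r' le_trans[OF r'(2) r(2)] by blast
  qed
qed

text \<open>Defined from \<open>Feq\<close> without a further recursion; the density below
  \<open>p\<close> is built in.\<close>

definition Fmem :: "'a \<Rightarrow> 'a \<Rightarrow> 'a \<Rightarrow> bool" where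
  "Fmem p x y \<longleftrightarrow> p \<in> P \<and> (\<forall>q\<in>P. q \<sqsubseteq> p \<longrightarrow>
     (\<exists>r\<in>P. r \<sqsubseteq> q \<and> (\<exists>u v. opr u v \<epsilon> y \<and> v \<in> P \<and> r \<sqsubseteq> v \<and> Feq r x u)))"

lemma Dfn_Fmem [dfn]: "Trm t \<Longrightarrow> Trm u \<Longrightarrow> Trm s \<Longrightarrow> Dfn (\<lambda>e. Fmem (t e) (u e) (s e))"
  by (rule Dfn_sub3[where P=Fmem]) (unfold Fmem_def, intro dfn)

lemma Fmem_mono: "Fmem p x y \<Longrightarrow> q \<in> P \<Longrightarrow> q \<sqsubseteq> p \<Longrightarrow> Fmem q x y"
  unfolding Fmem_def using le_trans by blast

lemma Fmem_dense:
  assumes "p \<in> P" "\<And>q. q \<in> P \<Longrightarrow> q \<sqsubseteq> p \<Longrightarrow> \<exists>r\<in>P. r \<sqsubseteq> q \<and> Fmem r x y" shows "Fmem p x y"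
  unfolding Fmem_def
proof (intro conjI ballI impI assms(1))
  fix q assume "q \<in> P" "q \<sqsubseteq> p"
  then obtain r where r: "r \<in> P" "r \<sqsubseteq> q" "Fmem r x y" using assms(2) by blast
  then obtain r' where "r' \<in> P" "r' \<sqsubseteq> r" "\<exists>u v. opr u v \<epsilon> y \<and> v \<in> P \<and> r' \<sqsubseteq> v \<and> Feq r' x u"
    using le_refl unfolding Fmem_def by blast
  then show "\<exists>r\<in>P. r \<sqsubseteq> q \<and> (\<exists>u v. opr u v \<epsilon> y \<and> v \<in> P \<and> r \<sqsubseteq> v \<and> Feq r x u)"
    using le_trans[OF _ r(2)] by blast
qed

primrec forces :: "fm \<Rightarrow> 'a \<Rightarrow> (nat \<Rightarrow> 'a) \<Rightarrow> bool" where
  "forces (Mem i j) p e \<longleftrightarrow> Fmem p (e i) (e j)"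
| "forces (Eq i j) p e \<longleftrightarrow> Feq p (e i) (e j)"
| "forces (Neg f) p e \<longleftrightarrow> p \<in> P \<and> (\<forall>q\<in>P. q \<sqsubseteq> p \<longrightarrow> \<not> forces f q e)"
| "forces (Conj f g) p e \<longleftrightarrow> forces f p e \<and> forces g p e"
| "forces (All f) p e \<longleftrightarrow> (\<forall>x. forces f p (case_nat x e))"

text \<open>Definability of forcing: an induction on the formula outside of the model. Quantifiers
  over names are quantifiers over all elements, because every element serves as a name.\<close>

lemma Dfn_forces0: "Dfn (\<lambda>e. forces f (e 0) (\<lambda>i. e (Suc i)))"
proof (induction f)
  case (Neg f)
  have "Dfn (\<lambda>e. forces f (e 0) (\<lambda>i. e (Suc (Suc i))))"
    using Dfn_rename[OF Neg, of "case_nat 0 (\<lambda>i. Suc (Suc i))"] by simp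
  then show ?case unfolding forces.simps by (intro dfn)
next
  case (All f)
  have "Dfn (\<lambda>e. forces f (e 1) (case_nat (e 0) (\<lambda>i. e (Suc (Suc i)))))"
  proof -
    have *: "(\<lambda>i. e (case_nat 0 (\<lambda>i. Suc (Suc i)) i)) = case_nat (e 0) (\<lambda>i. e (Suc (Suc i)))" for e :: "nat \<Rightarrow> 'a"
      by (auto split: nat.split)
    show ?thesis using Dfn_rename[OF All, of "case_nat 1 (case_nat 0 (\<lambda>i. Suc (Suc i)))"] by (simp add: *)
  qed
  note * = this
  show ?case unfolding forces.simps by (rule Dfn_all) (rule *[unfolded One_nat_def])
qed (unfold forces.simps, (intro dfn | assumption)+)

lemma Dfn_forces:
  assumes "Trm t" "Trm u" shows "Dfn (\<lambda>e. forces f (t e) (case_nat (u e) c))"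
proof (rule Dfn_sub2[where P="\<lambda>p x. forces f p (case_nat x c)", OF _ assms])
  have "(\<lambda>i. if Suc i < 2 then e (Suc i) else case_nat undefined (case_nat undefined c) (Suc i)) = case_nat (e 1) c" for e :: "nat \<Rightarrow> 'a"
    by (auto split: nat.split)
  then show "Dfn (\<lambda>e. forces f (e 0) (case_nat (e 1) c))"
    using Dfn_param[OF Dfn_forces0, of f 2 "case_nat undefined (case_nat undefined c)"] by simp
qed

lemma Dfn_forces3:
  assumes "Trm t" "Trm u" "Trm s" shows "Dfn (\<lambda>e. forces f (t e) (case_nat (u e) (case_nat (s e) c)))"
proof (rule Dfn_sub3[where P="\<lambda>p x y. forces f p (case_nat x (case_nat y c))", OF _ assms])
  have "(\<lambda>i. if Suc i < 3 then e (Suc i) else case_nat undefined (case_nat undefined (case_nat undefined c)) (Suc i)) = case_nat (e 1) (case_nat (e 2) c)" for e :: "nat \<Rightarrow> 'a"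
    by (auto split: nat.split simp: numeral_2_eq_2 numeral_3_eq_3)
  then show "Dfn (\<lambda>e. forces f (e 0) (case_nat (e 1) (case_nat (e 2) c)))"
    using Dfn_param[OF Dfn_forces0, of f 3 "case_nat undefined (case_nat undefined (case_nat undefined c))"] by simp
qed

lemma forces_mono: "forces f p e \<Longrightarrow> q \<in> P \<Longrightarrow> q \<sqsubseteq> p \<Longrightarrow> forces f q e"
proof (induction f arbitrary: p q e)
  case (Mem i j)
  then show ?case unfolding forces.simps by (rule Fmem_mono)
next
  case (Eq i j)
  then show ?case unfolding forces.simps by (rule Feq_mono)
next
  case (Neg f)
  then show ?case unfolding forces.simps using le_trans by blast
next
  case (Conj f g)
  have "forces f p e" "forces g p e" using Conj.prems(1) unfolding forces.simps by blast+
  from Conj.IH(1)[OF this(1) Conj.prems(2,3)] Conj.IH(2)[OF this(2) Conj.prems(2,3)]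
  show ?case unfolding forces.simps ..
next
  case (All f)
  show ?case using All.prems unfolding forces.simps by (intro allI, elim allE) (rule All.IH)
qed

text \<open>Consequently, if \<open>p\<close> does not force a formula, some stronger condition
  forces its negation; the case of the universal quantifier in the truth lemma needs this.\<close>

lemma forces_dense:
  assumes "p \<in> P" "\<And>q. q \<in> P \<Longrightarrow> q \<sqsubseteq> p \<Longrightarrow> \<exists>r\<in>P. r \<sqsubseteq> q \<and> forces f r e" shows "forces f p e"
  using assms
proof (induction f arbitrary: p e)
  case (Mem i j)
  show ?case unfolding forces.simps by (rule Fmem_dense[OF Mem.prems(1) Mem.prems(2)[unfolded forces.simps]])
next
  case (Eq i j)
  show ?case unfolding forces.simps by (rule Feq_dense[OF Eq.prems(1) Eq.prems(2)[unfolded forces.simps]])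
next
  case (Neg f)
  show ?case unfolding forces.simps
  proof (intro conjI ballI impI notI)
    fix q assume q: "q \<in> P" "q \<sqsubseteq> p" "forces f q e"
    obtain r where "r \<in> P" "r \<sqsubseteq> q" "forces (Neg f) r e" using Neg.prems(2)[OF q(1,2)] by blast
    then show False using forces_mono[OF q(3)] le_refl by auto
  qed (rule Neg.prems)
next
  case (Conj f g)
  show ?case unfolding forces.simps
    by (intro conjI Conj.IH Conj.prems(1); drule (1) Conj.prems(2)[unfolded forces.simps]; blast)
next
  case (All f)
  show ?case unfolding forces.simps
    by (intro allI All.IH All.prems(1); drule (1) All.prems(2)[unfolded forces.simps]; blast)
qed

end

section \<open>Generic extensions\<close>

context set_structure
begin

lemma Dfn_sat: "Dfn (\<lambda>e. sat mem e f)"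
proof -
  have "(\<lambda>i. merge e v (2 * i)) = e" for e v :: "nat \<Rightarrow> 'm" by (simp add: merge_def)
  then show ?thesis unfolding Dfn_def
    by (intro exI[of _ "rename_fm (\<lambda>i. 2 * i) f"] exI) (simp add: sat_rename_fm)
qed

lemma Dfn_sat2:
  assumes "Trm t" "Trm u" shows "Dfn (\<lambda>e. sat mem (case_nat (t e) (case_nat (u e) c)) f)"
proof (rule Dfn_sub2[where P="\<lambda>x y. sat mem (case_nat x (case_nat y c)) f", OF _ assms])
  have "(\<lambda>i. if i < 2 then e i else case_nat undefined (case_nat undefined c) i) = case_nat (e 0) (case_nat (e 1) c)" for e
    by (rule ext) (auto split: nat.split simp: numeral_2_eq_2)
  then show "Dfn (\<lambda>e. sat mem (case_nat (e 0) (case_nat (e 1) c)) f)"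
    using Dfn_param[OF Dfn_sat, of 2 "case_nat undefined (case_nat undefined c)" f] by simp
qed

lemma Dfn_unary_sat:
  assumes "Dfn (\<lambda>e. Q (e 0))" shows "\<exists>p v. \<forall>x. Q x \<longleftrightarrow> sat mem (case_nat x v) p"
proof -
  obtain p v where p: "\<And>e. Q (e 0) \<longleftrightarrow> sat mem (merge e v) p"
    using assms unfolding Dfn_def by (elim exE) blast
  define u where "u = merge v v"
  have "case_nat x u (if even i then 0 else Suc i) = merge (\<lambda>_. x) v i" for x i
    by (simp add: u_def merge_def)
  then have "(\<lambda>i. case_nat x u (if even i then 0 else Suc i)) = merge (\<lambda>_. x) v" for x by (rule ext)
  then have "Q x \<longleftrightarrow> sat mem (case_nat x u) (rename_fm (\<lambda>i. if even i then 0 else Suc i) p)" for x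
    using p[of "\<lambda>_. x"] by (simp add: sat_rename_fm)
  then show ?thesis by (intro exI allI)
qed

end

text \<open>The extension is not built by evaluating names recursively but as a quotient of the
  names: equality and membership hold if a condition in \<open>G\<close> forces them. The usual
  evaluation is recovered in \<open>memN_iff\<close>. Genericity refers to dense classes definable
  with parameters.\<close>

locale generic = forcing +
  fixes G :: "'a set" and val :: "'a \<Rightarrow> 'n" and memN :: "'n \<Rightarrow> 'n \<Rightarrow> bool"
  assumes G_P: "p \<in> G \<Longrightarrow> p \<in> P" and one_G: "one \<in> G"
    and G_up: "p \<in> G \<Longrightarrow> p \<sqsubseteq> q \<Longrightarrow> q \<in> P \<Longrightarrow> q \<in> G"
    and G_dir: "p \<in> G \<Longrightarrow> q \<in> G \<Longrightarrow> \<exists>r\<in>G. r \<sqsubseteq> p \<and> r \<sqsubseteq> q"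
    and G_generic: "Dfn (\<lambda>e. D (e 0)) \<Longrightarrow> (\<And>p. p \<in> P \<Longrightarrow> \<exists>q\<in>P. q \<sqsubseteq> p \<and> D q) \<Longrightarrow> \<exists>p\<in>G. D p"
    and val_surj: "surj val"
    and val_eq: "val x = val y \<longleftrightarrow> (\<exists>p\<in>G. Feq p x y)"
    and memN_val: "memN (val x) (val y) \<longleftrightarrow> (\<exists>p\<in>G. Fmem p x y)"
begin

sublocale N: set_structure memN .

lemma Dfn_forces_const: "Trm t \<Longrightarrow> Dfn (\<lambda>e. forces f (t e) c)"
proof -
  assume t: "Trm t"
  have "case_nat (c 0) (\<lambda>i. c (Suc i)) = c" by (rule ext) (simp split: nat.split)
  then show ?thesis using Dfn_forces[OF t Trm_const, of f "c 0" "\<lambda>i. c (Suc i)"] by simp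
qed

lemma generic_below:
  assumes D: "Dfn (\<lambda>e. D (e 0))" and p: "p \<in> G"
    and dense: "\<And>q. q \<in> P \<Longrightarrow> q \<sqsubseteq> p \<Longrightarrow> \<exists>r\<in>P. r \<sqsubseteq> q \<and> D r"
  shows "\<exists>r\<in>G. D r"
proof -
  \<comment> \<open>A set that is dense below \<open>p\<close> becomes dense everywhere when the
    conditions incompatible with \<open>p\<close> are added, and none of these belongs to
    \<open>G\<close>.\<close>
  have "\<exists>r\<in>G. D r \<or> (\<forall>s\<in>P. s \<sqsubseteq> r \<longrightarrow> \<not> s \<sqsubseteq> p)"
  proof (rule G_generic)
    show "Dfn (\<lambda>e. D (e 0) \<or> (\<forall>s\<in>P. s \<sqsubseteq> e 0 \<longrightarrow> \<not> s \<sqsubseteq> p))" by (intro dfn D)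
    fix q assume q: "q \<in> P"
    show "\<exists>r\<in>P. r \<sqsubseteq> q \<and> (D r \<or> (\<forall>s\<in>P. s \<sqsubseteq> r \<longrightarrow> \<not> s \<sqsubseteq> p))"
    proof (cases "\<exists>s\<in>P. s \<sqsubseteq> q \<and> s \<sqsubseteq> p")
      case True
      then obtain s where s: "s \<in> P" "s \<sqsubseteq> q" "s \<sqsubseteq> p" by blast
      then show ?thesis using dense[of s] le_trans[OF _ s(2)] by blast
    next
      case False
      then show ?thesis using q le_refl by blast
    qed
  qed
  then obtain r where r: "r \<in> G" "D r \<or> (\<forall>s\<in>P. s \<sqsubseteq> r \<longrightarrow> \<not> s \<sqsubseteq> p)" by blast
  obtain s where "s \<in> G" "s \<sqsubseteq> r" "s \<sqsubseteq> p" using G_dir[OF r(1) p] by blast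
  then show ?thesis using r G_P by blast
qed

lemma memN_iff: "memN (val x) (val y) \<longleftrightarrow> (\<exists>u v. opr u v \<epsilon> y \<and> v \<in> G \<and> val x = val u)"
proof
  assume "memN (val x) (val y)"
  then obtain p where p: "p \<in> G" "Fmem p x y" unfolding memN_val by blast
  have "\<exists>r\<in>G. \<exists>u v. opr u v \<epsilon> y \<and> v \<in> P \<and> r \<sqsubseteq> v \<and> Feq r x u"
    by (rule generic_below[OF _ p(1)], intro dfn) (use p(2) in \<open>auto simp: Fmem_def\<close>)
  then obtain r u v where "r \<in> G" "opr u v \<epsilon> y" "v \<in> P" "r \<sqsubseteq> v" "Feq r x u" by blast
  then have "v \<in> G" "val x = val u" using G_up val_eq by blast+
  then show "\<exists>u v. opr u v \<epsilon> y \<and> v \<in> G \<and> val x = val u" using \<open>opr u v \<epsilon> y\<close> by blast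
next
  assume "\<exists>u v. opr u v \<epsilon> y \<and> v \<in> G \<and> val x = val u"
  then obtain u v where uv: "opr u v \<epsilon> y" "v \<in> G" "val x = val u" by blast
  then obtain p where p: "p \<in> G" "Feq p x u" using val_eq by blast
  obtain q where q: "q \<in> G" "q \<sqsubseteq> p" "q \<sqsubseteq> v" using G_dir[OF p(1) uv(2)] by blast
  have "Fmem q x y" unfolding Fmem_def
  proof (intro conjI ballI impI)
    fix r assume r: "r \<in> P" "r \<sqsubseteq> q"
    show "\<exists>r'\<in>P. r' \<sqsubseteq> r \<and> (\<exists>u v. opr u v \<epsilon> y \<and> v \<in> P \<and> r' \<sqsubseteq> v \<and> Feq r' x u)"
      using r le_refl[OF r(1)] uv(1) G_P[OF uv(2)] le_trans[OF r(2) q(3)]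
        Feq_mono[OF p(2) r(1) le_trans[OF r(2) q(2)]] by blast
  qed (rule G_P[OF q(1)])
  then show "memN (val x) (val y)" using q(1) memN_val by blast
qed

lemma valE: obtains x where "z = val x"
  using val_surj by (metis surjD)

lemma memN_ext:
  assumes "\<And>z. memN z a \<longleftrightarrow> memN z b" shows "a = b"
proof -
  obtain x where a: "a = val x" by (rule valE)
  obtain y where b: "b = val y" by (rule valE)
  \<comment> \<open>Either the names are forced to be equal, or a member of one of them is forced by
    a condition below its label to stay outside of the other. Such conditions are dense.\<close>
  define E where "E p = (Feq p x y \<or> (\<exists>t s. opr t s \<epsilon> x \<and> s \<in> P \<and> p \<sqsubseteq> s \<and> (\<forall>q\<in>P. q \<sqsubseteq> p \<longrightarrow> \<not> Fmem q t y))
     \<or> (\<exists>t s. opr t s \<epsilon> y \<and> s \<in> P \<and> p \<sqsubseteq> s \<and> (\<forall>q\<in>P. q \<sqsubseteq> p \<longrightarrow> \<not> Fmem q t x)))" for p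
  have half: "\<exists>r u v. r \<in> P \<and> r \<sqsubseteq> q \<and> v \<in> P \<and> opr u v \<epsilon> y \<and> r \<sqsubseteq> v \<and> Feq r t u"
    if n: "\<not> (\<exists>q\<in>P. q \<sqsubseteq> p \<and> (\<exists>t s. opr t s \<epsilon> x \<and> s \<in> P \<and> q \<sqsubseteq> s \<and> (\<forall>r\<in>P. r \<sqsubseteq> q \<longrightarrow> \<not> Fmem r t y)))"
      and *: "opr t s \<epsilon> x" "s \<in> P" "q \<in> P" "q \<sqsubseteq> p" "q \<sqsubseteq> s" for p x y t s q
  proof -
    obtain r where r: "r \<in> P" "r \<sqsubseteq> q" "Fmem r t y" using n * by blast
    then obtain r' where "r' \<in> P" "r' \<sqsubseteq> r" "\<exists>u v. opr u v \<epsilon> y \<and> v \<in> P \<and> r' \<sqsubseteq> v \<and> Feq r' t u"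
      using le_refl unfolding Fmem_def by blast
    then show ?thesis using le_trans[OF _ r(2)] by blast
  qed
  have "\<exists>p\<in>G. E p"
  proof (rule G_generic)
    show "Dfn (\<lambda>e. E (e 0))" unfolding E_def by (intro dfn)
    fix p assume p: "p \<in> P"
    show "\<exists>q\<in>P. q \<sqsubseteq> p \<and> E q"
    proof (rule ccontr)
      assume n: "\<not> (\<exists>q\<in>P. q \<sqsubseteq> p \<and> E q)"
      have n1: "\<not> (\<exists>q\<in>P. q \<sqsubseteq> p \<and> (\<exists>t s. opr t s \<epsilon> x \<and> s \<in> P \<and> q \<sqsubseteq> s \<and> (\<forall>r\<in>P. r \<sqsubseteq> q \<longrightarrow> \<not> Fmem r t y)))"
        and n2: "\<not> (\<exists>q\<in>P. q \<sqsubseteq> p \<and> (\<exists>t s. opr t s \<epsilon> y \<and> s \<in> P \<and> q \<sqsubseteq> s \<and> (\<forall>r\<in>P. r \<sqsubseteq> q \<longrightarrow> \<not> Fmem r t x)))"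
        using n unfolding E_def by blast+
      have "Feq p x y"
      proof (rule Feq_I[OF p])
        fix t s q assume "opr t s \<epsilon> x" "s \<in> P" "q \<in> P" "q \<sqsubseteq> p" "q \<sqsubseteq> s"
        from half[OF n1 this] show "\<exists>r u v. r \<in> P \<and> r \<sqsubseteq> q \<and> v \<in> P \<and> opr u v \<epsilon> y \<and> r \<sqsubseteq> v \<and> Feq r t u" .
      next
        fix u v q assume "opr u v \<epsilon> y" "v \<in> P" "q \<in> P" "q \<sqsubseteq> p" "q \<sqsubseteq> v"
        from half[OF n2 this] show "\<exists>r t s. r \<in> P \<and> r \<sqsubseteq> q \<and> s \<in> P \<and> opr t s \<epsilon> x \<and> r \<sqsubseteq> s \<and> Feq r t u"
          using Feq_sym by blast
      qed
      then show False using n p le_refl unfolding E_def by blast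
    qed
  qed
  then obtain p where p: "p \<in> G" "E p" by blast
  have no: False if "opr t s \<epsilon> x" "s \<in> P" "p \<sqsubseteq> s" "\<forall>q\<in>P. q \<sqsubseteq> p \<longrightarrow> \<not> Fmem q t y"
      "\<And>z. memN z (val x) \<Longrightarrow> memN z (val y)" for t s x y
  proof -
    have "s \<in> G" using G_up[OF p(1) that(3,2)] .
    then have "memN (val t) (val x)" unfolding memN_iff using that(1) by blast
    then have "memN (val t) (val y)" by (rule that(5))
    then obtain q where q: "q \<in> G" "Fmem q t y" unfolding memN_val by blast
    obtain r where "r \<in> G" "r \<sqsubseteq> p" "r \<sqsubseteq> q" using G_dir[OF p(1) q(1)] by blast
    then show False using that(4) Fmem_mono[OF q(2)] G_P by blast
  qed
  have "Feq p x y"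
    using p(2) no[of _ _ x y] no[of _ _ y x] assms unfolding E_def a b by blast
  then show ?thesis using p(1) val_eq unfolding a b by blast
qed

lemma truth: "sat memN (\<lambda>i. val (e i)) f \<longleftrightarrow> (\<exists>p\<in>G. forces f p e)"
proof (induction f arbitrary: e)
  case (Mem i j)
  then show ?case by (simp add: memN_val)
next
  case (Eq i j)
  then show ?case by (simp add: val_eq)
next
  case (Neg f)
  show ?case
  proof
    assume n: "sat memN (\<lambda>i. val (e i)) (Neg f)"
    have "\<exists>p\<in>G. forces f p e \<or> forces (Neg f) p e"
    proof (rule G_generic)
      show "Dfn (\<lambda>x. forces f (x 0) e \<or> forces (Neg f) (x 0) e)" by (intro dfn Dfn_forces_const)
      fix p assume "p \<in> P"
      then show "\<exists>q\<in>P. q \<sqsubseteq> p \<and> (forces f q e \<or> forces (Neg f) q e)"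
        unfolding forces.simps using le_refl by blast
    qed
    then show "\<exists>p\<in>G. forces (Neg f) p e" using n Neg by auto
  next
    assume "\<exists>p\<in>G. forces (Neg f) p e"
    then obtain p where p: "p \<in> G" "forces (Neg f) p e" by blast
    have False if q: "q \<in> G" "forces f q e" for q
    proof -
      obtain r where "r \<in> G" "r \<sqsubseteq> p" "r \<sqsubseteq> q" using G_dir[OF p(1) q(1)] by blast
      then show False using p(2) forces_mono[OF q(2)] G_P unfolding forces.simps by blast
    qed
    then show "sat memN (\<lambda>i. val (e i)) (Neg f)" using Neg by auto
  qed
next
  case (Conj f g)
  show ?case
  proof
    assume "sat memN (\<lambda>i. val (e i)) (Conj f g)"
    then obtain p q where p: "p \<in> G" "forces f p e" and q: "q \<in> G" "forces g q e" using Conj by auto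
    obtain r where r: "r \<in> G" "r \<sqsubseteq> p" "r \<sqsubseteq> q" using G_dir[OF p(1) q(1)] by blast
    then show "\<exists>p\<in>G. forces (Conj f g) p e"
      using forces_mono[OF p(2) G_P[OF r(1)] r(2)] forces_mono[OF q(2) G_P[OF r(1)] r(3)] by auto
  qed (use Conj in auto)
next
  case (All f)
  have val_case: "(\<lambda>i. val (case_nat x e i)) = case_nat (val x) (\<lambda>i. val (e i))" for x
    by (auto split: nat.split)
  have "sat memN (\<lambda>i. val (e i)) (All f) \<longleftrightarrow> (\<forall>x. sat memN (case_nat (val x) (\<lambda>i. val (e i))) f)"
    using val_surj unfolding sat.simps by (metis surjD)
  also have "\<dots> \<longleftrightarrow> (\<forall>x. \<exists>p\<in>G. forces f p (case_nat x e))"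
    unfolding val_case[symmetric] All ..
  also have "\<dots> \<longleftrightarrow> (\<exists>p\<in>G. forces (All f) p e)"
  proof
    assume all: "\<forall>x. \<exists>p\<in>G. forces f p (case_nat x e)"
    have "\<exists>p\<in>G. forces (All f) p e \<or> (\<exists>x. forces (Neg f) p (case_nat x e))"
    proof (rule G_generic)
      show "Dfn (\<lambda>z. forces (All f) (z 0) e \<or> (\<exists>x. forces (Neg f) (z 0) (case_nat x e)))"
        by (intro dfn Dfn_forces_const Dfn_forces)
      fix p assume p: "p \<in> P"
      show "\<exists>q\<in>P. q \<sqsubseteq> p \<and> (forces (All f) q e \<or> (\<exists>x. forces (Neg f) q (case_nat x e)))"
      proof (cases "forces (All f) p e")
        case True
        then show ?thesis using p le_refl by blast
      next
        case False
        then obtain x where "\<not> forces f p (case_nat x e)" by auto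
        then obtain q where "q \<in> P" "q \<sqsubseteq> p" "\<forall>r\<in>P. r \<sqsubseteq> q \<longrightarrow> \<not> forces f r (case_nat x e)"
          using forces_dense[OF p] by blast
        then show ?thesis unfolding forces.simps by blast
      qed
    qed
    then obtain p where p: "p \<in> G" "forces (All f) p e \<or> (\<exists>x. forces (Neg f) p (case_nat x e))" by blast
    have False if n: "forces (Neg f) p (case_nat x e)" for x
    proof -
      obtain q where q: "q \<in> G" "forces f q (case_nat x e)" using all by blast
      obtain r where "r \<in> G" "r \<sqsubseteq> p" "r \<sqsubseteq> q" using G_dir[OF p(1) q(1)] by blast
      then show False using n forces_mono[OF q(2)] G_P unfolding forces.simps by blast
    qed
    with p show "\<exists>p\<in>G. forces (All f) p e" by blast
  qed auto
  finally show ?case .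
qed

lemma truth2:
  "sat memN (case_nat (val x) (\<lambda>i. val (e i))) f \<longleftrightarrow> (\<exists>p\<in>G. forces f p (case_nat x e))"
proof -
  have "(\<lambda>i. val (case_nat x e i)) = case_nat (val x) (\<lambda>i. val (e i))" by (auto split: nat.split)
  then show ?thesis using truth[of "case_nat x e" f] by simp
qed

lemma truth3:
  "sat memN (case_nat (val x) (case_nat (val y) (\<lambda>i. val (e i)))) f \<longleftrightarrow>
    (\<exists>p\<in>G. forces f p (case_nat x (case_nat y e)))"
proof -
  have "(\<lambda>i. val (case_nat y e i)) = case_nat (val y) (\<lambda>i. val (e i))" by (auto split: nat.split)
  then show ?thesis using truth2[of x "case_nat y e" f] by simp
qed

section \<open>The axioms of ZFC in the extension\<close>

lemma val_env: obtains e where "v = (\<lambda>i::nat. val (e i))"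
  using val_surj by (metis surj_f_inv_f)

lemma N_set:
  assumes "small A" shows "\<exists>n. \<forall>z. memN z n \<longleftrightarrow> z \<in> val ` A"
proof -
  have "small ((\<lambda>x. opr x one) ` A)" by (rule small_image[OF assms], intro dfn)
  then have m: "p \<epsilon> mk ((\<lambda>x. opr x one) ` A) \<longleftrightarrow> (\<exists>x\<in>A. p = opr x one)" for p by (subst mem_mk) auto
  have "memN (val z) (val (mk ((\<lambda>x. opr x one) ` A))) \<longleftrightarrow> val z \<in> val ` A" for z
    unfolding memN_iff m using one_G by auto
  then show ?thesis by (metis valE)
qed

lemma N_separation: "\<exists>b. \<forall>x. memN x b \<longleftrightarrow> memN x a \<and> sat memN (case_nat x v) f"
proof -
  obtain a' where a: "a = val a'" by (rule valE)
  obtain e where v: "v = (\<lambda>i. val (e i))" by (rule val_env)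
  define B where "B = {w. \<exists>u p. w = opr u p \<and> u \<in> {u. \<exists>s. opr u s \<epsilon> a'} \<and> p \<in> P \<and> Fmem p u a' \<and> forces f p (case_nat u e)}"
  have B: "small B"
  proof (rule small_subset[OF small_Times[OF small_Domain[of a'] P_small]])
    show "B \<subseteq> {opr x y |x y. x \<in> {x. \<exists>y. opr x y \<epsilon> a'} \<and> y \<in> P}" unfolding B_def by blast
    show "Dfn (\<lambda>e. e 0 \<in> B)" unfolding B_def mem_Collect_eq by (intro dfn Dfn_forces)
  qed
  have "memN (val z) (val (mk B)) \<longleftrightarrow> memN (val z) a \<and> sat memN (case_nat (val z) v) f" for z
  proof
    assume "memN (val z) (val (mk B))"
    then obtain u p where u: "p \<in> G" "val z = val u" "Fmem p u a'" "forces f p (case_nat u e)"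
      unfolding memN_iff mem_mk[OF B] unfolding B_def by auto
    then show "memN (val z) a \<and> sat memN (case_nat (val z) v) f"
      unfolding a v u(2) memN_val truth2 by blast
  next
    assume *: "memN (val z) a \<and> sat memN (case_nat (val z) v) f"
    then obtain u s where u: "opr u s \<epsilon> a'" "val z = val u" unfolding a memN_iff by blast
    obtain p where p: "p \<in> G" "Fmem p u a'" using * unfolding a u(2) memN_val by blast
    obtain q where q: "q \<in> G" "forces f q (case_nat u e)" using * unfolding v u(2) truth2 by blast
    obtain r where r: "r \<in> G" "r \<sqsubseteq> p" "r \<sqsubseteq> q" using G_dir[OF p(1) q(1)] by blast
    have "opr u r \<in> B" unfolding B_def mem_Collect_eq
      using u(1) G_P[OF r(1)] Fmem_mono[OF p(2) _ r(2)] forces_mono[OF q(2) _ r(3)] by blast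
    then show "memN (val z) (val (mk B))" unfolding memN_iff mem_mk[OF B] using r(1) u(2) by blast
  qed
  then show ?thesis by (metis valE)
qed

lemma N_sep_Dfn:
  assumes "N.Dfn (\<lambda>e. Q (e 0))" shows "\<exists>b. \<forall>x. memN x b \<longleftrightarrow> memN x a \<and> Q x"
proof -
  obtain p v where "\<And>x. Q x \<longleftrightarrow> sat memN (case_nat x v) p" using N.Dfn_unary_sat[OF assms] by blast
  then show ?thesis using N_separation[of a v p] by simp
qed

lemma N_replacement:
  assumes ex: "\<forall>x. memN x a \<longrightarrow> (\<exists>!y. sat memN (case_nat x (case_nat y v)) f)"
  shows "\<exists>b. \<forall>y. memN y b \<longleftrightarrow> (\<exists>x. memN x a \<and> sat memN (case_nat x (case_nat y v)) f)"
proof -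
  obtain a' where a: "a = val a'" by (rule valE)
  obtain e where v: "v = (\<lambda>i. val (e i))" by (rule val_env)
  \<comment> \<open>The second disjunct makes \<open>R\<close> total, so that collection applies.
    The set obtained contains enough names; separation in the extension selects the right
    values.\<close>
  define R where "R w y \<longleftrightarrow> (\<exists>u p. w = opr u p \<and> (forces f p (case_nat u (case_nat y e)) \<or>
      \<not> (\<exists>y. forces f p (case_nat u (case_nat y e)))))" for w y
  have RD: "Dfn (\<lambda>e. R (e 0) (e 1))" unfolding R_def by (intro dfn Dfn_forces3)
  have "\<exists>y. R w y" if "w \<in> {opr x y |x y. x \<in> {x. \<exists>y. opr x y \<epsilon> a'} \<and> y \<in> P}" for w
    using that unfolding R_def by auto
  from collection[OF small_Times[OF small_Domain P_small] RD this]
  obtain B where B: "small B" "\<And>w. w \<in> {opr x y |x y. x \<in> {x. \<exists>y. opr x y \<epsilon> a'} \<and> y \<in> P} \<Longrightarrow> \<exists>y\<in>B. R w y"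
    by blast
  obtain n where n: "\<And>z. memN z n \<longleftrightarrow> z \<in> val ` B" using N_set[OF B(1)] by blast
  have "memN y n" if x: "memN x a" and y: "sat memN (case_nat x (case_nat y v)) f" for x y
  proof -
    obtain z where z: "x = val z" by (rule valE)
    obtain u s where u: "opr u s \<epsilon> a'" "x = val u" using x unfolding z a memN_iff by blast
    obtain y' where y': "y = val y'" by (rule valE)
    obtain p where p: "p \<in> G" "forces f p (case_nat u (case_nat y' e))"
      using y unfolding u(2) y' v truth3 by blast
    obtain y'' where y'': "y'' \<in> B" "R (opr u p) y''" using B(2)[of "opr u p"] u(1) G_P[OF p(1)] by blast
    then have "forces f p (case_nat u (case_nat y'' e))" using p(2) unfolding R_def by auto
    then have "sat memN (case_nat x (case_nat (val y'') v)) f" unfolding u(2) v truth3 using p(1) by blast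
    then have "y = val y''" using ex x y by blast
    then show ?thesis unfolding n using y''(1) by blast
  qed
  note bound = this
  have "N.Dfn (\<lambda>w. \<exists>x. memN x a \<and> sat memN (case_nat x (case_nat (w 0) v)) f)"
    by (intro N.Dfn_ex N.Dfn_conj N.Dfn_mem N.Trm_var N.Trm_const N.Dfn_sat2)
  then obtain b where "\<forall>y. memN y b \<longleftrightarrow> memN y n \<and> (\<exists>x. memN x a \<and> sat memN (case_nat x (case_nat y v)) f)"
    using N_sep_Dfn[of "\<lambda>y. \<exists>x. memN x a \<and> sat memN (case_nat x (case_nat y v)) f" n] by blast
  then show ?thesis using bound by blast
qed

lemma wfp_memN: "wfp memN"
  unfolding wfp_def
proof (rule wfI_min)
  fix z and Q :: "'n set" assume "z \<in> Q"
  then obtain x where x: "x \<in> {x. val x \<in> Q}" using valE[of z] by auto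
  from wfE_min[OF wf_dom this] obtain m where m: "val m \<in> Q" "\<And>t. (t, m) \<in> {(t, x). \<exists>s. opr t s \<epsilon> x} \<Longrightarrow> val t \<notin> Q"
    by auto
  have "w \<notin> Q" if w: "memN w (val m)" for w
  proof -
    obtain w' where w': "w = val w'" by (rule valE)
    obtain u v where u: "opr u v \<epsilon> m" "w = val u" using w unfolding w' memN_iff by blast
    show ?thesis unfolding u(2) by (rule m(2)) (use u(1) in blast)
  qed
  with m(1) show "\<exists>z\<in>Q. \<forall>y. (y, z) \<in> {(x, y). memN x y} \<longrightarrow> y \<notin> Q" by auto
qed

section \<open>Names for the elements of the ground model\<close>

definition chk :: "'a \<Rightarrow> 'a" where
  "chk = (SOME f. (\<forall>x. f x = mk {opr v one | v. \<exists>u. opr u v \<epsilon> lam (elts x) f}) \<and> Dfn (\<lambda>e. e 0 = f (e 1)) \<and>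
     (\<forall>x. small {opr y (f y) | y. y \<in> elts x}))"

lemma small_chk: "small {opr v one | v. \<exists>u. opr u v \<epsilon> h}"
proof -
  have "small ((\<lambda>v. opr v one) ` {v. \<exists>u. opr u v \<epsilon> h})" by (rule small_image[OF small_Range], intro dfn)
  moreover have "(\<lambda>v. opr v one) ` {v. \<exists>u. opr u v \<epsilon> h} = {opr v one | v. \<exists>u. opr u v \<epsilon> h}" by blast
  ultimately show ?thesis by (rule subst[rotated])
qed

lemma chk: "chk x = mk {opr v one | v. \<exists>u. opr u v \<epsilon> lam (elts x) chk}"
  and chk_Dfn: "Dfn (\<lambda>e. e 0 = chk (e 1))"
  and chk_lam: "small {opr y (chk y) | y. y \<in> elts x}"
proof -
  have "Dfn (\<lambda>e. e 0 = mk {opr v one | v. \<exists>u. opr u v \<epsilon> e 2})"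
    unfolding mk_eq_iff[OF small_chk] mem_Collect_eq by (intro dfn)
  note D = this
  have "\<exists>f. (\<forall>x. f x = mk {opr v one | v. \<exists>u. opr u v \<epsilon> lam (elts x) f}) \<and> Dfn (\<lambda>e. e 0 = f (e 1)) \<and>
     (\<forall>x. small {opr y (f y) | y. y \<in> elts x})"
    by (rule mem_recursion[of "\<lambda>x h. mk {opr v one | v. \<exists>u. opr u v \<epsilon> h}", OF D], rule exI, intro conjI allI)
  note * = someI_ex[OF this, folded chk_def]
  show "chk x = mk {opr v one | v. \<exists>u. opr u v \<epsilon> lam (elts x) chk}" by (rule conjunct1[OF *, THEN spec])
  show "Dfn (\<lambda>e. e 0 = chk (e 1))" by (rule conjunct1[OF conjunct2[OF *]])
  show "small {opr y (chk y) | y. y \<in> elts x}" by (rule conjunct2[OF conjunct2[OF *], THEN spec])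
qed

lemma Trm_chk [dfn]: "Trm t \<Longrightarrow> Trm (\<lambda>e. chk (t e))"
  by (rule Trm_sub1[where F=chk, OF chk_Dfn])

definition ck :: "'a \<Rightarrow> 'n" where "ck x = val (chk x)"

lemma mem_ck: "memN z (ck x) \<longleftrightarrow> (\<exists>y. y \<epsilon> x \<and> z = ck y)"
proof -
  obtain z' where z: "z = val z'" by (rule valE)
  have "opr u v \<epsilon> chk x \<longleftrightarrow> v = one \<and> (\<exists>y. y \<epsilon> x \<and> u = chk y)" for u v
  proof -
    have "opr u v \<epsilon> chk x \<longleftrightarrow> opr u v \<in> {opr v one | v. \<exists>u. opr u v \<epsilon> lam (elts x) chk}"
      by (subst chk) (rule mem_mk[OF small_chk])
    then show ?thesis unfolding mem_Collect_eq mem_lam[OF chk_lam] by auto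
  qed
  then show ?thesis unfolding z ck_def memN_iff using one_G by auto
qed

lemma ck_eq [simp]: "ck x = ck y \<longleftrightarrow> x = y"
proof
  show "ck x = ck y \<Longrightarrow> x = y"
  proof (induction x arbitrary: y rule: mem_induct)
    case (step x)
    have 1: "z \<epsilon> y" if z: "z \<epsilon> x" for z
    proof -
      have "memN (ck z) (ck y)" using step.prems z mem_ck[of "ck z" x] by auto
      then obtain w where "w \<epsilon> y" "ck z = ck w" unfolding mem_ck by blast
      then show ?thesis using step.IH[OF z] by blast
    qed
    have 2: "w \<epsilon> x" if w: "w \<epsilon> y" for w
    proof -
      have "memN (ck w) (ck x)" using step.prems w mem_ck[of "ck w" y] by auto
      then obtain z where "z \<epsilon> x" "ck w = ck z" unfolding mem_ck by blast
      then show ?thesis using step.IH[of z w] by auto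
    qed
    show ?case unfolding eq_iff_mem[of x y] using 1 2 by blast
  qed
qed simp

lemma N_infinity: "\<exists>a. N.is_inductive a"
proof
  show "N.is_inductive (ck omg)" unfolding N.is_inductive_def
  proof (intro conjI allI impI)
    have "N.is_empty (ck (num 0))" unfolding N.is_empty_def mem_ck by simp
    moreover have "memN (ck (num 0)) (ck omg)" unfolding mem_ck mem_omg by blast
    ultimately show "\<exists>e. N.is_empty e \<and> memN e (ck omg)" by blast
    fix x assume "memN x (ck omg)"
    then obtain n where x: "x = ck (num n)" unfolding mem_ck mem_omg by blast
    have "N.is_succ (ck (num (Suc n))) x" unfolding N.is_succ_def mem_ck x by auto
    moreover have "memN (ck (num (Suc n))) (ck omg)" unfolding mem_ck mem_omg by blast
    ultimately show "\<exists>s. N.is_succ s x \<and> memN s (ck omg)" by blast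
  qed
qed

text \<open>Every subset of the value of \<open>a'\<close> is the value of a name that is a subset
  of the product of the domain of \<open>a'\<close> with \<open>P\<close>, and these names form a
  set.\<close>

lemma N_power: "\<exists>p. \<forall>x. memN x p \<longleftrightarrow> N.sub x a"
proof -
  obtain a' where a: "a = val a'" by (rule valE)
  define A where "A = {opr x y |x y. x \<in> {x. \<exists>y. opr x y \<epsilon> a'} \<and> y \<in> P}"
  have A: "small A" unfolding A_def by (rule small_Times[OF small_Domain P_small])
  obtain n where n: "\<And>z. memN z n \<longleftrightarrow> z \<in> val ` {x. elts x \<subseteq> A}" using N_set[OF small_Pow[OF A]] by blast
  have sub_n: "memN x n" if x: "N.sub x a" for x
  proof -
    obtain x' where x': "x = val x'" by (rule valE)
    have B: "small {w \<in> A. \<forall>u p. w = opr u p \<longrightarrow> Fmem p u x'}" by (rule small_sep[OF A], intro dfn)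
    have "memN z x \<longleftrightarrow> memN z (val (mk {w \<in> A. \<forall>u p. w = opr u p \<longrightarrow> Fmem p u x'}))" for z
    proof -
      obtain z' where z: "z = val z'" by (rule valE)
      show ?thesis
      proof
        assume zx: "memN z x"
        then have "memN z a" using x unfolding N.sub_def by blast
        then obtain u s where u: "opr u s \<epsilon> a'" "z = val u" unfolding a z memN_iff by auto
        obtain p where p: "p \<in> G" "Fmem p u x'" using zx unfolding u(2) x' memN_val by blast
        have "opr u p \<in> {w \<in> A. \<forall>u p. w = opr u p \<longrightarrow> Fmem p u x'}"
          unfolding A_def using u(1) p(2) G_P[OF p(1)] by fastforce
        note * = this
        show "memN z (val (mk {w \<in> A. \<forall>u p. w = opr u p \<longrightarrow> Fmem p u x'}))"
          unfolding u(2) memN_iff mem_mk[OF B] by (rule exI[of _ u], rule exI[of _ p], intro conjI refl p(1) *)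
      next
        assume "memN z (val (mk {w \<in> A. \<forall>u p. w = opr u p \<longrightarrow> Fmem p u x'}))"
        then obtain u p where u: "p \<in> G" "z = val u" "Fmem p u x'"
          unfolding z memN_iff mem_mk[OF B] by auto
        then show "memN z x" unfolding u(2) x' memN_val by blast
      qed
    qed
    then have "x = val (mk {w \<in> A. \<forall>u p. w = opr u p \<longrightarrow> Fmem p u x'})" by (rule memN_ext)
    moreover have "elts (mk {w \<in> A. \<forall>u p. w = opr u p \<longrightarrow> Fmem p u x'}) \<subseteq> A"
      unfolding elts_mk[OF B] by blast
    ultimately show ?thesis unfolding n by (intro image_eqI) simp_all
  qed
  have "\<exists>b. \<forall>x. memN x b \<longleftrightarrow> memN x n \<and> N.sub x a"
    by (rule N_sep_Dfn, rule N.Dfn_sub, rule N.Trm_var, rule N.Trm_const)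
  then obtain b where b: "\<forall>x. memN x b \<longleftrightarrow> memN x n \<and> N.sub x a" ..
  show ?thesis by (rule exI[of _ b]) (use b sub_n in auto)
qed

lemma N_union: "\<exists>u. \<forall>z. memN z u \<longleftrightarrow> (\<exists>x. memN x a \<and> memN z x)"
proof -
  obtain a' where a: "a = val a'" by (rule valE)
  have "small (\<Union>y\<in>{x. \<exists>s. opr x s \<epsilon> a'}. elts (mk {x. \<exists>s. opr x s \<epsilon> y}))"
    by (rule small_UN[OF small_Domain], unfold mk_eq_iff[OF small_Domain] mem_Collect_eq, intro dfn)
  from N_set[OF this, unfolded elts_mk[OF small_Domain]]
  obtain n where n: "\<forall>z. memN z n \<longleftrightarrow> z \<in> val ` (\<Union>y\<in>{x. \<exists>s. opr x s \<epsilon> a'}. {x. \<exists>s. opr x s \<epsilon> y})" ..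
  have b: "memN z n" if x: "memN x a" and z: "memN z x" for x z
  proof -
    obtain x' where x': "x = val x'" by (rule valE)
    obtain u s where u: "opr u s \<epsilon> a'" "x = val u" using x unfolding a x' memN_iff by auto
    obtain z' where z': "z = val z'" by (rule valE)
    obtain w t where w: "opr w t \<epsilon> u" "z = val w" using z unfolding u(2) z' memN_iff by auto
    have "val w \<in> val ` (\<Union>y\<in>{x. \<exists>s. opr x s \<epsilon> a'}. {x. \<exists>s. opr x s \<epsilon> y})"
      by (rule imageI, rule UN_I[of u]) (use u(1) w(1) in blast)+
    then show ?thesis unfolding w(2) using n by simp
  qed
  have "\<exists>b. \<forall>z. memN z b \<longleftrightarrow> memN z n \<and> (\<exists>x. memN x a \<and> memN z x)"
    by (rule N_sep_Dfn, intro N.Dfn_ex N.Dfn_conj N.Dfn_mem N.Trm_var N.Trm_const)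
  then obtain m where m: "\<forall>z. memN z m \<longleftrightarrow> memN z n \<and> (\<exists>x. memN x a \<and> memN z x)" ..
  show ?thesis by (rule exI[of _ m]) (use m b in auto)
qed

text \<open>Choice: enumerate names of the members of the union and consider the chain \<open>S\<close> of the initial
  segments. The first member of \<open>S\<close> that meets \<open>x\<close> meets it in exactly one point.\<close>

lemma N_choice:
  assumes ne: "\<forall>x. memN x a \<longrightarrow> (\<exists>z. memN z x)"
    and disj: "\<forall>x y. memN x a \<and> memN y a \<and> x \<noteq> y \<longrightarrow> \<not> (\<exists>z. memN z x \<and> memN z y)"
  shows "\<exists>c. \<forall>x. memN x a \<longrightarrow> (\<exists>!z. memN z x \<and> memN z c)"
proof -
  obtain U where U: "\<And>z. memN z U \<longleftrightarrow> (\<exists>x. memN x a \<and> memN z x)" using N_union[of a] by blast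
  obtain U' where U': "U = val U'" by (rule valE)
  obtain al F where al: "Ord al" and F: "Dfn (\<lambda>e. e 0 = F (e 1))" and bij: "bij_betw F (elts al) {x. \<exists>s. opr x s \<epsilon> U'}"
    by (rule Zermelo[OF small_Domain])
  have U_F: "\<exists>b. b \<epsilon> al \<and> z = val (F b)" if "memN z U" for z
  proof -
    obtain z' where z': "z = val z'" by (rule valE)
    obtain u s where u: "opr u s \<epsilon> U'" "z = val u" using \<open>memN z U\<close> unfolding U' z' memN_iff by auto
    then have "u \<in> F ` elts al" using bij unfolding bij_betw_def by blast
    then show ?thesis using u(2) by auto
  qed
  define nb where "nb b = mk {opr (F c) one | c. c \<epsilon> b}" for b
  have nb_small: "small {opr (F c) one | c. c \<epsilon> b}" for b
  proof -
    have "small ((\<lambda>c. opr (F c) one) ` elts b)"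
      by (rule small_image[OF small_elts], intro dfn Trm_sub1[where F=F, OF F])
    moreover have "(\<lambda>c. opr (F c) one) ` elts b = {opr (F c) one | c. c \<epsilon> b}" by auto
    ultimately show ?thesis by (rule subst[rotated])
  qed
  have mem_nb: "memN z (val (nb b)) \<longleftrightarrow> (\<exists>c. c \<epsilon> b \<and> z = val (F c))" for z b
  proof -
    obtain z' where z': "z = val z'" by (rule valE)
    show ?thesis unfolding z' memN_iff nb_def mem_mk[OF nb_small] using one_G by auto
  qed
  have "small (nb ` elts (suc al))"
    by (rule small_image[OF small_elts], unfold nb_def mk_eq_iff[OF nb_small] mem_Collect_eq,
        intro dfn Trm_sub1[where F=F, OF F])
  then obtain S where S: "\<And>z. memN z S \<longleftrightarrow> z \<in> val ` nb ` elts (suc al)" using N_set by blast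
  have suc_al: "b \<epsilon> suc al \<Longrightarrow> Ord b \<and> (\<forall>c. c \<epsilon> b \<longrightarrow> c \<epsilon> al)" for b
    using al Ord_mem[OF al] Ord_trans[OF al] by auto
  \<comment> \<open>\<open>Q\<close> asks for some segment with a single common point with
    \<open>x\<close>, not for the first one; this keeps the order of the segments out of the
    definition, which has to be evaluated in the extension.\<close>
  define Q where "Q y \<longleftrightarrow> (\<exists>x s. memN x a \<and> memN s S \<and> memN y x \<and> memN y s \<and>
     (\<forall>z. memN z x \<and> memN z s \<longrightarrow> z = y))" for y
  have "N.Dfn (\<lambda>e. Q (e 0))" unfolding Q_def
    by (intro N.Dfn_ex N.Dfn_all N.Dfn_imp N.Dfn_eq N.Dfn_conj N.Dfn_mem N.Trm_var N.Trm_const)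
  then obtain c where c: "\<And>y. memN y c \<longleftrightarrow> memN y U \<and> Q y" using N_sep_Dfn[of Q U] by blast
  have "\<exists>!z. memN z x \<and> memN z c" if x: "memN x a" for x
  proof -
    obtain y0 where y0: "memN y0 x" using ne x by blast
    then have "memN y0 U" unfolding U using x by blast
    then obtain b0 where "b0 \<epsilon> al" "y0 = val (F b0)" using U_F by blast
    then have "\<exists>y. memN y x \<and> memN y (val (nb al))" using y0 unfolding mem_nb by blast
    from ex1_implies_ex[OF Ord_least[OF al, of "\<lambda>b. \<exists>y. memN y x \<and> memN y (val (nb b))", OF this]]
    obtain b y where b: "Ord b" "memN y x" "memN y (val (nb b))"
      and least: "\<forall>c. c \<epsilon> b \<longrightarrow> \<not> (\<exists>y. memN y x \<and> memN y (val (nb c)))" by (elim exE conjE) (rule that)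
    have "\<not> al \<epsilon> b" using least \<open>\<exists>y. memN y x \<and> memN y (val (nb al))\<close> by blast
    then have b_al: "b \<epsilon> suc al" using Ord_linear[OF b(1) al] by auto
    have uniq: "z = y" if z: "memN z x" "memN z (val (nb b))" for z
    proof -
      obtain c where c: "c \<epsilon> b" "y = val (F c)" using b(3) unfolding mem_nb by blast
      obtain d where d: "d \<epsilon> b" "z = val (F d)" using z(2) unfolding mem_nb by blast
      have "\<not> c \<epsilon> d" using least[rule_format, OF d(1)] b(2) c(2) unfolding mem_nb by blast
      moreover have "\<not> d \<epsilon> c" using least[rule_format, OF c(1)] z(1) d(2) unfolding mem_nb by blast
      ultimately have "c = d" using Ord_linear[OF Ord_mem[OF b(1) c(1)] Ord_mem[OF b(1) d(1)]] by blast
      then show ?thesis using c(2) d(2) by simp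
    qed
    have sS: "memN (val (nb b)) S" unfolding S using b_al by (intro imageI) simp
    have "Q y" unfolding Q_def
      by (rule exI[of _ x], rule exI[of _ "val (nb b)"], intro conjI allI impI x sS b(2,3), elim conjE, rule uniq)
    moreover have "memN y U" unfolding U using x b(2) by blast
    ultimately have yc: "memN y c" unfolding c by blast
    have "z = y" if z: "memN z x" "memN z c" for z
    proof -
      obtain x' s where x': "memN x' a" "memN s S" "memN z x'" "memN z s" "\<forall>w. memN w x' \<and> memN w s \<longrightarrow> w = z"
        using z(2) unfolding c Q_def by (elim exE conjE) (rule that)
      have "x' = x" using disj x'(1,3) x z(1) by blast
      obtain d where d: "d \<epsilon> suc al" "s = val (nb d)" using x'(2) unfolding S image_image image_iff in_elts Bex_def
        by (elim exE conjE) (rule that)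
      \<comment> \<open>The segments are nested and \<open>b\<close> gives the first one that meets
        \<open>x\<close>, so every segment that \<open>Q\<close> may use contains the same point
        \<open>y\<close>.\<close>
      have "\<not> d \<epsilon> b" using least[THEN spec, of d] z(1) x'(4) d(2) by blast
      then have "b \<epsilon> d \<or> b = d" using Ord_linear[of b d] b(1) suc_al[OF d(1)] by blast
      then have "memN y s"
        using b(3) Ord_trans[of d b] suc_al[OF d(1)] unfolding d(2) mem_nb by blast
      then show ?thesis using x'(5)[rule_format, of y] b(2) \<open>x' = x\<close> by simp
    qed
    then show ?thesis by (intro ex1I[of _ y] conjI b(2) yc, elim conjE)
  qed
  then show ?thesis by blast
qed

lemma N_pairing: "\<exists>p. N.is_upair p x y"
proof -
  obtain x' where x: "x = val x'" by (rule valE)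
  obtain y' where y: "y = val y'" by (rule valE)
  obtain n where "\<And>z. memN z n \<longleftrightarrow> z \<in> val ` {x', y'}" using N_set[OF small_upair] by blast
  then have "N.is_upair n x y" unfolding N.is_upair_def x y image_insert image_empty insert_iff empty_iff by simp
  then show ?thesis ..
qed

theorem N_zfc: "N.zfc"
  unfolding N.zfc_def
proof (intro conjI)
  show "\<forall>x y. (\<forall>z. memN z x \<longleftrightarrow> memN z y) \<longrightarrow> x = y" by (intro allI impI, rule memN_ext, erule spec)
  show "\<forall>x. (\<exists>y. memN y x) \<longrightarrow> (\<exists>y. memN y x \<and> \<not> (\<exists>z. memN z x \<and> memN z y))"
  proof (intro allI impI)
    fix x assume "\<exists>y. memN y x"
    then obtain y where "y \<in> {y. memN y x}" by blast
    then show "\<exists>y. memN y x \<and> \<not> (\<exists>z. memN z x \<and> memN z y)"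
    proof (rule wfE_min[OF wfp_memN[unfolded wfp_def]])
      fix m assume "m \<in> {y. memN y x}" "\<And>w. (w, m) \<in> {(x, y). memN x y} \<Longrightarrow> w \<notin> {y. memN y x}"
      then show ?thesis by (intro exI[of _ m]) auto
    qed
  qed
  show "\<forall>a. \<exists>u. N.is_Union u a" unfolding N.is_Union_def by (intro allI N_union)
  show "\<forall>a. \<exists>p. N.is_power p a" unfolding N.is_power_def by (intro allI N_power)
  show "\<forall>x y. \<exists>p. N.is_upair p x y" by (intro allI N_pairing)
  show "\<exists>a. N.is_inductive a" by (rule N_infinity)
  show "\<forall>a. (\<forall>x. memN x a \<longrightarrow> (\<exists>z. memN z x)) \<and>
          (\<forall>x y. memN x a \<and> memN y a \<and> x \<noteq> y \<longrightarrow> \<not> (\<exists>z. memN z x \<and> memN z y)) \<longrightarrow>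
          (\<exists>c. \<forall>x. memN x a \<longrightarrow> (\<exists>!z. memN z x \<and> memN z c))"
    by (intro allI impI, elim conjE, rule N_choice)
  show "\<forall>p v a. \<exists>b. \<forall>x. memN x b \<longleftrightarrow> memN x a \<and> sat memN (case_nat x v) p"
    by (intro allI N_separation)
  show "\<forall>p v a. (\<forall>x. memN x a \<longrightarrow> (\<exists>!y. sat memN (case_nat x (case_nat y v)) p)) \<longrightarrow>
        (\<exists>b. \<forall>y. memN y b \<longleftrightarrow> (\<exists>x. memN x a \<and> sat memN (case_nat x (case_nat y v)) p))"
    by (intro allI impI, rule N_replacement)
qed

sublocale N: zfc_model memN
  by unfold_locales (rule wfp_memN, rule N_zfc)

end

section \<open>Countability and the continuum hypothesis in a model\<close>

lemma bij_betw_left_inverse: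
  assumes "bij_betw F A B" "\<forall>x\<in>A. H (F x) = x" shows "bij_betw H B A"
proof -
  have B: "B = F ` A" using assms(1) by (simp add: bij_betw_def)
  show ?thesis unfolding B by (rule bij_betw_byWitness[where f'=F]) (use assms(2) in auto)
qed

context zfc_model
begin

abbreviation DF :: "('a \<Rightarrow> 'a) \<Rightarrow> bool" where "DF F \<equiv> Dfn (\<lambda>e. e 0 = F (e 1))"

lemma related_iff: "related f x y \<longleftrightarrow> opr x y \<epsilon> f"
  unfolding related_def is_opair_iff by auto

lemma DF_comp:
  assumes "DF F" "DF H" shows "DF (\<lambda>x. F (H x))"
  by (intro dfn Trm_sub1[where F=F, OF assms(1)] Trm_sub1[where F=H, OF assms(2)])

lemma DF_app: "DF (app f)"
  by (intro dfn)

lemma is_map_lam: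
  assumes F: "DF F" and ab: "\<And>x. x \<epsilon> a \<Longrightarrow> F x \<epsilon> b"
  shows "is_map (lam (elts a) F) a b" and "related (lam (elts a) F) x y \<longleftrightarrow> x \<epsilon> a \<and> y = F x"
proof -
  have m: "p \<epsilon> lam (elts a) F \<longleftrightarrow> (\<exists>x. x \<epsilon> a \<and> p = opr x (F x))" for p
    unfolding mem_lam[OF small_lam[OF small_elts F]] by auto
  show r: "related (lam (elts a) F) x y \<longleftrightarrow> x \<epsilon> a \<and> y = F x" for x y
    unfolding related_iff m by auto
  show "is_map (lam (elts a) F) a b"
    unfolding is_map_def r is_opair_iff m using ab by auto
qed

lemma is_map_app:
  assumes "is_map f a b"
  shows "x \<epsilon> a \<Longrightarrow> app f x \<epsilon> b" and "related f x y \<longleftrightarrow> x \<epsilon> a \<and> y = app f x"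
proof -
  have 1: "x \<epsilon> a \<and> y \<epsilon> b" if "related f x y" for x y
    using assms that unfolding is_map_def related_iff is_opair_iff by (metis opr_eq)
  have 2: "\<exists>!y. related f x y" if "x \<epsilon> a" for x using assms that unfolding is_map_def by simp
  have 3: "related f x (app f x)" if x: "x \<epsilon> a" for x
    using theI'[OF 2[OF x]] 2[OF x] unfolding related_iff app_def by simp
  show "x \<epsilon> a \<Longrightarrow> app f x \<epsilon> b" using 1[OF 3] by simp
  show "related f x y \<longleftrightarrow> x \<epsilon> a \<and> y = app f x"
  proof
    assume r: "related f x y"
    then have "x \<epsilon> a" using 1 by simp
    have "y = app f x" by (rule ex1E[OF 2[OF \<open>x \<epsilon> a\<close>]]) (use r 3[OF \<open>x \<epsilon> a\<close>] in auto)
    with \<open>x \<epsilon> a\<close> show "x \<epsilon> a \<and> y = app f x" by simp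
  qed (use 3 in auto)
qed

lemma ex_is_inj_map: "(\<exists>f. is_inj_map f a b) \<longleftrightarrow> (\<exists>F. DF F \<and> inj_on F (elts a) \<and> F ` elts a \<subseteq> elts b)"
proof
  assume "\<exists>f. is_inj_map f a b"
  then obtain f where f: "is_map f a b" "\<And>x x' y. related f x y \<Longrightarrow> related f x' y \<Longrightarrow> x = x'"
    unfolding is_inj_map_def by blast
  have "inj_on (app f) (elts a)"
  proof (rule inj_onI)
    fix x y assume "x \<in> elts a" "y \<in> elts a" "app f x = app f y"
    then have "related f x (app f x)" "related f y (app f x)" unfolding is_map_app(2)[OF f(1)] by simp_all
    then show "x = y" by (rule f(2))
  qed
  moreover have "app f ` elts a \<subseteq> elts b" using is_map_app(1)[OF f(1)] by auto
  ultimately show "\<exists>F. DF F \<and> inj_on F (elts a) \<and> F ` elts a \<subseteq> elts b" using DF_app by (intro exI conjI)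
next
  assume "\<exists>F. DF F \<and> inj_on F (elts a) \<and> F ` elts a \<subseteq> elts b"
  then obtain F where F: "DF F" "inj_on F (elts a)" "F ` elts a \<subseteq> elts b" by (elim exE conjE)
  have ab: "\<And>x. x \<epsilon> a \<Longrightarrow> F x \<epsilon> b" using F(3) by (auto simp: image_subset_iff)
  have r: "related (lam (elts a) F) x y \<longleftrightarrow> x \<epsilon> a \<and> y = F x" for x y
    by (rule is_map_lam(2)[OF F(1)], rule ab)
  have "is_map (lam (elts a) F) a b" by (rule is_map_lam(1)[OF F(1)], rule ab)
  then have "is_inj_map (lam (elts a) F) a b"
    unfolding is_inj_map_def r using F(2) by (auto dest: inj_onD)
  then show "\<exists>f. is_inj_map f a b" ..
qed

lemma ex_is_bij_map: "(\<exists>f. is_bij_map f a b) \<longleftrightarrow> (\<exists>F. DF F \<and> bij_betw F (elts a) (elts b))"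
proof
  assume "\<exists>f. is_bij_map f a b"
  then obtain f where f: "is_map f a b" "\<And>x x' y. related f x y \<Longrightarrow> related f x' y \<Longrightarrow> x = x'"
      "\<And>y. y \<epsilon> b \<Longrightarrow> \<exists>x. related f x y"
    unfolding is_bij_map_def is_inj_map_def by blast
  have "inj_on (app f) (elts a)"
  proof (rule inj_onI)
    fix x y assume "x \<in> elts a" "y \<in> elts a" "app f x = app f y"
    then have "related f x (app f x)" "related f y (app f x)" unfolding is_map_app(2)[OF f(1)] by simp_all
    then show "x = y" by (rule f(2))
  qed
  moreover have "app f ` elts a = elts b"
  proof (intro equalityI subsetI)
    fix y assume "y \<in> elts b"
    then have "y \<epsilon> b" by simp
    from f(3)[OF this] obtain x where "x \<epsilon> a" "y = app f x"
      unfolding is_map_app(2)[OF f(1)] by (elim exE conjE) (rule that)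
    then show "y \<in> app f ` elts a" by (intro image_eqI) auto
  qed (use is_map_app(1)[OF f(1)] in auto)
  ultimately have "bij_betw (app f) (elts a) (elts b)" by (simp add: bij_betw_def)
  then show "\<exists>F. DF F \<and> bij_betw F (elts a) (elts b)" using DF_app by (intro exI conjI)
next
  assume "\<exists>F. DF F \<and> bij_betw F (elts a) (elts b)"
  then obtain F where F: "DF F" "bij_betw F (elts a) (elts b)" by (elim exE conjE)
  have inj: "inj_on F (elts a)" and im: "F ` elts a = elts b" using F(2) by (auto simp: bij_betw_def)
  have ab: "\<And>x. x \<epsilon> a \<Longrightarrow> F x \<epsilon> b" using im by auto
  have "\<exists>x. x \<epsilon> a \<and> y = F x" if "y \<epsilon> b" for y
    using that mem_elts[OF im[symmetric], of y] by auto
  moreover have r: "related (lam (elts a) F) x y \<longleftrightarrow> x \<epsilon> a \<and> y = F x" for x y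
    by (rule is_map_lam(2)[OF F(1)], rule ab)
  moreover have "is_map (lam (elts a) F) a b" by (rule is_map_lam(1)[OF F(1)], rule ab)
  ultimately have "is_bij_map (lam (elts a) F) a b"
    unfolding is_bij_map_def is_inj_map_def r using inj by (auto dest: inj_onD)
  then show "\<exists>f. is_bij_map f a b" ..
qed

lemma DF_inverse:
  assumes F: "DF F" "inj_on F A" and A: "small A"
  obtains H where "DF H" "\<forall>x\<in>A. H (F x) = x"
proof -
  define H where "H y = (if \<exists>!x. x \<in> A \<and> y = F x then THE x. x \<in> A \<and> y = F x else emp)" for y
  show ?thesis
  proof (rule that)
    show "DF H" unfolding H_def
      by (rule Dfn_the, intro dfn Dfn_small[OF A] Trm_sub1[where F=F, OF F(1)])
    show "\<forall>x\<in>A. H (F x) = x"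
    proof
      fix x assume x: "x \<in> A"
      have *: "x' = x" if "x' \<in> A" "F x = F x'" for x' by (rule inj_onD[OF F(2)]) (simp_all add: that x)
      have 1: "\<exists>!x'. x' \<in> A \<and> F x = F x'" by (intro ex1I[of _ x] conjI x refl, elim conjE, rule *)
      show "H (F x) = x" unfolding H_def if_P[OF 1] by (rule the1_equality[OF 1]) (simp add: x)
    qed
  qed
qed

text \<open>Countability in the sense of the model: the injection has to be definable, and on a
  small set it is then given by an element.\<close>

definition cntbl :: "'a set \<Rightarrow> bool" where
  "cntbl A \<longleftrightarrow> (\<exists>J. DF J \<and> inj_on J A \<and> J ` A \<subseteq> range num)"

lemma is_countable_iff: "is_countable a \<longleftrightarrow> cntbl (elts a)"
  unfolding is_countable_def is_omega_iff cntbl_def using ex_is_inj_map[of a omg] by simp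

lemma cntbl_inj:
  assumes "cntbl B" "DF F" "inj_on F A" "F ` A \<subseteq> B" shows "cntbl A"
proof -
  obtain J where J: "DF J" "inj_on J B" "J ` B \<subseteq> range num" using assms(1) unfolding cntbl_def by (elim exE conjE)
  have "inj_on (\<lambda>x. J (F x)) A"
    using comp_inj_on[OF assms(3) inj_on_subset[OF J(2) assms(4)]] by (simp add: comp_def)
  moreover have "(\<lambda>x. J (F x)) ` A \<subseteq> range num"
    using J(3) assms(4) unfolding image_subset_iff by simp
  ultimately show ?thesis unfolding cntbl_def using DF_comp[OF J(1) assms(2)] by (intro exI conjI)
qed

lemma not_cntbl_power_omega: "\<not> cntbl (elts (pw omg))"
proof
  assume "cntbl (elts (pw omg))"
  then obtain J where J: "DF J" "inj_on J (elts (pw omg))" "J ` elts (pw omg) \<subseteq> range num"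
    unfolding cntbl_def by (elim exE conjE)
  define D where "D = {n. \<exists>x. sub x omg \<and> J x = num n \<and> \<not> num n \<epsilon> x}"
  have D: "D \<in> Rl" unfolding D_def by (rule Rl_I, intro dfn Trm_sub1[where F=J, OF J(1)])
  have st: "st D \<in> elts (pw omg)" using sub_st_omg[OF D] by simp
  have "J (st D) \<in> range num" using J(3) st unfolding image_subset_iff by simp
  then obtain n where n: "J (st D) = num n" by (elim rangeE)
  have D_iff: "m \<in> D \<longleftrightarrow> (\<exists>x. sub x omg \<and> J x = num m \<and> \<not> num m \<epsilon> x)" for m by (simp add: D_def)
  have mem: "num n \<epsilon> st D \<longleftrightarrow> n \<in> D" using mem_st[OF D] by auto
  have "n \<in> D \<longleftrightarrow> n \<notin> D"
  proof
    assume "n \<in> D"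
    then obtain x where x: "sub x omg" "J x = num n" "\<not> num n \<epsilon> x" unfolding D_iff by (elim exE conjE)
    have "x = st D" by (rule inj_onD[OF J(2)]) (use x n st in simp_all)
    then show "n \<notin> D" using x(3) mem by simp
  next
    assume "n \<notin> D"
    then show "n \<in> D" unfolding D_iff by (intro exI[of _ "st D"] conjI n sub_st_omg[OF D]) (simp add: mem D_iff)
  qed
  then show False by blast
qed

text \<open>The reals of the model are uncountable in it and can be well-ordered, so some ordinal is
  uncountable; the least one is the \<open>\<omega>\<^sub>1\<close> of the model.\<close>

lemma ex_omega1: obtains w where "Ord w" "\<not> cntbl (elts w)" "\<And>a. a \<epsilon> w \<Longrightarrow> cntbl (elts a)"
proof -
  obtain al F where al: "Ord al" "DF F" "bij_betw F (elts al) (elts (pw omg))"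
    by (rule Zermelo[OF small_elts])
  have inj: "inj_on F (elts al)" and im: "F ` elts al = elts (pw omg)" using al(3) by (auto simp: bij_betw_def)
  obtain H where H: "DF H" "\<forall>x\<in>elts al. H (F x) = x" by (rule DF_inverse[OF al(2) inj small_elts], rule that)
  have "\<not> cntbl (elts al)"
  proof
    assume c: "cntbl (elts al)"
    have "inj_on H (elts (pw omg))" unfolding im[symmetric] by (rule inj_onI) (use H(2) in force)
    moreover have "H ` elts (pw omg) \<subseteq> elts al" unfolding im[symmetric] using H(2) by auto
    ultimately show False using cntbl_inj[OF c H(1)] not_cntbl_power_omega by simp
  qed
  from ex1_implies_ex[OF Ord_least[OF al(1), of "\<lambda>a. \<not> cntbl (elts a)", OF this]]
  obtain w where w: "Ord w" "\<not> cntbl (elts w)" "\<forall>c. c \<epsilon> w \<longrightarrow> \<not> \<not> cntbl (elts c)" by (elim exE conjE)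
  show ?thesis by (rule that[OF w(1,2)]) (use w(3) in simp)
qed

lemma DF_least: "DF (\<lambda>z. if \<exists>!b. b \<epsilon> z \<and> (\<forall>c. c \<epsilon> b \<longrightarrow> \<not> c \<epsilon> z) then THE b. b \<epsilon> z \<and> (\<forall>c. c \<epsilon> b \<longrightarrow> \<not> c \<epsilon> z) else emp)"
  by (rule Dfn_the, intro dfn)

text \<open>The enumeration is strictly increasing, hence its value at \<open>b\<close> is never
  below \<open>b\<close>. This bounds the order type of \<open>Y\<close> by
  \<open>w\<close>.\<close>

lemma increasing_enumeration:
  assumes Y: "small Y" "Y \<subseteq> elts w" and w: "Ord w"
  obtains al F where "Ord al" "DF F" "bij_betw F (elts al) Y" "\<forall>b. b \<epsilon> al \<longrightarrow> \<not> F b \<epsilon> b"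
proof -
  define ch where "ch z = (if \<exists>!b. b \<epsilon> z \<and> (\<forall>c. c \<epsilon> b \<longrightarrow> \<not> c \<epsilon> z) then THE b. b \<epsilon> z \<and> (\<forall>c. c \<epsilon> b \<longrightarrow> \<not> c \<epsilon> z) else emp)" for z
  have ch: "ch (mk B) \<in> B \<and> (\<forall>c. c \<epsilon> ch (mk B) \<longrightarrow> c \<notin> B)" if B: "B \<subseteq> Y" "small B" "B \<noteq> {}" for B
  proof -
    obtain b where b: "b \<in> B" using B(3) by blast
    have O: "Ord x" if "x \<in> B" for x using B(1) Y(2) Ord_mem[OF w] that by auto
    have eq: "Ord b \<and> b \<in> B \<and> (\<forall>c. c \<epsilon> b \<longrightarrow> c \<notin> B) \<longleftrightarrow> b \<epsilon> mk B \<and> (\<forall>c. c \<epsilon> b \<longrightarrow> \<not> c \<epsilon> mk B)" for b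
      unfolding mem_mk[OF B(2)] using O by auto
    have "\<exists>!b. Ord b \<and> b \<in> B \<and> (\<forall>c. c \<epsilon> b \<longrightarrow> c \<notin> B)" by (rule Ord_least[of b "\<lambda>b. b \<in> B", OF O[OF b] b])
    then have 1: "\<exists>!b. b \<epsilon> mk B \<and> (\<forall>c. c \<epsilon> b \<longrightarrow> \<not> c \<epsilon> mk B)" unfolding eq .
    have "ch (mk B) = (THE b. b \<epsilon> mk B \<and> (\<forall>c. c \<epsilon> b \<longrightarrow> \<not> c \<epsilon> mk B))" unfolding ch_def by (rule if_P[OF 1])
    note ch_eq = this
    show ?thesis using theI'[OF 1, folded ch_eq] unfolding mem_mk[OF B(2)] .
  qed
  have DFch: "DF ch" unfolding ch_def by (rule DF_least)
  have ch1: "\<And>B. B \<subseteq> Y \<Longrightarrow> small B \<Longrightarrow> B \<noteq> {} \<Longrightarrow> ch (mk B) \<in> B" by (rule conjunct1[OF ch])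
  obtain al F where al: "Ord al" "DF F" "bij_betw F (elts al) Y"
    "\<And>b. b \<epsilon> al \<Longrightarrow> F b = ch (mk (Y - F ` elts b))" "\<And>b. small (Y - F ` elts b)"
  proof (rule enumeration[OF Y(1) DFch])
    fix B assume "B \<subseteq> Y" "small B" "B \<noteq> {}"
    then show "ch (mk B) \<in> B" by (rule ch1)
  next
    fix al F assume "Ord al" "DF F" "bij_betw F (elts al) Y"
      "\<And>b. b \<epsilon> al \<Longrightarrow> F b = ch (mk (Y - F ` elts b))" "\<And>b. small (Y - F ` elts b)"
    then show thesis by (rule that)
  qed
  have FY: "F b \<in> Y" if "b \<epsilon> al" for b using al(3) that unfolding bij_betw_def by auto
  have inj: "F b \<noteq> F c" if "b \<epsilon> al" "c \<epsilon> al" "b \<noteq> c" for b c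
    using al(3) that unfolding bij_betw_def inj_on_def by auto
  have incr: "F b \<epsilon> F c" if c: "c \<epsilon> al" and bc: "b \<epsilon> c" for b c
  proof -
    have b: "b \<epsilon> al" using Ord_trans[OF al(1) c bc] .
    have Fc: "F c \<in> Y - F ` elts b"
    proof -
      have nd: "F c \<noteq> F d" if "d \<epsilon> b" for d
        by (rule inj[OF c Ord_trans[OF al(1) b that]]) (use mem_asym[OF bc] that in auto)
      have "F c \<notin> F ` elts b"
      proof
        assume "F c \<in> F ` elts b"
        then obtain d where d: "d \<epsilon> b" "F c = F d" by auto
        show False using nd[OF d(1)] d(2) by simp
      qed
      then show ?thesis using FY[OF c] by simp
    qed
    then have ne: "Y - F ` elts b \<noteq> {}" by blast
    have "\<forall>d. d \<epsilon> ch (mk (Y - F ` elts b)) \<longrightarrow> d \<notin> Y - F ` elts b"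
      by (rule conjunct2[OF ch[OF Diff_subset al(5) ne]])
    then have "\<not> F c \<epsilon> F b" using Fc unfolding al(4)[OF b, symmetric] by blast
    moreover have "F b \<noteq> F c" by (rule inj[OF b c]) (use bc in auto)
    moreover have "Ord (F b)" "Ord (F c)" using FY[OF b] FY[OF c] Y(2) Ord_mem[OF w] by auto
    ultimately show ?thesis using Ord_linear[of "F b" "F c"] by simp
  qed
  have "b \<epsilon> al \<longrightarrow> \<not> F b \<epsilon> b" for b
  proof (induction b rule: mem_induct)
    case (step b)
    show ?case
    proof (intro impI notI)
      assume b: "b \<epsilon> al" "F b \<epsilon> b"
      have "F (F b) \<epsilon> F b" by (rule incr[OF b])
      then show False using step[OF b(2)] Ord_trans[OF al(1) b] by simp
    qed
  qed
  note * = this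
  show ?thesis by (rule that[OF al(1) al(2) al(3)], rule allI, rule *)
qed

text \<open>Sending a real to its least index makes every set of reals equinumerous with a subset of
  \<open>w\<close>, and such a subset has order type \<open>w\<close> or a countable one. Applied to
  all reals this gives a bijection with \<open>w\<close>, through which the uncountable sets are
  compared with the power set.\<close>

theorem CH_criterion:
  assumes w: "Ord w" "\<And>a. a \<epsilon> w \<Longrightarrow> cntbl (elts a)"
    and E: "Dfn (\<lambda>e. E (e 0) (e 1))" "\<And>a r r'. E a r \<Longrightarrow> E a r' \<Longrightarrow> r = r'"
    and onto: "\<And>r. sub r omg \<Longrightarrow> \<exists>a. a \<epsilon> w \<and> E a r"
  shows satisfies_CH
proof -
  define R where "R a r \<longleftrightarrow> a \<epsilon> w \<and> E a r \<and> (\<forall>b. b \<epsilon> a \<longrightarrow> \<not> E b r)" for a r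
  define m where "m r = (if \<exists>!a. R a r then THE a. R a r else emp)" for r
  have m: "DF m" unfolding m_def by (rule Dfn_the, unfold R_def, intro dfn Dfn_sub2[where P=E, OF E(1)])
  have Rm: "R (m r) r" if r: "sub r omg" for r
  proof -
    obtain a where a: "a \<epsilon> w" "E a r" using onto[OF r] by blast
    from Ord_least[OF Ord_mem[OF w(1) a(1)], of "\<lambda>a. a \<epsilon> w \<and> E a r", OF conjI[OF a]]
    have "\<exists>!b. Ord b \<and> (b \<epsilon> w \<and> E b r) \<and> (\<forall>c. c \<epsilon> b \<longrightarrow> \<not> (c \<epsilon> w \<and> E c r))" .
    moreover have "(Ord b \<and> (b \<epsilon> w \<and> E b r) \<and> (\<forall>c. c \<epsilon> b \<longrightarrow> \<not> (c \<epsilon> w \<and> E c r))) \<longleftrightarrow> R b r" for b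
      unfolding R_def using Ord_mem[OF w(1), of b] Ord_trans[OF w(1), of b] by blast
    ultimately have 1: "\<exists>!a. R a r" by simp
    have "m r = (THE a. R a r)" unfolding m_def by (rule if_P[OF 1])
    then show ?thesis using theI'[OF 1] by simp
  qed
  have dich: "cntbl X \<or> (\<exists>F. DF F \<and> bij_betw F X (elts w))" if X: "X \<subseteq> elts (pw omg)" "small X" for X
  proof -
    have Xs: "R (m r) r" if "r \<in> X" for r using X(1) that Rm by auto
    have inj: "inj_on m X"
    proof (rule inj_onI)
      fix r r' assume *: "r \<in> X" "r' \<in> X" "m r = m r'"
      have "E (m r) r" "E (m r) r'" using Xs[OF *(1)] Xs[OF *(2)] *(3) unfolding R_def by auto
      then show "r = r'" by (rule E(2))
    qed
    have sm: "small (m ` X)" by (rule small_image[OF X(2) m])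
    have sub: "m ` X \<subseteq> elts w" using Xs unfolding R_def by auto
    obtain al F where al: "Ord al" "DF F" "bij_betw F (elts al) (m ` X)" "\<forall>b. b \<epsilon> al \<longrightarrow> \<not> F b \<epsilon> b"
      by (rule increasing_enumeration[OF sm sub w(1)], rule that)
    have injF: "inj_on F (elts al)" using al(3) by (simp add: bij_betw_def)
    obtain H where H: "DF H" "\<forall>x\<in>elts al. H (F x) = x" by (rule DF_inverse[OF al(2) injF small_elts], rule that)
    have bijH: "bij_betw H (m ` X) (elts al)"
      by (rule bij_betw_left_inverse[OF al(3) H(2)])
    have bij: "bij_betw (\<lambda>x. H (m x)) X (elts al)"
      using bij_betw_trans[OF inj_on_imp_bij_betw[OF inj] bijH] by (simp add: comp_def)
    have D: "DF (\<lambda>x. H (m x))" by (rule DF_comp[OF H(1) m])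
    \<comment> \<open>At position \<open>w\<close> the increasing enumeration would take a value
      that is not below \<open>w\<close>.\<close>
    have "\<not> w \<epsilon> al"
    proof
      assume "w \<epsilon> al"
      then have "F w \<in> m ` X" "\<not> F w \<epsilon> w" using al(3,4) unfolding bij_betw_def by auto
      then show False using sub by auto
    qed
    then consider "al \<epsilon> w" | "al = w" using Ord_linear[OF al(1) w(1)] by blast
    then show ?thesis
    proof cases
      case 1
      have "cntbl X" by (rule cntbl_inj[OF w(2)[OF 1] D]) (use bij in \<open>auto simp: bij_betw_def\<close>)
      then show ?thesis ..
    next
      case 2
      then show ?thesis using bij D by (intro disjI2 exI conjI) simp_all
    qed
  qed
  obtain F0 where F0: "DF F0" "bij_betw F0 (elts (pw omg)) (elts w)"
    using dich[OF subset_refl small_elts] not_cntbl_power_omega by blast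
  have inj0: "inj_on F0 (elts (pw omg))" using F0(2) by (simp add: bij_betw_def)
  obtain H where H: "DF H" "\<forall>x\<in>elts (pw omg). H (F0 x) = x" by (rule DF_inverse[OF F0(1) inj0 small_elts], rule that)
  have bijH: "bij_betw H (elts w) (elts (pw omg))"
    by (rule bij_betw_left_inverse[OF F0(2) H(2)])
  show ?thesis unfolding satisfies_CH_def is_omega_iff is_power_iff
  proof (intro allI impI, elim conjE, hypsubst)
    fix x assume x: "sub x (pw omg)"
    then have "elts x \<subseteq> elts (pw omg)" by (auto simp: sub_def)
    from dich[OF this small_elts] show "is_countable x \<or> (\<exists>f. is_bij_map f x (pw omg))"
    proof
      assume "\<exists>F. DF F \<and> bij_betw F (elts x) (elts w)"
      then obtain F where F: "DF F" "bij_betw F (elts x) (elts w)" by (elim exE conjE)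
      have "bij_betw (\<lambda>y. H (F y)) (elts x) (elts (pw omg))"
        using bij_betw_trans[OF F(2) bijH] by (simp add: comp_def)
      then show ?thesis unfolding ex_is_bij_map using DF_comp[OF H(1) F(1)] by (intro disjI2 exI conjI)
    qed (simp add: is_countable_iff)
  qed
qed

text \<open>A bijection with a number may be taken from the universe: its graph is finite and hence
  an element of the model.\<close>

lemma is_finite_iff: "is_finite a \<longleftrightarrow> finite (elts a)"
proof
  assume "is_finite a"
  then obtain n f where "is_bij_map f a (num n)" unfolding is_finite_def is_omega_iff by (auto simp: mem_omg)
  then obtain F where "bij_betw F (elts a) (elts (num n))" using ex_is_bij_map[of a "num n"] by auto
  then show "finite (elts a)" using bij_betw_finite elts_num by (metis finite_imageI finite_lessThan)
next
  assume fin: "finite (elts a)"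
  obtain h where h: "bij_betw h (elts a) {..<card (elts a)}"
    using ex_bij_betw_finite_nat[OF fin] by (auto simp: lessThan_atLeast0)
  define f where "f = mk ((\<lambda>x. opr x (num (h x))) ` elts a)"
  have f: "p \<epsilon> f \<longleftrightarrow> (\<exists>x. x \<epsilon> a \<and> p = opr x (num (h x)))" for p
    unfolding f_def by (subst mem_mk[OF small_finite]) (use fin in auto)
  have r: "related f x y \<longleftrightarrow> x \<epsilon> a \<and> y = num (h x)" for x y unfolding related_iff f by auto
  have inj: "x = y" if "x \<epsilon> a" "y \<epsilon> a" "h x = h y" for x y
    using h that unfolding bij_betw_def inj_on_def by auto
  have im: "h ` elts a = {..<card (elts a)}" using h by (simp add: bij_betw_def)
  have hl: "h x < card (elts a)" if "x \<epsilon> a" for x using im that by auto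
  have surj: "\<exists>x. x \<epsilon> a \<and> y = num (h x)" if y: "y \<epsilon> num (card (elts a))" for y
  proof -
    obtain k where "y = num k" "k < card (elts a)" using y by (auto simp: mem_elts[OF elts_num])
    then show ?thesis using im by (metis imageE in_elts lessThan_iff)
  qed
  have "is_bij_map f a (num (card (elts a)))"
    unfolding is_bij_map_def is_inj_map_def is_map_def r is_opair_iff f
    using hl inj surj by (intro conjI allI impI) auto
  then show "is_finite a" unfolding is_finite_def is_omega_iff using mem_omg by blast
qed

end

section \<open>Forcing the continuum hypothesis\<close>

context forcing
begin

lemma Fmem_cong:
  assumes x: "Feq p x x'" and y: "Feq p y y'" and xy: "Fmem p x y" shows "Fmem p x' y'"
  unfolding Fmem_def
proof (intro conjI ballI impI)
  show p: "p \<in> P" by (rule Feq_P[OF x])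
  fix q assume q: "q \<in> P" "q \<sqsubseteq> p"
  obtain r u v where r: "r \<in> P" "r \<sqsubseteq> q" "opr u v \<epsilon> y" "v \<in> P" "r \<sqsubseteq> v" "Feq r x u"
    using xy q unfolding Fmem_def by blast
  have rp: "r \<sqsubseteq> p" by (rule le_trans[OF r(2) q(2)])
  obtain r' u' v' where r': "r' \<in> P" "r' \<sqsubseteq> r" "v' \<in> P" "opr u' v' \<epsilon> y'" "r' \<sqsubseteq> v'" "Feq r' u u'"
    using Feq_D1[OF y r(3,4,1) rp r(5)] by blast
  have "Feq r' x' x" by (rule Feq_sym[OF Feq_mono[OF x r'(1) le_trans[OF r'(2) rp]]])
  from Feq_trans[OF Feq_trans[OF this Feq_mono[OF r(6) r'(1,2)]] r'(6)] have "Feq r' x' u'" .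
  then show "\<exists>r\<in>P. r \<sqsubseteq> q \<and> (\<exists>u v. opr u v \<epsilon> y' \<and> v \<in> P \<and> r \<sqsubseteq> v \<and> Feq r x' u)"
    using r' le_trans[OF r'(2) r(2)] by blast
qed

text \<open>Infinitely many names with pairwise different values, for the natural numbers.\<close>

primrec num_name :: "nat \<Rightarrow> 'a set" where
  "num_name 0 = {}"
| "num_name (Suc k) = insert (opr (mk (num_name k)) one) (num_name k)"

lemma num_name: "num_name k = (\<lambda>j. opr (mk (num_name j)) one) ` {..<k}"
  by (induction k) (auto simp: lessThan_Suc)

lemma mem_num_name: "p \<epsilon> mk (num_name k) \<longleftrightarrow> (\<exists>j<k. p = opr (mk (num_name j)) one)"
proof -
  have "finite (num_name k)" by (subst num_name) simp
  then have "p \<epsilon> mk (num_name k) \<longleftrightarrow> p \<in> num_name k" by (intro mem_mk small_finite)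
  then show ?thesis by (subst (asm) (2) num_name) auto
qed

lemma num_name_neq: "p \<in> P \<Longrightarrow> i < j \<Longrightarrow> \<not> Feq p (mk (num_name i)) (mk (num_name j))"
proof (induction i arbitrary: j p rule: less_induct)
  case (less i)
  show ?case
  proof
    assume eq: "Feq p (mk (num_name i)) (mk (num_name j))"
    have "opr (mk (num_name i)) one \<epsilon> mk (num_name j)" unfolding mem_num_name using less.prems by blast
    from Feq_D2[OF eq this one(1) less.prems(1) le_refl[OF less.prems(1)] one(2)[OF less.prems(1)]]
    obtain r t s where r: "r \<in> P" "opr t s \<epsilon> mk (num_name i)" "Feq r t (mk (num_name i))" by blast
    then obtain l where "l < i" "t = mk (num_name l)" unfolding mem_num_name by auto
    then show False using less.IH[OF _ r(1), of l i] r(3) by simp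
  qed
qed

end

text \<open>The elements of the model are themselves numbers, so stage n of the descending sequence
  can enter the set of conditions named by the element n. A definable dense class cuts out a set of
  conditions by separation, and is met at the stage which is that set.\<close>

theorem ex_generic:
  fixes mem :: "nat \<Rightarrow> nat \<Rightarrow> bool"
  assumes "forcing mem P le one"
  shows "\<exists>G (val :: nat \<Rightarrow> nat) memN. generic mem P le one G val memN"
proof -
  interpret forcing mem P le one by (rule assms)
  define f where "f = rec_nat one (\<lambda>n p. if \<exists>q. q \<in> P \<and> le q p \<and> mem q n then SOME q. q \<in> P \<and> le q p \<and> mem q n else p)"
  have f0: "f 0 = one" by (simp add: f_def)
  have fS: "f (Suc n) = (if \<exists>q. q \<in> P \<and> le q (f n) \<and> mem q n then SOME q. q \<in> P \<and> le q (f n) \<and> mem q n else f n)" for n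
    unfolding f_def nat.rec(2) ..
  have fS': "f (Suc n) \<in> P \<and> le (f (Suc n)) (f n)" if "f n \<in> P" for n
  proof (cases "\<exists>q. q \<in> P \<and> le q (f n) \<and> mem q n")
    case True
    from someI_ex[OF this] show ?thesis unfolding fS if_P[OF True] by blast
  next
    case False
    then show ?thesis unfolding fS if_not_P[OF False] using that le_refl by blast
  qed
  have fP: "f n \<in> P" for n by (induction n) (use f0 one(1) fS' in auto)
  have f_le: "le (f (n + k)) (f n)" for n k
    by (induction k) (use le_refl[OF fP] fS'[OF fP] le_trans in \<open>auto intro: le_trans\<close>)
  define G where "G = {q \<in> P. \<exists>n. le (f n) q}"
  have fG: "f n \<in> G" for n using fP le_refl[OF fP] by (auto simp: G_def)
  have GP: "p \<in> G \<Longrightarrow> p \<in> P" for p by (simp add: G_def)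
  have oneG: "one \<in> G" using fG[of 0] by (simp add: f0)
  have up: "p \<in> G \<Longrightarrow> le p q \<Longrightarrow> q \<in> P \<Longrightarrow> q \<in> G" for p q
    unfolding G_def using le_trans by blast
  have dir: "\<exists>r\<in>G. le r p \<and> le r q" if pq: "p \<in> G" "q \<in> G" for p q
  proof -
    obtain n m where "le (f n) p" "le (f m) q" using pq by (auto simp: G_def)
    then have "le (f (n + m)) p" "le (f (m + n)) q" using f_le le_trans by blast+
    then show ?thesis using fG[of "n + m"] by (auto simp: add.commute)
  qed
  have gen: "\<exists>p\<in>G. D p" if D: "Dfn (\<lambda>e. D (e 0))" and dense: "\<And>p. p \<in> P \<Longrightarrow> \<exists>q\<in>P. le q p \<and> D q" for D
  proof -
    have "small {p \<in> P. D p}" by (rule small_sep[OF P_small D])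
    then obtain d where "elts d = {p \<in> P. D p}" unfolding small_def ..
    then have d: "mem q d \<longleftrightarrow> q \<in> P \<and> D q" for q using mem_elts by auto
    have ex: "\<exists>q. q \<in> P \<and> le q (f d) \<and> mem q d" using dense[OF fP[of d]] d by blast
    have "mem (f (Suc d)) d" using someI_ex[OF ex] unfolding fS if_P[OF ex] by blast
    then show ?thesis using fG d by blast
  qed
  define R where "R = {(x, y). \<exists>p\<in>G. Feq p x y}"
  have R: "equiv UNIV R"
  proof (rule equivI)
    show "refl R" unfolding R_def refl_on_def using oneG Feq_refl[OF one(1)] by blast
    show "sym R" unfolding R_def sym_def using Feq_sym by blast
    show "trans R" unfolding R_def
    proof (rule transI, clarsimp)
      fix x y z p q assume *: "p \<in> G" "Feq p x y" "q \<in> G" "Feq q y z"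
      obtain r where r: "r \<in> G" "le r p" "le r q" using dir[OF *(1,3)] by blast
      then show "\<exists>p\<in>G. Feq p x z"
        using Feq_trans[OF Feq_mono[OF *(2) GP[OF r(1)] r(2)] Feq_mono[OF *(4) GP[OF r(1)] r(3)]] by blast
    qed
  qed simp
  define C where "C = range (\<lambda>x. R `` {x})"
  have cls: "R `` {x} = R `` {y} \<longleftrightarrow> (\<exists>p\<in>G. Feq p x y)" for x y
    using eq_equiv_class_iff[OF R, of x y] by (simp add: R_def)
  have "inj (\<lambda>k. R `` {mk (num_name k)})"
  proof (rule injI)
    fix i j assume *: "R `` {mk (num_name i)} = R `` {mk (num_name j)}"
    obtain p where p: "p \<in> G" "Feq p (mk (num_name i)) (mk (num_name j))" using * unfolding cls by blast
    have "\<not> i < j" using num_name_neq[OF GP[OF p(1)]] p(2) by blast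
    moreover have "\<not> j < i" using num_name_neq[OF GP[OF p(1)]] Feq_sym[OF p(2)] by blast
    ultimately show "i = j" by simp
  qed
  \<comment> \<open>Countable models are required to have all of \<open>nat\<close> as their
    universe; the classes of names can be renumbered bijectively because there are infinitely many
    of them.\<close>
  then have "infinite (range (\<lambda>k. R `` {mk (num_name k)}))" by (rule range_inj_infinite)
  moreover have "range (\<lambda>k. R `` {mk (num_name k)}) \<subseteq> C" unfolding C_def by auto
  ultimately have "infinite C" using finite_subset by blast
  moreover have "countable C" unfolding C_def by simp
  ultimately obtain g :: "nat set \<Rightarrow> nat" where g: "bij_betw g C UNIV" using countableE_infinite by blast
  define val where "val x = g (R `` {x})" for x
  define memN where "memN a b \<longleftrightarrow> (\<exists>x y. a = val x \<and> b = val y \<and> (\<exists>p\<in>G. Fmem p x y))" for a b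
  have val_eq: "val x = val y \<longleftrightarrow> (\<exists>p\<in>G. Feq p x y)" for x y
    unfolding val_def cls[symmetric] using g by (auto simp: bij_betw_def inj_on_def C_def)
  have "surj val"
  proof -
    have "range val = g ` C" unfolding val_def C_def by auto
    then show ?thesis using g by (simp add: bij_betw_def)
  qed
  have memN: "memN (val x) (val y) \<longleftrightarrow> (\<exists>p\<in>G. Fmem p x y)" for x y
  proof
    assume "memN (val x) (val y)"
    then obtain x' y' p where *: "val x' = val x" "val y' = val y" "p \<in> G" "Fmem p x' y'"
      unfolding memN_def by metis
    obtain q where q: "q \<in> G" "Feq q x' x" using *(1) val_eq by blast
    obtain r where r: "r \<in> G" "Feq r y' y" using *(2) val_eq by blast
    obtain s where s: "s \<in> G" "le s p" "le s q" using dir[OF *(3) q(1)] by blast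
    obtain t where t: "t \<in> G" "le t s" "le t r" using dir[OF s(1) r(1)] by blast
    have "Fmem t x y"
      by (rule Fmem_cong[OF Feq_mono[OF q(2) GP[OF t(1)] le_trans[OF t(2) s(3)]] Feq_mono[OF r(2) GP[OF t(1)] t(3)]
          Fmem_mono[OF *(4) GP[OF t(1)] le_trans[OF t(2) s(2)]]])
    then show "\<exists>p\<in>G. Fmem p x y" using t(1) by blast
  qed (unfold memN_def, blast)
  have "generic mem P le one G val memN"
    by (unfold_locales) (fact GP oneG up dir gen \<open>surj val\<close> val_eq memN)+
  then show ?thesis by blast
qed

section \<open>Codes, ordinals, countability and reals of the ground model in the extension\<close>

context generic
begin

lemma ck_upr: "ck (upr x y) = N.upr (ck x) (ck y)"
  unfolding N.eq_iff_mem[of "ck (upr x y)"] mem_ck mem_upr N.mem_upr by blast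

lemma ck_opr: "ck (opr x y) = N.opr (ck x) (ck y)"
  unfolding opr_def N.opr_def ck_upr ..

lemma ck_emp: "ck emp = N.emp"
  unfolding N.eq_iff_mem[of "ck emp"] mem_ck by simp

lemma ck_num: "ck (num n) = N.num n"
proof (induction n)
  case (Suc n)
  show ?case unfolding num.simps N.num.simps N.eq_iff_mem[of "ck (suc (num n))"] mem_ck mem_suc N.mem_suc Suc[symmetric]
    by blast
qed (simp add: ck_emp)

lemma ck_represents:
  assumes "represents R l" shows "N.represents R (ck l)"
proof -
  have l: "p \<epsilon> l \<longleftrightarrow> (\<exists>m n. (m, n) \<in> R \<and> p = opr (num m) (num n))" for p
    using assms unfolding represents_def is_numeral_iff is_opair_iff by simp
  have e: "(\<exists>y. (\<exists>m n. (m, n) \<in> R \<and> y = opr (num m) (num n)) \<and> p = ck y) \<longleftrightarrow>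
      (\<exists>m n. (m, n) \<in> R \<and> p = ck (opr (num m) (num n)))" for p by blast
  show ?thesis unfolding N.represents_def N.is_numeral_iff N.is_opair_iff mem_ck l e ck_opr ck_num by simp
qed

lemma N_Ord:
  assumes a: "Ord a" shows "N.Ord (ck a)"
  unfolding N.Ord_def
proof (intro conjI allI impI; elim conjE)
  fix x y assume "memN x (ck a)" "memN y x"
  then obtain x' y' where "x' \<epsilon> a" "y' \<epsilon> x'" "y = ck y'" unfolding mem_ck by auto (auto simp: mem_ck)
  then show "memN y (ck a)" unfolding mem_ck using Ord_trans[OF a] by blast
next
  fix x y z assume "memN x (ck a)" "memN y x" "memN z y"
  then obtain x' where x: "x' \<epsilon> a" "x = ck x'" unfolding mem_ck by blast
  obtain y' where y: "y' \<epsilon> x'" "y = ck y'" using \<open>memN y x\<close> unfolding x(2) mem_ck by blast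
  obtain z' where z: "z' \<epsilon> y'" "z = ck z'" using \<open>memN z y\<close> unfolding y(2) mem_ck by blast
  show "memN z x" unfolding x(2) z(2) mem_ck using Ord_trans[OF Ord_mem[OF a x(1)] y(1) z(1)] by blast
qed

lemma N_cntbl:
  assumes "cntbl (elts a)" shows "N.cntbl (N.elts (ck a))"
proof -
  obtain J where J: "DF J" "inj_on J (elts a)" "J ` elts a \<subseteq> range num"
    using assms unfolding cntbl_def by (elim exE conjE)
  define j where "j = ck (lam (elts a) J)"
  have j: "memN p j \<longleftrightarrow> (\<exists>x. x \<epsilon> a \<and> p = N.opr (ck x) (ck (J x)))" for p
    unfolding j_def mem_ck mem_lam[OF small_lam[OF small_elts J(1)]] by (auto simp: ck_opr[symmetric])
  have app: "N.app j (ck x) = ck (J x)" if x: "x \<epsilon> a" for x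
    by (rule N.app_eq) (use x in \<open>auto simp: j\<close>)
  have "inj_on (N.app j) (N.elts (ck a))"
  proof (rule inj_onI)
    fix u v assume *: "u \<in> N.elts (ck a)" "v \<in> N.elts (ck a)" "N.app j u = N.app j v"
    then obtain x y where x: "x \<epsilon> a" "u = ck x" and y: "y \<epsilon> a" "v = ck y" by (auto simp: mem_ck)
    have "J x = J y" using *(3) unfolding x(2) y(2) app[OF x(1)] app[OF y(1)] by simp
    then have "x = y" by (rule inj_onD[OF J(2)]) (simp_all add: x y)
    then show "u = v" by (simp add: x y)
  qed
  moreover have "N.app j ` N.elts (ck a) \<subseteq> range N.num"
  proof (rule image_subsetI)
    fix u assume "u \<in> N.elts (ck a)"
    then obtain x where x: "x \<epsilon> a" "u = ck x" by (auto simp: mem_ck)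
    have "J x \<in> range num" using J(3) x(1) unfolding image_subset_iff by simp
    then obtain n where "J x = num n" by (elim rangeE)
    then show "N.app j u \<in> range N.num" unfolding x(2) app[OF x(1)] by (simp add: ck_num)
  qed
  ultimately show ?thesis unfolding N.cntbl_def using N.DF_app by (intro exI conjI)
qed

lemma Rl_N_Rl: "X \<in> Rl \<Longrightarrow> X \<in> N.Rl \<and> ck (st X) = N.st X"
proof -
  assume X: "X \<in> Rl"
  have "N.elts (ck (st X)) = N.num ` X"
    using mem_st[OF X] by (auto simp: mem_ck ck_num[symmetric])
  from N.mkI[OF this] this show ?thesis unfolding N.Rl_def N.st_def mem_Collect_eq N.small_def by simp blast
qed

end

text \<open>The conditions are countable partial functions from \<open>\<omega>\<^sub>1\<close> to the reals, presented by an enumeration: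
  this makes the lower bound of a descending sequence explicit.\<close>

locale collapse = zfc_model +
  fixes w
  assumes w_Ord: "Ord w" and w_unc: "\<not> cntbl (elts w)" and w_cntbl: "\<And>a. a \<epsilon> w \<Longrightarrow> cntbl (elts a)"
begin

definition Q :: "'a set" where "Q = {opr a r | a r. a \<in> elts w \<and> r \<in> elts (pw omg)}"

definition bound :: "'a set" where "bound = {opr n x | n x. n \<in> elts omg \<and> x \<in> Q}"

definition Cond :: "'a set" where
  "Cond = {h \<in> {h. elts h \<subseteq> bound}.
     (\<forall>n x y. opr (num n) x \<epsilon> h \<and> opr (num n) y \<epsilon> h \<longrightarrow> x = y) \<and>
     (\<forall>n m a r s. opr (num n) (opr a r) \<epsilon> h \<and> opr (num m) (opr a s) \<epsilon> h \<longrightarrow> r = s)}"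

text \<open>Only the listed pairs are compared and not their indices, so a condition may be
  renumbered when it is enlarged.\<close>

definition ext :: "'a \<Rightarrow> 'a \<Rightarrow> bool" where
  "ext q p \<longleftrightarrow> (\<forall>n x. opr (num n) x \<epsilon> p \<longrightarrow> (\<exists>m. opr (num m) x \<epsilon> q))"

lemma small_Q: "small Q" unfolding Q_def by (intro small_Times small_elts)

lemma small_bound: "small bound" unfolding bound_def by (intro small_Times small_elts small_Q)

lemma small_Cond: "small Cond"
  unfolding Cond_def by (rule small_sep[OF small_Pow[OF small_bound]], intro dfn)

lemma ext_trans: "ext q p \<Longrightarrow> ext p r \<Longrightarrow> ext q r"
  unfolding ext_def by metis

sublocale forcing mem Cond ext emp
proof unfold_locales
  show "small Cond" by (rule small_Cond)
  show "Dfn (\<lambda>e. ext (e 0) (e 1))" unfolding ext_def by (intro dfn)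
  show "ext p p" if "p \<in> Cond" for p unfolding ext_def by metis
  show "ext p r" if "ext p q" "ext q r" for p q r using that by (rule ext_trans)
  show "emp \<in> Cond" unfolding Cond_def by simp
  show "ext p emp" if "p \<in> Cond" for p unfolding ext_def by simp
qed

lemma Cond_I:
  assumes "\<And>p. p \<epsilon> h \<Longrightarrow> p \<in> bound" "\<And>n x y. opr (num n) x \<epsilon> h \<Longrightarrow> opr (num n) y \<epsilon> h \<Longrightarrow> x = y"
    "\<And>n m a r s. opr (num n) (opr a r) \<epsilon> h \<Longrightarrow> opr (num m) (opr a s) \<epsilon> h \<Longrightarrow> r = s"
  shows "h \<in> Cond"
  unfolding Cond_def
proof (intro CollectI conjI allI impI; (elim conjE)?)
  show "elts h \<subseteq> bound" using assms(1) by auto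
qed (rule assms; assumption)+

lemma Cond_D:
  assumes "h \<in> Cond"
  shows "p \<epsilon> h \<Longrightarrow> p \<in> bound" "opr (num n) x \<epsilon> h \<Longrightarrow> opr (num n) y \<epsilon> h \<Longrightarrow> x = y"
    "opr (num n) (opr a r) \<epsilon> h \<Longrightarrow> opr (num m) (opr a s) \<epsilon> h \<Longrightarrow> r = s"
  using assms unfolding Cond_def by (fastforce, blast, blast)

lemma boundE:
  assumes "p \<in> bound" obtains n a r where "p = opr (num n) (opr a r)" "a \<epsilon> w" "sub r omg"
  using assms unfolding bound_def Q_def by (auto simp: mem_omg)

lemma bound_iff: "opr x (opr a r) \<in> bound \<longleftrightarrow> x \<epsilon> omg \<and> a \<epsilon> w \<and> sub r omg"
  unfolding bound_def Q_def by (auto simp: mem_omg)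

text \<open>Density of the conditions that have \<open>r\<close> as a value. A free argument exists
  because a condition is countable and \<open>w\<close> is not.\<close>

lemma Cond_add:
  assumes h: "h \<in> Cond" and r: "sub r omg"
  shows "\<exists>k\<in>Cond. ext k h \<and> (\<exists>n a. opr (num n) (opr a r) \<epsilon> k)"
proof -
  have "\<exists>a. a \<epsilon> w \<and> (\<forall>n s. \<not> opr (num n) (opr a s) \<epsilon> h)"
  proof (rule ccontr)
    assume "\<not> (\<exists>a. a \<epsilon> w \<and> (\<forall>n s. \<not> opr (num n) (opr a s) \<epsilon> h))"
    then have ex: "\<exists>n s. opr (num n) (opr a s) \<epsilon> h" if "a \<epsilon> w" for a using that by blast
    \<comment> \<open>If every argument below \<open>w\<close> were listed, its first index would be
      an injection of \<open>w\<close> into the natural numbers.\<close>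
    define J where "J a = num (LEAST n. \<exists>s. opr (num n) (opr a s) \<epsilon> h)" for a
    have J: "DF J" unfolding J_def by (intro dfn)
    have J1: "\<exists>s. opr (J a) (opr a s) \<epsilon> h" if "a \<epsilon> w" for a
      unfolding J_def using LeastI_ex[OF ex[OF that]] .
    have "inj_on J (elts w)"
    proof (rule inj_onI)
      fix a b assume ab: "a \<in> elts w" "b \<in> elts w" "J a = J b"
      obtain s where s: "opr (J a) (opr a s) \<epsilon> h" using J1[of a] ab by auto
      obtain t where t: "opr (J a) (opr b t) \<epsilon> h" using J1[of b] ab by auto
      have "opr a s = opr b t" by (rule Cond_D(2)[OF h s[unfolded J_def] t[unfolded J_def]])
      then show "a = b" by simp
    qed
    then have "cntbl (elts w)" unfolding cntbl_def using J by (intro exI[of _ J] conjI) (auto simp: J_def)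
    then show False using w_unc by simp
  qed
  then obtain a where a: "a \<epsilon> w" "\<And>n s. \<not> opr (num n) (opr a s) \<epsilon> h" by blast
  \<comment> \<open>The indices of \<open>h\<close> are shifted by one to free the index 0 for the
    new pair.\<close>
  define K where "K = {p \<in> bound. p = opr (num 0) (opr a r) \<or> (\<exists>n x. p = opr (num (Suc n)) x \<and> opr (num n) x \<epsilon> h)}"
  have K: "small K" unfolding K_def by (rule small_sep[OF small_bound]) (intro dfn)
  have mK: "opr (num n) (opr b s) \<epsilon> mk K \<longleftrightarrow>
      n = 0 \<and> b = a \<and> s = r \<or> (\<exists>k. n = Suc k \<and> opr (num k) (opr b s) \<epsilon> h)" for n b s
  proof -
    have "opr (num n) (opr b s) \<in> bound" if "opr (num k) (opr b s) \<epsilon> h" for k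
      using Cond_D(1)[OF h that] by (simp add: bound_iff mem_omg)
    moreover have "opr (num 0) (opr a r) \<in> bound" unfolding bound_iff mem_omg using a(1) r by blast
    moreover have "num n = num 0 \<longleftrightarrow> n = 0" "num n = num (Suc k) \<longleftrightarrow> n = Suc k" for k by (rule num_eq)+
    ultimately show ?thesis unfolding mem_mk[OF K] unfolding K_def mem_Collect_eq opr_eq by auto
  qed
  have mKb: "p \<in> bound" if "p \<epsilon> mk K" for p using that unfolding mem_mk[OF K] by (simp add: K_def)
  have "mk K \<in> Cond"
  proof (rule Cond_I[OF mKb])
    fix n x y assume *: "opr (num n) x \<epsilon> mk K" "opr (num n) y \<epsilon> mk K"
    obtain b s where x: "x = opr b s" using mKb[OF *(1)] by (elim boundE) auto
    obtain c t where y: "y = opr c t" using mKb[OF *(2)] by (elim boundE) auto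
    show "x = y" using * Cond_D(2)[OF h, of _ "opr b s" "opr c t"] unfolding x y mK by auto
  next
    fix n m b s t assume "opr (num n) (opr b s) \<epsilon> mk K" "opr (num m) (opr b t) \<epsilon> mk K"
    then show "s = t" unfolding mK using a(2) Cond_D(3)[OF h, of _ b s _ t] by auto
  qed
  moreover have "ext (mk K) h" unfolding ext_def
  proof (intro allI impI)
    fix n x assume nx: "opr (num n) x \<epsilon> h"
    then obtain b s where x: "x = opr b s" using Cond_D(1)[OF h nx] by (elim boundE) auto
    show "\<exists>m. opr (num m) x \<epsilon> mk K" using nx unfolding x mK by auto
  qed
  moreover have "opr (num 0) (opr a r) \<epsilon> mk K" unfolding mK by simp
  ultimately show ?thesis by blast
qed

lemma Cond_closed:
  assumes F: "\<And>t. NTrm t \<Longrightarrow> Trm (\<lambda>e. F (t e))" and FC: "\<And>n. F n \<in> Cond" and Fd: "\<And>n. ext (F (Suc n)) (F n)"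
  shows "\<exists>q\<in>Cond. \<forall>n. ext q (F n)"
proof -
  \<comment> \<open>Index (n, m) of the lower bound lists entry m of the n-th condition.\<close>
  define K where "K = {p \<in> bound. \<exists>n m x. p = opr (num (prod_encode (n, m))) x \<and> opr (num m) x \<epsilon> F n}"
  have K: "small K" unfolding K_def by (rule small_sep[OF small_bound]) (intro dfn F)
  have mK: "opr (num k) x \<epsilon> mk K \<longleftrightarrow> (\<exists>n m. k = prod_encode (n, m) \<and> opr (num m) x \<epsilon> F n)" for k x
  proof -
    have "opr (num k) x \<in> bound" if mx: "opr (num m) x \<epsilon> F n" for m n
    proof -
      obtain b s where x: "x = opr b s" using Cond_D(1)[OF FC mx] by (elim boundE) auto
      show ?thesis using Cond_D(1)[OF FC mx] unfolding x bound_iff mem_omg by simp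
    qed
    then show ?thesis unfolding mem_mk[OF K] unfolding K_def by auto
  qed
  have mKb: "p \<in> bound" if "p \<epsilon> mk K" for p using that unfolding mem_mk[OF K] by (simp add: K_def)
  have Fle: "ext (F (n + k)) (F n)" for n k
  proof (induction k)
    case 0 show ?case unfolding ext_def by auto
  next
    case (Suc k) then show ?case using ext_trans[OF Fd] by simp
  qed
  have "mk K \<in> Cond"
  proof (rule Cond_I[OF mKb])
    fix n x y assume "opr (num n) x \<epsilon> mk K" "opr (num n) y \<epsilon> mk K"
    then obtain i j where "opr (num j) x \<epsilon> F i" "opr (num j) y \<epsilon> F i" unfolding mK by auto
    then show "x = y" by (rule Cond_D(2)[OF FC])
  next
    fix n m b s t assume "opr (num n) (opr b s) \<epsilon> mk K" "opr (num m) (opr b t) \<epsilon> mk K"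
    then obtain i j i' j' where *: "opr (num j) (opr b s) \<epsilon> F i" "opr (num j') (opr b t) \<epsilon> F i'" unfolding mK by blast
    obtain k where k: "opr (num k) (opr b s) \<epsilon> F (i + i')" using Fle[of i i'] *(1) unfolding ext_def by blast
    obtain k' where k': "opr (num k') (opr b t) \<epsilon> F (i + i')"
      using Fle[of i' i] *(2) unfolding ext_def by (metis add.commute)
    show "s = t" by (rule Cond_D(3)[OF FC k k'])
  qed
  moreover have "ext (mk K) (F n)" for n unfolding ext_def mK by auto
  ultimately show ?thesis by blast
qed

end

locale collapse_extension = collapse +
  fixes G and val :: "'a \<Rightarrow> 'n" and memN
  assumes gen: "generic mem Cond ext emp G val memN"
begin

sublocale generic mem Cond ext emp G val memN by (rule gen)

lemma N_Rl: "N.Rl = Rl"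
proof
  show "Rl \<subseteq> N.Rl" using Rl_N_Rl by blast
  show "N.Rl \<subseteq> Rl"
  proof
    fix X assume X: "X \<in> N.Rl"
    obtain \<tau> where \<tau>: "N.st X = val \<tau>" by (rule valE)
    \<comment> \<open>\<open>q\<close> decides the whole set named by \<open>\<tau>\<close> to be a
      real \<open>Y\<close> of the ground model. Density: decide the numbers one after the other and
      take a lower bound.\<close>
    define D where "D q \<longleftrightarrow> (\<exists>Y\<in>Rl. \<forall>n. (n \<in> Y \<longrightarrow> Fmem q (chk (num n)) \<tau>) \<and>
        (n \<notin> Y \<longrightarrow> (\<forall>s\<in>Cond. ext s q \<longrightarrow> \<not> Fmem s (chk (num n)) \<tau>)))" for q
    have "\<exists>q\<in>G. D q"
    proof (rule G_generic)
      show "Dfn (\<lambda>e. D (e 0))" unfolding D_def by (intro dfn)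
      fix p assume p: "p \<in> Cond"
      define R where "R n x y \<longleftrightarrow> ext y x \<and> (Fmem y (chk (num n)) \<tau> \<or> (\<forall>s\<in>Cond. ext s y \<longrightarrow> \<not> Fmem s (chk (num n)) \<tau>))" for n x y
      have RD: "Dfn (\<lambda>e. R (nm (e 0)) (e 1) (e 2))" unfolding R_def by (intro dfn)
      have ex: "\<exists>y\<in>Cond. R n x y" if x: "x \<in> Cond" for n x
      proof (cases "\<exists>s\<in>Cond. ext s x \<and> Fmem s (chk (num n)) \<tau>")
        case True
        then show ?thesis unfolding R_def by blast
      next
        case False
        then show ?thesis using x le_refl[OF x] unfolding R_def by blast
      qed
      obtain F where F: "F 0 = p" "\<And>n. F n \<in> Cond" "\<And>n. R n (F n) (F (Suc n))" "\<And>t. NTrm t \<Longrightarrow> Trm (\<lambda>e. F (t e))"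
        by (rule dependent_choice[OF small_Cond RD p ex]) blast+
      have "ext (F (Suc n)) (F n)" for n using F(3)[of n] unfolding R_def by blast
      from Cond_closed[of F, OF F(4) F(2) this]
      obtain q where q: "q \<in> Cond" "\<And>n. ext q (F n)" by blast
      define Y where "Y = {n. Fmem q (chk (num n)) \<tau>}"
      have Y: "Y \<in> Rl" unfolding Y_def by (rule Rl_I, intro dfn)
      have "\<not> Fmem s (chk (num n)) \<tau>" if n: "n \<notin> Y" and s: "s \<in> Cond" "ext s q" for n s
      proof -
        have "\<not> Fmem (F (Suc n)) (chk (num n)) \<tau>" using n Fmem_mono[OF _ q(1) q(2)[of "Suc n"]] unfolding Y_def by blast
        then have "\<forall>s\<in>Cond. ext s (F (Suc n)) \<longrightarrow> \<not> Fmem s (chk (num n)) \<tau>" using F(3)[of n] unfolding R_def by blast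
        then show ?thesis using s ext_trans[OF s(2) q(2)] by blast
      qed
      then have "D q" unfolding D_def using Y by (intro bexI[of _ Y]) (auto simp: Y_def)
      then show "\<exists>q\<in>Cond. ext q p \<and> D q" using q(1) q(2)[of 0] unfolding F(1) by blast
    qed
    then obtain q Y where q: "q \<in> G" "Y \<in> Rl" "\<And>n. n \<in> Y \<Longrightarrow> Fmem q (chk (num n)) \<tau>"
       "\<And>n s. n \<notin> Y \<Longrightarrow> s \<in> Cond \<Longrightarrow> ext s q \<Longrightarrow> \<not> Fmem s (chk (num n)) \<tau>" unfolding D_def by blast
    have X_iff: "n \<in> X \<longleftrightarrow> (\<exists>p\<in>G. Fmem p (chk (num n)) \<tau>)" for n
    proof -
      have "n \<in> X \<longleftrightarrow> memN (N.num n) (N.st X)" using N.mem_st[OF X] by auto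
      then show ?thesis unfolding \<tau> ck_num[symmetric] ck_def memN_val .
    qed
    have "n \<in> X \<longleftrightarrow> n \<in> Y" for n
    proof
      assume "n \<in> X"
      then obtain p where p: "p \<in> G" "Fmem p (chk (num n)) \<tau>" unfolding X_iff by blast
      obtain r where r: "r \<in> G" "ext r p" "ext r q" using G_dir[OF p(1) q(1)] by blast
      show "n \<in> Y"
      proof (rule ccontr)
        assume "n \<notin> Y"
        from q(4)[OF this G_P[OF r(1)] r(3)] Fmem_mono[OF p(2) G_P[OF r(1)] r(2)] show False by blast
      qed
    next
      assume "n \<in> Y"
      then show "n \<in> X" unfolding X_iff using q(1,3) by blast
    qed
    then have "X = Y" by blast
    then show "X \<in> Rl" using q(2) by simp
  qed
qed

theorem N_CH: "N.satisfies_CH"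
proof -
  \<comment> \<open>A name for the union of the generic conditions, a partial function from
    \<open>w\<close> onto the reals of the ground model, which are all the reals of the
    extension.\<close>
  define B where "B = {p. \<exists>x h. p = opr (chk x) h \<and> x \<in> Q \<and> h \<in> Cond \<and> (\<exists>n. opr (num n) x \<epsilon> h)}"
  have "small (chk ` Q)" by (rule small_image[OF small_Q], intro dfn)
  from small_Times[OF this small_Cond] have B: "small B"
  proof (rule small_subset)
    show "B \<subseteq> {opr x y |x y. x \<in> chk ` Q \<and> y \<in> Cond}" unfolding B_def by blast
    show "Dfn (\<lambda>e. e 0 \<in> B)" unfolding B_def mem_Collect_eq by (intro dfn Dfn_small[OF small_Q])
  qed
  define g where "g = val (mk B)"
  have g: "memN z g \<longleftrightarrow> (\<exists>x h n. x \<in> Q \<and> h \<in> G \<and> opr (num n) x \<epsilon> h \<and> z = ck x)" for z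
  proof -
    obtain z' where z: "z = val z'" by (rule valE)
    have "opr u h \<epsilon> mk B \<longleftrightarrow> (\<exists>x. u = chk x \<and> x \<in> Q \<and> h \<in> Cond \<and> (\<exists>n. opr (num n) x \<epsilon> h))" for u h
      unfolding mem_mk[OF B] unfolding B_def by auto
    note m = this
    show ?thesis unfolding z g_def memN_iff ck_def m using G_P by blast
  qed
  show ?thesis
  proof (rule N.CH_criterion[of "ck w" "\<lambda>a r. memN (N.opr a r) g"])
    show "N.Ord (ck w)" by (rule N_Ord[OF w_Ord])
    show "N.cntbl (N.elts a)" if a: "memN a (ck w)" for a
    proof -
      obtain b where b: "b \<epsilon> w" "a = ck b" using a unfolding mem_ck by blast
      show ?thesis unfolding b(2) by (rule N_cntbl[OF w_cntbl[OF b(1)]])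
    qed
    show "N.Dfn (\<lambda>e. memN (N.opr (e 0) (e 1)) g)"
      by (intro N.Dfn_mem N.Trm_opr N.Trm_var N.Trm_const)
    fix a r r' assume *: "memN (N.opr a r) g" "memN (N.opr a r') g"
    obtain x h n where x: "x \<in> Q" "h \<in> G" "opr (num n) x \<epsilon> h" "N.opr a r = ck x" using *(1) unfolding g by blast
    obtain x' h' n' where x': "x' \<in> Q" "h' \<in> G" "opr (num n') x' \<epsilon> h'" "N.opr a r' = ck x'" using *(2) unfolding g by blast
    obtain b s where b: "x = opr b s" using x(1) unfolding Q_def by blast
    obtain b' s' where b': "x' = opr b' s'" using x'(1) unfolding Q_def by blast
    have e: "a = ck b" "r = ck s" "a = ck b'" "r' = ck s'" using x(4) x'(4) unfolding b b' ck_opr by auto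
    have bb: "b' = b" using e(1,3) by simp
    obtain k where k: "k \<in> G" "ext k h" "ext k h'" using G_dir[OF x(2) x'(2)] by blast
    obtain i where i: "opr (num i) (opr b s) \<epsilon> k" using k(2) x(3) unfolding ext_def b by blast
    obtain j where j: "opr (num j) (opr b s') \<epsilon> k" using k(3) x'(3) unfolding ext_def b' bb by blast
    have "s = s'" by (rule Cond_D(3)[OF G_P[OF k(1)] i j])
    then show "r = r'" using e by simp
  next
    fix r assume r: "N.sub r N.omg"
    have rl: "N.rl r \<in> Rl" unfolding N_Rl[symmetric] by (rule N.rl_in_Rl)
    define s where "s = st (N.rl r)"
    have rs: "r = ck s" unfolding s_def using Rl_N_Rl[OF rl] N.st_rl[OF r] by simp
    have s: "sub s omg" unfolding s_def by (rule sub_st_omg[OF rl])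
    have "\<exists>h\<in>G. \<exists>n a. opr (num n) (opr a s) \<epsilon> h"
    proof (rule G_generic)
      show "Dfn (\<lambda>e. \<exists>n a. opr (num n) (opr a s) \<epsilon> e 0)" by (intro dfn)
    qed (rule Cond_add[OF _ s])
    then obtain h n a where h: "h \<in> G" "opr (num n) (opr a s) \<epsilon> h" by blast
    have "opr (num n) (opr a s) \<in> bound" by (rule Cond_D(1)[OF G_P[OF h(1)] h(2)])
    then have a: "a \<epsilon> w" unfolding bound_iff by blast
    have "opr a s \<in> Q" unfolding Q_def using a s by auto
    then have "memN (N.opr (ck a) r) g" unfolding g rs ck_opr[symmetric] using h by blast
    moreover have "memN (ck a) (ck w)" unfolding mem_ck using a by blast
    ultimately show "\<exists>a. memN a (ck w) \<and> memN (N.opr a r) g" by blast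
  qed
qed

end

theorem ctm_CH:
  assumes "ctm_with_code c E l r"
  shows "\<exists>E l r. ctm_with_code c E l r \<and> set_structure.satisfies_CH E"
proof -
  interpret M: zfc_model E
    using assms unfolding ctm_with_code_def by unfold_locales blast+
  obtain w where w: "M.Ord w" "\<not> M.cntbl (M.elts w)" "\<And>a. E a w \<Longrightarrow> M.cntbl (M.elts a)"
    by (rule M.ex_omega1) blast
  interpret C: collapse E w by unfold_locales (fact w)+
  have f: "forcing E C.Cond C.ext M.emp" by unfold_locales
  have col: "collapse E w" by unfold_locales
  obtain G and val :: "nat \<Rightarrow> nat" and memN where g: "generic E C.Cond C.ext M.emp G val memN"
    using ex_generic[OF f] by blast
  interpret X: collapse_extension E w G val memN by (intro collapse_extension.intro collapse_extension_axioms.intro g col)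
  have "ctm_with_code c memN (X.ck l) (X.ck r)"
    using assms X.wfp_memN X.N_zfc X.ck_represents unfolding ctm_with_code_def by blast
  then show ?thesis using X.N_CH by blast
qed

section \<open>Witnesses for extendability\<close>

text \<open>A number \<open>x i\<close> stands for two pieces of information: whether \<open>i \<in> A\<close> (\<open>bitA\<close>), and whether
  \<open>i \<in> T\<close> for the evaluation \<open>T\<close> of a Borel code at \<open>A\<close> (\<open>bitT\<close>, where a nonzero value also names
  the reason for \<open>i \<in> T\<close>). Thus the pairs \<open>(A, T)\<close> are the branches of the tree of \<open>gd\<close> lists.\<close>

definition bitA :: "nat \<Rightarrow> nat" where "bitA x = fst (prod_decode x)"
definition bitT :: "nat \<Rightarrow> nat" where "bitT x = snd (prod_decode x)"

text \<open>Since reasons are named, the existential clauses of \<open>code_eval\<close> become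
  conditions on finitely many entries. Being good is closed: it passes to prefixes, and a function
  all of whose prefixes are good is an exact evaluation.\<close>

definition gd :: "borel_code \<Rightarrow> nat list \<Rightarrow> bool" where
  "gd c s \<longleftrightarrow> (\<forall>i<length s.
     (bitT (nthl s i) = 0 \<longrightarrow> (\<forall>k<length s. ((i, k) \<in> fst c \<longrightarrow> bitA (nthl s k) = 0) \<and>
        ((i, k) \<in> snd c \<longrightarrow> bitT (nthl s k) \<noteq> 0))) \<and>
     (\<forall>k. bitT (nthl s i) = Suc (prod_encode (0, k)) \<longrightarrow>
        (i, k) \<in> fst c \<and> (k < length s \<longrightarrow> bitA (nthl s k) \<noteq> 0)) \<and>
     (\<forall>l k. bitT (nthl s i) = Suc (prod_encode (Suc l, k)) \<longrightarrow>
        (i, k) \<in> snd c \<and> (k < length s \<longrightarrow> bitT (nthl s k) = 0)))"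

definition tn :: "borel_code \<Rightarrow> nat list \<Rightarrow> bool" where
  "tn c s \<longleftrightarrow> gd c s \<and> (0 < length s \<longrightarrow> bitT (nthl s 0) \<noteq> 0)"

definition inA :: "nat \<Rightarrow> nat list \<Rightarrow> bool" where
  "inA i s \<longleftrightarrow> i < length s \<and> bitA (nthl s i) \<noteq> 0"

definition pfx :: "nat list \<Rightarrow> nat list \<Rightarrow> bool" where
  "pfx s t \<longleftrightarrow> length s \<le> length t \<and> (\<forall>i<length s. nthl s i = nthl t i)"

lemma nthl_map [simp]: "nthl (map f [0..<n]) i = (if i < n then f i else 0)"
  by (simp add: nthl_def)

lemma gd_pfx: "gd c t \<Longrightarrow> pfx s t \<Longrightarrow> gd c s"
  unfolding gd_def pfx_def by (auto intro: less_le_trans)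

lemma tn_pfx:
  assumes "tn c t" "pfx s t" shows "tn c s"
proof -
  have "gd c s" using assms gd_pfx[of c t s] unfolding tn_def by simp
  then show ?thesis using assms unfolding tn_def pfx_def by auto
qed

lemma gd_map:
  assumes "\<And>n. gd c (map x [0..<n])"
  shows "code_eval c {i. bitA (x i) \<noteq> 0} {i. bitT (x i) \<noteq> 0}"
proof -
  have g: "(bitT (x i) = 0 \<longrightarrow> ((i, k) \<in> fst c \<longrightarrow> bitA (x k) = 0) \<and> ((i, k) \<in> snd c \<longrightarrow> bitT (x k) \<noteq> 0)) \<and>
     (bitT (x i) = Suc (prod_encode (0, k)) \<longrightarrow> (i, k) \<in> fst c \<and> bitA (x k) \<noteq> 0) \<and>
     (bitT (x i) = Suc (prod_encode (Suc l, k)) \<longrightarrow> (i, k) \<in> snd c \<and> bitT (x k) = 0)" for i k l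
  proof -
    define N where "N = Suc (max i k)"
    have N: "i < N" "k < N" unfolding N_def by auto
    then have "i < length (map x [0..<N])" by simp
    from assms[of N, unfolded gd_def, THEN spec, THEN mp, OF this] N show ?thesis by simp
  qed
  show ?thesis unfolding code_eval_def mem_Collect_eq
  proof (intro allI iffI)
    fix n assume "bitT (x n) \<noteq> 0"
    then obtain d where d: "bitT (x n) = Suc d" using not0_implies_Suc by blast
    obtain l k where "prod_decode d = (l, k)" by fastforce
    then have "d = prod_encode (l, k)" by (metis prod_decode_inverse)
    then show "(\<exists>k\<in>{i. bitA (x i) \<noteq> 0}. (n, k) \<in> fst c) \<or> (\<exists>m. (n, m) \<in> snd c \<and> \<not> bitT (x m) \<noteq> 0)"
      using d g[of n k] by (cases l) blast+
  next
    fix n assume "(\<exists>k\<in>{i. bitA (x i) \<noteq> 0}. (n, k) \<in> fst c) \<or> (\<exists>m. (n, m) \<in> snd c \<and> \<not> bitT (x m) \<noteq> 0)"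
    then consider k where "bitA (x k) \<noteq> 0" "(n, k) \<in> fst c" | m where "(n, m) \<in> snd c" "bitT (x m) = 0" by blast
    then show "bitT (x n) \<noteq> 0"
    proof cases
      case (1 k)
      then show ?thesis using g[of n k 0] by auto
    next
      case (2 m)
      then show ?thesis using g[of n m 0] by auto
    qed
  qed
qed

lemma gd_of_eval:
  assumes e: "code_eval c A T"
  obtains x where "\<And>n. gd c (map x [0..<n])" "\<And>i. bitA (x i) \<noteq> 0 \<longleftrightarrow> i \<in> A" "\<And>i. bitT (x i) \<noteq> 0 \<longleftrightarrow> i \<in> T"
proof -
  have e: "n \<in> T \<longleftrightarrow> (\<exists>k. k \<in> A \<and> (n, k) \<in> fst c) \<or> (\<exists>m. (n, m) \<in> snd c \<and> m \<notin> T)" for n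
    using e unfolding code_eval_def by blast
  define P where "P n d \<longleftrightarrow> (if n \<in> T then (\<exists>k. d = Suc (prod_encode (0, k)) \<and> k \<in> A \<and> (n, k) \<in> fst c) \<or>
      (\<exists>m. d = Suc (prod_encode (1, m)) \<and> (n, m) \<in> snd c \<and> m \<notin> T) else d = 0)" for n d
  have "\<exists>d. P n d" for n
  proof (cases "n \<in> T")
    case True
    then consider k where "k \<in> A" "(n, k) \<in> fst c" | m where "(n, m) \<in> snd c" "m \<notin> T" using e[of n] by blast
    then show ?thesis unfolding P_def if_P[OF True] by cases blast+
  qed (simp add: P_def)
  then have "\<forall>n. \<exists>d. P n d" ..
  from choice[OF this] obtain w where w: "\<forall>n. P n (w n)" ..
  define x where "x i = prod_encode (if i \<in> A then 1 else 0, w i)" for i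
  have bA: "bitA (x i) \<noteq> 0 \<longleftrightarrow> i \<in> A" for i by (simp add: x_def bitA_def)
  have bT: "bitT (x i) = w i" for i by (simp add: x_def bitT_def)
  have w0: "w i \<noteq> 0 \<longleftrightarrow> i \<in> T" for i using w[THEN spec, of i] unfolding P_def by (auto split: if_splits)
  have "gd c (map x [0..<n])" for n unfolding gd_def
  proof (intro allI impI conjI, goal_cases)
    case (1 i k)
    then have *: "w i = 0" "k < n" "(i, k) \<in> fst c" by (auto simp: bT)
    have "k \<notin> A" using e[of i] w0[of i] * by blast
    then show ?case using bA[of k] *(2) by simp
  next
    case (2 i k)
    then have *: "w i = 0" "k < n" "(i, k) \<in> snd c" by (auto simp: bT)
    have "k \<in> T" using e[of i] w0[of i] * by blast
    then show ?case using w0[of k] *(2) by (simp add: bT)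
  next
    case (3 i k)
    then show ?case using w0[of i] w[THEN spec, of i] unfolding P_def by (auto simp: bT split: if_splits)
  next
    case (4 i k)
    then show ?case using w0[of i] w[THEN spec, of i] bA[of k] unfolding P_def by (auto simp: bT split: if_splits)
  next
    case (5 i l k)
    then show ?case using w0[of i] w[THEN spec, of i] unfolding P_def by (auto simp: bT split: if_splits)
  next
    case (6 i l k)
    then show ?case using w0[of i] w[THEN spec, of i] w0[of k] unfolding P_def by (auto simp: bT split: if_splits)
  qed
  then show ?thesis by (rule that[of x]) (simp_all only: bA bT w0)
qed

text \<open>An attempt to show that the coded family is not contained in a \<open>P\<^sup>+\<close>-ideal, as a single
  function \<open>y\<close>: a set \<open>B\<close> outside of the family (given by an evaluation), a set of live pairs
  \<open>(n, s)\<close>, and for a live \<open>(n, s)\<close> and a child \<open>m\<close> of \<open>n\<close> in \<open>S\<close> extensions of \<open>s\<close> that keep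
  \<open>(m, s')\<close> alive and cover \<open>B\<close> from \<open>y (posS m s 0)\<close> on up to \<open>j\<close>. The tree \<open>S\<close> is taken to be
  the tree of finite approximations to such an attempt, so that a branch of \<open>S\<close> is itself an attempt.\<close>

definition posB :: "nat \<Rightarrow> nat" where "posB i = prod_encode (0, i)"
definition posA :: "nat list \<Rightarrow> nat list \<Rightarrow> nat" where
  "posA n s = prod_encode (1, prod_encode (list_encode n, list_encode s))"
definition posS :: "nat list \<Rightarrow> nat list \<Rightarrow> nat \<Rightarrow> nat" where
  "posS m s j = prod_encode (2, prod_encode (list_encode m, prod_encode (list_encode s, j)))"

text \<open>The clauses of \<open>attempt\<close>, each guarded by the length of \<open>u\<close>: a
  clause is tested only when the entries that it mentions are present. An attempt is then a function
  all of whose prefixes pass.\<close>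

definition apx :: "borel_code \<Rightarrow> nat set \<Rightarrow> nat list \<Rightarrow> bool" where
  "apx c S u \<longleftrightarrow>
     (posA [] [] < length u \<longrightarrow> nthl u (posA [] []) \<noteq> 0) \<and>
     (\<forall>s. (\<forall>i<length s. posB i < length u \<and> nthl s i = nthl u (posB i)) \<longrightarrow>
        gd c s \<and> (0 < length s \<longrightarrow> bitT (nthl s 0) = 0)) \<and>
     (\<forall>n v m s s' j. m = n @ [v] \<and> list_encode m \<in> S \<and> posA n s < length u \<and> nthl u (posA n s) \<noteq> 0 \<and>
        posS m s 0 < length u \<and> posS m s (Suc j) < length u \<and> s' = list_decode (nthl u (posS m s (Suc j))) \<longrightarrow>
        tn c s' \<and> pfx s s' \<and> j \<le> length s' \<and> (posA m s' < length u \<longrightarrow> nthl u (posA m s') \<noteq> 0) \<and>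
        (\<forall>i. nthl u (posS m s 0) \<le> i \<and> i < j \<and> posB i < length u \<and> bitA (nthl u (posB i)) \<noteq> 0 \<longrightarrow> inA i s'))"

definition attempt :: "borel_code \<Rightarrow> nat set \<Rightarrow> (nat \<Rightarrow> nat) \<Rightarrow> bool" where
  "attempt c S y \<longleftrightarrow>
     y (posA [] []) \<noteq> 0 \<and>
     (\<forall>n. gd c (map (\<lambda>i. y (posB i)) [0..<n])) \<and> bitT (y (posB 0)) = 0 \<and>
     (\<forall>n v m s s' j. m = n @ [v] \<and> list_encode m \<in> S \<and> y (posA n s) \<noteq> 0 \<and>
        s' = list_decode (y (posS m s (Suc j))) \<longrightarrow>
        tn c s' \<and> pfx s s' \<and> j \<le> length s' \<and> y (posA m s') \<noteq> 0 \<and>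
        (\<forall>i. y (posS m s 0) \<le> i \<and> i < j \<and> bitA (y (posB i)) \<noteq> 0 \<longrightarrow> inA i s'))"

text \<open>The tree enters the definition of its own members. Testing a list only against nodes
  with smaller codes makes this a recursion on codes.\<close>

primrec Sn :: "borel_code \<Rightarrow> nat \<Rightarrow> nat set" where
  "Sn c 0 = {}"
| "Sn c (Suc k) = (if apx c (Sn c k) (list_decode k) then insert k (Sn c k) else Sn c k)"

definition treeS :: "borel_code \<Rightarrow> nat set" where "treeS c = (\<Union>k. Sn c k)"

lemma Sn_eq: "Sn c k = treeS c \<inter> {..<k}"
proof -
  have 1: "Sn c k \<subseteq> {..<k}" for k by (induction k) (auto simp: less_Suc_eq)
  have 2: "Sn c (k + d) \<inter> {..<k} = Sn c k" for k d
    by (induction d) (use 1[of k] in auto)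
  have 3: "x \<in> Sn c k" if "x \<in> Sn c l" "x < k" for x l
    using 2[of k l] 2[of l k] that 1[of l] by (auto simp: add.commute)
  show ?thesis using 1[of k] 3 unfolding treeS_def by auto
qed

lemma treeS_iff: "k \<in> treeS c \<longleftrightarrow> apx c (treeS c \<inter> {..<k}) (list_decode k)"
proof -
  have "k \<in> treeS c \<longleftrightarrow> k \<in> Sn c (Suc k)" unfolding Sn_eq by auto
  also have "\<dots> \<longleftrightarrow> apx c (Sn c k) (list_decode k)" using Sn_eq[of c k] by auto
  finally show ?thesis unfolding Sn_eq .
qed

lemma length_le_list_encode: "length xs \<le> list_encode xs"
proof (induction xs)
  case (Cons x xs)
  have "list_encode xs \<le> prod_encode (x, list_encode xs)" by (rule le_prod_encode_2)
  then show ?case using Cons by simp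
qed simp

lemma attempt_apx:
  assumes "attempt c S y" "S' \<subseteq> S" shows "apx c S' (map y [0..<k])"
  unfolding apx_def
proof (intro conjI allI impI)
  show "nthl (map y [0..<k]) (posA [] []) \<noteq> 0" if "posA [] [] < length (map y [0..<k])"
    using assms(1) that unfolding attempt_def by simp
next
  fix s assume *: "\<forall>i<length s. posB i < length (map y [0..<k]) \<and> nthl s i = nthl (map y [0..<k]) (posB i)"
  have "s = map (\<lambda>i. y (posB i)) [0..<length s]"
    using * by (intro nth_equalityI) (auto simp: nthl_def split: if_splits)
  then show "gd c s" using assms(1) unfolding attempt_def by metis
  show "bitT (nthl s 0) = 0" if "0 < length s" using * that assms(1) unfolding attempt_def by simp
next
  fix n v m s s' j
  assume *: "m = n @ [v] \<and> list_encode m \<in> S' \<and> posA n s < length (map y [0..<k]) \<and> nthl (map y [0..<k]) (posA n s) \<noteq> 0 \<and>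
        posS m s 0 < length (map y [0..<k]) \<and> posS m s (Suc j) < length (map y [0..<k]) \<and>
        s' = list_decode (nthl (map y [0..<k]) (posS m s (Suc j)))"
  then have "m = n @ [v] \<and> list_encode m \<in> S \<and> y (posA n s) \<noteq> 0 \<and> s' = list_decode (y (posS m s (Suc j)))"
    using assms(2) by auto
  then have **: "tn c s' \<and> pfx s s' \<and> j \<le> length s' \<and> y (posA m s') \<noteq> 0 \<and>
        (\<forall>i. y (posS m s 0) \<le> i \<and> i < j \<and> bitA (y (posB i)) \<noteq> 0 \<longrightarrow> inA i s')"
    using assms(1) unfolding attempt_def by blast
  then show "tn c s'" "pfx s s'" "j \<le> length s'" by blast+
  show "nthl (map y [0..<k]) (posA m s') \<noteq> 0" if "posA m s' < length (map y [0..<k])" using ** that by simp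
  show "inA i s'" if "nthl (map y [0..<k]) (posS m s 0) \<le> i \<and> i < j \<and> posB i < length (map y [0..<k]) \<and>
      bitA (nthl (map y [0..<k]) (posB i)) \<noteq> 0" for i
    using ** that * by auto
qed

lemma apx_attempt:
  assumes apx: "\<And>k. apx c (S \<inter> {..<list_encode (map y [0..<k])}) (map y [0..<k])"
  shows "attempt c S y"
  unfolding attempt_def
proof (intro conjI allI impI)
  define N where "N = Suc (posA [] [])"
  have "posA [] [] < N" by (simp add: N_def)
  then show "y (posA [] []) \<noteq> 0" using apx[of N, unfolded apx_def, THEN conjunct1] by simp
  have B: "gd c (map (\<lambda>i. y (posB i)) [0..<n]) \<and> (0 < n \<longrightarrow> bitT (y (posB 0)) = 0)" for n
  proof -
    define k where "k = Suc (Max (insert 0 (posB ` {..<n})))"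
    have k: "posB i < k" if "i < n" for i unfolding k_def by (rule le_imp_less_Suc, rule Max_ge) (use that in auto)
    have "(\<forall>i<length (map (\<lambda>i. y (posB i)) [0..<n]). posB i < length (map y [0..<k]) \<and>
        nthl (map (\<lambda>i. y (posB i)) [0..<n]) i = nthl (map y [0..<k]) (posB i))" using k by simp
    from apx[of k, unfolded apx_def, THEN conjunct2, THEN conjunct1, THEN spec, THEN mp, OF this]
    show ?thesis by simp
  qed
  show "gd c (map (\<lambda>i. y (posB i)) [0..<n])" for n using B by blast
  show "bitT (y (posB 0)) = 0" using B[of 1] by simp
next
  fix n v m s s' j
  assume *: "m = n @ [v] \<and> list_encode m \<in> S \<and> y (posA n s) \<noteq> 0 \<and> s' = list_decode (y (posS m s (Suc j)))"
  have **: "tn c s' \<and> pfx s s' \<and> j \<le> length s' \<and> y (posA m s') \<noteq> 0 \<and>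
      (y (posS m s 0) \<le> i \<and> i < j \<and> bitA (y (posB i)) \<noteq> 0 \<longrightarrow> inA i s')" for i
  proof -
    define k where "k = Suc (list_encode m + posA n s + posS m s 0 + posS m s (Suc j) + posA m s' + posB i)"
    \<comment> \<open>A list of length k has a code of at least k, so the restriction to smaller
      codes disappears in the limit: a long prefix is tested against the node
      \<open>m\<close>.\<close>
    have "k \<le> list_encode (map y [0..<k])" using length_le_list_encode[of "map y [0..<k]"] by simp
    then have "list_encode m \<in> S \<inter> {..<list_encode (map y [0..<k])}" using * unfolding k_def by auto
    moreover have "posA n s < k" "posS m s 0 < k" "posS m s (Suc j) < k" "posA m s' < k" "posB i < k" unfolding k_def by simp_all
    ultimately show ?thesis
      using apx[of k, unfolded apx_def, THEN conjunct2, THEN conjunct2, THEN spec, THEN spec, THEN spec, THEN spec, THEN spec, THEN spec, of m n v s j s'] * by simp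
  qed
  then show "tn c s'" "pfx s s'" "j \<le> length s'" "y (posA m s') \<noteq> 0" by blast+
  show "y (posS m s 0) \<le> i \<and> i < j \<and> bitA (y (posB i)) \<noteq> 0 \<Longrightarrow> inA i s'" for i using ** by blast
qed

lemma pfx_trans: "pfx s t \<Longrightarrow> pfx t u \<Longrightarrow> pfx s u"
  unfolding pfx_def by (auto intro: less_le_trans)

lemma pfx_refl [simp]: "pfx s s" by (simp add: pfx_def)

section \<open>Well-foundedness of the tree S\<close>

locale coded_ideal =
  fixes c :: borel_code
  assumes code: "is_borel_code c" and ideal: "ideal (coded_family c)"
begin

lemma coded_Un: "A \<in> coded_family c \<Longrightarrow> B \<in> coded_family c \<Longrightarrow> A \<union> B \<in> coded_family c"
  using ideal unfolding ideal_on_def by simp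

lemma coded_subset: "A \<in> coded_family c \<Longrightarrow> B \<subseteq> A \<Longrightarrow> B \<in> coded_family c"
  using ideal unfolding ideal_on_def by blast

lemma coded_finite: "finite A \<Longrightarrow> A \<in> coded_family c"
  using ideal unfolding ideal_on_def by simp

lemma limit_in_coded:
  assumes s: "\<And>k. tn c (s k)" "\<And>k. pfx (s k) (s (Suc k))" "\<And>k. k \<le> length (s (Suc k))"
  shows "{i. \<exists>k. inA i (s k)} \<in> coded_family c"
proof -
  \<comment> \<open>Length at least \<open>k\<close> is known for \<open>s (Suc k)\<close>, so
    position \<open>i\<close> is certain to exist from \<open>s (Suc (Suc i))\<close> on.\<close>
  define x where "x i = nthl (s (Suc (Suc i))) i" for i
  have mono: "pfx (s k) (s (k + d))" for k d
  proof (induction d)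
    case (Suc d)
    then show ?case using pfx_trans[OF Suc s(2)] by simp
  qed simp
  have mono': "pfx (s k) (s l)" if "k \<le> l" for k l using mono[of k "l - k"] that by simp
  have x: "nthl (s k) i = x i" if "i < length (s k)" for k i
  proof -
    have i: "i < length (s (Suc (Suc i)))" using s(3)[of "Suc i"] by simp
    show ?thesis
    proof (cases "k \<le> Suc (Suc i)")
      case True
      from mono'[OF True, unfolded pfx_def, THEN conjunct2, THEN spec, THEN mp, OF that] show ?thesis by (simp only: x_def)
    next
      case False
      then have "Suc (Suc i) \<le> k" by simp
      from mono'[OF this, unfolded pfx_def, THEN conjunct2, THEN spec, THEN mp, OF i] show ?thesis by (simp only: x_def)
    qed
  qed
  have "pfx (map x [0..<n]) (s (Suc n))" for n
    unfolding pfx_def using s(3)[of n] x[of _ "Suc n"] by auto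
  then have "tn c (map x [0..<n])" for n using tn_pfx[OF s(1)] by blast
  then have "gd c (map x [0..<n])" "0 < n \<Longrightarrow> bitT (x 0) \<noteq> 0" for n unfolding tn_def by (blast, force)
  from gd_map[OF this(1)] this(2)[of 1] have "{i. bitA (x i) \<noteq> 0} \<in> coded_family c"
    unfolding coded_family_def by auto
  then show ?thesis
    by (rule coded_subset) (use x in \<open>auto simp: inA_def\<close>)
qed

text \<open>Along the branch, live approximations can be extended forever. An extension captures
  \<open>B\<close> only from a threshold on, which depends on the approximation reached before, so
  one chain leaves gaps; a second chain is made to fill them, and the first fills those of the
  second. Then \<open>B\<close> is covered by two members of the ideal and a finite set, although
  its evaluation says that it is not in the family.\<close>

lemma attempt_no_branch:
  assumes y: "attempt c S y" and f: "\<And>k. list_encode (map f [0..<k]) \<in> S"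
  shows False
proof -
  define m where "m k = map f [0..<k]" for k
  define sg where "sg k s j = list_decode (y (posS (m (Suc k)) s (Suc j)))" for k s j
  define kp where "kp k s = y (posS (m (Suc k)) s 0)" for k s
  define B where "B = {i. bitA (y (posB i)) \<noteq> 0}"
  have step: "tn c (sg k s j) \<and> pfx s (sg k s j) \<and> j \<le> length (sg k s j) \<and> y (posA (m (Suc k)) (sg k s j)) \<noteq> 0 \<and>
        (\<forall>i. kp k s \<le> i \<and> i < j \<and> i \<in> B \<longrightarrow> inA i (sg k s j))" if "y (posA (m k) s) \<noteq> 0" for k s j
  proof -
    have "m (Suc k) = m k @ [f k]" "list_encode (m (Suc k)) \<in> S" using f[of "Suc k"] by (simp_all add: m_def)
    then show ?thesis using y that unfolding attempt_def sg_def kp_def B_def by blast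
  qed
  \<comment> \<open>Each chain is extended up to the threshold of the other one, so that their
    intervals interlock; the maximum with \<open>k\<close> makes the lengths unbounded.\<close>
  define st where "st = rec_nat ([], []) (\<lambda>k (s, t). let s' = sg k s (max k (kp k t)) in (s', sg k t (max k (kp (Suc k) s'))))"
  define s where "s k = fst (st k)" for k
  define t where "t k = snd (st k)" for k
  have s0: "s 0 = []" "t 0 = []" by (simp_all add: s_def t_def st_def)
  have sS: "s (Suc k) = sg k (s k) (max k (kp k (t k)))" for k
    by (simp add: s_def t_def st_def Let_def split: prod.split)
  have tS: "t (Suc k) = sg k (t k) (max k (kp (Suc k) (s (Suc k))))" for k
    by (simp add: s_def t_def st_def Let_def split: prod.split)
  have "y (posA [] []) \<noteq> 0" using y unfolding attempt_def by blast
  then have al0: "y (posA (m 0) []) \<noteq> 0" by (simp add: m_def)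
  have tn0: "tn c []" by (simp add: tn_def gd_def)
  have inv: "tn c (s k) \<and> y (posA (m k) (s k)) \<noteq> 0 \<and> tn c (t k) \<and> y (posA (m k) (t k)) \<noteq> 0" for k
  proof (induction k)
    case 0
    then show ?case using al0 tn0 by (simp add: s0)
  next
    case (Suc k)
    then show ?case using step[of k "s k"] step[of k "t k"] unfolding sS tS by blast
  qed
  have ps: "pfx (s k) (s (Suc k)) \<and> max k (kp k (t k)) \<le> length (s (Suc k)) \<and>
      (\<forall>i. kp k (s k) \<le> i \<and> i < max k (kp k (t k)) \<and> i \<in> B \<longrightarrow> inA i (s (Suc k)))" for k
    using step[of k "s k"] inv[of k] unfolding sS by blast
  have pt: "pfx (t k) (t (Suc k)) \<and> max k (kp (Suc k) (s (Suc k))) \<le> length (t (Suc k)) \<and>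
      (\<forall>i. kp k (t k) \<le> i \<and> i < max k (kp (Suc k) (s (Suc k))) \<and> i \<in> B \<longrightarrow> inA i (t (Suc k)))" for k
    using step[of k "t k"] inv[of k] unfolding tS by blast
  have As: "{i. \<exists>k. inA i (s k)} \<in> coded_family c"
    by (rule limit_in_coded) (use inv ps in auto)
  have At: "{i. \<exists>k. inA i (t k)} \<in> coded_family c"
    by (rule limit_in_coded) (use inv pt in auto)
  have "B \<subseteq> {i. \<exists>k. inA i (s k)} \<union> {i. \<exists>k. inA i (t k)} \<union> {..<kp 0 (s 0)}"
  proof
    fix i assume i: "i \<in> B"
    show "i \<in> {i. \<exists>k. inA i (s k)} \<union> {i. \<exists>k. inA i (t k)} \<union> {..<kp 0 (s 0)}"
    proof (cases "\<exists>k. i < kp k (s k)")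
      case False
      then have "kp (Suc i) (s (Suc i)) \<le> i" by (simp add: not_less)
      then have "inA i (s (Suc (Suc i)))" using ps[of "Suc i"] i by auto
      then show ?thesis by blast
    next
      case True
      define k where "k = (LEAST k. i < kp k (s k))"
      have k: "i < kp k (s k)" unfolding k_def using LeastI_ex[OF True] .
      show ?thesis
      proof (cases k)
        case 0
        then show ?thesis using k by simp
      next
        case (Suc l)
        then have l: "kp l (s l) \<le> i" using not_less_Least[of l "\<lambda>k. i < kp k (s k)"] unfolding k_def by simp
        show ?thesis
        proof (cases "i < kp l (t l)")
          case True
          then have "inA i (s (Suc l))" using ps[of l] l i by auto
          then show ?thesis by blast
        next
          case False
          then have "inA i (t (Suc l))" using pt[of l] k i unfolding Suc by auto
          then show ?thesis by blast
        qed
      qed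
    qed
  qed
  then have "B \<in> coded_family c"
    by (rule coded_subset[rotated]) (intro coded_Un As At coded_finite finite_lessThan)
  moreover have "code_eval c B {i. bitT (y (posB i)) \<noteq> 0}"
    unfolding B_def by (rule gd_map) (use y in \<open>auto simp: attempt_def\<close>)
  ultimately have "0 \<in> {i. bitT (y (posB i)) \<noteq> 0}" using coded_family_iff[OF code] by blast
  then show False using y unfolding attempt_def by simp
qed

text \<open>A branch of the tree is itself an attempt, and it also serves as the path required by
  \<open>attempt_no_branch\<close>.\<close>

theorem treeS_no_branch: "\<exists>k. list_encode (map f [0..<k]) \<notin> treeS c"
proof (rule ccontr)
  assume "\<not> ?thesis"
  then have f: "list_encode (map f [0..<k]) \<in> treeS c" for k by blast
  have "attempt c (treeS c) f"
    by (rule apx_attempt) (rule iffD1[OF treeS_iff, OF f, unfolded list_encode_inverse])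
  from attempt_no_branch[OF this f] show False .
qed

text \<open>The prefixes of an attempt would form a branch. Existence of a branch and of an attempt
  are thus refuted by the same function in both roles.\<close>

corollary no_attempt: "\<not> attempt c (treeS c) y"
proof
  assume y: "attempt c (treeS c) y"
  have "list_encode (map y [0..<k]) \<in> treeS c" for k
    by (rule iffD2[OF treeS_iff], unfold list_encode_inverse, rule attempt_apx[OF y]) blast
  with attempt_no_branch[OF y] show False by blast
qed

end

section \<open>Ideals with the property \<open>P\<^sup>+\<close>\<close>

lemma ideal_subset: "ideal K \<Longrightarrow> A \<in> K \<Longrightarrow> B \<subseteq> A \<Longrightarrow> B \<in> K"
  unfolding ideal_on_def by blast

lemma ideal_Un: "ideal K \<Longrightarrow> A \<in> K \<Longrightarrow> B \<in> K \<Longrightarrow> A \<union> B \<in> K"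
  unfolding ideal_on_def by blast

lemma ideal_finite: "ideal K \<Longrightarrow> finite A \<Longrightarrow> A \<in> K"
  unfolding ideal_on_def by blast

lemma ideal_UNIV: "ideal K \<Longrightarrow> UNIV \<notin> K"
  unfolding ideal_on_def by blast

lemma ideal_almost_subset:
  assumes K: "ideal K" and "A \<in> K" "finite (B - A)" shows "B \<in> K"
proof -
  have "B \<subseteq> A \<union> (B - A)" by blast
  then show ?thesis using ideal_subset[OF K ideal_Un[OF K assms(2) ideal_finite[OF K assms(3)]]] by blast
qed

lemma P_plus_pseudointersection:
  assumes K: "P_plus_ideal K" and A: "\<And>n. A n \<notin> K" "\<And>n. A (Suc n) \<subseteq> A n"
  shows "\<exists>B. B \<notin> K \<and> B \<subseteq> A 0 \<and> (\<forall>n. finite (B - A n))"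
proof -
  obtain B where B: "B \<notin> K" "B \<subseteq> A 0" "\<And>n. finite (B \<inter> (A n - A (Suc n)))"
    using K A unfolding P_plus_ideal_def by blast
  have "finite (B - A n)" for n
  proof (induction n)
    case (Suc n)
    have "B - A (Suc n) \<subseteq> (B - A n) \<union> (B \<inter> (A n - A (Suc n)))" by blast
    then show ?case using Suc B(3)[of n] finite_subset by blast
  qed (use B(2) in \<open>simp add: Diff_eq_empty_iff[THEN iffD2]\<close>)
  with B show ?thesis by blast
qed

lemma P_plus_vimage:
  assumes K: "P_plus_ideal K" and J: "ideal J" and f: "\<And>B. B \<in> J \<Longrightarrow> f -` B \<in> K"
  shows "extendable_to_P_plus J"
proof -
  have K': "ideal K" using K unfolding P_plus_ideal_def by blast
  define L where "L = {B. f -` B \<in> K}"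
  have "ideal L" unfolding ideal_on_def L_def
    using ideal_Un[OF K'] ideal_UNIV[OF K'] ideal_subset[OF K'] f ideal_finite[OF J]
    by (auto simp: vimage_Un) (metis vimage_mono)
  moreover have "\<exists>B. B \<notin> L \<and> B \<subseteq> A 0 \<and> (\<forall>n. finite (B \<inter> (A n - A (Suc n))))"
    if A: "\<forall>n. A n \<notin> L" "\<forall>n. A (Suc n) \<subseteq> A n" for A
  proof -
    obtain B where B: "B \<notin> K" "B \<subseteq> f -` A 0" "\<And>n. finite (B \<inter> (f -` A n - f -` A (Suc n)))"
    proof -
      have "\<forall>n. f -` A n \<notin> K" "\<forall>n. f -` A (Suc n) \<subseteq> f -` A n" using A unfolding L_def by auto
      then have "\<exists>B. B \<notin> K \<and> B \<subseteq> f -` A 0 \<and> (\<forall>n. finite (B \<inter> (f -` A n - f -` A (Suc n))))"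
        using K[unfolded P_plus_ideal_def, THEN conjunct2, rule_format, of "\<lambda>n. f -` A n"] by blast
      then show ?thesis using that by blast
    qed
    have "f ` B \<inter> (A n - A (Suc n)) \<subseteq> f ` (B \<inter> (f -` A n - f -` A (Suc n)))" for n by blast
    then have "finite (f ` B \<inter> (A n - A (Suc n)))" for n using B(3) finite_subset by blast
    moreover have "f ` B \<notin> L" unfolding L_def using B(1) ideal_subset[OF K', of "f -` f ` B" B] by blast
    moreover have "f ` B \<subseteq> A 0" using B(2) by blast
    ultimately show ?thesis by blast
  qed
  ultimately have "P_plus_ideal L" unfolding P_plus_ideal_def by blast
  moreover have "J \<subseteq> L" unfolding L_def using f by blast
  ultimately show ?thesis unfolding extendable_to_P_plus_def by blast
qed

section \<open>Adjoining countable families, and the ideal Fin^2\<close>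

lemma ideal_adjoin_ideal:
  assumes K: "ideal K"
  shows "A \<in> ideal_adjoin K \<A> \<Longrightarrow> B \<in> ideal_adjoin K \<A> \<Longrightarrow> A \<union> B \<in> ideal_adjoin K \<A>"
    and "A \<in> ideal_adjoin K \<A> \<Longrightarrow> B \<subseteq> A \<Longrightarrow> B \<in> ideal_adjoin K \<A>"
proof -
  assume "A \<in> ideal_adjoin K \<A>" "B \<in> ideal_adjoin K \<A>"
  then obtain F H where F: "finite F" "F \<subseteq> \<A>" "A - \<Union>F \<in> K" and H: "finite H" "H \<subseteq> \<A>" "B - \<Union>H \<in> K"
    unfolding ideal_adjoin_def by blast
  have "(A \<union> B) - \<Union>(F \<union> H) \<in> K"
    by (rule ideal_subset[OF K ideal_Un[OF K F(3) H(3)]]) blast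
  then show "A \<union> B \<in> ideal_adjoin K \<A>" unfolding ideal_adjoin_def using F H by blast
next
  assume "A \<in> ideal_adjoin K \<A>" "B \<subseteq> A"
  then obtain F where F: "finite F" "F \<subseteq> \<A>" "A - \<Union>F \<in> K" unfolding ideal_adjoin_def by blast
  have "B - \<Union>F \<in> K" by (rule ideal_subset[OF K F(3)]) (use \<open>B \<subseteq> A\<close> in blast)
  then show "B \<in> ideal_adjoin K \<A>" unfolding ideal_adjoin_def using F by blast
qed

lemma Fin2_nat_iff: "B \<in> Fin2_nat \<longleftrightarrow> finite {n. infinite {k. prod_encode (n, k) \<in> B}}"
proof
  assume "B \<in> Fin2_nat"
  then obtain A where "A \<in> Fin2" "B = prod_encode ` A" unfolding Fin2_nat_def by blast
  then show "finite {n. infinite {k. prod_encode (n, k) \<in> B}}"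
    unfolding Fin2_def by (simp add: inj_image_mem_iff[OF inj_prod_encode])
next
  assume fin: "finite {n. infinite {k. prod_encode (n, k) \<in> B}}"
  define A where "A = {x. prod_encode x \<in> B}"
  have "B = prod_encode ` A" unfolding A_def proof (intro set_eqI iffI)
    fix x assume "x \<in> B"
    then show "x \<in> prod_encode ` {x. prod_encode x \<in> B}"
      by (intro image_eqI[of _ _ "prod_decode x"]) (auto simp: prod_decode_inverse)
  qed auto
  moreover have "A \<in> Fin2" unfolding Fin2_def A_def using fin by simp
  ultimately show "B \<in> Fin2_nat" unfolding Fin2_nat_def by blast
qed

lemma P_plus_not_preceq:
  assumes K: "P_plus_ideal K" and "J \<subseteq> K"
  shows "\<not> preceq_omega1 UNIV one_one Fin2_nat J"
proof
  have K': "ideal K" using K unfolding P_plus_ideal_def by blast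
  assume "preceq_omega1 UNIV one_one Fin2_nat J"
  moreover have "ideal_le one_one J K"
    unfolding ideal_le_def one_one_def using assms(2) by (intro bexI[of _ id]) auto
  ultimately have "\<exists>\<A>. countable \<A> \<and> UNIV \<notin> ideal_adjoin K \<A> \<and> ideal_le UNIV Fin2_nat (ideal_adjoin K \<A>)"
    using K' unfolding preceq_omega1_def by simp
  then obtain \<A> where \<A>: "countable \<A>" "UNIV \<notin> ideal_adjoin K \<A>"
    and le: "ideal_le UNIV Fin2_nat (ideal_adjoin K \<A>)" by blast
  obtain f where f: "\<And>B. B \<in> Fin2_nat \<Longrightarrow> f -` B \<in> ideal_adjoin K \<A>"
    using le unfolding ideal_le_def by blast
  define a where "a = from_nat_into (insert {} \<A>)"
  have ra: "range a = insert {} \<A>" unfolding a_def by (rule range_from_nat_into) (use \<A>(1) in auto)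
  have a_in: "a i \<in> ideal_adjoin K \<A>" for i
  proof (cases "a i = {}")
    case True
    then show ?thesis unfolding ideal_adjoin_def mem_Collect_eq
      by (intro exI[of _ "{}"]) (simp add: ideal_finite[OF K'])
  next
    case False
    have "a i \<in> range a" by (rule rangeI)
    with False have "a i \<in> \<A>" unfolding ra by simp
    then show ?thesis unfolding ideal_adjoin_def mem_Collect_eq
      by (intro exI[of _ "{a i}"]) (simp add: ideal_finite[OF K'])
  qed
  define V where "V i = f -` {z. fst (prod_decode z) = i}" for i
  have "{z. fst (prod_decode z) = i} \<in> Fin2_nat" for i
  proof -
    have "{n. infinite {k. prod_encode (n, k) \<in> {z. fst (prod_decode z) = i}}} \<subseteq> {i}" by auto
    then show ?thesis unfolding Fin2_nat_iff using finite_subset by blast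
  qed
  then have V: "V i \<in> ideal_adjoin K \<A>" for i unfolding V_def by (rule f)
  \<comment> \<open>The n-th set avoids the first n members of the family and the preimages of the
    first n columns. A pseudointersection is almost disjoint from all of these.\<close>
  define A where "A n = - (\<Union>i<n. a i \<union> V i)" for n
  have cov: "(\<Union>i<n. a i \<union> V i) \<in> ideal_adjoin K \<A>" for n
  proof (induction n)
    case 0
    show ?case unfolding ideal_adjoin_def mem_Collect_eq
      by (intro exI[of _ "{}"]) (simp add: ideal_finite[OF K'])
  next
    case (Suc n)
    then show ?case unfolding lessThan_Suc UN_insert
      by (intro ideal_adjoin_ideal(1)[OF K'] a_in V)
  qed
  have "A n \<notin> K" for n
  proof
    assume "A n \<in> K"
    then have "A n \<in> ideal_adjoin K \<A>" unfolding ideal_adjoin_def by (auto intro!: exI[of _ "{}"])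
    from ideal_adjoin_ideal(1)[OF K' this cov[of n]] have "UNIV \<in> ideal_adjoin K \<A>"
      unfolding A_def by (simp only: Compl_partition2)
    with \<A>(2) show False ..
  qed
  moreover have "A (Suc n) \<subseteq> A n" for n unfolding A_def by (auto simp: less_Suc_eq)
  ultimately obtain B where B: "B \<notin> K" "\<And>n. finite (B - A n)" using P_plus_pseudointersection[OF K] by metis
  have fa: "finite (B \<inter> a i)" and fV: "finite (B \<inter> V i)" for i
    by (rule finite_subset[OF _ B(2)[of "Suc i"]], auto simp: A_def)+
  have "f ` B \<in> Fin2_nat"
  proof -
    have "finite {k. prod_encode (n, k) \<in> f ` B}" for n
    proof (rule finite_subset)
      show "{k. prod_encode (n, k) \<in> f ` B} \<subseteq> (\<lambda>x. snd (prod_decode (f x))) ` (B \<inter> V n)"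
      proof
        fix k assume "k \<in> {k. prod_encode (n, k) \<in> f ` B}"
        then obtain x where "x \<in> B" "f x = prod_encode (n, k)" by auto
        then show "k \<in> (\<lambda>x. snd (prod_decode (f x))) ` (B \<inter> V n)"
          by (intro image_eqI[of _ _ x]) (auto simp: V_def)
      qed
    qed (use fV in blast)
    then show ?thesis unfolding Fin2_nat_iff by simp
  qed
  then have "f -` f ` B \<in> ideal_adjoin K \<A>" by (rule f)
  then have "B \<in> ideal_adjoin K \<A>" by (rule ideal_adjoin_ideal(2)[OF K']) blast
  then obtain F where F: "finite F" "F \<subseteq> \<A>" "B - \<Union>F \<in> K" unfolding ideal_adjoin_def by blast
  have "finite (B \<inter> X)" if "X \<in> F" for X
  proof -
    have "X \<in> range a" unfolding ra using that F(2) by blast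
    then show ?thesis using fa by blast
  qed
  then have "finite (\<Union>X\<in>F. B \<inter> X)" using F(1) by blast
  moreover have "B - (B - \<Union>F) \<subseteq> (\<Union>X\<in>F. B \<inter> X)" by blast
  ultimately have "finite (B - (B - \<Union>F))" using finite_subset by blast
  with ideal_almost_subset[OF K' F(3)] B(1) show False by blast
qed

lemma not_preceq_extendable:
  assumes J: "ideal J" and n: "\<not> preceq_omega1 UNIV UNIV Fin2_nat J"
  shows "extendable_to_P_plus J"
proof -
  obtain K where K: "ideal K" "ideal_le UNIV J K"
    and no': "\<not> (\<exists>\<A>. countable \<A> \<and> UNIV \<notin> ideal_adjoin K \<A> \<and> ideal_le UNIV Fin2_nat (ideal_adjoin K \<A>))"
    using n unfolding preceq_omega1_def not_all not_imp by (elim exE conjE)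
  have no: "\<not> ideal_le UNIV Fin2_nat (ideal_adjoin K \<A>)" if "countable \<A>" "UNIV \<notin> ideal_adjoin K \<A>" for \<A>
    using no' that by blast
  have "\<exists>B. B \<notin> K \<and> B \<subseteq> A 0 \<and> (\<forall>n. finite (B \<inter> (A n - A (Suc n))))"
    if A: "\<forall>n. A n \<notin> K" "\<forall>n. A (Suc n) \<subseteq> A n" for A :: "nat \<Rightarrow> nat set"
  proof (cases "(\<Inter>n. A n) \<in> K")
    case False
    then show ?thesis proof (intro exI[of _ "\<Inter>n. A n"] conjI allI)
      show "finite ((\<Inter>n. A n) \<inter> (A n - A (Suc n)))" for n by (rule finite_subset[of _ "{}"]) auto
    qed auto
  next
    case True
    have dec: "A m \<subseteq> A n" if "n \<le> m" for n m using lift_Suc_antimono_le[of A n m] A(2) that by blast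
    define \<A> where "\<A> = range (\<lambda>n. - A n)"
    have "UNIV \<notin> ideal_adjoin K \<A>"
    proof
      assume "UNIV \<in> ideal_adjoin K \<A>"
      then obtain F where F: "finite F" "F \<subseteq> \<A>" "UNIV - \<Union>F \<in> K" unfolding ideal_adjoin_def by blast
      obtain I where I: "finite I" "F = (\<lambda>n. - A n) ` I" using finite_subset_image[OF F(1) F(2)[unfolded \<A>_def]] by blast
      have "A (Max (insert 0 I)) \<subseteq> UNIV - \<Union>F"
      proof -
        have "A (Max (insert 0 I)) \<subseteq> A i" if "i \<in> I" for i by (rule dec) (use that I(1) in simp)
        then show ?thesis unfolding I(2) by blast
      qed
      then have "A (Max (insert 0 I)) \<in> K" by (rule ideal_subset[OF K(1) F(3)])
      with A(1) show False by blast
    qed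
    from no[OF _ this] have no': "\<not> (\<forall>B\<in>Fin2_nat. g -` B \<in> ideal_adjoin K \<A>)" for g
      unfolding \<A>_def ideal_le_def by auto
    \<comment> \<open>\<open>lv x\<close> is the layer at which \<open>x\<close> leaves the
      sequence; \<open>g\<close> sends the layers injectively into the columns of Fin^2.\<close>
    define lv where "lv x = (LEAST n. x \<notin> A (Suc n))" for x
    define g where "g x = prod_encode (lv x, x)" for x
    obtain B where B: "B \<in> Fin2_nat" "g -` B \<notin> ideal_adjoin K \<A>" using no'[of g] by blast
    define N where "N = {n. infinite {k. prod_encode (n, k) \<in> B}}"
    have N: "finite N" using B(1) unfolding Fin2_nat_iff N_def .
    define m where "m = Suc (Max (insert 0 N))"
    have m: "n < m" if "n \<in> N" for n unfolding m_def by (rule le_imp_less_Suc, rule Max_ge) (use N that in auto)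
    \<comment> \<open>Beyond level \<open>m\<close> all columns of \<open>B\<close> are finite, so
      \<open>X\<close> meets each layer in a finite set. Positivity survives because the complement
      of \<open>A m\<close> has been adjoined and the intersection of the sequence is in
      \<open>K\<close>.\<close>
    define X where "X = (g -` B \<inter> A m) - (\<Inter>n. A n)"
    have lv: "lv x = n" if "x \<in> A n" "x \<notin> A (Suc n)" for x n
      unfolding lv_def
    proof (rule Least_equality)
      fix k assume "x \<notin> A (Suc k)"
      then show "n \<le> k" using dec[of "Suc k" n] that(1) by (metis not_less_eq_eq subsetD)
    qed (rule that(2))
    have "X \<notin> K"
    proof
      assume "X \<in> K"
      then have "X \<union> (\<Inter>n. A n) \<in> K" by (rule ideal_Un[OF K(1) _ True])
      then have "g -` B - \<Union>{- A m} \<in> K" by (rule ideal_subset[OF K(1)]) (auto simp: X_def)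
      then have "g -` B \<in> ideal_adjoin K \<A>" unfolding ideal_adjoin_def \<A>_def by (auto intro!: exI[of _ "{- A m}"])
      with B(2) show False ..
    qed
    moreover have "X \<subseteq> A 0" unfolding X_def using dec[of 0 m] by auto
    moreover have "finite (X \<inter> (A n - A (Suc n)))" for n
    proof (cases "n < m")
      case True
      then have "X \<inter> (A n - A (Suc n)) = {}" unfolding X_def using dec[of "Suc n" m] by auto
      then show ?thesis by simp
    next
      case False
      then have "n \<notin> N" using m by blast
      then have "finite {k. prod_encode (n, k) \<in> B}" unfolding N_def by simp
      moreover have "X \<inter> (A n - A (Suc n)) \<subseteq> {k. prod_encode (n, k) \<in> B}"
        unfolding X_def g_def using lv by auto
      ultimately show ?thesis using finite_subset by blast
    qed
    ultimately show ?thesis by blast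
  qed
  then have P: "P_plus_ideal K" unfolding P_plus_ideal_def using K(1) by blast
  obtain f where "\<And>B. B \<in> J \<Longrightarrow> f -` B \<in> K" using K(2) unfolding ideal_le_def by blast
  then show ?thesis by (rule P_plus_vimage[OF P J])
qed

lemma preceq_mono:
  assumes "G \<subseteq> G'" "preceq_omega1 F G' I J" shows "preceq_omega1 F G I J"
  using assms unfolding preceq_omega1_def ideal_le_def by (meson subsetD)

theorem extendable_iff_not_preceq:
  assumes J: "ideal J"
  shows "extendable_to_P_plus J \<longleftrightarrow> \<not> preceq_omega1 UNIV one_one Fin2_nat J"
    "extendable_to_P_plus J \<longleftrightarrow> \<not> preceq_omega1 UNIV fin_one Fin2_nat J"
    "extendable_to_P_plus J \<longleftrightarrow> \<not> preceq_omega1 UNIV UNIV Fin2_nat J"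
proof -
  have 1: "one_one \<subseteq> fin_one" unfolding one_one_def fin_one_def by (auto simp: finite_vimageI)
  have 2: "fin_one \<subseteq> UNIV" by simp
  have a: "extendable_to_P_plus J \<Longrightarrow> \<not> preceq_omega1 UNIV one_one Fin2_nat J"
    unfolding extendable_to_P_plus_def using P_plus_not_preceq by blast
  have b: "\<not> preceq_omega1 UNIV UNIV Fin2_nat J \<Longrightarrow> extendable_to_P_plus J" by (rule not_preceq_extendable[OF J])
  note c = preceq_mono[OF 1, of UNIV Fin2_nat J] preceq_mono[OF 2, of UNIV Fin2_nat J]
  show "extendable_to_P_plus J \<longleftrightarrow> \<not> preceq_omega1 UNIV one_one Fin2_nat J"
    "extendable_to_P_plus J \<longleftrightarrow> \<not> preceq_omega1 UNIV fin_one Fin2_nat J"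
    "extendable_to_P_plus J \<longleftrightarrow> \<not> preceq_omega1 UNIV UNIV Fin2_nat J"
    using a b c by blast+
qed

section \<open>Towers of positive sets\<close>

lemma P_point_extendable:
  assumes U: "P_point U" and J: "ideal J" and le: "ideal_le UNIV J (dual_ideal U)"
  shows "extendable_to_P_plus J"
proof -
  have uf: "ultrafilter U" using U unfolding P_point_def by blast
  have dual: "A \<in> dual_ideal U \<longleftrightarrow> - A \<in> U" for A
    unfolding dual_ideal_def by (auto intro: exI[of _ "- A"])
  have nd: "A \<notin> dual_ideal U \<longleftrightarrow> A \<in> U" for A
  proof -
    have "\<not> (A \<in> U \<and> - A \<in> U)"
    proof
      assume "A \<in> U \<and> - A \<in> U"
      then have "A \<inter> - A \<in> U" using uf unfolding ultrafilter_def by blast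
      then show False using uf unfolding ultrafilter_def by simp
    qed
    moreover have "A \<in> U \<or> - A \<in> U" using uf unfolding ultrafilter_def by blast
    ultimately show ?thesis unfolding dual by blast
  qed
  have "ideal (dual_ideal U)" unfolding ideal_on_def dual
  proof (intro conjI ballI allI impI)
    show "- (A \<union> B) \<in> U" if "A \<in> dual_ideal U" "B \<in> dual_ideal U" for A B
      using that uf unfolding dual ultrafilter_def Compl_Un by blast
    show "- B \<in> U" if "A \<in> dual_ideal U" "B \<subseteq> A" for A B
      using that uf unfolding dual ultrafilter_def by (metis Compl_subset_Compl_iff)
    show "- A \<in> U" if "finite A \<and> A \<subseteq> UNIV" for A
      using that uf unfolding ultrafilter_def by blast
    show "- UNIV \<notin> U" using uf unfolding ultrafilter_def by simp
  qed simp
  moreover have "\<exists>B. B \<notin> dual_ideal U \<and> B \<subseteq> A 0 \<and> (\<forall>n. finite (B \<inter> (A n - A (Suc n))))"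
    if A: "\<forall>n. A n \<notin> dual_ideal U" for A
  proof -
    have AU: "A n \<in> U" for n using A nd by blast
    have "countable (range (\<lambda>n. - A n)) \<and> range (\<lambda>n. - A n) \<subseteq> dual_ideal U" unfolding dual_ideal_def using AU by blast
    then obtain B where B: "B \<in> U" "\<forall>X\<in>range (\<lambda>n. - A n). finite (X \<inter> B)"
      using U unfolding P_point_def by blast
    have "B \<inter> A 0 \<in> U"
      using uf[unfolded ultrafilter_def, THEN conjunct2, THEN conjunct2, THEN conjunct1] B(1) AU[of 0] by simp
    moreover have "finite ((B \<inter> A 0) \<inter> (A n - A (Suc n)))" for n
      by (rule finite_subset[of _ "- A (Suc n) \<inter> B"]) (use B(2) in auto)
    ultimately show ?thesis using nd by (intro exI[of _ "B \<inter> A 0"]) auto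
  qed
  ultimately have P: "P_plus_ideal (dual_ideal U)" unfolding P_plus_ideal_def by blast
  obtain f where "\<And>B. B \<in> J \<Longrightarrow> f -` B \<in> dual_ideal U" using le unfolding ideal_le_def by blast
  then show ?thesis by (rule P_plus_vimage[OF P J])
qed

section \<open>Deciding sequences of sets, and P-points from towers\<close>

definition seq_of :: "nat set \<Rightarrow> nat \<Rightarrow> nat set" where
  "seq_of X n = {i. prod_encode (n, i) \<in> X}"

text \<open>One notion for two purposes: deciding constant sequences makes the filter generated by a
  tower an ultrafilter, and deciding sequences from it makes this ultrafilter a P-point.\<close>

definition decides :: "nat set \<Rightarrow> (nat \<Rightarrow> nat set) \<Rightarrow> bool" where
  "decides B Y \<longleftrightarrow> (\<exists>n. finite (B \<inter> Y n)) \<or> (\<forall>n. finite (B - Y n))"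

lemma seq_of_surj: "\<exists>X. seq_of X = Y"
proof
  show "seq_of {z. snd (prod_decode z) \<in> Y (fst (prod_decode z))} = Y"
    unfolding seq_of_def by (rule ext) simp
qed

lemma almost_subset_trans: "finite (A - B) \<Longrightarrow> finite (B - C) \<Longrightarrow> finite (A - C)"
  by (rule finite_subset[of _ "(A - B) \<union> (B - C)"]) auto

lemma tower_ultrafilter:
  assumes inf: "\<And>B. B \<in> T \<Longrightarrow> infinite B" and chain: "\<And>A B. A \<in> T \<Longrightarrow> B \<in> T \<Longrightarrow> finite (A - B) \<or> finite (B - A)"
  shows "A \<in> T \<Longrightarrow> B \<in> T \<Longrightarrow> finite (A - X) \<Longrightarrow> finite (B \<inter> X) \<Longrightarrow> False"
    and "A \<in> T \<Longrightarrow> B \<in> T \<Longrightarrow> finite (A - X) \<Longrightarrow> finite (B - Y) \<Longrightarrow> \<exists>C\<in>T. finite (C - (X \<inter> Y))"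
proof -
  assume *: "A \<in> T" "B \<in> T" "finite (A - X)" "finite (B \<inter> X)"
  from chain[OF *(1,2)] show False
  proof
    assume "finite (A - B)"
    then have "finite ((A - B) \<union> (A - X) \<union> (B \<inter> X))" using * by blast
    then have "finite A" by (rule finite_subset[rotated]) auto
    with inf[OF *(1)] show False ..
  next
    assume "finite (B - A)"
    then have "finite ((B - A) \<union> (A - X) \<union> (B \<inter> X))" using * by blast
    then have "finite B" by (rule finite_subset[rotated]) auto
    with inf[OF *(2)] show False ..
  qed
next
  assume *: "A \<in> T" "B \<in> T" "finite (A - X)" "finite (B - Y)"
  from chain[OF *(1,2)] show "\<exists>C\<in>T. finite (C - (X \<inter> Y))"
  proof
    assume "finite (A - B)"
    then have "finite ((A - X) \<union> (A - Y))" using *(3) almost_subset_trans[OF _ *(4)] by blast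
    then show ?thesis by (intro bexI[OF _ *(1)]) (simp add: Diff_Int)
  next
    assume "finite (B - A)"
    then have "finite ((B - X) \<union> (B - Y))" using *(4) almost_subset_trans[OF _ *(3)] by blast
    then show ?thesis by (intro bexI[OF _ *(2)]) (simp add: Diff_Int)
  qed
qed

lemma tower_P_point:
  assumes inf: "\<And>B. B \<in> T \<Longrightarrow> infinite B" and chain: "\<And>A B. A \<in> T \<Longrightarrow> B \<in> T \<Longrightarrow> finite (A - B) \<or> finite (B - A)"
    and dec: "\<And>Y. \<exists>B\<in>T. decides B Y"
  shows "P_point {X. \<exists>B\<in>T. finite (B - X)}"
proof -
  define U where "U = {X. \<exists>B\<in>T. finite (B - X)}"
  note tu = tower_ultrafilter[of T, OF inf chain]
  have "ultrafilter U" unfolding ultrafilter_def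
  proof (intro conjI ballI allI impI)
    show "{} \<notin> U" unfolding U_def using inf by auto
    show "B \<in> U" if "A \<in> U" "A \<subseteq> B" for A B
    proof -
      obtain C where C: "C \<in> T" "finite (C - A)" using \<open>A \<in> U\<close> unfolding U_def by blast
      have "finite (C - B)" by (rule finite_subset[OF _ C(2)]) (use \<open>A \<subseteq> B\<close> in blast)
      then show ?thesis unfolding U_def using C(1) by blast
    qed
    show "A \<inter> B \<in> U" if "A \<in> U" "B \<in> U" for A B
      using that tu(2) unfolding U_def by blast
    show "A \<in> U \<or> - A \<in> U" for A
    proof -
      obtain B where B: "B \<in> T" "decides B (\<lambda>_. A)" using dec by blast
      then show ?thesis unfolding decides_def U_def by (auto simp: Diff_eq)
    qed
    show "- A \<in> U" if "finite A" for A
    proof -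
      obtain B where B: "B \<in> T" using dec by blast
      have "finite (B - - A)" using that by (simp add: Diff_eq)
      then show ?thesis unfolding U_def using B by blast
    qed
  qed
  moreover have "\<exists>B\<in>U. \<forall>A\<in>\<A>. finite (A \<inter> B)" if \<A>: "countable \<A>" "\<A> \<subseteq> dual_ideal U" for \<A>
  proof (cases "\<A> = {}")
    case True
    obtain B where "B \<in> T" using dec by blast
    then have "B \<in> U" unfolding U_def by (auto intro!: bexI[of _ B])
    then show ?thesis using True by blast
  next
    case False
    define Y where "Y n = - from_nat_into \<A> n" for n
    have YU: "Y n \<in> U" for n
    proof -
      have "from_nat_into \<A> n \<in> dual_ideal U" using from_nat_into[OF False] \<A>(2) by blast
      then show ?thesis unfolding Y_def dual_ideal_def by auto
    qed
    obtain B where B: "B \<in> T" "decides B Y" using dec by blast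
    have "infinite (B \<inter> Y n)" for n
    proof
      assume fin: "finite (B \<inter> Y n)"
      obtain C where C: "C \<in> T" "finite (C - Y n)" using YU[of n] unfolding U_def by blast
      from C(1) B(1) C(2) fin show False by (rule tu(1)[rotated 3])
    qed
    then have fin: "finite (B - Y n)" for n using B(2) unfolding decides_def by blast
    have "finite (A \<inter> B)" if a: "A \<in> \<A>" for A
    proof -
      obtain n where "A = from_nat_into \<A> n" using from_nat_into_surj[OF \<A>(1) a] by metis
      then have "A \<inter> B = B - Y n" unfolding Y_def by auto
      then show ?thesis using fin by simp
    qed
    moreover have "B \<in> U" unfolding U_def using B(1) by (auto intro!: bexI[of _ B])
    ultimately show ?thesis by blast
  qed
  ultimately show ?thesis unfolding P_point_def U_def[symmetric] by blast
qed

text \<open>If all finite intersections with \<open>B\<close> are positive, take a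
  pseudointersection. Otherwise, at the first step where the intersection becomes small, the part
  removed at that step is positive and misses one of the sets.\<close>

lemma P_plus_decide:
  assumes K: "P_plus_ideal K" and B: "B \<notin> K"
  shows "\<exists>C. C \<notin> K \<and> C \<subseteq> B \<and> decides C Y"
proof -
  have K': "ideal K" using K unfolding P_plus_ideal_def by blast
  define A where "A n = B \<inter> (\<Inter>i<n. Y i)" for n
  have A: "A 0 = B" "A (Suc n) = A n \<inter> Y n" "A (Suc n) \<subseteq> A n" for n unfolding A_def by (auto simp: less_Suc_eq)
  show ?thesis
  proof (cases "\<forall>n. A n \<notin> K")
    case True
    then obtain C where C: "C \<notin> K" "C \<subseteq> A 0" "\<And>n. finite (C - A n)"
      using P_plus_pseudointersection[OF K, of A] A(3) by blast
    have "finite (C - Y n)" for n by (rule finite_subset[OF _ C(3)[of "Suc n"]]) (auto simp: A(2))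
    then show ?thesis using C A(1) unfolding decides_def by blast
  next
    case False
    then have ex: "\<exists>n. A n \<in> K" by blast
    define n where "n = (LEAST n. A n \<in> K)"
    have n: "A n \<in> K" unfolding n_def using LeastI_ex[OF ex] .
    then have "n \<noteq> 0" using A(1) B by metis
    then obtain m where m: "n = Suc m" using not0_implies_Suc by blast
    have "A m \<notin> K" using not_less_Least[of m "\<lambda>n. A n \<in> K"] m unfolding n_def by simp
    moreover have "A m \<subseteq> A n \<union> (A m - Y m)" unfolding m A(2) by blast
    ultimately have "A m - Y m \<notin> K" using ideal_subset[OF K' ideal_Un[OF K' n]] by blast
    moreover have "A m - Y m \<subseteq> B" unfolding A_def by blast
    moreover have "(A m - Y m) \<inter> Y m = {}" by blast
    ultimately show ?thesis unfolding decides_def by (metis finite.emptyI)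
  qed
qed

definition almost_chain :: "nat set set \<Rightarrow> bool" where
  "almost_chain T \<longleftrightarrow> (\<forall>A\<in>T. \<forall>B\<in>T. finite (A - B) \<or> finite (B - A))"

text \<open>A recursion over a well-order of the sets of natural numbers whose proper initial
  segments have fewer than continuum many elements. Each set also stands for a sequence, which is
  decided at its turn.\<close>

theorem ex_P_point_avoiding:
  assumes K: "P_plus_ideal K"
    and pos: "\<And>T. |T| <o |UNIV :: nat set set| \<Longrightarrow> T \<inter> K = {} \<Longrightarrow> almost_chain T \<Longrightarrow> \<exists>B. B \<notin> K \<and> (\<forall>A\<in>T. finite (B - A))"
  shows "\<exists>U. P_point U \<and> K \<subseteq> dual_ideal U"
proof -
  have K': "ideal K" using K unfolding P_plus_ideal_def by blast
  define r where "r = |UNIV :: nat set set|"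
  have co: "Card_order r" "Field r = UNIV" unfolding r_def by (simp_all add: card_of_card_order_on Field_card_of)
  have wo: "Well_order r" using co(1) unfolding card_order_on_def by blast
  then have wf: "wf (r - Id)" by (simp add: well_order_on_def)
  define good where "good X B T \<longleftrightarrow> B \<notin> K \<and> (\<forall>A\<in>T. finite (B - A)) \<and> decides B (seq_of X)" for X B T
  define g where "g = wfrec (r - Id) (\<lambda>h X. SOME B. good X B (h ` {Y. (Y, X) \<in> r - Id}))"
  have g: "g X = (SOME B. good X B (g ` {Y. (Y, X) \<in> r - Id}))" for X
  proof -
    have "cut g (r - Id) X ` {Y. (Y, X) \<in> r - Id} = g ` {Y. (Y, X) \<in> r - Id}"
      by (rule image_cong) (auto simp: cut_apply)
    then show ?thesis unfolding g_def by (subst wfrec[OF wf]) simp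
  qed
  have good: "good X (g X) (g ` {Y. (Y, X) \<in> r - Id})" for X
    using wf
  proof (induction X rule: wf_induct_rule)
    case (less X)
    define T where "T = g ` {Y. (Y, X) \<in> r - Id}"
    have "|{Y. (Y, X) \<in> r - Id}| <o r"
      using card_of_underS[OF co(1), of X] co(2) by (simp add: underS_def conj_commute)
    then have 1: "|T| <o |UNIV :: nat set set|"
      unfolding T_def r_def using card_of_image ordLeq_ordLess_trans by blast
    have 2: "T \<inter> K = {}" unfolding T_def using less unfolding good_def by blast
    have 3: "almost_chain T" unfolding almost_chain_def T_def
    proof (intro ballI)
      fix A B assume "A \<in> g ` {Y. (Y, X) \<in> r - Id}" "B \<in> g ` {Y. (Y, X) \<in> r - Id}"
      then obtain Y Z where Y: "(Y, X) \<in> r - Id" "A = g Y" and Z: "(Z, X) \<in> r - Id" "B = g Z" by blast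
      have "Y = Z \<or> (Y, Z) \<in> r - Id \<or> (Z, Y) \<in> r - Id"
        using wo co(2) unfolding well_order_on_def linear_order_on_def total_on_def by blast
      then show "finite (A - B) \<or> finite (B - A)"
        using less[OF Y(1)] less[OF Z(1)] unfolding good_def Y(2) Z(2) by auto
    qed
    obtain B where B: "B \<notin> K" "\<forall>A\<in>T. finite (B - A)" using pos[OF 1 2 3] by blast
    obtain C where C: "C \<notin> K" "C \<subseteq> B" "decides C (seq_of X)" using P_plus_decide[OF K B(1)] by blast
    have "finite (C - A)" if "A \<in> T" for A
      by (rule finite_subset[of _ "B - A"]) (use C(2) B(2) that in auto)
    then have "good X C T" unfolding good_def using C by blast
    then have "good X (SOME B. good X B T) T" by (rule someI)
    then show ?case unfolding T_def g[of X, symmetric] .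
  qed
  have chain: "finite (A - B) \<or> finite (B - A)" if AB: "A \<in> range g" "B \<in> range g" for A B
  proof -
    obtain Y where Y: "A = g Y" using AB(1) by blast
    obtain Z where Z: "B = g Z" using AB(2) by blast
    have "Y = Z \<or> (Y, Z) \<in> r - Id \<or> (Z, Y) \<in> r - Id"
      using wo co(2) unfolding well_order_on_def linear_order_on_def total_on_def by blast
    then show ?thesis using good[of Y] good[of Z] unfolding good_def Y Z by auto
  qed
  have gK: "g X \<notin> K" for X using good[of X] unfolding good_def by blast
  have inf: "infinite B" if "B \<in> range g" for B using that gK ideal_finite[OF K'] by blast
  have dec: "\<exists>B\<in>range g. decides B Y" for Y
  proof -
    obtain X where "seq_of X = Y" using seq_of_surj by blast
    then show ?thesis using good[of X] unfolding good_def by blast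
  qed
  have U: "P_point {X. \<exists>B\<in>range g. finite (B - X)}" by (rule tower_P_point[OF inf chain dec])
  have "A \<in> dual_ideal {X. \<exists>B\<in>range g. finite (B - X)}" if A: "A \<in> K" for A
  proof -
    obtain B where B: "B \<in> range g" "decides B (\<lambda>_. A)" using dec by blast
    \<comment> \<open>A positive set is not almost contained in \<open>A\<close>, so the tower must
      decide against \<open>A\<close>.\<close>
    have "\<not> finite (B - A)" using ideal_almost_subset[OF K' A] B(1) gK by blast
    then have "finite (B \<inter> A)" using B(2) unfolding decides_def by blast
    then have "- A \<in> {X. \<exists>B\<in>range g. finite (B - X)}" using B(1) by (auto simp: Diff_eq)
    then show ?thesis unfolding dual_ideal_def by (intro CollectI exI[of _ "- A"]) simp
  qed
  with U show ?thesis by blast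
qed

lemma countable_chain_positive:
  assumes K: "P_plus_ideal K" and T: "countable T" "T \<inter> K = {}" "almost_chain T"
  shows "\<exists>B. B \<notin> K \<and> (\<forall>A\<in>T. finite (B - A))"
proof (cases "T = {}")
  case True
  then show ?thesis using K ideal_UNIV unfolding P_plus_ideal_def by blast
next
  case False
  have K': "ideal K" using K unfolding P_plus_ideal_def by blast
  define a where "a = from_nat_into T"
  have aT: "a n \<in> T" for n unfolding a_def by (rule from_nat_into[OF False])
  define A where "A n = (\<Inter>i\<le>n. a i)" for n
  have "\<exists>i\<le>n. finite (a i - A n)" for n
  proof (induction n)
    case 0
    show ?case unfolding A_def by auto
  next
    case (Suc n)
    then obtain i where i: "i \<le> n" "finite (a i - A n)" by blast
    have AS: "A (Suc n) = A n \<inter> a (Suc n)" unfolding A_def by (auto simp: le_Suc_eq)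
    from T(3) aT have "finite (a i - a (Suc n)) \<or> finite (a (Suc n) - a i)" unfolding almost_chain_def by blast
    then show ?case
    proof
      assume "finite (a i - a (Suc n))"
      then have "finite (a i - A (Suc n))" unfolding AS Diff_Int using i(2) by blast
      then show ?thesis using i(1) le_SucI by blast
    next
      assume "finite (a (Suc n) - a i)"
      then have "finite (a (Suc n) - A n)" by (rule almost_subset_trans[OF _ i(2)])
      then have "finite (a (Suc n) - A (Suc n))" unfolding AS Diff_Int by simp
      then show ?thesis by blast
    qed
  qed
  then have "A n \<notin> K" for n using ideal_almost_subset[OF K', of "A n"] T(2) aT by blast
  moreover have "A (Suc n) \<subseteq> A n" for n unfolding A_def by auto
  ultimately obtain B where B: "B \<notin> K" "\<And>n. finite (B - A n)" using P_plus_pseudointersection[OF K, of A] by blast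
  have "finite (B - X)" if x: "X \<in> T" for X
  proof -
    obtain n where "X = a n" unfolding a_def using from_nat_into_surj[OF T(1) x] by metis
    then show ?thesis by (intro finite_subset[OF _ B(2)[of n]]) (auto simp: A_def)
  qed
  with B(1) show ?thesis by blast
qed

theorem CH_P_point:
  assumes CH and "extendable_to_P_plus J"
  shows "\<exists>U. P_point U \<and> \<not> J_point J U"
proof -
  obtain K where K: "P_plus_ideal K" "J \<subseteq> K" using assms(2) unfolding extendable_to_P_plus_def by blast
  have "\<exists>U. P_point U \<and> K \<subseteq> dual_ideal U"
  proof (rule ex_P_point_avoiding[OF K(1)])
    fix T assume T: "|T| <o |UNIV :: nat set set|" "T \<inter> K = {}" "almost_chain T"
    have "\<not> (\<exists>f. bij_betw f T (UNIV :: nat set set))"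
      using T(1) card_of_ordIso not_ordLess_ordIso by blast
    then have "countable T" using assms(1) unfolding CH_def by blast
    then show "\<exists>B. B \<notin> K \<and> (\<forall>A\<in>T. finite (B - A))" by (rule countable_chain_positive[OF K(1) _ T(2,3)])
  qed
  then obtain U where U: "P_point U" "K \<subseteq> dual_ideal U" by blast
  have "ideal_le one_one J (dual_ideal U)"
    unfolding ideal_le_def one_one_def using K(2) U(2) by (intro bexI[of _ id]) auto
  with U(1) show ?thesis unfolding J_point_def by blast
qed

lemma not_J_point_cases:
  assumes "P_point U"
  shows "\<not> J_point J U \<Longrightarrow> \<not> weak_J_ultrafilter J U" "\<not> weak_J_ultrafilter J U \<Longrightarrow> \<not> J_ultrafilter J U"
    "ideal J \<Longrightarrow> \<not> J_ultrafilter J U \<Longrightarrow> extendable_to_P_plus J"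
proof -
  have u: "ultrafilter U" using assms unfolding P_point_def by blast
  show "\<not> J_point J U \<Longrightarrow> \<not> weak_J_ultrafilter J U"
    unfolding J_point_def weak_J_ultrafilter_def ideal_le_def one_one_def fin_one_def using u
    by (auto intro: finite_vimageI)
  show "\<not> weak_J_ultrafilter J U \<Longrightarrow> \<not> J_ultrafilter J U"
    unfolding J_ultrafilter_def weak_J_ultrafilter_def ideal_le_def using u by auto
  show "ideal J \<Longrightarrow> \<not> J_ultrafilter J U \<Longrightarrow> extendable_to_P_plus J"
    using P_point_extendable[OF assms] u unfolding J_ultrafilter_def by blast
qed

lemma P_point_equivalences:
  assumes J: "ideal J" and "extendable_to_P_plus J \<Longrightarrow> \<exists>U. P_point U \<and> \<not> J_point J U"
  shows "(extendable_to_P_plus J \<longleftrightarrow> (\<exists>U. P_point U \<and> \<not> J_point J U)) \<and>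
        (extendable_to_P_plus J \<longleftrightarrow> (\<exists>U. P_point U \<and> \<not> weak_J_ultrafilter J U)) \<and>
        (extendable_to_P_plus J \<longleftrightarrow> (\<exists>U. P_point U \<and> \<not> J_ultrafilter J U))"
proof -
  note c = not_J_point_cases(1)[where J = J] not_J_point_cases(2)[where J = J]
    not_J_point_cases(3)[OF _ J]
  show ?thesis
    by (intro conjI iffI; (elim exE conjE)?) (meson assms(2) c)+
qed

section \<open>The ideal coded by a witness\<close>

text \<open>A function \<open>x\<close> declares the pair \<open>(n, s)\<close> alive by the value 0, and otherwise names a child of
  \<open>n\<close> by the value \<open>Suc v\<close>. A set is small if, for some \<open>N\<close>, its initial segments above \<open>N\<close> are
  covered by at most \<open>N\<close> pieces, each of which extends a dead \<open>s\<close> and is alive for the named child.\<close>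

definition posP :: "nat list \<Rightarrow> nat list \<Rightarrow> nat" where
  "posP n s = prod_encode (list_encode n, list_encode s)"

definition piece :: "borel_code \<Rightarrow> (nat \<Rightarrow> nat) \<Rightarrow> nat \<Rightarrow> nat \<Rightarrow> nat \<Rightarrow> bool" where
  "piece c x N j t \<longleftrightarrow> (\<exists>n s v s'. t = prod_encode (posP n s, list_encode s') \<and> posP n s < N \<and>
     x (posP n s) = Suc v \<and> x (posP (n @ [v]) s') = 0 \<and> tn c s' \<and> pfx s s' \<and> j \<le> length s')"

text \<open>The one parameter \<open>N\<close> bounds the number of pieces and the codes of the dead
  pairs, and it also marks where the covering starts. This makes covers monotone in \<open>N\<close>
  and lets covers for \<open>N\<close> and \<open>M\<close> be joined to one for
  \<open>N + M\<close>, whence an ideal.\<close>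

definition covers :: "borel_code \<Rightarrow> (nat \<Rightarrow> nat) \<Rightarrow> nat \<Rightarrow> nat \<Rightarrow> nat set \<Rightarrow> nat list \<Rightarrow> bool" where
  "covers c x N j X ts \<longleftrightarrow> length ts \<le> N \<and> (\<forall>k<length ts. piece c x N j (nthl ts k)) \<and>
     (\<forall>i<j. N \<le> i \<and> i \<in> X \<longrightarrow> (\<exists>k<length ts. inA i (list_decode (snd (prod_decode (nthl ts k))))))"

definition cov :: "borel_code \<Rightarrow> (nat \<Rightarrow> nat) \<Rightarrow> nat \<Rightarrow> nat \<Rightarrow> nat set \<Rightarrow> bool" where
  "cov c x N j X \<longleftrightarrow> (\<exists>ts. covers c x N j X ts)"

text \<open>Covers for different \<open>j\<close> need not cohere. Hence non-membership means that
  for each \<open>N\<close> there is a single \<open>j\<close> without cover, which depends only on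
  the finite part of the set between \<open>N\<close> and \<open>j\<close>: positivity has finite
  certificates.\<close>

definition KI :: "borel_code \<Rightarrow> (nat \<Rightarrow> nat) \<Rightarrow> nat set set" where
  "KI c x = {X. \<exists>N. \<forall>j. cov c x N j X}"

definition wit :: "borel_code \<Rightarrow> (nat \<Rightarrow> nat) \<Rightarrow> bool" where
  "wit c x \<longleftrightarrow> x (posP [] []) \<noteq> 0 \<and>
     (\<forall>n s v. x (posP n s) = Suc v \<longrightarrow> list_encode (n @ [v]) \<in> treeS c) \<and>
     (\<forall>N. \<exists>j. \<not> cov c x N j UNIV)"

lemma posP_inject [simp]: "posP n s = posP m t \<longleftrightarrow> n = m \<and> s = t"
  unfolding posP_def by (metis list_encode_inverse prod.inject prod_encode_inverse)

lemma posP_surj: "\<exists>n s. p = posP n s"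
  unfolding posP_def by (metis list_decode_inverse prod_decode_inverse surj_pair)

lemma nthl_append: "nthl (xs @ ys) k = (if k < length xs then nthl xs k else nthl ys (k - length xs))"
  by (auto simp: nthl_def nth_append)

lemma piece_mono: "piece c x N j t \<Longrightarrow> N \<le> M \<Longrightarrow> piece c x M j t"
proof -
  assume "piece c x N j t" and le: "N \<le> M"
  then obtain n s v s' where *: "t = prod_encode (posP n s, list_encode s')" "posP n s < N"
     "x (posP n s) = Suc v" "x (posP (n @ [v]) s') = 0" "tn c s'" "pfx s s'" "j \<le> length s'"
    unfolding piece_def by blast
  have "posP n s < M" using *(2) le by simp
  with * show "piece c x M j t" unfolding piece_def by blast
qed

lemma cov_mono:
  assumes "cov c x N j X" "N \<le> M" "\<And>i. M \<le> i \<Longrightarrow> i < j \<Longrightarrow> i \<in> Y \<Longrightarrow> i \<in> X"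
  shows "cov c x M j Y"
proof -
  obtain ts where ts: "covers c x N j X ts" using assms(1) unfolding cov_def by blast
  have "covers c x M j Y ts" unfolding covers_def
  proof (intro conjI allI impI)
    show "length ts \<le> M" using ts assms(2) unfolding covers_def by simp
    show "piece c x M j (nthl ts k)" if "k < length ts" for k
      using ts that assms(2) piece_mono[of c x N j _ M] unfolding covers_def by simp
    show "\<exists>k<length ts. inA i (list_decode (snd (prod_decode (nthl ts k))))" if "i < j" "M \<le> i \<and> i \<in> Y" for i
      using ts that assms(2,3) unfolding covers_def by simp
  qed
  then show ?thesis unfolding cov_def by blast
qed

lemma cov_Un:
  assumes "cov c x N j X" "cov c x M j Y" shows "cov c x (N + M) j (X \<union> Y)"
proof -
  obtain ts us where ts: "covers c x N j X ts" and us: "covers c x M j Y us" using assms unfolding cov_def by blast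
  have "covers c x (N + M) j (X \<union> Y) (ts @ us)" unfolding covers_def
  proof (intro conjI allI impI)
    show "length (ts @ us) \<le> N + M" using ts us unfolding covers_def by simp
    show "piece c x (N + M) j (nthl (ts @ us) k)" if "k < length (ts @ us)" for k
      using ts us that piece_mono[of c x N j _ "N + M"] piece_mono[of c x M j _ "N + M"]
      unfolding covers_def nthl_append by simp
    fix i assume i: "i < j" "N + M \<le> i \<and> i \<in> X \<union> Y"
    show "\<exists>k<length (ts @ us). inA i (list_decode (snd (prod_decode (nthl (ts @ us) k))))"
    proof (cases "i \<in> X")
      case True
      then obtain k where "k < length ts" "inA i (list_decode (snd (prod_decode (nthl ts k))))"
        using ts i unfolding covers_def by auto
      then show ?thesis by (intro exI[of _ k]) (simp add: nthl_append)
    next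
      case False
      then obtain k where "k < length us" "inA i (list_decode (snd (prod_decode (nthl us k))))"
        using us i unfolding covers_def by auto
      then show ?thesis by (intro exI[of _ "length ts + k"]) (simp add: nthl_append)
    qed
  qed
  then show ?thesis unfolding cov_def by blast
qed

lemma cov_Nil: "X \<subseteq> {..<N} \<Longrightarrow> cov c x N j X"
  unfolding cov_def covers_def by (intro exI[of _ "[]"]) auto

lemma mem_KI: "X \<in> KI c x \<longleftrightarrow> (\<exists>N. \<forall>j. cov c x N j X)"
  unfolding KI_def by (rule mem_Collect_eq)

lemma KI_ideal:
  assumes "wit c x" shows "ideal (KI c x)"
  unfolding ideal_on_def
proof (intro conjI ballI allI impI)
  show "A \<union> B \<in> KI c x" if A: "A \<in> KI c x" and B: "B \<in> KI c x" for A B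
  proof -
    obtain N where "\<forall>j. cov c x N j A" using A unfolding KI_def by blast
    moreover obtain M where "\<forall>j. cov c x M j B" using B unfolding KI_def by blast
    ultimately have "cov c x (N + M) j (A \<union> B)" for j by (intro cov_Un) simp_all
    then show ?thesis unfolding KI_def by blast
  qed
  show "B \<in> KI c x" if A: "A \<in> KI c x" "B \<subseteq> A" for A B
  proof -
    obtain N where N: "\<forall>j. cov c x N j A" using iffD1[OF mem_KI A(1)] by (elim exE)
    have "cov c x N j B" for j
      by (rule cov_mono[OF N[THEN spec]]) (use A(2) in auto)
    then show ?thesis unfolding mem_KI by (intro exI allI)
  qed
  show "A \<in> KI c x" if fin: "finite A \<and> A \<subseteq> UNIV" for A
  proof -
    obtain N where "A \<subseteq> {..<N}" using fin finite_nat_iff_bounded[of A] by blast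
    from cov_Nil[OF this] show ?thesis unfolding mem_KI by (intro exI allI)
  qed
  show "UNIV \<notin> KI c x" using assms[unfolded wit_def, THEN conjunct2, THEN conjunct2] unfolding KI_def by simp
qed (rule subset_UNIV)

text \<open>From the n-th set only a finite part is kept, just enough to certify that
  \<open>n\<close> is no bound for a cover. The union has certificates for all \<open>n\<close> and
  is almost contained in each set of a decreasing sequence.\<close>

definition diag :: "borel_code \<Rightarrow> (nat \<Rightarrow> nat) \<Rightarrow> (nat \<Rightarrow> nat set) \<Rightarrow> nat set" where
  "diag c x A = {i. \<exists>n. i \<in> A n \<and> n \<le> i \<and> i < (LEAST j. \<not> cov c x n j (A n))}"

lemma diag_positive:
  assumes A: "\<forall>n. A n \<notin> KI c x" shows "diag c x A \<notin> KI c x"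
proof
  assume "diag c x A \<in> KI c x"
  then obtain N where N: "\<forall>j. cov c x N j (diag c x A)" unfolding mem_KI by (elim exE)
  define j where "j = (LEAST j. \<not> cov c x N j (A N))"
  have "\<exists>j. \<not> cov c x N j (A N)" using A[THEN spec, of N] unfolding mem_KI by metis
  then have "\<not> cov c x N j (A N)" unfolding j_def by (rule LeastI_ex)
  moreover have "cov c x N j (A N)"
    by (rule cov_mono[OF N[THEN spec]]) (auto simp: diag_def j_def)
  ultimately show False ..
qed

lemma diag_almost:
  assumes sub: "\<forall>n. A (Suc n) \<subseteq> A n" shows "finite (diag c x A - A n)"
proof (rule finite_subset)
  show "diag c x A - A n \<subseteq> (\<Union>m\<le>n. {..<LEAST j. \<not> cov c x m j (A m)})"
  proof
    fix i assume i: "i \<in> diag c x A - A n"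
    then obtain m where m: "i \<in> A m" "i < (LEAST j. \<not> cov c x m j (A m))" unfolding diag_def by blast
    have "m \<le> n"
    proof (rule ccontr)
      assume "\<not> m \<le> n"
      then have "A m \<subseteq> A n" by (intro lift_Suc_antimono_le[where f = A, OF sub[THEN spec]]) simp
      then show False using m i by blast
    qed
    then show "i \<in> (\<Union>m\<le>n. {..<LEAST j. \<not> cov c x m j (A m)})" using m(2) by blast
  qed
qed simp

lemma KI_P_plus:
  assumes "wit c x" shows "P_plus_ideal (KI c x)"
proof -
  have "\<exists>B. B \<notin> KI c x \<and> B \<subseteq> A 0 \<and> (\<forall>n. finite (B \<inter> (A n - A (Suc n))))"
    if A: "\<forall>n. A n \<notin> KI c x" and sub: "\<forall>n. A (Suc n) \<subseteq> A n" for A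
  proof (intro exI[of _ "diag c x A"] conjI allI)
    show "diag c x A \<notin> KI c x" by (rule diag_positive[OF A])
    have "A n \<subseteq> A 0" for n by (rule lift_Suc_antimono_le[where f = A, OF sub[THEN spec]]) simp
    then show "diag c x A \<subseteq> A 0" unfolding diag_def by blast
    show "finite (diag c x A \<inter> (A n - A (Suc n)))" for n
      by (rule finite_subset[OF _ diag_almost[OF sub, of c x "Suc n"]]) blast
  qed
  then show ?thesis unfolding P_plus_ideal_def using KI_ideal[OF assms] by simp
qed

lemma Nil_in_treeS: "list_encode [] \<in> treeS c"
proof (rule iffD2[OF treeS_iff], unfold list_encode_inverse)
  have "gd c []" by (simp add: gd_def)
  then show "apx c S []" for S unfolding apx_def by auto
qed

text \<open>Follow the approximations to a member \<open>A\<close> of the family. If one is dead at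
  a node with named child, then either all its extensions along \<open>A\<close> are alive for the
  child, and these single pieces put \<open>A\<close> into \<open>KI c x\<close>, or some extension
  is dead for the child. The second case cannot recur forever, because the tree has no
  branch.\<close>

lemma (in coded_ideal) coded_subset_KI:
  assumes w: "wit c x" shows "coded_family c \<subseteq> KI c x"
proof
  fix A assume "A \<in> coded_family c"
  then obtain T where T: "code_eval c A T" "0 \<in> T" unfolding coded_family_def by blast
  obtain y where y: "\<And>n. gd c (map y [0..<n])" "\<And>i. bitA (y i) \<noteq> 0 \<longleftrightarrow> i \<in> A" "\<And>i. bitT (y i) \<noteq> 0 \<longleftrightarrow> i \<in> T"
    by (rule gd_of_eval[OF T(1)], blast)
  have tny: "tn c (map y [0..<n])" for n unfolding tn_def using y(1) y(3)[of 0] T(2) by simp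
  have pf: "pfx (map y [0..<l]) (map y [0..<m])" if "l \<le> m" for l m using that unfolding pfx_def by simp
  show "A \<in> KI c x"
  proof (rule ccontr)
    assume nA: "A \<notin> KI c x"
    define dead where "dead n \<longleftrightarrow> list_encode n \<in> treeS c \<and> (\<exists>l. x (posP n (map y [0..<l])) \<noteq> 0)" for n
    have step: "\<exists>v. dead (n @ [v])" if n: "dead n" for n
    proof -
      obtain l v where v: "x (posP n (map y [0..<l])) = Suc v" using n unfolding dead_def using not0_implies_Suc by blast
      have S: "list_encode (n @ [v]) \<in> treeS c" using w v unfolding wit_def by blast
      have "\<exists>l'. x (posP (n @ [v]) (map y [0..<l'])) \<noteq> 0"
      proof (rule ccontr)
        assume "\<nexists>l'. x (posP (n @ [v]) (map y [0..<l'])) \<noteq> 0"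
        then have z: "x (posP (n @ [v]) (map y [0..<l'])) = 0" for l' by blast
        define N where "N = Suc (posP n (map y [0..<l]))"
        have "cov c x N j A" for j
        proof -
          define s' where "s' = map y [0..<max l j]"
          define t where "t = prod_encode (posP n (map y [0..<l]), list_encode s')"
          have "piece c x N j t" unfolding piece_def
            by (rule exI[of _ n], rule exI[of _ "map y [0..<l]"], rule exI[of _ v], rule exI[of _ s'])
              (use v z tny pf[of l "max l j"] in \<open>simp add: t_def N_def s'_def\<close>)
          then have "covers c x N j A [t]" unfolding covers_def
            using y(2) by (auto simp: N_def nthl_def t_def inA_def s'_def)
          then show ?thesis unfolding cov_def by blast
        qed
        then show False using nA unfolding KI_def by blast
      qed
      with S show ?thesis unfolding dead_def by blast
    qed
    have "x (posP [] (map y [0..<0])) \<noteq> 0" using w unfolding wit_def by simp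
    then have d0: "dead []" using Nil_in_treeS unfolding dead_def by blast
    define m where "m = rec_nat [] (\<lambda>k n. n @ [SOME v. dead (n @ [v])])"
    define f where "f k = (SOME v. dead (m k @ [v]))" for k
    have mS: "m 0 = []" "m (Suc k) = m k @ [f k]" for k by (simp_all add: m_def f_def)
    have "dead (m k)" for k
    proof (induction k)
      case (Suc k)
      show ?case unfolding mS f_def by (rule someI_ex[OF step[OF Suc]])
    qed (simp add: mS d0)
    moreover have "m k = map f [0..<k]" for k by (induction k) (simp_all add: mS)
    ultimately have "list_encode (map f [0..<k]) \<in> treeS c" for k unfolding dead_def by metis
    with treeS_no_branch[of f] show False by blast
  qed
qed

lemma (in coded_ideal) wit_extendable: "wit c x \<Longrightarrow> extendable_to_P_plus (coded_family c)"
  unfolding extendable_to_P_plus_def using KI_P_plus coded_subset_KI by blast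

section \<open>Existence of witnesses\<close>

text \<open>Given a set \<open>al\<close> of live pairs, a set \<open>X\<close> is in the class of \<open>(m, s)\<close> if its initial segments above
  some \<open>k\<close> are covered by single live extensions of \<open>s\<close>; a pair \<open>(n, s)\<close> stays alive if for each child of \<open>n\<close>
  the class contains a set in \<open>U\<close>. The witness is read off from the largest fixed point.\<close>

definition inC :: "borel_code \<Rightarrow> nat set \<Rightarrow> nat list \<Rightarrow> nat list \<Rightarrow> nat set \<Rightarrow> bool" where
  "inC c al m s X \<longleftrightarrow> (\<exists>k. \<forall>j. \<exists>s'. tn c s' \<and> pfx s s' \<and> j \<le> length s' \<and> posP m s' \<in> al \<and>
     (\<forall>i<j. k \<le> i \<and> i \<in> X \<longrightarrow> inA i s'))"

definition liveF :: "borel_code \<Rightarrow> nat set set \<Rightarrow> nat set \<Rightarrow> nat set" where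
  "liveF c U al = {posP n s | n s. \<forall>v. list_encode (n @ [v]) \<in> treeS c \<longrightarrow> (\<exists>X\<in>U. inC c al (n @ [v]) s X)}"

definition bad :: "borel_code \<Rightarrow> nat set set \<Rightarrow> nat set \<Rightarrow> nat list \<Rightarrow> nat list \<Rightarrow> nat \<Rightarrow> bool" where
  "bad c U al n s v \<longleftrightarrow> list_encode (n @ [v]) \<in> treeS c \<and> \<not> (\<exists>X\<in>U. inC c al (n @ [v]) s X)"

definition witx :: "borel_code \<Rightarrow> nat set set \<Rightarrow> nat set \<Rightarrow> nat \<Rightarrow> nat" where
  "witx c U al p = (if p \<in> al then 0 else
     Suc (LEAST v. bad c U al (list_decode (fst (prod_decode p))) (list_decode (snd (prod_decode p))) v))"

text \<open>A single set coding, for each \<open>i\<close>, the set of those \<open>j\<close> for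
  which the \<open>k\<close>-th piece of the first cover up to \<open>j\<close> contains
  \<open>i\<close> and extends the pair \<open>p\<close>. These are the sets along which the
  \<open>U\<close>-limit of the covers is formed; as one set, they can be required to lie in
  \<open>R\<close>.\<close>

definition limF :: "borel_code \<Rightarrow> (nat \<Rightarrow> nat) \<Rightarrow> nat \<Rightarrow> nat \<Rightarrow> nat \<Rightarrow> nat set" where
  "limF c x N k p = {z. let ts = list_decode (LEAST t. covers c x N (snd (prod_decode z)) UNIV (list_decode t))
     in k < length ts \<and> fst (prod_decode (nthl ts k)) = p \<and>
        inA (fst (prod_decode z)) (list_decode (snd (prod_decode (nthl ts k))))}"

lemma inC_almost:
  assumes "inC c al m s X" "finite (B - X)" shows "inC c al m s B"
proof -
  obtain k where k: "\<forall>j. \<exists>s'. tn c s' \<and> pfx s s' \<and> j \<le> length s' \<and> posP m s' \<in> al \<and>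
     (\<forall>i<j. k \<le> i \<and> i \<in> X \<longrightarrow> inA i s')" using assms(1) unfolding inC_def by blast
  obtain l where l: "B - X \<subseteq> {..<l}" using assms(2) finite_nat_iff_bounded[of "B - X"] by blast
  show ?thesis unfolding inC_def
  proof (intro exI[of _ "max k l"] allI)
    fix j
    obtain s' where s': "tn c s' \<and> pfx s s' \<and> j \<le> length s' \<and> posP m s' \<in> al \<and>
      (\<forall>i<j. k \<le> i \<and> i \<in> X \<longrightarrow> inA i s')" using k by blast
    have "inA i s'" if i: "i < j" "max k l \<le> i" "i \<in> B" for i
    proof -
      have "i \<in> X" using i l by (auto simp: subset_iff)
      then show ?thesis using s' i by simp
    qed
    then show "\<exists>s'. tn c s' \<and> pfx s s' \<and> j \<le> length s' \<and> posP m s' \<in> al \<and>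
      (\<forall>i<j. max k l \<le> i \<and> i \<in> B \<longrightarrow> inA i s')" using s' by blast
  qed
qed

text \<open>Otherwise the live pairs, the thresholds and the extensions provided by
  \<open>inC\<close> for this one set \<open>B\<close>, together with an evaluation of the code at
  \<open>B\<close>, would make up an attempt.\<close>

lemma (in coded_ideal) root_dead:
  assumes B: "B \<notin> coded_family c"
    and inC: "\<And>n s v. posP n s \<in> al \<Longrightarrow> list_encode (n @ [v]) \<in> treeS c \<Longrightarrow> inC c al (n @ [v]) s B"
  shows "posP [] [] \<notin> al"
proof
  assume root: "posP [] [] \<in> al"
  obtain T where T: "code_eval c B T" using code_eval_ex1[OF code] by blast
  have "0 \<notin> T" using B coded_family_iff[OF code T] by simp
  obtain b where b: "\<And>n. gd c (map b [0..<n])" "\<And>i. bitA (b i) \<noteq> 0 \<longleftrightarrow> i \<in> B" "\<And>i. bitT (b i) \<noteq> 0 \<longleftrightarrow> i \<in> T"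
    by (rule gd_of_eval[OF T], blast)
  define P where "P m s k s' j \<longleftrightarrow> tn c s' \<and> pfx s s' \<and> j \<le> length s' \<and> posP m s' \<in> al \<and>
     (\<forall>i<j. k \<le> i \<and> i \<in> B \<longrightarrow> inA i s')" for m s k s' j
  define kap where "kap m s = (SOME k. \<forall>j. \<exists>s'. P m s k s' j)" for m s
  define ext where "ext m s j = (SOME s'. P m s (kap m s) s' j)" for m s j
  have ext: "P m s (kap m s) (ext m s j) j" if "inC c al m s B" for m s j
  proof -
    have "\<exists>k. \<forall>j. \<exists>s'. P m s k s' j" using that unfolding inC_def P_def .
    then have "\<forall>j. \<exists>s'. P m s (kap m s) s' j" unfolding kap_def by (rule someI_ex)
    then have "\<exists>s'. P m s (kap m s) s' j" ..
    then show ?thesis unfolding ext_def by (rule someI_ex)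
  qed
  \<comment> \<open>The tags 0, 1 and 2 are those of \<open>posB\<close>, \<open>posA\<close> and
    \<open>posS\<close>; the index 0 after tag 2 holds the threshold, and index \<open>Suc j\<close>
    the extension up to \<open>j\<close>.\<close>
  define y where "y p = (let (t, q) = prod_decode p in
     if t = 0 then b q else if t = 1 then (if q \<in> al then 1 else 0) else
     (let (m, r) = prod_decode q; (s, j) = prod_decode r in
       if j = 0 then kap (list_decode m) (list_decode s)
       else list_encode (ext (list_decode m) (list_decode s) (j - 1))))" for p
  have y: "y (posB i) = b i" "y (posA n s) = (if posP n s \<in> al then 1 else 0)" "y (posS m s 0) = kap m s"
    "y (posS m s (Suc j)) = list_encode (ext m s j)" for i n s m j
    unfolding y_def posB_def posA_def posS_def posP_def by simp_all
  have "attempt c (treeS c) y" unfolding attempt_def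
  proof (intro conjI)
    show "y (posA [] []) \<noteq> 0" unfolding y using root by simp
    show "\<forall>n. gd c (map (\<lambda>i. y (posB i)) [0..<n])" unfolding y using b(1) by blast
    show "bitT (y (posB 0)) = 0" unfolding y using b(3)[of 0] \<open>0 \<notin> T\<close> by blast
    show "\<forall>n v m s s' j. m = n @ [v] \<and> list_encode m \<in> treeS c \<and> y (posA n s) \<noteq> 0 \<and>
        s' = list_decode (y (posS m s (Suc j))) \<longrightarrow>
        tn c s' \<and> pfx s s' \<and> j \<le> length s' \<and> y (posA m s') \<noteq> 0 \<and>
        (\<forall>i. y (posS m s 0) \<le> i \<and> i < j \<and> bitA (y (posB i)) \<noteq> 0 \<longrightarrow> inA i s')"
    proof (intro allI impI, elim conjE)
      fix n v m s s' j
      assume m: "m = n @ [v]" "list_encode m \<in> treeS c" and al: "y (posA n s) \<noteq> 0"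
        and s': "s' = list_decode (y (posS m s (Suc j)))"
      have "inC c al m s B" unfolding m(1) by (rule inC) (use al m in \<open>simp_all add: y split: if_splits\<close>)
      from ext[OF this, of j] have "P m s (kap m s) s' j" unfolding s' y by simp
      then show "tn c s' \<and> pfx s s' \<and> j \<le> length s' \<and> y (posA m s') \<noteq> 0 \<and>
        (\<forall>i. y (posS m s 0) \<le> i \<and> i < j \<and> bitA (y (posB i)) \<noteq> 0 \<longrightarrow> inA i s')"
        unfolding P_def y b(2) by simp
    qed
  qed
  with no_attempt show False by blast
qed

text \<open>\<open>U\<close> is an ultrafilter on \<open>R\<close>, where \<open>R\<close> consists of all sets or of those of a model. If the
  whole of the natural numbers were small, then a \<open>U\<close>-limit of the covers would be a cover of a
  set in \<open>U\<close> by a single live piece.\<close>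

lemma wit_witx:
  assumes root: "posP [] [] \<notin> al" and al: "liveF c U al = al"
    and U: "{} \<notin> U" "\<And>A B. A \<in> U \<Longrightarrow> B \<in> U \<Longrightarrow> A \<inter> B \<in> U" "\<And>n. {n..} \<in> U"
    and Un: "\<And>S n. finite S \<Longrightarrow> S \<subseteq> R \<Longrightarrow> {n..} \<subseteq> \<Union>S \<Longrightarrow> \<exists>A\<in>S. A \<in> U"
    and R: "\<And>F. F \<in> R \<Longrightarrow> {i. seq_of F i \<in> U} \<in> R" "\<And>F i. F \<in> R \<Longrightarrow> seq_of F i \<in> R"
    and lim: "\<And>N k p. limF c (witx c U al) N k p \<in> R"
  shows "wit c (witx c U al)"
  unfolding wit_def
proof (intro conjI allI impI)
  define x where "x = witx c U al"
  have x0: "x p = 0 \<longleftrightarrow> p \<in> al" for p unfolding x_def witx_def by simp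
  have bad: "bad c U al n s v" if v: "x (posP n s) = Suc v" for n s v
  proof -
    have dead: "posP n s \<notin> al" using v x0[of "posP n s"] by simp
    then have "\<exists>v. bad c U al n s v" using al unfolding liveF_def bad_def by blast
    then have "bad c U al n s (LEAST v. bad c U al n s v)" by (rule LeastI_ex)
    moreover have "v = (LEAST v. bad c U al n s v)" using v dead unfolding x_def witx_def by (simp add: posP_def)
    ultimately show ?thesis by simp
  qed
  show "witx c U al (posP [] []) \<noteq> 0" using root x0 unfolding x_def by blast
  show "list_encode (n @ [v]) \<in> treeS c" if "witx c U al (posP n s) = Suc v" for n s v
    using bad[of n s v] that unfolding x_def bad_def by blast
  fix N
  show "\<exists>j. \<not> cov c (witx c U al) N j UNIV"
  proof (rule ccontr)
    assume "\<nexists>j. \<not> cov c (witx c U al) N j UNIV"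
    then have cv: "cov c x N j UNIV" for j unfolding x_def by blast
    define T where "T j = list_decode (LEAST t. covers c x N j UNIV (list_decode t))" for j
    have T: "covers c x N j UNIV (T j)" for j
    proof -
      have "\<exists>t. covers c x N j UNIV (list_decode t)" using cv[of j] unfolding cov_def by (metis list_encode_inverse)
      then show ?thesis unfolding T_def by (rule LeastI_ex)
    qed
    define F where "F k p = limF c x N k p" for k p
    have F: "j \<in> seq_of (F k p) i \<longleftrightarrow> k < length (T j) \<and> fst (prod_decode (nthl (T j) k)) = p \<and>
        inA i (list_decode (snd (prod_decode (nthl (T j) k))))" for i j k p
      unfolding F_def limF_def seq_of_def T_def by (simp add: Let_def)
    have FR: "F k p \<in> R" for k p unfolding F_def x_def by (rule lim)
    define X where "X k p = {i. seq_of (F k p) i \<in> U}" for k p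
    have XR: "X k p \<in> R" for k p unfolding X_def by (rule R(1)[OF FR])
    \<comment> \<open>Every \<open>i\<close> from \<open>N\<close> on lies, for each
      \<open>j > i\<close>, in some piece of the cover up to \<open>j\<close>. There are at most
      \<open>N\<close> pieces and fewer than \<open>N + 1\<close> codes of dead pairs, so one choice
      of \<open>k\<close> and \<open>p\<close> occurs for \<open>U\<close>-many
      \<open>j\<close>.\<close>
    have "{N..} \<subseteq> \<Union>((\<lambda>(k, p). X k p) ` ({..<N} \<times> {..<N}))"
    proof
      fix i assume i: "i \<in> {N..}"
      have "\<exists>A\<in>(\<lambda>(k, p). seq_of (F k p) i) ` ({..<N} \<times> {..<N}). A \<in> U"
      proof (rule Un)
        show "(\<lambda>(k, p). seq_of (F k p) i) ` ({..<N} \<times> {..<N}) \<subseteq> R" using R(2)[OF FR] by auto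
        show "{Suc i..} \<subseteq> \<Union>((\<lambda>(k, p). seq_of (F k p) i) ` ({..<N} \<times> {..<N}))"
        proof
          fix j assume "j \<in> {Suc i..}"
          then have "i < j" by simp
          then obtain k where k: "k < length (T j)" "inA i (list_decode (snd (prod_decode (nthl (T j) k))))"
            using T[of j] i unfolding covers_def by auto
          have "piece c x N j (nthl (T j) k)" "k < N" using T[of j] k(1) unfolding covers_def by simp_all
          then have "fst (prod_decode (nthl (T j) k)) < N" unfolding piece_def by auto
          moreover have "j \<in> seq_of (F k (fst (prod_decode (nthl (T j) k)))) i" unfolding F using k by simp
          ultimately show "j \<in> \<Union>((\<lambda>(k, p). seq_of (F k p) i) ` ({..<N} \<times> {..<N}))" using \<open>k < N\<close> by auto
        qed
      qed simp
      then show "i \<in> \<Union>((\<lambda>(k, p). X k p) ` ({..<N} \<times> {..<N}))" unfolding X_def by auto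
    qed
    then have "\<exists>A\<in>(\<lambda>(k, p). X k p) ` ({..<N} \<times> {..<N}). A \<in> U"
      by (intro Un) (use XR in auto)
    then obtain k p where XU: "X k p \<in> U" by auto
    \<comment> \<open>Finitely many elements of \<open>X k p\<close> lie together in the
      \<open>k\<close>-th piece of some cover with arbitrarily large \<open>j\<close>.\<close>
    have fin: "\<exists>j\<ge>n. \<forall>i\<in>I. j \<in> seq_of (F k p) i" if I: "finite I" "I \<subseteq> X k p" for I n
    proof -
      have "{n..} \<inter> (\<Inter>i\<in>I. seq_of (F k p) i) \<in> U"
        using I
      proof (induction I)
        case empty
        then show ?case using U(3) by simp
      next
        case (insert i I)
        have "({n..} \<inter> (\<Inter>i\<in>I. seq_of (F k p) i)) \<inter> seq_of (F k p) i \<in> U"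
          by (rule U(2)) (use insert in \<open>auto simp: X_def\<close>)
        then show ?case by (simp add: Int_ac)
      qed
      then have "{n..} \<inter> (\<Inter>i\<in>I. seq_of (F k p) i) \<noteq> {}" using U(1) by metis
      then show ?thesis by auto
    qed
    obtain i0 where i0: "i0 \<in> X k p" using XU U(1) by (metis ex_in_conv)
    obtain n s where p: "p = posP n s" using posP_surj by blast
    have pc: "\<exists>v s'. nthl (T j) k = prod_encode (posP n s, list_encode s') \<and>
       x (posP n s) = Suc v \<and> x (posP (n @ [v]) s') = 0 \<and> tn c s' \<and> pfx s s' \<and> j \<le> length s'"
      if j: "j \<in> seq_of (F k p) i" for i j
    proof -
      have k: "k < length (T j)" "fst (prod_decode (nthl (T j) k)) = posP n s" using j unfolding F p by auto
      then have "piece c x N j (nthl (T j) k)" using T[of j] unfolding covers_def by simp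
      then show ?thesis unfolding piece_def using k(2) by auto
    qed
    obtain j1 where "j1 \<in> seq_of (F k p) i0" using fin[of "{i0}" 0] i0 by auto
    from pc[OF this] obtain v where v: "x (posP n s) = Suc v" by blast
    \<comment> \<open>One live extension of \<open>s\<close> thus covers each initial segment of
      \<open>X k p\<close>, even from 0 on; but the child was named because its class contains no
      set in \<open>U\<close>.\<close>
    have "inC c al (n @ [v]) s (X k p)" unfolding inC_def
    proof (intro exI[of _ 0] allI)
      fix j0
      obtain j where j: "j \<ge> j0" "\<And>i. i \<in> insert i0 (X k p \<inter> {..<j0}) \<Longrightarrow> j \<in> seq_of (F k p) i"
        using fin[of "insert i0 (X k p \<inter> {..<j0})" j0] i0 by auto
      from pc[OF j(2)[OF insertI1]] v obtain s' where
        s': "nthl (T j) k = prod_encode (posP n s, list_encode s')" "x (posP (n @ [v]) s') = 0" "tn c s'" "pfx s s'" "j \<le> length s'"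
        by auto
      have "inA i s'" if i: "i < j0" "i \<in> X k p" for i using j(2)[of i] i unfolding F s'(1) by simp
      then show "\<exists>s'. tn c s' \<and> pfx s s' \<and> j0 \<le> length s' \<and> posP (n @ [v]) s' \<in> al \<and>
          (\<forall>i<j0. 0 \<le> i \<and> i \<in> X k p \<longrightarrow> inA i s')"
        using s' j(1) x0 by (intro exI[of _ s']) auto
    qed
    then show False using bad[OF v] XU unfolding bad_def by blast
  qed
qed

lemma inC_mono: "inC c a m s X \<Longrightarrow> a \<subseteq> b \<Longrightarrow> inC c b m s X"
  unfolding inC_def by (meson subsetD)

lemma liveF_mono: "a \<subseteq> b \<Longrightarrow> liveF c U a \<subseteq> liveF c U b"
proof
  fix p assume ab: "a \<subseteq> b" and "p \<in> liveF c U a"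
  then obtain n s where p: "p = posP n s"
    "\<forall>v. list_encode (n @ [v]) \<in> treeS c \<longrightarrow> (\<exists>X\<in>U. inC c a (n @ [v]) s X)" unfolding liveF_def by blast
  then have "\<forall>v. list_encode (n @ [v]) \<in> treeS c \<longrightarrow> (\<exists>X\<in>U. inC c b (n @ [v]) s X)"
    using inC_mono[OF _ ab] by blast
  with p(1) show "p \<in> liveF c U b" unfolding liveF_def by blast
qed

text \<open>Knaster-Tarski relative to \<open>R\<close>: a model can only form the union of the
  post-fixed points that it has, so this union and its image have to be known to lie in
  \<open>R\<close>.\<close>

lemma liveF_gfp:
  assumes "\<And>a. a \<in> R \<Longrightarrow> liveF c U a \<in> R" "\<Union>{a\<in>R. a \<subseteq> liveF c U a} \<in> R"
  shows "liveF c U (\<Union>{a\<in>R. a \<subseteq> liveF c U a}) = \<Union>{a\<in>R. a \<subseteq> liveF c U a}"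
proof
  define G where "G = \<Union>{a\<in>R. a \<subseteq> liveF c U a}"
  have 1: "G \<subseteq> liveF c U G"
  proof
    fix p assume "p \<in> G"
    then obtain a where a: "a \<in> R" "a \<subseteq> liveF c U a" "p \<in> a" unfolding G_def by blast
    then have "a \<subseteq> G" unfolding G_def by blast
    from liveF_mono[OF this] a show "p \<in> liveF c U G" by blast
  qed
  have GR: "G \<in> R" unfolding G_def by (rule assms(2))
  have "liveF c U G \<in> {a\<in>R. a \<subseteq> liveF c U a}"
    by (intro CollectI conjI assms(1)[OF GR] liveF_mono[OF 1])
  then have 2: "liveF c U G \<subseteq> G" unfolding G_def by (rule Union_upper)
  show "liveF c U (\<Union>{a\<in>R. a \<subseteq> liveF c U a}) \<subseteq> \<Union>{a\<in>R. a \<subseteq> liveF c U a}"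
    using 2 unfolding G_def .
  show "\<Union>{a\<in>R. a \<subseteq> liveF c U a} \<subseteq> liveF c U (\<Union>{a\<in>R. a \<subseteq> liveF c U a})"
    using 1 unfolding G_def .
qed

text \<open>Complements are asked for only within the cover, because the ultrafilter of a model
  decides only the sets of that model.\<close>

lemma finite_cover_large:
  assumes U: "{} \<notin> U" "\<And>A B. A \<in> U \<Longrightarrow> B \<in> U \<Longrightarrow> A \<inter> B \<in> U" "{n..} \<in> U"
    and C: "\<And>A. A \<in> S \<Longrightarrow> A \<in> U \<or> - A \<in> U" and S: "finite S" "{n..} \<subseteq> \<Union>S"
  shows "\<exists>A\<in>S. A \<in> U"
proof (rule ccontr)
  assume no: "\<not> (\<exists>A\<in>S. A \<in> U)"
  have "{n..} - \<Union>F \<in> U" if F: "finite F" "F \<subseteq> S" for F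
    using F
  proof (induction F)
    case (insert A F)
    then have "- A \<in> U" using no C[of A] by blast
    then have "({n..} - \<Union>F) \<inter> - A \<in> U" using insert by (intro U(2)) auto
    moreover have "({n..} - \<Union>F) \<inter> - A = {n..} - \<Union>(insert A F)" by blast
    ultimately show ?case by simp
  qed (simp add: U(3))
  from this[OF S(1) subset_refl] have "{} \<in> U" using S(2) by (simp add: Diff_eq_empty_iff[THEN iffD2])
  with U(1) show False ..
qed

text \<open>The complement of a maximal ideal above \<open>K\<close>. Its members are positive for
  \<open>K\<close>, so the property P+ of \<open>K\<close> yields pseudointersections of sequences
  from \<open>U\<close>, although \<open>U\<close> itself may fail to be a P-point.\<close>

lemma P_plus_ultrafilter:
  assumes K: "ideal K"
  obtains U where "ultrafilter U" "U \<inter> K = {}"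
proof -
  define \<J> where "\<J> = {I. ideal I \<and> K \<subseteq> I}"
  have "\<exists>M\<in>\<J>. \<forall>X\<in>\<J>. M \<subseteq> X \<longrightarrow> X = M"
  proof (rule subset_Zorn_nonempty)
    show "\<J> \<noteq> {}" unfolding \<J>_def using K by blast
    fix C assume ne: "C \<noteq> {}" and ch: "subset.chain \<J> C"
    have CJ: "I \<in> \<J>" if "I \<in> C" for I using ch that unfolding subset.chain_def by blast
    have id: "ideal I" if "I \<in> C" for I using CJ[OF that] unfolding \<J>_def by simp
    have "ideal (\<Union>C)" unfolding ideal_on_def
    proof (intro conjI ballI allI impI)
      fix A B assume A: "A \<in> \<Union>C" and B: "B \<in> \<Union>C"
      obtain I where I: "I \<in> C" "A \<in> I" using A by blast
      obtain H where H: "H \<in> C" "B \<in> H" using B by blast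
      have "I \<subseteq> H \<or> H \<subseteq> I" using ch I(1) H(1) unfolding subset.chain_def by blast
      then show "A \<union> B \<in> \<Union>C"
      proof
        assume "I \<subseteq> H"
        then have "A \<union> B \<in> H" using I H by (intro ideal_Un id) auto
        with H(1) show ?thesis by blast
      next
        assume "H \<subseteq> I"
        then have "A \<union> B \<in> I" using I H by (intro ideal_Un id) auto
        with I(1) show ?thesis by blast
      qed
    next
      fix A B assume A: "A \<in> \<Union>C" and B: "B \<subseteq> A"
      obtain I where I: "I \<in> C" "A \<in> I" using A by blast
      have "B \<in> I" by (rule ideal_subset[OF id[OF I(1)] I(2) B])
      with I(1) show "B \<in> \<Union>C" by blast
    next
      fix A :: "nat set" assume A: "finite A \<and> A \<subseteq> UNIV"
      obtain I where I: "I \<in> C" using ne by blast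
      have "A \<in> I" using ideal_finite[OF id[OF I]] A by simp
      with I show "A \<in> \<Union>C" by blast
    next
      show "UNIV \<notin> \<Union>C" using ideal_UNIV[OF id] by blast
    qed (rule subset_UNIV)
    moreover have "K \<subseteq> \<Union>C" using ne CJ unfolding \<J>_def by blast
    ultimately show "\<Union>C \<in> \<J>" unfolding \<J>_def by simp
  qed
  then obtain M where M: "M \<in> \<J>" "\<forall>X\<in>\<J>. M \<subseteq> X \<longrightarrow> X = M" by blast
  have iM: "ideal M" and KM: "K \<subseteq> M" using M(1) unfolding \<J>_def by auto
  have max: "- X \<in> M" if X: "X \<notin> M" for X
  proof -
    define I where "I = {Y. \<exists>m\<in>M. Y \<subseteq> m \<union> X}"
    have MI: "M \<subseteq> I" unfolding I_def by blast
    have XI: "X \<in> I" unfolding I_def using ideal_finite[OF iM, of "{}"] by blast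
    have "\<not> ideal I"
    proof
      assume "ideal I"
      then have "I \<in> \<J>" unfolding \<J>_def using KM MI by simp
      then show False using M(2) MI XI X by blast
    qed
    moreover have "ideal I" if U: "UNIV \<notin> I" unfolding ideal_on_def
    proof (intro conjI ballI allI impI U)
      fix A B assume A: "A \<in> I" and B: "B \<in> I"
      obtain m where m: "m \<in> M" "A \<subseteq> m \<union> X" using A unfolding I_def by blast
      obtain n where n: "n \<in> M" "B \<subseteq> n \<union> X" using B unfolding I_def by blast
      have "m \<union> n \<in> M" by (rule ideal_Un[OF iM m(1) n(1)])
      moreover have "A \<union> B \<subseteq> (m \<union> n) \<union> X" using m n by blast
      ultimately show "A \<union> B \<in> I" unfolding I_def by blast
    next
      fix A B :: "nat set" assume "A \<in> I" "B \<subseteq> A"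
      then show "B \<in> I" unfolding I_def using order_trans[of B A] by (simp, metis)
    next
      fix A :: "nat set" assume "finite A \<and> A \<subseteq> UNIV"
      then show "A \<in> I" using ideal_finite[OF iM, of A] MI by auto
    qed (rule subset_UNIV)
    ultimately have "UNIV \<in> I" by blast
    then obtain m where m: "m \<in> M" "UNIV \<subseteq> m \<union> X" unfolding I_def by blast
    show ?thesis by (rule ideal_subset[OF iM m(1)]) (use m(2) in blast)
  qed
  have "ultrafilter (- M)" unfolding ultrafilter_def
  proof (intro conjI ballI allI impI)
    show "{} \<notin> - M" using ideal_finite[OF iM, of "{}"] by simp
    show "B \<in> - M" if AB: "A \<in> - M" "A \<subseteq> B" for A B using ideal_subset[OF iM _ AB(2)] AB(1) by blast
    show "A \<inter> B \<in> - M" if A: "A \<in> - M" and B: "B \<in> - M" for A B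
    proof
      assume "A \<inter> B \<in> M"
      moreover have "- A \<in> M" "- B \<in> M" using max A B by auto
      ultimately have "(A \<inter> B) \<union> (- A \<union> - B) \<in> M" by (intro ideal_Un[OF iM])
      moreover have "(A \<inter> B) \<union> (- A \<union> - B) = UNIV" by blast
      ultimately show False using ideal_UNIV[OF iM] by simp
    qed
    show "A \<in> - M \<or> - A \<in> - M" for A
    proof (rule ccontr)
      assume "\<not> (A \<in> - M \<or> - A \<in> - M)"
      then have "A \<union> - A \<in> M" by (intro ideal_Un[OF iM]) auto
      then show False using ideal_UNIV[OF iM] by simp
    qed
    show "- A \<in> - M" if A: "finite A" for A
    proof
      assume "- A \<in> M"
      then have "A \<union> - A \<in> M" by (intro ideal_Un[OF iM] ideal_finite[OF iM A])
      then show False using ideal_UNIV[OF iM] by simp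
    qed
  qed
  moreover have "- M \<inter> K = {}" using KM by blast
  ultimately show ?thesis by (rule that)
qed

theorem (in coded_ideal) extendable_wit:
  assumes "extendable_to_P_plus (coded_family c)"
  shows "\<exists>x. wit c x"
proof -
  obtain K where K: "P_plus_ideal K" "coded_family c \<subseteq> K" using assms unfolding extendable_to_P_plus_def by blast
  have "ideal K" using K(1) unfolding P_plus_ideal_def by blast
  then obtain U where U: "ultrafilter U" "U \<inter> K = {}" by (rule P_plus_ultrafilter)
  have U0: "{} \<notin> U" and UI: "\<And>A B. A \<in> U \<Longrightarrow> B \<in> U \<Longrightarrow> A \<inter> B \<in> U" and UC: "\<And>A. A \<in> U \<or> - A \<in> U"
    and Uf: "\<And>A. finite A \<Longrightarrow> - A \<in> U" using U(1) unfolding ultrafilter_def by simp_all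
  define al where "al = \<Union>{a\<in>UNIV. a \<subseteq> liveF c U a}"
  have al: "liveF c U al = al" unfolding al_def by (rule liveF_gfp) simp_all
  define P where "P q X \<longleftrightarrow> X \<in> U \<and> (\<forall>n s v. q = prod_encode (posP n s, v) \<and> posP n s \<in> al \<and>
      list_encode (n @ [v]) \<in> treeS c \<longrightarrow> inC c al (n @ [v]) s X)" for q X
  have "\<exists>X. P q X" for q
  proof -
    obtain p v where "q = prod_encode (p, v)" by (metis prod_decode_inverse surj_pair)
    moreover obtain n s where "p = posP n s" using posP_surj[of p] by blast
    ultimately have q: "q = prod_encode (posP n s, v)" by simp
    show ?thesis
    proof (cases "posP n s \<in> al \<and> list_encode (n @ [v]) \<in> treeS c")
      case True
      then have "posP n s \<in> liveF c U al" unfolding al by blast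
      then obtain X where "X \<in> U" "inC c al (n @ [v]) s X" unfolding liveF_def using True by auto
      then show ?thesis unfolding P_def q by (intro exI[of _ X]) simp
    next
      case False
      have "UNIV \<in> U" using Uf[of "{}"] by simp
      then show ?thesis unfolding P_def q using False by (intro exI[of _ UNIV]) auto
    qed
  qed
  then have "\<forall>q. \<exists>X. P q X" ..
  from choice[OF this] obtain X where X: "\<forall>q. P q (X q)" ..
  \<comment> \<open>One set in \<open>U\<close> for each live pair and child is enough, and there
    are countably many. A positive pseudointersection \<open>B\<close> of them belongs to all the
    classes at once.\<close>
  define A where "A n = (\<Inter>q\<le>n. X q)" for n
  have "A n \<in> U" for n
  proof (induction n)
    case 0
    then show ?case using X unfolding A_def P_def by simp
  next
    case (Suc n)
    then show ?case using X UI[of "X (Suc n)" "A n"] unfolding A_def P_def atMost_Suc by simp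
  qed
  then have "A n \<notin> K" for n using U(2) by blast
  moreover have "A (Suc n) \<subseteq> A n" for n unfolding A_def by auto
  ultimately obtain B where B: "B \<notin> K" "\<And>n. finite (B - A n)" using P_plus_pseudointersection[OF K(1), of A] by blast
  have "posP [] [] \<notin> al"
  proof (rule root_dead[of B])
    show "B \<notin> coded_family c" using B(1) K(2) by blast
    fix n s v assume *: "posP n s \<in> al" "list_encode (n @ [v]) \<in> treeS c"
    define q where "q = prod_encode (posP n s, v)"
    have "inC c al (n @ [v]) s (X q)" using X[THEN spec, of q] * unfolding P_def q_def by blast
    moreover have "finite (B - X q)" by (rule finite_subset[OF _ B(2)[of q]]) (auto simp: A_def)
    ultimately show "inC c al (n @ [v]) s B" by (rule inC_almost)
  qed
  then have "wit c (witx c U al)"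
  proof (rule wit_witx[where R = UNIV, OF _ al U0 UI])
    show "{n..} \<in> U" for n :: nat using Uf[of "{..<n}"] by (simp add: Compl_lessThan)
    then have tail: "{n..} \<in> U" for n :: nat .
    fix S :: "nat set set" and n assume S: "finite S" "{n..} \<subseteq> \<Union>S"
    show "\<exists>A\<in>S. A \<in> U"
      by (rule finite_cover_large[OF U0 UI tail UC S])
  qed simp_all
  then show ?thesis by blast
qed

section \<open>P-points from p = c\<close>

lemma small_sfip_pseudointersection:
  fixes G :: "nat set set"
  assumes "p_eq_c" and G: "|G| <o |UNIV :: nat set set|"
    and sfip: "\<And>H. finite H \<Longrightarrow> H \<subseteq> G \<Longrightarrow> infinite (\<Inter>H)"
  shows "\<exists>B. infinite B \<and> (\<forall>A\<in>G. finite (B - A))"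
proof (rule ccontr)
  assume "\<not> ?thesis"
  then have nG: "sfip_no_pseudointersection G" unfolding sfip_no_pseudointersection_def using sfip by blast
  define \<F> where "\<F> = card_of ` {F. sfip_no_pseudointersection F}"
  have "\<exists>r\<in>\<F>. \<forall>r'\<in>\<F>. r \<le>o r'"
    by (rule exists_minim_Card_order) (use nG in \<open>auto simp: \<F>_def card_of_Card_order\<close>)
  then have "\<exists>F. sfip_no_pseudointersection F \<and> (\<forall>G. sfip_no_pseudointersection G \<longrightarrow> |F| \<le>o |G| )"
    unfolding \<F>_def by auto
  from someI_ex[OF this] nG have "pseudointersection_number \<le>o |G|" unfolding pseudointersection_number_def by blast
  then have "pseudointersection_number <o |UNIV :: nat set set|" using G by (rule ordLeq_ordLess_trans)
  then show False using assms(1) unfolding p_eq_c_def using not_ordLess_ordIso by auto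
qed

text \<open>Finitely many members of an almost-chain have one that is almost contained in all of
  them; deleting finitely many points makes the inclusions exact.\<close>

lemma finite_chain_positive:
  assumes K: "ideal K" and T: "T \<inter> K = {}" "almost_chain T" and S: "finite S" "S \<subseteq> T"
  shows "\<exists>A. A \<notin> K \<and> (\<forall>B\<in>S. A \<subseteq> B)"
proof -
  have "\<exists>A. (A \<in> T \<or> A = UNIV) \<and> (\<forall>B\<in>S. finite (A - B))" using S
  proof (induction S)
    case (insert B S)
    then obtain A where A: "A \<in> T \<or> A = UNIV" "\<forall>B\<in>S. finite (A - B)" by auto
    have BT: "B \<in> T" using insert by simp
    have "finite (A - B) \<or> finite (B - A)"
      using A(1) BT T(2) unfolding almost_chain_def by auto
    then show ?case
    proof
      assume "finite (A - B)"
      with A show ?thesis by (intro exI[of _ A]) simp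
    next
      assume BA: "finite (B - A)"
      have "finite (B - C)" if "C \<in> S" for C by (rule almost_subset_trans[OF BA]) (use A(2) that in blast)
      with BT show ?thesis by (intro exI[of _ B]) simp
    qed
  qed auto
  then obtain A where A: "A \<in> T \<or> A = UNIV" "\<forall>B\<in>S. finite (A - B)" by blast
  have nA: "A \<notin> K" using A(1) T(1) ideal_UNIV[OF K] by blast
  define D where "D = A - (\<Union>B\<in>S. A - B)"
  have "finite (\<Union>B\<in>S. A - B)" using S(1) A(2) by blast
  moreover have "A - D \<subseteq> (\<Union>B\<in>S. A - B)" unfolding D_def by blast
  ultimately have "finite (A - D)" using finite_subset by blast
  then have "D \<notin> K" using ideal_almost_subset[OF K, of D A] nA by blast
  then show ?thesis by (intro exI[of _ D]) (auto simp: D_def)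
qed

text \<open>The definition of the pseudointersection number cannot produce a positive
  pseudointersection directly, so it is applied to sets of finite certificates of positivity instead
  of to the chain. The union of the finite sets in the certificates obtained is positive and almost
  contained in every member of the chain.\<close>

lemma KI_chain_positive:
  assumes p: p_eq_c and w: "wit c x" and T: "|T| <o |UNIV :: nat set set|" "T \<inter> KI c x = {}" "almost_chain T"
  shows "\<exists>B. B \<notin> KI c x \<and> (\<forall>A\<in>T. finite (B - A))"
proof -
  \<comment> \<open>A code in \<open>pr A\<close> is a number n with a finite subset of
    \<open>A\<close> above n that has no cover with bound n. The tails \<open>tl\<close> make n tend
    to infinity along a pseudointersection.\<close>
  define pr where "pr A = {z. set (list_decode (snd (prod_decode z))) \<subseteq> A \<inter> {fst (prod_decode z)..} \<and>
     (\<exists>j. \<not> cov c x (fst (prod_decode z)) j (set (list_decode (snd (prod_decode z)))))}" for A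
  define tl where "tl k = {z \<in> pr UNIV. k \<le> fst (prod_decode z)}" for k :: nat
  have pr_mono: "pr A \<subseteq> pr B" if "A \<subseteq> B" for A B using that unfolding pr_def by auto
  have ex: "\<exists>z\<in>pr A. fst (prod_decode z) = n" if A: "A \<notin> KI c x" for A n
  proof -
    obtain j where j: "\<not> cov c x n j A" using A unfolding mem_KI by blast
    obtain l where l: "set l = A \<inter> {n..<j}" using finite_list[of "A \<inter> {n..<j}"] by auto
    have "\<not> cov c x n j (set l)"
    proof
      assume "cov c x n j (set l)"
      then have "cov c x n j A" by (rule cov_mono) (simp_all add: l)
      with j show False ..
    qed
    then show ?thesis using l by (intro bexI[of _ "prod_encode (n, list_encode l)"]) (auto simp: pr_def)
  qed
  define G where "G = pr ` T \<union> range tl"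
  have "|pr ` T| <o |UNIV :: nat set set|" using card_of_image T(1) by (rule ordLeq_ordLess_trans)
  moreover have "|range tl| <o |UNIV :: nat set set|"
  proof -
    have "|range tl| \<le>o |UNIV :: nat set|" by (rule card_of_image)
    moreover have "|UNIV :: nat set| <o |UNIV :: nat set set|" using card_of_Pow[of "UNIV :: nat set"] by simp
    ultimately show ?thesis by (rule ordLeq_ordLess_trans)
  qed
  ultimately have G: "|G| <o |UNIV :: nat set set|"
    unfolding G_def by (intro card_of_Un_ordLess_infinite) (simp add: Finite_Set.finite_set)
  have "\<exists>B. infinite B \<and> (\<forall>A\<in>G. finite (B - A))"
  proof (rule small_sfip_pseudointersection[OF p G])
    fix H assume H: "finite H" "H \<subseteq> G"
    have "\<exists>S K. finite S \<and> finite K \<and> S \<subseteq> T \<and> H \<subseteq> pr ` S \<union> tl ` K"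
    proof -
      have "finite (H \<inter> pr ` T)" "H \<inter> pr ` T \<subseteq> pr ` T" using H(1) by auto
      from finite_subset_image[OF this] obtain S where S: "S \<subseteq> T" "finite S" "H \<inter> pr ` T = pr ` S" by blast
      have "finite (H \<inter> range tl)" "H \<inter> range tl \<subseteq> range tl" using H(1) by auto
      from finite_subset_image[OF this] obtain K where K: "finite K" "H \<inter> range tl = tl ` K" by blast
      have "H = H \<inter> pr ` T \<union> H \<inter> range tl" using H(2) unfolding G_def by auto
      then have "H \<subseteq> pr ` S \<union> tl ` K" unfolding S(3) K(2) by (rule equalityD1)
      with S K show ?thesis by blast
    qed
    then obtain S K where S: "finite S" "S \<subseteq> T" and K: "finite K" and HS: "H \<subseteq> pr ` S \<union> tl ` K" by blast
    have "\<exists>A. A \<notin> KI c x \<and> (\<forall>B\<in>S. A \<subseteq> B)"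
      by (rule finite_chain_positive[OF KI_ideal[OF w] T(2,3) S])
    then obtain A where A: "A \<notin> KI c x" "\<And>B. B \<in> S \<Longrightarrow> A \<subseteq> B" by blast
    have "\<exists>z\<in>\<Inter>H. fst (prod_decode z) = n" if n: "Max (insert 0 K) \<le> n" for n
    proof -
      obtain z where z: "z \<in> pr A" "fst (prod_decode z) = n" using ex[OF A(1)] by blast
      have "z \<in> pr B" if "B \<in> S" for B using z(1) A(2)[OF that] unfolding pr_def by blast
      moreover have "z \<in> tl k" if k: "k \<in> K" for k
      proof -
        have "k \<le> Max (insert 0 K)" using K k by simp
        then show ?thesis unfolding tl_def using n z pr_mono[of A UNIV] by auto
      qed
      ultimately have "z \<in> \<Inter>H" using HS by blast
      with z(2) show ?thesis by blast
    qed
    then have "{Max (insert 0 K)..} \<subseteq> (\<lambda>z. fst (prod_decode z)) ` \<Inter>H" by fastforce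
    then show "infinite (\<Inter>H)" using finite_surj infinite_Ici by blast
  qed
  then obtain P where P: "infinite P" "\<And>A. A \<in> G \<Longrightarrow> finite (P - A)" by blast
  define W where "W z = set (list_decode (snd (prod_decode z)))" for z
  define B where "B = (\<Union>z\<in>P \<inter> tl 0. W z)"
  have fin: "finite (P - tl k)" for k by (rule P(2)) (simp add: G_def)
  have "B \<notin> KI c x"
  proof
    assume "B \<in> KI c x"
    then obtain N where N: "\<forall>j. cov c x N j B" unfolding mem_KI by (elim exE)
    have "infinite (P \<inter> tl N)" 
    proof
      assume "finite (P \<inter> tl N)"
      then have "finite ((P \<inter> tl N) \<union> (P - tl N))" using fin[of N] by (rule finite_UnI)
      then show False using P(1) by (simp add: Int_Diff_Un)
    qed
    then have "P \<inter> tl N \<noteq> {}" by (metis finite.emptyI)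
    then obtain z where z: "z \<in> P" "z \<in> tl N" by blast
    have z0: "z \<in> tl 0" using z(2) unfolding tl_def by simp
    obtain j where j: "\<not> cov c x (fst (prod_decode z)) j (W z)" using z(2) unfolding tl_def pr_def W_def by blast
    have "W z \<subseteq> B" unfolding B_def using z(1) z0 by blast
    moreover have "N \<le> fst (prod_decode z)" using z(2) unfolding tl_def by simp
    ultimately have "cov c x (fst (prod_decode z)) j (W z)" by (intro cov_mono[OF N[THEN spec]]) auto
    with j show False ..
  qed
  moreover have "finite (B - A)" if A: "A \<in> T" for A
  proof (rule finite_subset)
    show "B - A \<subseteq> (\<Union>z\<in>P - pr A. W z)" unfolding B_def pr_def W_def by blast
    have "finite (P - pr A)" by (rule P(2)) (simp add: G_def A)
    then show "finite (\<Union>z\<in>P - pr A. W z)" unfolding W_def by simp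
  qed
  ultimately show ?thesis by blast
qed

theorem p_eq_c_P_point:
  assumes p: p_eq_c and J: "borel_family J" "ideal J" and e: "extendable_to_P_plus J"
  shows "\<exists>U. P_point U \<and> \<not> J_point J U"
proof -
  obtain c where c: "is_borel_code c" "coded_family c = J" using J(1) borel_family_iff_coded by blast
  interpret coded_ideal c using c J(2) by unfold_locales simp_all
  obtain x where x: "wit c x" using extendable_wit e c(2) by blast
  have "\<exists>U. P_point U \<and> KI c x \<subseteq> dual_ideal U"
    by (rule ex_P_point_avoiding[OF KI_P_plus[OF x]]) (rule KI_chain_positive[OF p x])
  then obtain U where U: "P_point U" "KI c x \<subseteq> dual_ideal U" by blast
  have "J \<subseteq> dual_ideal U" using coded_subset_KI[OF x] U(2) c(2) by simp
  then have "ideal_le one_one J (dual_ideal U)"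
    unfolding ideal_le_def one_one_def by (intro bexI[of _ id]) auto
  with U(1) show ?thesis unfolding J_point_def by blast
qed

section \<open>Absoluteness\<close>

context zfc_model
begin

lemma Dfn_Lsub1:
  assumes "Dfn (\<lambda>e. P (list_decode (nm (e 0))))" "LTrm t" shows "Dfn (\<lambda>e. P (t e))"
proof -
  have "Dfn (\<lambda>e. P (list_decode (nm (num (list_encode (t e))))))"
    by (rule Dfn_sub1[where P = "\<lambda>x. P (list_decode (nm x))", OF assms(1)])
      (use assms(2) in \<open>simp add: LTrm_def NTrm_def\<close>)
  then show ?thesis by simp
qed

lemma Dfn_Lsub2:
  assumes "Dfn (\<lambda>e. P (list_decode (nm (e 0))) (list_decode (nm (e 1))))" "LTrm t" "LTrm u"
  shows "Dfn (\<lambda>e. P (t e) (u e))"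
proof -
  have "Dfn (\<lambda>e. P (list_decode (nm (num (list_encode (t e))))) (list_decode (nm (num (list_encode (u e))))))"
    by (rule Dfn_sub2[where P = "\<lambda>x y. P (list_decode (nm x)) (list_decode (nm y))", OF assms(1)])
      (use assms(2,3) in \<open>simp_all add: LTrm_def NTrm_def\<close>)
  then show ?thesis by simp
qed

lemma Dfn_pfx [dfn]: assumes "LTrm t" "LTrm u" shows "Dfn (\<lambda>e. pfx (t e) (u e))"
  by (rule Dfn_Lsub2[OF _ assms]) (unfold pfx_def, intro dfn)

lemma LTrm_snoc [dfn]:
  assumes "LTrm t" "NTrm u" shows "LTrm (\<lambda>e. t e @ [u e])"
proof -
  have *: "x = xs @ [v] \<longleftrightarrow> length x = Suc (length xs) \<and> pfx xs x \<and> nthl x (length xs) = v" for x xs :: "nat list" and v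
  proof
    show "length x = Suc (length xs) \<and> pfx xs x \<and> nthl x (length xs) = v \<Longrightarrow> x = xs @ [v]"
      unfolding pfx_def nthl_def by (auto intro!: nth_equalityI simp: nth_append less_Suc_eq)
  qed (auto simp: pfx_def nthl_def nth_append)
  have "nm a = list_encode (list_decode m @ [v]) \<longleftrightarrow> list_decode (nm a) = list_decode m @ [v]" for a m v
    by (metis list_decode_inverse list_encode_inverse)
  then have "Dfn (\<lambda>e. nm (e 0) = list_encode (list_decode (nm (e 1)) @ [nm (e 2)]))"
    unfolding * by (simp only:) (intro dfn)
  from NTrm_sub2[where F = "\<lambda>m v. list_encode (list_decode m @ [v])", OF this, of "\<lambda>e. list_encode (t e)" u]
  show ?thesis using assms unfolding LTrm_def by simp
qed

lemma NTrm_posP [dfn]: "LTrm t \<Longrightarrow> LTrm u \<Longrightarrow> NTrm (\<lambda>e. posP (t e) (u e))"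
  unfolding posP_def by (intro dfn)

lemma Dfn_inA [dfn]: assumes "NTrm t" "LTrm u" shows "Dfn (\<lambda>e. inA (t e) (u e))"
  unfolding inA_def bitA_def by (intro dfn assms)

lemma Dfn_Rl_mem [dfn]: assumes "X \<in> Rl" "LTrm t" shows "Dfn (\<lambda>e. list_encode (t e) \<in> X)"
  by (rule Dfn_mem_Rl[OF assms(1)]) (intro dfn assms)

text \<open>The nodes of rank \<open>y\<close> of a tree, and the leftmost branch through the nodes without rank:
  well-foundedness of a tree is absolute.\<close>

theorem branch_absolute:
  assumes tree: "\<tau> \<in> Rl" and closed: "\<And>s t. list_encode t \<in> \<tau> \<Longrightarrow> pfx s t \<Longrightarrow> list_encode s \<in> \<tau>"
    and g: "\<And>k. list_encode (map g [0..<k]) \<in> \<tau>"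
  shows "\<exists>f. (\<forall>t. NTrm t \<longrightarrow> NTrm (\<lambda>e. f (t e))) \<and> (\<forall>k. list_encode (map f [0..<k]) \<in> \<tau>)"
proof -
  define below where "below t t' \<longleftrightarrow> pfx (list_decode t) (list_decode t') \<and>
    length (list_decode t) < length (list_decode t') \<and> t' \<in> \<tau>" for t t'
  have Dfn_below: "Dfn (\<lambda>e. below (t e) (u e))" if "NTrm t" "NTrm u" for t u
    unfolding below_def by (intro dfn that Dfn_mem_Rl[OF tree])
  \<comment> \<open>A node gets the rank \<open>y\<close> if all its proper extensions in the tree
    have ranks that are members of \<open>y\<close>. Any set may serve as a rank.\<close>
  define G where "G y h = st {t. \<forall>t'. below t t' \<longrightarrow> (\<exists>z. z \<epsilon> y \<and> t' \<in> rl (app h z))}" for y h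
  have GR: "{t. \<forall>t'. below t t' \<longrightarrow> (\<exists>z. z \<epsilon> y \<and> t' \<in> rl (app h z))} \<in> Rl" for y h
    by (rule Rl_I) (intro dfn Dfn_below)
  have "Trm (\<lambda>e. G (e 1) (e 2))" unfolding G_def
    by (rule Trm_st[OF _ GR]) (unfold mem_Collect_eq, intro dfn Dfn_below)
  note GD = Dfn_eq[OF Trm_var this]
  obtain f where f: "\<And>x. f x = G x (lam (elts x) f)" "Dfn (\<lambda>e. e 0 = f (e 1))"
      "\<And>x. small {opr y (f y) | y. y \<in> elts x}" by (rule mem_recursion[of G, OF GD], rule that)
  define W where "W y = rl (f y)" for y
  have W: "W y = {t. \<forall>t'. below t t' \<longrightarrow> (\<exists>z. z \<epsilon> y \<and> t' \<in> W z)}" for y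
  proof -
    have "W y = {t. \<forall>t'. below t t' \<longrightarrow> (\<exists>z. z \<epsilon> y \<and> t' \<in> rl (app (lam (elts y) f) z))}"
      unfolding W_def by (subst f(1)) (simp add: G_def GR)
    also have "\<dots> = {t. \<forall>t'. below t t' \<longrightarrow> (\<exists>z. z \<epsilon> y \<and> t' \<in> W z)}"
      unfolding W_def by (simp add: app_lam[OF f(3)] cong: conj_cong)
    finally show ?thesis .
  qed
  have DW: "Dfn (\<lambda>e. t e \<in> W (u e))" if "NTrm t" "Trm u" for t u
    unfolding W_def by (intro dfn that Trm_sub1[OF f(2)])
  have gW: "list_encode (map g [0..<k]) \<notin> W y" for k y
  proof (induction y arbitrary: k rule: mem_induct)
    case (step y)
    show ?case
    proof
      assume *: "list_encode (map g [0..<k]) \<in> W y"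
      have "below (list_encode (map g [0..<k])) (list_encode (map g [0..<Suc k]))"
        unfolding below_def list_encode_inverse pfx_def using g[of "Suc k"] by (simp del: upt_Suc)
      with * obtain z where "z \<epsilon> y" "list_encode (map g [0..<Suc k]) \<in> W z" using W[of y] by blast
      with step[of z "Suc k"] show False by blast
    qed
  qed
  have nxt: "\<exists>t'. below t t' \<and> (\<forall>y. t' \<notin> W y)" if t: "\<forall>y. t \<notin> W y" for t
  proof (rule ccontr)
    assume no: "\<not> ?thesis"
    have sm: "small (num ` {t'. below t t'})"
    proof -
      have "{t'. below t t'} \<in> Rl" by (rule Rl_I) (intro dfn Dfn_below)
      then show ?thesis unfolding Rl_def by simp
    qed
    have ex: "\<exists>y. nm x \<in> W y" if x: "x \<in> num ` {t'. below t t'}" for x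
    proof -
      obtain t' where "x = num t'" "below t t'" using x by blast
      then show ?thesis using no by auto
    qed
    have "Dfn (\<lambda>e. nm (e 0) \<in> W (e 1))" by (intro dfn DW)
    \<comment> \<open>Ranks of the extensions are collected into a set, which itself is then a rank
      of \<open>t\<close>.\<close>
    obtain B where B: "small B" "\<And>x. x \<in> num ` {t'. below t t'} \<Longrightarrow> \<exists>y\<in>B. nm x \<in> W y"
      by (rule collection[of "num ` {t'. below t t'}" "\<lambda>x y. nm x \<in> W y", OF sm \<open>Dfn (\<lambda>e. nm (e 0) \<in> W (e 1))\<close> ex], assumption, rule that)
    have "\<exists>z. z \<epsilon> mk B \<and> t' \<in> W z" if t': "below t t'" for t' using B(2)[of "num t'"] t' mem_mk[OF B(1)] by auto
    then have "t \<in> W (mk B)" unfolding W[of "mk B"] by blast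
    with t show False by blast
  qed
  define step where "step t = (LEAST t'. below t t' \<and> (\<forall>y. t' \<notin> W y))" for t
  have step: "below t (step t) \<and> (\<forall>y. step t \<notin> W y)" if "\<forall>y. t \<notin> W y" for t
    unfolding step_def by (rule LeastI_ex[OF nxt[OF that]])
  define S where "S = rec_nat (num 0) (\<lambda>_ x. num (step (nm x)))"
  have TS: "Trm (\<lambda>e. S (t e))" if "NTrm t" for t
  proof (rule Trm_natrec[where F = S, OF _ _ _ that])
    show "S 0 = num 0" by (simp add: S_def)
    show "S (Suc n) = num (step (nm (S n)))" for n by (simp add: S_def)
    have "Trm (\<lambda>e. num (step (nm (e 2))))" unfolding step_def by (intro dfn Dfn_below DW)
    then show "Dfn (\<lambda>e. e 0 = num (step (nm (e 2))))" by (rule Dfn_eq[OF Trm_var])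
  qed
  define s where "s n = list_decode (nm (S n))" for n
  have Ls: "LTrm (\<lambda>e. s (t e))" if "NTrm t" for t unfolding s_def by (intro dfn TS that)
  have big: "\<forall>y. nm (S n) \<notin> W y" for n
  proof (induction n)
    case 0
    then show ?case using gW[of 0] by (simp add: S_def del: num.simps)
  next
    case (Suc n)
    then show ?case using step[OF Suc] by (simp add: S_def)
  qed
  have bel: "below (nm (S n)) (nm (S (Suc n)))" for n using step[OF big[of n]] by (simp add: S_def)
  have pf: "pfx (s n) (s (Suc n))" "length (s n) < length (s (Suc n))" "list_encode (s (Suc n)) \<in> \<tau>" for n
    using bel[of n] unfolding below_def s_def by simp_all
  have len: "n \<le> length (s n)" for n
  proof (induction n)
    case (Suc n)
    then show ?case using pf(2)[of n] by simp
  qed simp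
  have pf': "pfx (s n) (s (n + d))" for n d
    by (induction d) (use pfx_trans[OF _ pf(1)] in auto)
  define h where "h i = nthl (s (Suc i)) i" for i
  have "NTrm (\<lambda>e. h (t e))" if "NTrm t" for t unfolding h_def by (intro dfn Ls that)
  moreover have "list_encode (map h [0..<k]) \<in> \<tau>" for k
  proof (rule closed[OF pf(3)[of k]])
    have "h i = nthl (s (Suc k)) i" if "i < k" for i
    proof -
      have "pfx (s (Suc i)) (s (Suc k))" using pf'[of "Suc i" "k - i"] that by simp
      then show ?thesis unfolding pfx_def h_def using len[of "Suc i"] by simp
    qed
    then show "pfx (map h [0..<k]) (s (Suc k))" unfolding pfx_def using len[of "Suc k"] by simp
  qed
  ultimately show ?thesis by blast
qed

end

text \<open>Positions beyond the list are read as dead. A longer list can therefore only turn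
  further pieces alive: covers persist, and the absence of a cover passes to prefixes, which makes
  the approximations a tree.\<close>

definition xu :: "nat list \<Rightarrow> nat \<Rightarrow> nat" where
  "xu u p = (if p < length u then fst (prod_decode (nthl u p)) else 1)"

text \<open>Finite approximations to a witness together with a bound for the failure of covers.\<close>

definition wapx :: "borel_code \<Rightarrow> nat list \<Rightarrow> bool" where
  "wapx c u \<longleftrightarrow> (posP [] [] < length u \<longrightarrow> xu u (posP [] []) \<noteq> 0) \<and>
     (\<forall>n s v. posP n s < length u \<and> xu u (posP n s) = Suc v \<longrightarrow> list_encode (n @ [v]) \<in> treeS c) \<and>
     (\<forall>N<length u. \<not> cov c (xu u) N (snd (prod_decode (nthl u N))) UNIV)"

lemma covers_transfer:
  assumes ts: "covers c x N j X ts" and eq: "\<And>p. p < N \<Longrightarrow> x p \<noteq> 0 \<Longrightarrow> x' p = x p"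
    and live: "\<And>k n s v s'. k < length ts \<Longrightarrow> nthl ts k = prod_encode (posP n s, list_encode s') \<Longrightarrow>
      x (posP n s) = Suc v \<Longrightarrow> x (posP (n @ [v]) s') = 0 \<Longrightarrow> x' (posP (n @ [v]) s') = 0"
  shows "cov c x' N j X"
proof -
  have "piece c x' N j (nthl ts k)" if k: "k < length ts" for k
  proof -
    have "piece c x N j (nthl ts k)" using ts k unfolding covers_def by blast
    then obtain n s v s' where *: "nthl ts k = prod_encode (posP n s, list_encode s')" "posP n s < N"
      "x (posP n s) = Suc v" "x (posP (n @ [v]) s') = 0" "tn c s' \<and> pfx s s' \<and> j \<le> length s'"
      unfolding piece_def by blast
    have "x' (posP n s) = Suc v" using eq[OF *(2)] *(3) by simp
    moreover have "x' (posP (n @ [v]) s') = 0" by (rule live[OF k *(1,3,4)])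
    ultimately show ?thesis unfolding piece_def using * by blast
  qed
  then have "covers c x' N j X ts" using ts unfolding covers_def by blast
  then show ?thesis unfolding cov_def by blast
qed

lemma cov_transfer:
  assumes "cov c x N j X" "\<And>p. p < N \<Longrightarrow> x p \<noteq> 0 \<Longrightarrow> x' p = x p" "\<And>p. x p = 0 \<Longrightarrow> x' p = 0"
  shows "cov c x' N j X"
proof -
  obtain ts where ts: "covers c x N j X ts" using assms(1) unfolding cov_def by blast
  show ?thesis by (rule covers_transfer[OF ts]) (simp_all add: assms(2,3))
qed

lemma wapx_pfx:
  assumes t: "wapx c t" and s: "pfx s t" shows "wapx c s"
proof -
  have eq: "xu s p = xu t p" "nthl s p = nthl t p" "p < length t" if "p < length s" for p
    using s that unfolding pfx_def xu_def by auto
  have out: "xu s p = 1" if "\<not> p < length s" for p using that unfolding xu_def by simp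
  have "\<not> cov c (xu s) N (snd (prod_decode (nthl s N))) UNIV" if N: "N < length s" for N
  proof
    assume *: "cov c (xu s) N (snd (prod_decode (nthl s N))) UNIV"
    have "cov c (xu t) N (snd (prod_decode (nthl s N))) UNIV"
    proof (rule cov_transfer[OF *])
      show "xu t p = xu s p" if "p < N" for p using eq(1)[of p] that N by simp
      show "xu t p = 0" if "xu s p = 0" for p using eq(1)[of p] out[of p] that by (cases "p < length s") simp_all
    qed
    then show False using t eq(2,3)[OF N] unfolding wapx_def by simp
  qed
  moreover have "length s \<le> length t" using s unfolding pfx_def by blast
  moreover have "\<forall>n s' v. posP n s' < length t \<and> xu t (posP n s') = Suc v \<longrightarrow> list_encode (n @ [v]) \<in> treeS c"
    "posP [] [] < length t \<longrightarrow> xu t (posP [] []) \<noteq> 0" using t unfolding wapx_def by blast+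
  ultimately show ?thesis using eq unfolding wapx_def by (metis less_le_trans)
qed

lemma wit_wapx:
  assumes w: "wit c x" and th: "\<And>N. \<not> cov c x N (th N) UNIV"
  shows "wapx c (map (\<lambda>i. prod_encode (x i, th i)) [0..<k])"
proof -
  define u where "u = map (\<lambda>i. prod_encode (x i, th i)) [0..<k]"
  have u: "length u = k" "xu u p = (if p < k then x p else 1)" "p < k \<Longrightarrow> nthl u p = prod_encode (x p, th p)" for p
    unfolding u_def xu_def by simp_all
  have "\<not> cov c (xu u) N (snd (prod_decode (nthl u N))) UNIV" if N: "N < k" for N
  proof
    assume "cov c (xu u) N (snd (prod_decode (nthl u N))) UNIV"
    then have "cov c x N (snd (prod_decode (nthl u N))) UNIV"
      by (rule cov_transfer) (use N in \<open>auto simp: u(2) split: if_splits\<close>)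
    then show False using th[of N] u(3)[OF N] by simp
  qed
  then show ?thesis using w unfolding wapx_def wit_def u_def[symmetric] u(1) by (auto simp: u(2))
qed

lemma wapx_wit:
  assumes f: "\<And>k. wapx c (map f [0..<k])"
  shows "wit c (\<lambda>i. fst (prod_decode (f i)))"
proof -
  define x where "x i = fst (prod_decode (f i))" for i
  have u: "xu (map f [0..<k]) p = (if p < k then x p else 1)" for k p
    unfolding xu_def x_def by simp
  have "x (posP [] []) \<noteq> 0" using f[of "Suc (posP [] [])"] unfolding wapx_def u by simp
  moreover have "list_encode (n @ [v]) \<in> treeS c" if "x (posP n s) = Suc v" for n s v
    using f[of "Suc (posP n s)", unfolded wapx_def, THEN conjunct2, THEN conjunct1, THEN spec, of n, THEN spec, of s, THEN spec, of v] that
    by (simp add: u del: upt_Suc)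
  moreover have "\<not> cov c x N (snd (prod_decode (f N))) UNIV" for N
  proof
    assume "cov c x N (snd (prod_decode (f N))) UNIV"
    then obtain ts where ts: "covers c x N (snd (prod_decode (f N))) UNIV ts" unfolding cov_def by blast
    \<comment> \<open>A cover relies on the liveness of finitely many pairs, whose positions these
      are; a prefix longer than all of them would admit the same cover.\<close>
    define pos where "pos k = posP (list_decode (fst (prod_decode (fst (prod_decode (nthl ts k))))) @
        [x (fst (prod_decode (nthl ts k))) - 1]) (list_decode (snd (prod_decode (nthl ts k))))" for k
    define K where "K = Suc (N + (\<Sum>k<length ts. pos k))"
    have K: "pos k < K" if "k < length ts" for k
      unfolding K_def using member_le_sum[of k "{..<length ts}" pos] that by simp
    have "cov c (xu (map f [0..<K])) N (snd (prod_decode (f N))) UNIV"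
    proof (rule covers_transfer[OF ts])
      show "xu (map f [0..<K]) p = x p" if "p < N" for p using that unfolding u K_def by simp
      fix k n s v s' assume k: "k < length ts" "nthl ts k = prod_encode (posP n s, list_encode s')"
        "x (posP n s) = Suc v" "x (posP (n @ [v]) s') = 0"
      have "pos k = posP (n @ [v]) s'" unfolding pos_def k(2) using k(3) by (simp add: posP_def)
      then show "xu (map f [0..<K]) (posP (n @ [v]) s') = 0" using K[OF k(1)] k(4) unfolding u by simp
    qed
    moreover have "N < K" unfolding K_def by simp
    ultimately show False using f[of K] unfolding wapx_def by simp
  qed
  ultimately show ?thesis unfolding wit_def x_def by blast
qed

section \<open>Objects computed from the code that belong to every transitive model containing
  it\<close>

locale coded_model = zfc_model mem for mem :: "'a \<Rightarrow> 'a \<Rightarrow> bool" (infix "\<epsilon>" 50) +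
  fixes c :: borel_code and l r :: 'a
  assumes l: "represents (fst c) l" and r: "represents (snd c) r"
begin

lemma represents_opr: "represents R a \<Longrightarrow> opr (num m) (num n) \<epsilon> a \<longleftrightarrow> (m, n) \<in> R"
  unfolding represents_def is_numeral_iff is_opair_iff by auto

lemma Dfn_fst_code [dfn]: assumes "NTrm t" "NTrm u" shows "Dfn (\<lambda>e. (t e, u e) \<in> fst c)"
  unfolding represents_opr[OF l, symmetric] by (intro dfn assms)

lemma Dfn_snd_code [dfn]: assumes "NTrm t" "NTrm u" shows "Dfn (\<lambda>e. (t e, u e) \<in> snd c)"
  unfolding represents_opr[OF r, symmetric] by (intro dfn assms)

lemma Dfn_gd [dfn]: assumes "LTrm t" shows "Dfn (\<lambda>e. gd c (t e))"
  by (rule Dfn_Lsub1[OF _ assms]) (unfold gd_def bitA_def bitT_def, intro dfn)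

lemma Dfn_tn [dfn]: assumes "LTrm t" shows "Dfn (\<lambda>e. tn c (t e))"
  unfolding tn_def bitT_def by (intro dfn assms)

lemma treeS_Rl [simp]: "treeS c \<in> Rl"
proof -
  \<comment> \<open>The recursion for the tree is certified by a finite list \<open>a\<close>, which
    holds the characteristic function up to \<open>k\<close>.\<close>
  define chain where "chain a k \<longleftrightarrow> (\<forall>j<Suc k. nthl a j \<noteq> 0 \<longleftrightarrow> apx c {i. i < j \<and> nthl a i \<noteq> 0} (list_decode j))" for a k
  have chain: "nthl a j \<noteq> 0 \<longleftrightarrow> j \<in> treeS c" if a: "chain a k" "j \<le> k" for a j k
    using a(2)
  proof (induction j rule: less_induct)
    case (less j)
    have "{i. i < j \<and> nthl a i \<noteq> 0} = treeS c \<inter> {..<j}" using less by auto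
    then show ?case using a(1) less.prems treeS_iff[of j c] unfolding chain_def by simp
  qed
  have "k \<in> treeS c \<longleftrightarrow> (\<exists>a. chain a k \<and> nthl a k \<noteq> 0)" for k
  proof
    assume k: "k \<in> treeS c"
    define a where "a = map (\<lambda>i. if i \<in> treeS c then 1 else 0::nat) [0..<Suc k]"
    have a: "nthl a i \<noteq> 0 \<longleftrightarrow> i \<in> treeS c" if "i \<le> k" for i using that unfolding a_def nthl_map by simp
    have "chain a k" unfolding chain_def
    proof (intro allI impI)
      fix j assume j: "j < Suc k"
      have "{i. i < j \<and> nthl a i \<noteq> 0} = treeS c \<inter> {..<j}" using a j by auto
      then show "nthl a j \<noteq> 0 \<longleftrightarrow> apx c {i. i < j \<and> nthl a i \<noteq> 0} (list_decode j)"
        using a[of j] j treeS_iff[of j c] by simp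
    qed
    then show "\<exists>a. chain a k \<and> nthl a k \<noteq> 0" using a[of k] k by blast
  qed (use chain in blast)
  moreover have "{k. \<exists>a. chain a k \<and> nthl a k \<noteq> 0} \<in> Rl"
    by (rule Rl_I, unfold chain_def apx_def posA_def posB_def posS_def bitA_def bitT_def mem_Collect_eq) (intro dfn)
  moreover have "treeS c = {k. k \<in> treeS c}" by simp
  ultimately show ?thesis by (simp only:)
qed

lemma wapx_Rl: "{t. wapx c (list_decode t)} \<in> Rl"
  by (rule Rl_I, unfold wapx_def cov_def covers_def piece_def xu_def)
    (intro dfn Dfn_mem_Rl[OF Rl_UNIV] treeS_Rl)

theorem wit_absolute:
  assumes "wit c x"
  shows "\<exists>y. wit c y \<and> (\<forall>t. NTrm t \<longrightarrow> NTrm (\<lambda>e. y (t e)))"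
proof -
  have "\<forall>N. \<exists>j. \<not> cov c x N j UNIV" using assms unfolding wit_def by blast
  from Hilbert_Choice.choice[OF this] obtain th where th: "\<forall>N. \<not> cov c x N (th N) UNIV" ..
  define \<tau> where "\<tau> = {t. wapx c (list_decode t)}"
  have t: "list_encode u \<in> \<tau> \<longleftrightarrow> wapx c u" for u unfolding \<tau>_def by simp
  have "\<exists>f. (\<forall>t. NTrm t \<longrightarrow> NTrm (\<lambda>e. f (t e))) \<and> (\<forall>k. list_encode (map f [0..<k]) \<in> \<tau>)"
  proof (rule branch_absolute)
    show "\<tau> \<in> Rl" unfolding \<tau>_def by (rule wapx_Rl)
    show "list_encode s \<in> \<tau>" if "list_encode u \<in> \<tau>" "pfx s u" for s u
      using wapx_pfx that unfolding t by blast
    show "list_encode (map (\<lambda>i. prod_encode (x i, th i)) [0..<k]) \<in> \<tau>" for k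
      unfolding t by (rule wit_wapx[OF assms]) (use th in blast)
  qed
  then obtain f where f: "\<And>t. NTrm t \<Longrightarrow> NTrm (\<lambda>e. f (t e))" "\<And>k. list_encode (map f [0..<k]) \<in> \<tau>" by blast
  show ?thesis
  proof (intro exI[of _ "\<lambda>i. fst (prod_decode (f i))"] conjI allI impI)
    show "wit c (\<lambda>i. fst (prod_decode (f i)))" by (rule wapx_wit) (use f(2) t in blast)
    show "NTrm (\<lambda>e. fst (prod_decode (f (t e))))" if "NTrm t" for t by (intro dfn f(1) that)
  qed
qed

text \<open>An evaluation found in the model is one in the universe. Conversely, evaluations at
  \<open>rl b\<close> are branches of a tree of the model, so the model has one if the universe has
  one; uniqueness in the universe makes them agree.\<close>

lemma in_coded_family_iff:
  assumes code: "is_borel_code c" and b: "sub b omg"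
  shows "in_coded_family omg l r b \<longleftrightarrow> rl b \<in> coded_family c"
proof -
  have rel: "related l (num n) (num k) \<longleftrightarrow> (n, k) \<in> fst c" "related r (num n) (num k) \<longleftrightarrow> (n, k) \<in> snd c" for n k
    unfolding related_iff represents_opr[OF l] represents_opr[OF r] by simp_all
  have ev: "(\<forall>n. n \<epsilon> omg \<longrightarrow> (n \<epsilon> t \<longleftrightarrow> (\<exists>k. k \<epsilon> b \<and> related l n k) \<or>
      (\<exists>m. m \<epsilon> omg \<and> related r n m \<and> \<not> m \<epsilon> t))) \<longleftrightarrow> code_eval c (rl b) (rl t)" (is "?L \<longleftrightarrow> _") for t
  proof -
    have 1: "(\<exists>k. k \<epsilon> b \<and> related l (num n) k) \<longleftrightarrow> (\<exists>k\<in>rl b. (n, k) \<in> fst c)" for n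
    proof
      assume "\<exists>k. k \<epsilon> b \<and> related l (num n) k"
      then obtain k where k: "k \<epsilon> b" "related l (num n) k" by blast
      obtain m where "k = num m" using k(1) b mem_omg unfolding sub_def by blast
      then show "\<exists>k\<in>rl b. (n, k) \<in> fst c" using k rel unfolding rl_def by blast
    qed (use rel in \<open>auto simp: rl_def\<close>)
    have 2: "(\<exists>m. m \<epsilon> omg \<and> related r (num n) m \<and> \<not> m \<epsilon> t) \<longleftrightarrow> (\<exists>m. (n, m) \<in> snd c \<and> m \<notin> rl t)" for n
      unfolding mem_omg rl_def using rel by auto
    have "?L \<longleftrightarrow> (\<forall>n. num n \<epsilon> t \<longleftrightarrow> (\<exists>k. k \<epsilon> b \<and> related l (num n) k) \<or>
      (\<exists>m. m \<epsilon> omg \<and> related r (num n) m \<and> \<not> m \<epsilon> t))" unfolding mem_omg by blast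
    then show ?thesis unfolding code_eval_def 1 2 by (simp add: rl_def)
  qed
  have z: "(\<exists>z. is_empty z \<and> z \<epsilon> t) \<longleftrightarrow> 0 \<in> rl t" for t unfolding is_empty_iff rl_def by simp
  have "in_coded_family omg l r b \<longleftrightarrow> (\<exists>t. sub t omg \<and> code_eval c (rl b) (rl t) \<and> 0 \<in> rl t)"
    unfolding in_coded_family_def ev z using b by blast
  also have "\<dots> \<longleftrightarrow> rl b \<in> coded_family c"
  proof
    assume "rl b \<in> coded_family c"
    then obtain T where T: "code_eval c (rl b) T" "0 \<in> T" unfolding coded_family_def by blast
    obtain x where x: "\<And>n. gd c (map x [0..<n])" "\<And>i. bitA (x i) \<noteq> 0 \<longleftrightarrow> i \<in> rl b" "\<And>i. bitT (x i) \<noteq> 0 \<longleftrightarrow> i \<in> T"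
      by (rule gd_of_eval[OF T(1)], blast)
    \<comment> \<open>Good lists whose first components describe \<open>rl b\<close>; only the
      evaluation is left open.\<close>
    define \<tau> where "\<tau> = {t. gd c (list_decode t) \<and> (\<forall>i<length (list_decode t). bitA (nthl (list_decode t) i) \<noteq> 0 \<longleftrightarrow> i \<in> rl b)}"
    have "\<exists>f. (\<forall>t. NTrm t \<longrightarrow> NTrm (\<lambda>e. f (t e))) \<and> (\<forall>k. list_encode (map f [0..<k]) \<in> \<tau>)"
    proof (rule branch_absolute)
      show "\<tau> \<in> Rl" unfolding \<tau>_def by (rule Rl_I, unfold bitA_def) (intro dfn)
      show "list_encode s \<in> \<tau>" if "list_encode u \<in> \<tau>" "pfx s u" for s u
        using that gd_pfx[of c u s] unfolding \<tau>_def mem_Collect_eq list_encode_inverse by (auto simp: pfx_def)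
      show "list_encode (map x [0..<k]) \<in> \<tau>" for k
        unfolding \<tau>_def mem_Collect_eq list_encode_inverse using x by simp
    qed
    then obtain y where y: "\<And>t. NTrm t \<Longrightarrow> NTrm (\<lambda>e. y (t e))" "\<And>k. list_encode (map y [0..<k]) \<in> \<tau>" by blast
    have gy: "gd c (map y [0..<k])" and by': "\<And>i. i < k \<Longrightarrow> bitA (y i) \<noteq> 0 \<longleftrightarrow> i \<in> rl b" for k
      using y(2)[of k] unfolding \<tau>_def mem_Collect_eq list_encode_inverse by simp_all
    have bb: "{i. bitA (y i) \<noteq> 0} = rl b" using by'[of _ "Suc _"] by blast
    have ce: "code_eval c (rl b) {i. bitT (y i) \<noteq> 0}" using gd_map[OF gy] unfolding bb .
    have R: "{i. bitT (y i) \<noteq> 0} \<in> Rl" by (rule Rl_I, unfold bitT_def) (intro dfn y(1))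
    have "0 \<in> {i. bitT (y i) \<noteq> 0}"
      using coded_family_iff[OF code ce] coded_family_iff[OF code T(1)] T(2) by blast
    then show "\<exists>t. sub t omg \<and> code_eval c (rl b) (rl t) \<and> 0 \<in> rl t"
      using ce sub_st_omg[OF R] by (intro exI[of _ "st {i. bitT (y i) \<noteq> 0}"]) (simp only: rl_st[OF R])
  qed (auto simp: coded_family_def)
  finally show ?thesis .
qed

end

section \<open>P-points in a model\<close>

context zfc_model
begin

lemma all_sub_omg: "(\<forall>a. sub a omg \<longrightarrow> P a) \<longleftrightarrow> (\<forall>A\<in>Rl. P (st A))"
proof
  show "\<forall>a. sub a omg \<longrightarrow> P a" if *: "\<forall>A\<in>Rl. P (st A)"
  proof (intro allI impI)
    fix a assume "sub a omg"
    then have "st (rl a) = a" by (rule st_rl)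
    with *[THEN bspec, OF rl_in_Rl[of a]] show "P a" by simp
  qed
qed (simp add: sub_st_omg)

lemma sub_st: "A \<in> Rl \<Longrightarrow> B \<in> Rl \<Longrightarrow> sub (st A) (st B) \<longleftrightarrow> A \<subseteq> B"
  unfolding sub_def by (auto simp: mem_st)

lemma num_mem_st: "A \<in> Rl \<Longrightarrow> num n \<epsilon> st A \<longleftrightarrow> n \<in> A"
  by (auto simp: mem_st)

lemma eq_stI: "A \<in> Rl \<Longrightarrow> sub c omg \<Longrightarrow> (\<And>n. num n \<epsilon> c \<longleftrightarrow> n \<in> A) \<Longrightarrow> c = st A"
  using st_rl[of c] unfolding rl_def by simp

lemma is_inter_st: "A \<in> Rl \<Longrightarrow> B \<in> Rl \<Longrightarrow> is_inter c (st A) (st B) \<longleftrightarrow> c = st (A \<inter> B)"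
  unfolding is_inter_def eq_iff_mem[of c] by (auto simp: mem_st Rl_Int)

lemma is_diff_st: "A \<in> Rl \<Longrightarrow> is_diff c omg (st A) \<longleftrightarrow> c = st (- A)"
  unfolding is_diff_def eq_iff_mem[of c] by (auto simp: mem_st mem_omg Rl_Compl)

lemma is_finite_st: "A \<in> Rl \<Longrightarrow> is_finite (st A) \<longleftrightarrow> finite A"
  unfolding is_finite_iff by (simp add: elts_st finite_image_iff inj_on_def)

lemma st_empty: "st {} = emp"
  unfolding eq_iff_mem by (simp add: mem_st)

definition us :: "'a \<Rightarrow> nat set set" where "us u = {X \<in> Rl. st X \<epsilon> u}"

lemma us_Rl: "X \<in> us u \<Longrightarrow> X \<in> Rl"
  unfolding us_def by simp

lemma all_mem: "\<forall>a. a \<epsilon> u \<longrightarrow> sub a omg \<Longrightarrow> (\<forall>a. a \<epsilon> u \<longrightarrow> P a) \<longleftrightarrow> (\<forall>A\<in>us u. P (st A))"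
  using all_sub_omg[of "\<lambda>a. a \<epsilon> u \<longrightarrow> P a"] unfolding us_def by auto

lemma is_ultrafilter_iff:
  "is_ultrafilter omg u \<longleftrightarrow> (\<forall>a. a \<epsilon> u \<longrightarrow> sub a omg) \<and> {} \<notin> us u \<and> (\<forall>A\<in>us u. \<forall>B\<in>Rl. A \<subseteq> B \<longrightarrow> B \<in> us u) \<and>
     (\<forall>A\<in>us u. \<forall>B\<in>us u. A \<inter> B \<in> us u) \<and> (\<forall>A\<in>Rl. A \<in> us u \<or> - A \<in> us u) \<and> (\<forall>A. finite A \<longrightarrow> - A \<in> us u)"
proof (cases "\<forall>a. a \<epsilon> u \<longrightarrow> sub a omg")
  case True
  have us: "st X \<epsilon> u \<longleftrightarrow> X \<in> us u" if "X \<in> Rl" for X using that unfolding us_def by simp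
  have 1: "(\<forall>a. is_empty a \<longrightarrow> \<not> a \<epsilon> u) \<longleftrightarrow> {} \<notin> us u"
    unfolding is_empty_iff using us[of "{}"] by (simp add: st_empty)
  have 2: "(\<forall>a b. a \<epsilon> u \<and> sub a b \<and> sub b omg \<longrightarrow> b \<epsilon> u) \<longleftrightarrow> (\<forall>A\<in>us u. \<forall>B\<in>Rl. A \<subseteq> B \<longrightarrow> B \<in> us u)"
  proof -
    have "(\<forall>a b. a \<epsilon> u \<and> sub a b \<and> sub b omg \<longrightarrow> b \<epsilon> u) \<longleftrightarrow> (\<forall>a. a \<epsilon> u \<longrightarrow> (\<forall>b. sub b omg \<longrightarrow> sub a b \<longrightarrow> b \<epsilon> u))" by blast
    then show ?thesis unfolding all_mem[OF True] all_sub_omg by (auto simp: us sub_st us_Rl)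
  qed
  have 3: "(\<forall>a b c. a \<epsilon> u \<and> b \<epsilon> u \<and> is_inter c a b \<longrightarrow> c \<epsilon> u) \<longleftrightarrow> (\<forall>A\<in>us u. \<forall>B\<in>us u. A \<inter> B \<in> us u)"
  proof -
    have "(\<forall>a b c. a \<epsilon> u \<and> b \<epsilon> u \<and> is_inter c a b \<longrightarrow> c \<epsilon> u) \<longleftrightarrow> (\<forall>a. a \<epsilon> u \<longrightarrow> (\<forall>b. b \<epsilon> u \<longrightarrow> (\<forall>c. is_inter c a b \<longrightarrow> c \<epsilon> u)))" by blast
    then show ?thesis unfolding all_mem[OF True] by (auto simp: us is_inter_st us_Rl Rl_Int)
  qed
  have 4: "(\<forall>a b. sub a omg \<and> is_diff b omg a \<longrightarrow> a \<epsilon> u \<or> b \<epsilon> u) \<longleftrightarrow> (\<forall>A\<in>Rl. A \<in> us u \<or> - A \<in> us u)"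
  proof -
    have "(\<forall>a b. sub a omg \<and> is_diff b omg a \<longrightarrow> a \<epsilon> u \<or> b \<epsilon> u) \<longleftrightarrow> (\<forall>a. sub a omg \<longrightarrow> (\<forall>b. is_diff b omg a \<longrightarrow> a \<epsilon> u \<or> b \<epsilon> u))" by blast
    then show ?thesis unfolding all_sub_omg by (auto simp: us is_diff_st Rl_Compl)
  qed
  have 5: "(\<forall>a b. sub a omg \<and> is_finite a \<and> is_diff b omg a \<longrightarrow> b \<epsilon> u) \<longleftrightarrow> (\<forall>A. finite A \<longrightarrow> - A \<in> us u)"
  proof -
    have "(\<forall>a b. sub a omg \<and> is_finite a \<and> is_diff b omg a \<longrightarrow> b \<epsilon> u) \<longleftrightarrow> (\<forall>a. sub a omg \<longrightarrow> (\<forall>b. is_finite a \<and> is_diff b omg a \<longrightarrow> b \<epsilon> u))" by blast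
    then show ?thesis unfolding all_sub_omg by (auto simp: us is_diff_st is_finite_st Rl_Compl Rl_finite)
  qed
  show ?thesis unfolding is_ultrafilter_def 1 2 3 4 5 ..
next
  case False
  then show ?thesis unfolding is_ultrafilter_def by (simp only: simp_thms)
qed

lemma in_dual_st:
  assumes "\<forall>a. a \<epsilon> u \<longrightarrow> sub a omg" "A \<in> Rl" shows "in_dual omg u (st A) \<longleftrightarrow> - A \<in> us u"
proof -
  have "in_dual omg u (st A) \<longleftrightarrow> \<not> (\<forall>b. b \<epsilon> u \<longrightarrow> \<not> is_diff (st A) omg b)" unfolding in_dual_def by blast
  also have "\<dots> \<longleftrightarrow> (\<exists>B\<in>us u. st A = st (- B))" unfolding all_mem[OF assms(1)] by (auto simp: is_diff_st us_Rl)
  also have "\<dots> \<longleftrightarrow> - A \<in> us u"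
  proof
    show "- A \<in> us u" if ex: "\<exists>B\<in>us u. st A = st (- B)"
    proof -
      obtain B where B: "B \<in> us u" "st A = st (- B)" using ex by blast
      then have "A = - B" using assms(2) us_Rl[OF B(1)] by (simp add: Rl_Compl)
      with B(1) show ?thesis by simp
    qed
    show "\<exists>B\<in>us u. st A = st (- B)" if "- A \<in> us u" using that by (intro bexI[of _ "- A"]) simp_all
  qed
  finally show ?thesis .
qed

lemma Trm_seq_compl:
  assumes S: "S \<in> Rl" shows "Trm (\<lambda>e. st (- seq_of S (nm (e i))))" "- seq_of S n \<in> Rl" "seq_of S n \<in> Rl"
proof -
  have *: "seq_of S n \<in> Rl" for n unfolding seq_of_def by (rule Rl_I) (intro dfn Dfn_mem_Rl[OF S])
  then show R: "- seq_of S n \<in> Rl" for n by (rule Rl_Compl)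
  show "Trm (\<lambda>e. st (- seq_of S (nm (e i))))"
    by (rule Trm_st[OF _ R], unfold seq_of_def Compl_iff mem_Collect_eq) (intro dfn Dfn_mem_Rl[OF S])
  show "seq_of S n \<in> Rl" by (rule *)
qed

text \<open>A family that is countable in the model can be coded as the rows of a single real, which
  removes sets of reals from the definition.\<close>

lemma is_P_point_iff:
  "is_P_point omg u \<longleftrightarrow> is_ultrafilter omg u \<and>
     (\<forall>S\<in>Rl. (\<forall>q. seq_of S q \<in> us u) \<longrightarrow> (\<exists>D\<in>us u. \<forall>q. finite (D - seq_of S q)))"
proof (cases "is_ultrafilter omg u")
  case True
  then have u: "\<forall>a. a \<epsilon> u \<longrightarrow> sub a omg" unfolding is_ultrafilter_def by blast
  have inter: "(\<exists>b. b \<epsilon> u \<and> (\<forall>a c. a \<epsilon> s \<and> is_inter c a b \<longrightarrow> is_finite c)) \<longleftrightarrow>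
      (\<exists>D\<in>us u. \<forall>A\<in>us s. finite (A \<inter> D))" if s: "\<forall>a. a \<epsilon> s \<longrightarrow> sub a omg" for s
  proof -
    have "(\<exists>b. b \<epsilon> u \<and> (\<forall>a c. a \<epsilon> s \<and> is_inter c a b \<longrightarrow> is_finite c)) \<longleftrightarrow>
      \<not> (\<forall>b. b \<epsilon> u \<longrightarrow> \<not> (\<forall>a. a \<epsilon> s \<longrightarrow> (\<forall>c. is_inter c a b \<longrightarrow> is_finite c)))" by blast
    also have "\<dots> \<longleftrightarrow> (\<exists>D\<in>us u. \<forall>A\<in>us s. finite (A \<inter> D))"
      unfolding all_mem[OF u] all_mem[OF s] by (auto simp: is_inter_st us_Rl is_finite_st Rl_Int)
    finally show ?thesis .
  qed
  have dual: "sub a omg \<and> - rl a \<in> us u" if "in_dual omg u a" for a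
  proof -
    have "sub a omg" using that unfolding in_dual_def is_diff_def sub_def by blast
    then show ?thesis using in_dual_st[OF u, of "rl a"] that st_rl[of a] by simp
  qed
  show ?thesis
  proof
    assume P: "is_P_point omg u"
    have "\<exists>D\<in>us u. \<forall>q. finite (D - seq_of S q)" if S: "S \<in> Rl" "\<forall>q. seq_of S q \<in> us u" for S
    proof -
      define F where "F x = st (- seq_of S (nm x))" for x
      have DF: "DF F" unfolding F_def by (rule Dfn_eq[OF Trm_var Trm_seq_compl(1)[OF S(1)]])
      have sm: "small (F ` elts omg)" by (rule small_image[OF small_elts DF])
      define s where "s = mk (F ` elts omg)"
      have s: "a \<epsilon> s \<longleftrightarrow> (\<exists>q. a = st (- seq_of S q))" for a
        unfolding s_def mem_mk[OF sm] by (auto simp: F_def image_image)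
      have es: "elts s = F ` elts omg" unfolding s_def by (rule elts_mk[OF sm])
      have ss: "\<forall>a. a \<epsilon> s \<longrightarrow> sub a omg" unfolding s using sub_st_omg[OF Trm_seq_compl(2)[OF S(1)]] by auto
      have "in_dual omg u a" if a: "a \<epsilon> s" for a
      proof -
        obtain q where q: "a = st (- seq_of S q)" using s[of a] a by blast
        show ?thesis unfolding q in_dual_st[OF u Trm_seq_compl(2)[OF S(1)]] using S(2) by simp
      qed
      moreover have "is_countable s"
      proof -
        define J where "J a = num (LEAST q. a = st (- seq_of S q))" for a
        have "Trm (\<lambda>e. J (e 1))" unfolding J_def by (intro dfn Trm_seq_compl(1)[OF S(1)])
        then have DJ: "DF J" by (rule Dfn_eq[OF Trm_var])
        have J: "a = st (- seq_of S (nm (J a)))" if "a \<epsilon> s" for a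
          unfolding J_def nm_num by (rule LeastI_ex) (use s that in blast)
        have "inj_on J (elts s)"
        proof (rule inj_onI)
          fix a b assume ab: "a \<in> elts s" "b \<in> elts s" "J a = J b"
          have "a = st (- seq_of S (nm (J b)))" using J[of a] ab by simp
          also have "\<dots> = b" using J[of b] ab by simp
          finally show "a = b" .
        qed
        moreover have "J ` elts s \<subseteq> range num" unfolding J_def by auto
        ultimately show ?thesis unfolding is_countable_iff cntbl_def using DJ by blast
      qed
      ultimately have "\<exists>b. b \<epsilon> u \<and> (\<forall>a c. a \<epsilon> s \<and> is_inter c a b \<longrightarrow> is_finite c)"
        using P unfolding is_P_point_def by simp
      then obtain D where D: "D \<in> us u" "\<forall>A\<in>us s. finite (A \<inter> D)" unfolding inter[OF ss] by blast
      have "finite (D - seq_of S q)" for q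
      proof -
        have "- seq_of S q \<in> us s" unfolding us_def using Trm_seq_compl(2)[OF S(1)] s by blast
        then have "finite (- seq_of S q \<inter> D)" using D(2) by blast
        then show ?thesis by (simp add: Diff_eq Int_commute)
      qed
      with D(1) show ?thesis by blast
    qed
    with True show "is_ultrafilter omg u \<and>
     (\<forall>S\<in>Rl. (\<forall>q. seq_of S q \<in> us u) \<longrightarrow> (\<exists>D\<in>us u. \<forall>q. finite (D - seq_of S q)))" by blast
  next
    assume P: "is_ultrafilter omg u \<and>
     (\<forall>S\<in>Rl. (\<forall>q. seq_of S q \<in> us u) \<longrightarrow> (\<exists>D\<in>us u. \<forall>q. finite (D - seq_of S q)))"
    have "\<exists>b. b \<epsilon> u \<and> (\<forall>a c. a \<epsilon> s \<and> is_inter c a b \<longrightarrow> is_finite c)"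
      if cs: "is_countable s" and ds: "\<forall>a. a \<epsilon> s \<longrightarrow> in_dual omg u a" for s
    proof -
      have ss: "\<forall>a. a \<epsilon> s \<longrightarrow> sub a omg" using ds dual by blast
      obtain J where J: "DF J" "inj_on J (elts s)" "J ` elts s \<subseteq> range num"
        using cs unfolding is_countable_iff cntbl_def by blast
      \<comment> \<open>Row q is the complement of the member with index q, and everything if there
        is no such member.\<close>
      define S where "S = {z. \<forall>a. a \<epsilon> s \<and> J a = num (fst (prod_decode z)) \<longrightarrow> snd (prod_decode z) \<notin> rl a}"
      have S: "S \<in> Rl" unfolding S_def by (rule Rl_I) (intro dfn Trm_sub1[OF J(1)])
      have J': "nm (J a) = q \<longleftrightarrow> J a = num q" if "a \<epsilon> s" for a q
      proof -
        have "J a \<in> range num" using J(3) that by auto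
        then show ?thesis by auto
      qed
      have sq: "seq_of S q = - rl a" if a: "a \<epsilon> s" "J a = num q" for a q
      proof -
        have uni: "b = a" if b: "b \<epsilon> s \<and> J b = num q" for b
          by (rule inj_onD[OF J(2)]) (use a b in simp_all)
        have "seq_of S q = {i. \<forall>b. b \<epsilon> s \<and> J b = num q \<longrightarrow> i \<notin> rl b}" unfolding seq_of_def S_def by simp
        also have "\<dots> = - rl a"
        proof (intro set_eqI iffI)
          fix i assume "i \<in> {i. \<forall>b. b \<epsilon> s \<and> J b = num q \<longrightarrow> i \<notin> rl b}"
          then show "i \<in> - rl a" using a by simp
        next
          fix i assume i: "i \<in> - rl a"
          have "i \<notin> rl b" if "b \<epsilon> s \<and> J b = num q" for b using uni[OF that] i by simp
          then show "i \<in> {i. \<forall>b. b \<epsilon> s \<and> J b = num q \<longrightarrow> i \<notin> rl b}" by simp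
        qed
        finally show ?thesis .
      qed
      have "seq_of S q \<in> us u" for q
      proof (cases "\<exists>a. a \<epsilon> s \<and> J a = num q")
        case True
        then obtain a where a: "a \<epsilon> s" "J a = num q" by blast
        show ?thesis unfolding sq[OF a] using dual[of a] ds a(1) by simp
      next
        case False
        have "- {} \<in> us u" using P unfolding is_ultrafilter_iff by blast
        moreover have "seq_of S q = UNIV" unfolding seq_of_def S_def using False by auto
        ultimately show ?thesis by simp
      qed
      then obtain D where D: "D \<in> us u" "\<forall>q. finite (D - seq_of S q)" using P S by blast
      have "finite (A \<inter> D)" if A: "A \<in> us s" for A
      proof -
        have a: "st A \<epsilon> s" "rl (st A) = A" using A unfolding us_def by simp_all
        have "J (st A) = num (nm (J (st A)))" using J'[OF a(1)] by blast
        from sq[OF a(1) this] have "seq_of S (nm (J (st A))) = - A" unfolding a(2) .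
        then have "finite (D - - A)" using D(2)[THEN spec, of "nm (J (st A))"] by simp
        then show ?thesis by (simp add: Diff_eq Int_commute)
      qed
      with D(1) show ?thesis unfolding inter[OF ss] by blast
    qed
    note main = this
    show "is_P_point omg u" unfolding is_P_point_def
    proof (intro conjI allI impI True)
      fix s assume s: "is_countable s \<and> (\<forall>a. a \<epsilon> s \<longrightarrow> in_dual omg u a)"
      show "\<exists>b. b \<epsilon> u \<and> (\<forall>a c. a \<epsilon> s \<and> is_inter c a b \<longrightarrow> is_finite c)"
        by (rule main[OF conjunct1[OF s] conjunct2[OF s]])
    qed
  qed
qed (simp add: is_P_point_def)

end

section \<open>From a P-point of a model to a witness\<close>

locale coded_ideal_model = coded_model mem c l r + coded_ideal c
  for mem :: "'a \<Rightarrow> 'a \<Rightarrow> bool" (infix "\<epsilon>" 50) and c :: borel_code and l r :: 'a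
begin

text \<open>The construction of \<open>extendable_wit\<close> carried out for an ultrafilter of the
  model. The fixed point and the pseudointersection have to be reals of the model, which is why
  everything is kept definable; the attempt that \<open>root_dead\<close> refutes may live in the
  universe.\<close>

theorem P_point_wit:
  assumes "P_point_not_J_ultrafilter l r"
  shows "\<exists>x. wit c x"
proof -
  obtain u where P: "is_P_point omg u" and le: "code_le_dual any_map omg l r u"
    using assms unfolding P_point_not_J_ultrafilter_def is_omega_iff by blast
  obtain f where f: "is_map f omg omg"
    and dual: "\<And>b. in_coded_family omg l r b \<Longrightarrow> \<exists>d. is_preimage omg d f b \<and> in_dual omg u d"
    using le unfolding code_le_dual_def any_map_def by blast
  define F where "F n = nm (app f (num n))" for n
  have F: "app f (num n) = num (F n)" for n
    using is_map_app(1)[OF f, of "num n"] num_nm unfolding F_def by (simp add: mem_omg)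
  have NF: "NTrm (\<lambda>e. F (t e))" if "NTrm t" for t unfolding F_def by (intro dfn that)
  have uf: "is_ultrafilter omg u" using P unfolding is_P_point_def by blast
  note uf' = uf[unfolded is_ultrafilter_iff]
  have uo: "\<forall>a. a \<epsilon> u \<longrightarrow> sub a omg" and u0: "{} \<notin> us u" and uup: "\<And>A B. A \<in> us u \<Longrightarrow> B \<in> Rl \<Longrightarrow> A \<subseteq> B \<Longrightarrow> B \<in> us u"
    and uI: "\<And>A B. A \<in> us u \<Longrightarrow> B \<in> us u \<Longrightarrow> A \<inter> B \<in> us u" and uC: "\<And>A. A \<in> Rl \<Longrightarrow> A \<in> us u \<or> - A \<in> us u"
    and ucf: "\<And>A. finite A \<Longrightarrow> - A \<in> us u" using uf' by simp_all
  have vR: "F -` X \<in> Rl" if "X \<in> Rl" for X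
    unfolding vimage_def by (rule Rl_I) (intro NF dfn Dfn_mem_Rl[OF that])
  \<comment> \<open>The image of the ultrafilter under the map \<open>f\<close>, restricted to reals
    of the model. It is disjoint from the coded family by the choice of \<open>f\<close>.\<close>
  define U where "U = {X \<in> Rl. F -` X \<in> us u}"
  have UR: "X \<in> U \<longleftrightarrow> X \<in> Rl \<and> st (F -` X) \<epsilon> u" for X unfolding U_def us_def using vR by auto
  have DU: "Dfn (\<lambda>e. st (F -` rl (t e)) \<epsilon> u)" if "Trm t" for t
  proof (rule Dfn_sub1[where P = "\<lambda>x. st (F -` rl x) \<epsilon> u", OF _ that])
    have "Trm (\<lambda>e. st (F -` rl (e 0)))" by (rule Trm_st[OF _ vR[OF rl_in_Rl]]) (unfold vimage_eq, intro dfn NF)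
    then show "Dfn (\<lambda>e. st (F -` rl (e 0)) \<epsilon> u)" by (intro dfn)
  qed
  have bexU: "(\<exists>X\<in>U. Q X) \<longleftrightarrow> (\<exists>X\<in>Rl. st (F -` X) \<epsilon> u \<and> Q X)" for Q using UR by blast
  have U0: "{} \<notin> U" using u0 unfolding U_def by simp
  have UI: "A \<inter> B \<in> U" if "A \<in> U" "B \<in> U" for A B using that uI Rl_Int unfolding U_def by simp
  have UC: "A \<in> U \<or> - A \<in> U" if "A \<in> Rl" for A
    using uC[OF vR[OF that]] that unfolding U_def by (simp add: Rl_Compl vimage_Compl)
  have Uid: "X \<notin> coded_family c" if X: "X \<in> U" for X
  proof
    assume J: "X \<in> coded_family c"
    have R: "X \<in> Rl" using X unfolding U_def by blast
    have "in_coded_family omg l r (st X)" using in_coded_family_iff[OF code sub_st_omg[OF R]] J R by simp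
    then obtain d where d: "is_preimage omg d f (st X)" "in_dual omg u d" using dual by blast
    have "d = st (F -` X)"
    proof (rule eq_stI[OF vR[OF R]])
      show "sub d omg" using d(1) unfolding is_preimage_def sub_def by blast
      show "num n \<epsilon> d \<longleftrightarrow> n \<in> F -` X" for n
        using d(1) is_map_app(2)[OF f] F num_mem_st[OF R] unfolding is_preimage_def by (auto simp: mem_omg)
    qed
    then have "- (F -` X) \<in> us u" using d(2) in_dual_st[OF uo vR[OF R]] by simp
    moreover have "F -` X \<in> us u" using X unfolding U_def by blast
    ultimately show False using uI[of "F -` X" "- (F -` X)"] u0 by simp
  qed
  have tail: "{n..} \<in> U" for n
  proof -
    have fin: "{..<n} \<in> Rl" by (rule Rl_finite) simp
    have "{..<n} \<notin> U" using Uid[of "{..<n}"] coded_finite[of "{..<n}"] by blast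
    then show ?thesis using UC[OF fin] by (simp add: Compl_lessThan)
  qed
  define al where "al = \<Union>{a\<in>Rl. a \<subseteq> liveF c U a}"
  have mlF: "posP n s \<in> liveF c U a \<longleftrightarrow> (\<forall>v. list_encode (n @ [v]) \<in> treeS c \<longrightarrow> (\<exists>X\<in>U. inC c a (n @ [v]) s X))" for n s a
    unfolding liveF_def by auto
  \<comment> \<open>The union is over reals of the model only, and membership in \<open>U\<close> is
    expressed by the element \<open>u\<close>; so the largest fixed point is definable in the
    model.\<close>
  have alR: "al \<in> Rl"
  proof -
    have un: "\<Union>{a \<in> R. Q a} = {p. \<exists>a\<in>R. Q a \<and> p \<in> a}" for R :: "nat set set" and Q by blast
    have sub: "a \<subseteq> liveF c U a \<longleftrightarrow> (\<forall>n s. posP n s \<in> a \<longrightarrow> (\<forall>v. list_encode (n @ [v]) \<in> treeS c \<longrightarrow> (\<exists>X\<in>U. inC c a (n @ [v]) s X)))" for a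
      unfolding mlF[symmetric] using posP_surj by (metis subset_eq)
    have *: "al = {p. \<exists>a\<in>Rl. (\<forall>n s. posP n s \<in> a \<longrightarrow> (\<forall>v. list_encode (n @ [v]) \<in> treeS c \<longrightarrow>
        (\<exists>X\<in>Rl. st (F -` X) \<epsilon> u \<and> inC c a (n @ [v]) s X))) \<and> p \<in> a}"
      unfolding al_def un sub bexU ..
    show ?thesis unfolding * by (rule Rl_I) (unfold inC_def, intro dfn DU treeS_Rl)
  qed
  have lR: "liveF c U a \<in> Rl" if a: "a \<in> Rl" for a
    unfolding liveF_def bexU mem_Collect_eq by (rule Rl_I) (unfold inC_def, intro dfn DU treeS_Rl Dfn_mem_Rl[OF a])
  have al: "liveF c U al = al" unfolding al_def by (rule liveF_gfp[OF lR alR[unfolded al_def]])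
  have NX: "NTrm (\<lambda>e. witx c U al (t e))" if "NTrm t" for t
    by (rule NTrm_sub1[OF _ that], unfold witx_def bad_def bexU inC_def) (intro dfn DU treeS_Rl Dfn_mem_Rl[OF alR])
  have live: "\<exists>X\<in>U. inC c al (n @ [v]) s X" if "posP n s \<in> al" "list_encode (n @ [v]) \<in> treeS c" for n s v
    using that mlF[of n s al] unfolding al by blast
  have "posP [] [] \<notin> al"
  proof -
    \<comment> \<open>Candidates for the large set belonging to the pair and child coded by
      \<open>q\<close>. They are chosen by a choice function of the model, so that the P-point
      property can be applied to the sequence.\<close>
    define B where "B q = {a \<in> elts (pw omg). st (F -` rl a) \<epsilon> u \<and> (\<forall>n s v. q = prod_encode (posP n s, v) \<and>
        posP n s \<in> al \<and> list_encode (n @ [v]) \<in> treeS c \<longrightarrow> inC c al (n @ [v]) s (rl a))}" for q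
    have smB: "small (B q)" for q unfolding B_def inC_def
      by (rule small_sep[OF small_elts]) (intro dfn DU treeS_Rl Dfn_mem_Rl[OF alR])
    have neB: "B q \<noteq> {}" for q
    proof -
      have "\<exists>X\<in>U. \<forall>n s v. q = prod_encode (posP n s, v) \<and>
        posP n s \<in> al \<and> list_encode (n @ [v]) \<in> treeS c \<longrightarrow> inC c al (n @ [v]) s X"
      proof (cases "\<exists>n s v. q = prod_encode (posP n s, v) \<and> posP n s \<in> al \<and> list_encode (n @ [v]) \<in> treeS c")
        case True
        then obtain n s v where q: "q = prod_encode (posP n s, v)" and *: "posP n s \<in> al" "list_encode (n @ [v]) \<in> treeS c" by blast
        obtain X where "X \<in> U" "inC c al (n @ [v]) s X" using live[OF *] by blast
        then show ?thesis by (intro bexI[of _ X]) (simp_all add: q)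
      next
        case False
        then show ?thesis using tail[of 0] by blast
      qed
      then obtain X where X: "X \<in> U" "\<forall>n s v. q = prod_encode (posP n s, v) \<and>
        posP n s \<in> al \<and> list_encode (n @ [v]) \<in> treeS c \<longrightarrow> inC c al (n @ [v]) s X" by blast
      have "st X \<in> B q" unfolding B_def using X UR[of X] sub_st_omg[of X] by simp
      then show ?thesis by blast
    qed
    obtain ch where ch: "Dfn (\<lambda>e. e 0 = ch (e 1))" "\<And>B. B \<subseteq> elts (pw omg) \<Longrightarrow> small B \<Longrightarrow> B \<noteq> {} \<Longrightarrow> ch (mk B) \<in> B"
      by (rule choice_subsets[OF small_elts[of "pw omg"]], rule that)
    define X where "X q = rl (ch (mk (B q)))" for q
    have chB: "ch (mk (B q)) \<in> B q" for q by (rule ch(2)[OF _ smB neB]) (auto simp: B_def)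
    have "Trm (\<lambda>e. mk (B (nm (e i))))" for i
      by (rule Trm_mk[OF _ smB], unfold B_def inC_def mem_Collect_eq) (intro dfn DU treeS_Rl Dfn_mem_Rl[OF alR])
    then have TB: "Trm (\<lambda>e. mk (B (t e)))" if "NTrm t" for t
    proof -
      have "Dfn (\<lambda>e. e 0 = mk (B (nm (e 1))))" by (intro dfn \<open>\<And>i. Trm (\<lambda>e. mk (B (nm (e i))))\<close>)
      from Trm_sub1[where F = "\<lambda>x. mk (B (nm x))", OF this, of "\<lambda>e. num (t e)"] that
      show ?thesis unfolding NTrm_def by simp
    qed
    \<comment> \<open>The P-point lives before the map \<open>F\<close> and the large sets after it:
      row q is the preimage of \<open>X q\<close>, and a pseudointersection \<open>D\<close> is
      moved forward to its image.\<close>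
    define S where "S = {z. F (snd (prod_decode z)) \<in> X (fst (prod_decode z))}"
    have S: "S \<in> Rl" unfolding S_def X_def by (rule Rl_I) (intro dfn NF Trm_sub1[OF ch(1)] TB)
    have sq: "seq_of S q = F -` X q" for q unfolding seq_of_def S_def vimage_def by simp
    have "seq_of S q \<in> us u" for q
      unfolding sq using chB[of q] vR[OF rl_in_Rl] unfolding B_def X_def us_def by simp
    then obtain D where D: "D \<in> us u" "\<And>q. finite (D - seq_of S q)"
      using P S unfolding is_P_point_iff by blast
    show ?thesis
    proof (rule root_dead[of "F ` D"])
      have DR: "D \<in> Rl" by (rule us_Rl[OF D(1)])
      have FD: "F ` D = {m. \<exists>n. n \<in> D \<and> m = F n}" by blast
      have FR: "F ` D \<in> Rl" unfolding FD by (rule Rl_I) (intro dfn NF Dfn_mem_Rl[OF DR])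
      have "F -` F ` D \<in> us u" by (rule uup[OF D(1) vR[OF FR]]) blast
      then have "F ` D \<in> U" unfolding U_def using FR by blast
      then show "F ` D \<notin> coded_family c" by (rule Uid)
      fix n s v assume *: "posP n s \<in> al" "list_encode (n @ [v]) \<in> treeS c"
      define q where "q = prod_encode (posP n s, v)"
      have "inC c al (n @ [v]) s (X q)" using chB[of q] * unfolding B_def X_def q_def by blast
      moreover have "finite (F ` D - X q)"
        by (rule finite_subset[OF _ finite_imageI[OF D(2)[of q], of F]]) (auto simp: sq)
      ultimately show "inC c al (n @ [v]) s (F ` D)" by (rule inC_almost)
    qed
  qed
  then have "wit c (witx c U al)"
  proof (rule wit_witx[where R = Rl, OF _ al U0 UI tail])
    show "\<exists>A\<in>S. A \<in> U" if S: "finite S" "S \<subseteq> Rl" "{n..} \<subseteq> \<Union>S" for S n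
      by (rule finite_cover_large[OF U0 UI tail UC[OF subsetD[OF S(2)]] S(1,3)])
    fix H assume H: "H \<in> Rl"
    show sR: "seq_of H i \<in> Rl" for i by (rule Trm_seq_compl(3)[OF H])
    have "Trm (\<lambda>e. st (F -` seq_of H (nm (e 0))))"
      by (rule Trm_st[OF _ vR[OF sR]]) (unfold vimage_eq seq_of_def mem_Collect_eq, intro dfn NF Dfn_mem_Rl[OF H])
    then have "{i. st (F -` seq_of H i) \<epsilon> u} \<in> Rl" by (intro Rl_I dfn)
    then show "{i. seq_of H i \<in> U} \<in> Rl" unfolding UR using sR by simp
  next
    show "limF c (witx c U al) N k p \<in> Rl" for N k p
      unfolding limF_def Let_def covers_def piece_def by (rule Rl_I) (intro dfn NX Dfn_mem_Rl[OF Rl_UNIV])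
  qed
  then show ?thesis by blast
qed

end

section \<open>From a witness to a P-point in a model of CH\<close>

context zfc_model
begin

lemma Dfn_Int [dfn]: "Dfn (\<lambda>e. t e \<in> A e) \<Longrightarrow> Dfn (\<lambda>e. t e \<in> B e) \<Longrightarrow> Dfn (\<lambda>e. t e \<in> A e \<inter> B e)"
  unfolding Int_iff by (rule Dfn_conj)

lemma Dfn_Diff [dfn]: "Dfn (\<lambda>e. t e \<in> A e) \<Longrightarrow> Dfn (\<lambda>e. t e \<in> B e) \<Longrightarrow> Dfn (\<lambda>e. t e \<in> A e - B e)"
  unfolding Diff_iff by (intro Dfn_conj Dfn_not)

lemma Dfn_Collect [dfn]: "Dfn (\<lambda>e. P e (t e)) \<Longrightarrow> Dfn (\<lambda>e. t e \<in> {x. P e x})"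
  unfolding mem_Collect_eq .

lemma Dfn_finite [dfn]:
  assumes "Dfn (\<lambda>e. nm (e 0) \<in> A (\<lambda>i. e (Suc i)))" shows "Dfn (\<lambda>e. finite (A e))"
proof -
  have "Dfn (\<lambda>e. nm (e 0) \<in> A (\<lambda>i. e (Suc (Suc i))))"
    using Dfn_rename[OF assms, of "\<lambda>i. if i = 0 then 0 else Suc i"] by simp
  then have "Dfn (\<lambda>e. \<exists>m. \<forall>n. n \<in> A e \<longrightarrow> n < m)" by (intro dfn) simp_all
  moreover have "finite X \<longleftrightarrow> (\<exists>m. \<forall>n. n \<in> X \<longrightarrow> n < m)" for X :: "nat set"
    unfolding finite_nat_set_iff_bounded by blast
  ultimately show ?thesis by simp
qed

text \<open>The first \<open>w\<close> reals of a well-order, for the least uncountable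
  \<open>w\<close>, form an uncountable set, which CH puts into bijection with all reals.\<close>

lemma CH_enumeration:
  assumes CH: satisfies_CH
  shows "\<exists>w H. Ord w \<and> (\<forall>a. a \<epsilon> w \<longrightarrow> cntbl (elts a)) \<and> DF H \<and> bij_betw H (elts w) (elts (pw omg))"
proof -
  obtain al F where al: "Ord al" and F: "DF F" "bij_betw F (elts al) (elts (pw omg))"
    by (rule Zermelo[OF small_elts[of "pw omg"]], rule that)
  have inj: "inj_on F (elts al)" using F(2) unfolding bij_betw_def by blast
  have "\<not> cntbl (elts al)"
  proof
    assume c: "cntbl (elts al)"
    obtain H where H: "DF H" "\<forall>x\<in>elts al. H (F x) = x" by (rule DF_inverse[OF F(1) inj small_elts], rule that)
    have "bij_betw H (elts (pw omg)) (elts al)" by (rule bij_betw_left_inverse[OF F(2) H(2)])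
    then have "cntbl (elts (pw omg))" by (intro cntbl_inj[OF c H(1)]) (simp_all add: bij_betw_def)
    with not_cntbl_power_omega show False ..
  qed
  from Ord_least[where P = "\<lambda>b. \<not> cntbl (elts b)", OF al this] obtain w where
    w: "Ord w" "\<not> cntbl (elts w)" "\<And>a. a \<epsilon> w \<Longrightarrow> cntbl (elts a)" by blast
  have sub: "elts w \<subseteq> elts al"
  proof (cases "al \<epsilon> w")
    case True
    then show ?thesis using w(3) \<open>\<not> cntbl (elts al)\<close> by blast
  next
    case False
    then have "w \<epsilon> al \<or> w = al" using Ord_linear[OF al w(1)] by blast
    then show ?thesis using Ord_trans[OF al] by auto
  qed
  have injw: "inj_on F (elts w)" by (rule inj_on_subset[OF inj sub])
  define X where "X = F ` elts w"
  have Xs: "small X" unfolding X_def by (rule small_image[OF small_elts F(1)])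
  have Xp: "X \<subseteq> elts (pw omg)" unfolding X_def using F(2) sub unfolding bij_betw_def by blast
  have "\<not> is_countable (mk X)"
  proof
    assume "is_countable (mk X)"
    then have "cntbl X" unfolding is_countable_iff elts_mk[OF Xs] .
    then have "cntbl (elts w)" by (rule cntbl_inj[OF _ F(1) injw]) (simp add: X_def)
    with w(2) show False ..
  qed
  moreover have "sub (mk X) (pw omg)" unfolding sub_def mem_mk[OF Xs] using Xp by auto
  ultimately have "\<exists>f. is_bij_map f (mk X) (pw omg)"
    using CH unfolding satisfies_CH_def is_omega_iff is_power_iff by blast
  then obtain G where G: "DF G" "bij_betw G X (elts (pw omg))" unfolding ex_is_bij_map elts_mk[OF Xs] by blast
  have "bij_betw F (elts w) X" unfolding X_def bij_betw_def using injw by blast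
  from bij_betw_trans[OF this G(2)] have "bij_betw (\<lambda>x. G (F x)) (elts w) (elts (pw omg))" by (simp add: comp_def)
  moreover have "DF (\<lambda>x. G (F x))" by (rule DF_comp[OF G(1) F(1)])
  ultimately show ?thesis
    by (intro exI[of _ w] exI[of _ "\<lambda>x. G (F x)"] conjI allI impI w)
qed

end

context coded_ideal_model
begin

text \<open>The tower construction inside the model. Positivity for the ideal of a witness is
  arithmetic in the witness, and a witness can be taken from the model; hence the recursion along
  \<open>w\<close> is definable and its result is an element.\<close>

theorem wit_P_point_model:
  assumes CH: satisfies_CH and "wit c x"
  shows "P_point_not_J_point l r"
proof -
  obtain y where y: "wit c y" and Ny: "\<And>t. NTrm t \<Longrightarrow> NTrm (\<lambda>e. y (t e))" using wit_absolute[OF assms(2)] by blast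
  define K where "K = KI c y"
  have K: "ideal K" unfolding K_def by (rule KI_ideal[OF y])
  have DK: "Dfn (\<lambda>e. rl (t e) \<in> K)" if "Trm t" for t
    by (rule Dfn_sub1[where P = "\<lambda>x. rl x \<in> K", OF _ that], unfold K_def mem_KI cov_def covers_def piece_def) (intro dfn Ny)
  have diagR: "diag c y (seq_of S) \<in> Rl" if "S \<in> Rl" for S
    unfolding diag_def seq_of_def cov_def covers_def piece_def mem_Collect_eq
    by (rule Rl_I) (intro dfn Ny Dfn_mem_Rl[OF that])
  have decide: "\<exists>C\<in>Rl. C \<notin> K \<and> C \<subseteq> D \<and> decides C (seq_of Y)" if D: "D \<in> Rl" "D \<notin> K" and Y: "Y \<in> Rl" for D Y
  proof -
    \<comment> \<open>Row n is \<open>D\<close> intersected with the first n sets of the sequence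
      coded by \<open>Y\<close>, all rows in a single real of the model.\<close>
    define S where "S = {z. snd (prod_decode z) \<in> D \<and> (\<forall>m<fst (prod_decode z). prod_encode (m, snd (prod_decode z)) \<in> Y)}"
    have S: "S \<in> Rl" unfolding S_def by (rule Rl_I) (intro dfn Dfn_mem_Rl[OF D(1)] Dfn_mem_Rl[OF Y])
    define E where "E = seq_of S"
    have E: "E n = {i \<in> D. \<forall>m<n. i \<in> seq_of Y m}" for n unfolding E_def S_def seq_of_def by simp
    have ER: "E n \<in> Rl" for n unfolding E_def by (rule Trm_seq_compl(3)[OF S])
    show ?thesis
    proof (cases "\<exists>n. E n \<notin> K \<and> E (Suc n) \<in> K")
      case True
      then obtain n where n: "E n \<notin> K" "E (Suc n) \<in> K" by blast
      define C where "C = E n - seq_of Y n"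
      have "E n = C \<union> E (Suc n)" unfolding C_def E by (auto simp: less_Suc_eq)
      then have "C \<notin> K" using n ideal_Un[OF K, of C "E (Suc n)"] by auto
      moreover have "C \<in> Rl" unfolding C_def by (rule Rl_Diff[OF ER Trm_seq_compl(3)[OF Y]])
      moreover have "C \<inter> seq_of Y n = {}" "C \<subseteq> D" unfolding C_def E by blast+
      ultimately show ?thesis unfolding decides_def by (intro bexI[of _ C] conjI disjI1 exI[of _ n]) simp_all
    next
      case False
      have En: "E n \<notin> K" for n
      proof (induction n)
        case 0
        have "E 0 = D" unfolding E by simp
        with D(2) show ?case by simp
      qed (use False in blast)
      define C where "C = diag c y E"
      have "C \<notin> K" unfolding C_def K_def by (rule diag_positive) (use En in \<open>simp add: K_def\<close>)
      moreover have "C \<in> Rl" unfolding C_def E_def by (rule diagR[OF S])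
      moreover have "C \<subseteq> D" unfolding C_def diag_def E by blast
      moreover have "finite (C - seq_of Y n)" for n
      proof (rule finite_subset)
        show "C - seq_of Y n \<subseteq> C - E (Suc n)" unfolding E by auto
        show "finite (C - E (Suc n))" unfolding C_def by (rule diag_almost) (auto simp: E)
      qed
      ultimately show ?thesis unfolding decides_def by blast
    qed
  qed
  obtain w H where w: "Ord w" "\<And>a. a \<epsilon> w \<Longrightarrow> cntbl (elts a)" and H: "DF H" "bij_betw H (elts w) (elts (pw omg))"
    using CH_enumeration[OF CH] by blast
  \<comment> \<open>The admissible values at stage \<open>a\<close>: positive, almost contained in
    the earlier values, and deciding the sequence coded by the \<open>a\<close>-th real.\<close>
  define B where "B a g = {b \<in> elts (pw omg). rl b \<notin> K \<and> (\<forall>d. d \<epsilon> a \<longrightarrow> finite (rl b - rl (g d))) \<and>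
      decides (rl b) (seq_of (rl (H a)))}" for a g
  have DB: "Dfn (\<lambda>e. e 0 \<in> B (e i) (app (e j)))" for i j
    unfolding B_def decides_def seq_of_def mem_Collect_eq Int_iff Diff_iff by (intro dfn DK Trm_sub1[OF H(1)])
  have smB: "small (B a g)" if "DF g" for a g
    unfolding B_def decides_def seq_of_def by (rule small_sep[OF small_elts]) (intro dfn DK Trm_sub1[OF that] Trm_const)
  obtain ch where ch: "Dfn (\<lambda>e. e 0 = ch (e 1))" "\<And>B. B \<subseteq> elts (pw omg) \<Longrightarrow> small B \<Longrightarrow> B \<noteq> {} \<Longrightarrow> ch (mk B) \<in> B"
    by (rule choice_subsets[OF small_elts[of "pw omg"]], rule that)
  define G where "G a g = ch (mk (B a (app g)))" for a g
  have "Trm (\<lambda>e. mk (B (e 1) (app (e 2))))"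
    by (rule Trm_mk[OF _ smB[OF DF_app]]) (rule DB[of "Suc 1" "Suc 2"])
  then have GD: "Dfn (\<lambda>e. e 0 = G (e 1) (e 2))" unfolding G_def by (intro dfn Trm_sub1[OF ch(1)])
  obtain h where h: "\<And>x. h x = G x (lam (elts x) h)" "DF h" "\<And>x. small {opr y (h y) | y. y \<in> elts x}"
    by (rule mem_recursion[of G, OF GD], rule that)
  have h_eq: "h a = ch (mk (B a h))" for a
  proof -
    have "B a (app (lam (elts a) h)) = B a h" unfolding B_def by (simp add: app_lam[OF h(3)] cong: imp_cong)
    then show ?thesis by (subst h(1)) (simp add: G_def)
  qed
  have hB: "h a \<in> B a h" if "a \<epsilon> w" for a
    using that
  proof (induction a rule: mem_induct)
    case (step a)
    have IH: "h d \<in> B d h" if "d \<epsilon> a" for d using step(1)[OF that] Ord_trans[OF w(1) step(2) that] by blast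
    define T where "T = (\<lambda>d. rl (h d)) ` elts a"
    have T1: "T \<inter> K = {}" unfolding T_def using IH unfolding B_def by auto
    have T2: "almost_chain T" unfolding almost_chain_def T_def
    proof (intro ballI)
      fix X Z assume "X \<in> (\<lambda>d. rl (h d)) ` elts a" "Z \<in> (\<lambda>d. rl (h d)) ` elts a"
      then obtain d e where d: "d \<epsilon> a" "X = rl (h d)" and e: "e \<epsilon> a" "Z = rl (h e)" by auto
      have "Ord d" "Ord e" using Ord_mem[OF w(1)] Ord_trans[OF w(1) step(2)] d(1) e(1) by blast+
      then have "d \<epsilon> e \<or> d = e \<or> e \<epsilon> d" by (rule Ord_linear)
      then show "finite (X - Z) \<or> finite (Z - X)"
        using IH[OF d(1)] IH[OF e(1)] unfolding B_def d(2) e(2) by auto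
    qed
    obtain J where J: "DF J" "inj_on J (elts a)" "J ` elts a \<subseteq> range num" using w(2)[OF step(2)] unfolding cntbl_def by blast
    \<comment> \<open>Row n is the intersection of the earlier values with index below n. It is
      positive since a row uses only finitely many of them.\<close>
    define S where "S = {z. \<forall>d. d \<epsilon> a \<and> nm (J d) < fst (prod_decode z) \<longrightarrow> snd (prod_decode z) \<in> rl (h d)}"
    have S: "S \<in> Rl" unfolding S_def by (rule Rl_I) (intro dfn Trm_sub1[OF J(1)] Trm_sub1[OF h(2)])
    have Sn: "seq_of S n = {i. \<forall>d. d \<epsilon> a \<and> nm (J d) < n \<longrightarrow> i \<in> rl (h d)}" for n unfolding seq_of_def S_def by simp
    have pos: "seq_of S n \<notin> K" for n
    proof -
      define I where "I = {d. d \<epsilon> a \<and> nm (J d) < n}"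
      have "inj_on (\<lambda>d. nm (J d)) (elts a)"
      proof (rule inj_onI)
        fix d e assume d: "d \<in> elts a" "e \<in> elts a" "nm (J d) = nm (J e)"
        have "J d \<in> range num" "J e \<in> range num" using J(3) d(1,2) by blast+
        then have "J d = J e" using d(3) by auto
        then show "d = e" using J(2) d(1,2) by (auto dest: inj_onD)
      qed
      then have inj: "inj_on (\<lambda>d. nm (J d)) I" by (rule inj_on_subset) (auto simp: I_def)
      have "(\<lambda>d. nm (J d)) ` I \<subseteq> {..<n}" unfolding I_def by auto
      then have "finite I" using inj_on_finite[OF inj] by blast
      then have "finite ((\<lambda>d. rl (h d)) ` I)" "(\<lambda>d. rl (h d)) ` I \<subseteq> T" unfolding T_def I_def by auto
      from finite_chain_positive[OF K T1 T2 this] obtain A where A: "A \<notin> K" "\<forall>X\<in>(\<lambda>d. rl (h d)) ` I. A \<subseteq> X" by blast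
      have "A \<subseteq> seq_of S n" unfolding Sn using A(2) unfolding I_def by blast
      then show ?thesis using A(1) ideal_subset[OF K] by blast
    qed
    define D where "D = diag c y (seq_of S)"
    have DR: "D \<in> Rl" unfolding D_def by (rule diagR[OF S])
    have DnK: "D \<notin> K" unfolding D_def K_def by (rule diag_positive) (use pos in \<open>simp add: K_def\<close>)
    have Df: "finite (D - seq_of S n)" for n unfolding D_def by (rule diag_almost) (auto simp: Sn)
    obtain C where C: "C \<in> Rl" "C \<notin> K" "C \<subseteq> D" "decides C (seq_of (rl (H a)))" using decide[OF DR DnK rl_in_Rl] by blast
    have "finite (C - rl (h d))" if d: "d \<epsilon> a" for d
    proof (rule finite_subset[OF _ Df[of "Suc (nm (J d))"]])
      show "C - rl (h d) \<subseteq> D - seq_of S (Suc (nm (J d)))" using C(3) d unfolding Sn by auto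
    qed
    then have "st C \<in> B a h" unfolding B_def using C sub_st_omg[OF C(1)] by simp
    then have ne: "B a h \<noteq> {}" by blast
    have "ch (mk (B a h)) \<in> B a h" by (rule ch(2)[OF _ smB[OF h(2)] ne]) (auto simp: B_def)
    then show ?case unfolding h_eq[of a, symmetric] .
  qed
  define T where "T = (\<lambda>a. rl (h a)) ` elts w"
  have TK: "X \<notin> K" if "X \<in> T" for X using that hB unfolding T_def B_def by auto
  have inf: "infinite X" if "X \<in> T" for X using TK[OF that] ideal_finite[OF K] by blast
  have chain: "finite (X - Z) \<or> finite (Z - X)" if XZ: "X \<in> T" "Z \<in> T" for X Z
  proof -
    obtain d where d: "d \<epsilon> w" "X = rl (h d)" using XZ(1) unfolding T_def by auto
    obtain e where e: "e \<epsilon> w" "Z = rl (h e)" using XZ(2) unfolding T_def by auto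
    have "Ord d" "Ord e" using Ord_mem[OF w(1)] d(1) e(1) by blast+
    then have "d \<epsilon> e \<or> d = e \<or> e \<epsilon> d" by (rule Ord_linear)
    then show ?thesis using hB[OF d(1)] hB[OF e(1)] unfolding B_def d(2) e(2) by auto
  qed
  have dec: "\<exists>X\<in>T. decides X (seq_of S)" if S: "S \<in> Rl" for S
  proof -
    have "st S \<in> elts (pw omg)" using sub_st_omg[OF S] by simp
    then obtain a where a: "a \<epsilon> w" "H a = st S" using H(2) unfolding bij_betw_def by (metis imageE in_elts)
    have "decides (rl (h a)) (seq_of S)" using hB[OF a(1)] S unfolding B_def a(2) by simp
    then show ?thesis unfolding T_def using a(1) by auto
  qed
  have dec1: "\<exists>X\<in>T. finite (X \<inter> A) \<or> finite (X - A)" if A: "A \<in> Rl" for A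
  proof -
    have "{z. snd (prod_decode z) \<in> A} \<in> Rl" by (rule Rl_I) (intro dfn Dfn_mem_Rl[OF A])
    from dec[OF this] have "\<exists>X\<in>T. decides X (\<lambda>_. A)" unfolding seq_of_def by simp
    then show ?thesis unfolding decides_def by simp
  qed
  define u where "u = mk {a \<in> elts (pw omg). \<exists>d. d \<epsilon> w \<and> finite (rl (h d) - rl a)}"
  have smu: "small {a \<in> elts (pw omg). \<exists>d. d \<epsilon> w \<and> finite (rl (h d) - rl a)}"
    by (rule small_sep[OF small_elts]) (intro dfn Trm_sub1[OF h(2)])
  have mu: "a \<epsilon> u \<longleftrightarrow> sub a omg \<and> (\<exists>X\<in>T. finite (X - rl a))" for a
    unfolding u_def mem_mk[OF smu] T_def by auto
  have us: "X \<in> us u \<longleftrightarrow> X \<in> Rl \<and> (\<exists>Z\<in>T. finite (Z - X))" for X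
    unfolding us_def mu using sub_st_omg by auto
  have clash: False if "A \<in> T" "Z \<in> T" "finite (A - X)" "finite (Z \<inter> X)" for A Z X
    using that by (rule tower_ultrafilter(1)[of T, OF inf chain, rotated 3])
  have meet: "\<exists>C\<in>T. finite (C - (X \<inter> Y))" if "A \<in> T" "Z \<in> T" "finite (A - X)" "finite (Z - Y)" for A Z X Y
    using that by (rule tower_ultrafilter(2)[of T, OF inf chain, rotated 3])
  have uf: "is_ultrafilter omg u" unfolding is_ultrafilter_iff
  proof (intro conjI ballI allI impI)
    show "sub a omg" if "a \<epsilon> u" for a using that mu by blast
    show "{} \<notin> us u" using us inf by auto
    show "Z \<in> us u" if X: "X \<in> us u" "Z \<in> Rl" "X \<subseteq> Z" for X Z
    proof -
      obtain A where A: "A \<in> T" "finite (A - X)" using X(1) us by blast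
      have "finite (A - Z)" by (rule finite_subset[OF _ A(2)]) (use X(3) in blast)
      then show ?thesis using us X(2) A(1) by blast
    qed
    show "X \<inter> Z \<in> us u" if X: "X \<in> us u" and Z: "Z \<in> us u" for X Z
    proof -
      obtain A where A: "A \<in> T" "finite (A - X)" using X us by blast
      obtain A' where A': "A' \<in> T" "finite (A' - Z)" using Z us by blast
      show ?thesis using meet[OF A(1) A'(1) A(2) A'(2)] X Z us Rl_Int by simp
    qed
    show "A \<in> us u \<or> - A \<in> us u" if A: "A \<in> Rl" for A
      using dec1[OF A] us A Rl_Compl[OF A] by (auto simp: Diff_eq)
    show "- A \<in> us u" if A: "finite A" for A
    proof -
      obtain X where X: "X \<in> T" using dec1[OF Rl_empty] by blast
      have "finite (X - - A)" by (rule finite_subset[OF _ A]) blast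
      then show ?thesis using X us Rl_Compl[OF Rl_finite[OF A]] by blast
    qed
  qed
  have P: "is_P_point omg u" unfolding is_P_point_iff
  proof (intro conjI ballI impI uf)
    fix S assume S: "S \<in> Rl" and Su: "\<forall>q. seq_of S q \<in> us u"
    obtain X where X: "X \<in> T" "decides X (seq_of S)" using dec[OF S] by blast
    have "\<not> finite (X \<inter> seq_of S q)" for q
    proof
      assume fin: "finite (X \<inter> seq_of S q)"
      obtain A where A: "A \<in> T" "finite (A - seq_of S q)" using Su[THEN spec, of q] us by blast
      show False by (rule clash[OF A(1) X(1) A(2) fin])
    qed
    then have "\<forall>q. finite (X - seq_of S q)" using X(2) unfolding decides_def by blast
    moreover have "X \<in> us u"
    proof -
      have "X \<in> Rl" using X(1) unfolding T_def by auto
      then show ?thesis unfolding us using X(1) by (intro conjI bexI[of _ X]) simp_all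
    qed
    ultimately show "\<exists>D\<in>us u. \<forall>q. finite (D - seq_of S q)" by blast
  qed
  have "code_le_dual one_one_map omg l r u" unfolding code_le_dual_def
  proof (rule exI[of _ "lam (elts omg) (\<lambda>x. x)"], intro conjI allI impI)
    have DI: "DF (\<lambda>x. x)" by (intro dfn)
    have map: "is_map (lam (elts omg) (\<lambda>x. x)) omg omg" by (rule is_map_lam(1)[OF DI])
    have rel: "related (lam (elts omg) (\<lambda>x. x)) x y \<longleftrightarrow> x \<epsilon> omg \<and> y = x" for x y
      by (rule is_map_lam(2)[where F = "\<lambda>x. x" and b = omg, OF DI])
    show "one_one_map omg (lam (elts omg) (\<lambda>x. x))"
      unfolding one_one_map_def is_inj_map_def rel using map by blast
    fix b assume b: "in_coded_family omg l r b"
    then have sb: "sub b omg" unfolding in_coded_family_def by blast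
    have bK: "rl b \<in> K" using coded_subset_KI[OF y] in_coded_family_iff[OF code sb] b unfolding K_def by blast
    have "is_preimage omg b (lam (elts omg) (\<lambda>x. x)) b"
      unfolding is_preimage_def rel using sb unfolding sub_def by auto
    moreover have "in_dual omg u b"
    proof -
      obtain X where X: "X \<in> T" "finite (X \<inter> rl b) \<or> finite (X - rl b)" using dec1[OF rl_in_Rl] by blast
      have "\<not> finite (X - rl b)" using ideal_almost_subset[OF K bK] TK[OF X(1)] by blast
      then have "finite (X - - rl b)" using X(2) by (simp add: Diff_eq)
      then have "- rl b \<in> us u" unfolding us using X(1) Rl_Compl by blast
      moreover have "\<forall>a. a \<epsilon> u \<longrightarrow> sub a omg" using mu by blast
      ultimately have "in_dual omg u (st (rl b))" using in_dual_st by simp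
      then show ?thesis unfolding st_rl[OF sb] .
    qed
    ultimately show "\<exists>d. is_preimage omg d (lam (elts omg) (\<lambda>x. x)) b \<and> in_dual omg u d" by blast
  qed
  with P show ?thesis unfolding P_point_not_J_point_def is_omega_iff by blast
qed

end

section \<open>The three kinds of ultrafilters, and the equivalences\<close>

lemma (in zfc_model) one_one_map_fin_one_map:
  assumes "one_one_map omg f" shows "fin_one_map omg f"
  unfolding fin_one_map_def
proof (intro conjI allI impI)
  show "is_map f omg omg" using assms unfolding one_one_map_def is_inj_map_def by blast
  fix y s d assume *: "y \<epsilon> omg \<and> is_upair s y y \<and> is_preimage omg d f s"
  have s: "z \<epsilon> s \<longleftrightarrow> z = y" for z using * unfolding is_upair_def by blast
  have "x \<epsilon> d \<longleftrightarrow> x \<epsilon> omg \<and> (\<exists>y. y \<epsilon> s \<and> related f x y)" for x using * unfolding is_preimage_def by simp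
  then have d: "related f x y" if "x \<epsilon> d" for x using that s by auto
  have "x = x'" if "x \<epsilon> d" "x' \<epsilon> d" for x x'
    using assms d[OF that(1)] d[OF that(2)] unfolding one_one_map_def is_inj_map_def by blast
  then have "\<exists>x. elts d \<subseteq> {x}" 
    unfolding subset_iff in_elts singleton_iff by blast
  then show "is_finite d" unfolding is_finite_iff using finite_subset by blast
qed

lemma (in zfc_model) P_point_not_J_cases:
  "P_point_not_J_point l r \<Longrightarrow> P_point_not_weak_J_ultrafilter l r"
  "P_point_not_weak_J_ultrafilter l r \<Longrightarrow> P_point_not_J_ultrafilter l r"
proof -
  have "code_le_dual fin_one_map omg l r u" if "code_le_dual one_one_map omg l r u" for u
    using that one_one_map_fin_one_map unfolding code_le_dual_def by blast
  then show "P_point_not_J_point l r \<Longrightarrow> P_point_not_weak_J_ultrafilter l r"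
    unfolding P_point_not_J_point_def P_point_not_weak_J_ultrafilter_def is_omega_iff by blast
  have "code_le_dual any_map omg l r u" if "code_le_dual fin_one_map omg l r u" for u
    using that unfolding code_le_dual_def fin_one_map_def any_map_def by blast
  then show "P_point_not_weak_J_ultrafilter l r \<Longrightarrow> P_point_not_J_ultrafilter l r"
    unfolding P_point_not_J_ultrafilter_def P_point_not_weak_J_ultrafilter_def is_omega_iff by blast
qed

lemma ctm_zfc_model: "ctm_with_code c E l r \<Longrightarrow> zfc_model E"
  unfolding ctm_with_code_def by unfold_locales blast+

lemma ctm_coded_ideal_model:
  assumes "coded_ideal c" and ctm: "ctm_with_code c E l r" shows "coded_ideal_model E c l r"
proof -
  interpret coded_ideal c by fact
  interpret zfc_model E by (rule ctm_zfc_model[OF ctm])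
  show ?thesis using ctm unfolding ctm_with_code_def by unfold_locales blast+
qed

text \<open>All three variants at once: \<open>\<phi>\<close> lies between the strongest and the
  weakest of them. A single model with a P-point as in \<open>\<phi>\<close> yields a witness in the
  universe, and this witness serves both the universe under CH and every model of CH. The converse
  only needs one model of CH.\<close>

theorem consistent_iff_CH_implies:
  assumes c: "coded_ideal c" and ctm: "\<exists>E l r. ctm_with_code c E l r"
    and strong: "\<And>E l r. ctm_with_code c E l r \<Longrightarrow> set_structure.P_point_not_J_point E l r \<Longrightarrow> \<phi> E l r"
    and weak: "\<And>E l r. ctm_with_code c E l r \<Longrightarrow> \<phi> E l r \<Longrightarrow> set_structure.P_point_not_J_ultrafilter E l r"
    and Q: "\<And>U. P_point U \<Longrightarrow> \<not> J_point (coded_family c) U \<Longrightarrow> Q"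
  shows "consistent_with_ZFC \<phi> c \<longleftrightarrow> (CH \<longrightarrow> Q) \<and> CH_implies_in_models \<phi> c"
proof
  interpret coded_ideal c by fact
  assume "consistent_with_ZFC \<phi> c"
  then obtain E l r where E: "ctm_with_code c E l r" "\<phi> E l r" unfolding consistent_with_ZFC_def by blast
  interpret E: coded_ideal_model E c l r by (rule ctm_coded_ideal_model[OF c E(1)])
  obtain x where x: "wit c x" using E.P_point_wit[OF weak[OF E]] by blast
  have Q if CH
    using CH_P_point[OF that wit_extendable[OF x]] Q by blast
  moreover have "\<phi> E' l' r'" if E': "ctm_with_code c E' l' r'" "set_structure.satisfies_CH E'" for E' l' r'
  proof -
    interpret E': coded_ideal_model E' c l' r' by (rule ctm_coded_ideal_model[OF c E'(1)])
    show ?thesis by (rule strong[OF E'(1) E'.wit_P_point_model[OF E'(2) x]])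
  qed
  ultimately show "(CH \<longrightarrow> Q) \<and> CH_implies_in_models \<phi> c" unfolding CH_implies_in_models_def by blast
next
  assume "(CH \<longrightarrow> Q) \<and> CH_implies_in_models \<phi> c"
  moreover obtain E l r where "ctm_with_code c E l r" "set_structure.satisfies_CH E"
    using ctm ctm_CH by blast
  ultimately show "consistent_with_ZFC \<phi> c"
    unfolding consistent_with_ZFC_def CH_implies_in_models_def by blast
qed

theorem theorem6p3:
  fixes J :: "nat set set"
  assumes "ideal J"
  shows
    "((extendable_to_P_plus J \<longleftrightarrow> \<not> preceq_omega1 UNIV one_one Fin2_nat J) \<and>
      (extendable_to_P_plus J \<longleftrightarrow> \<not> preceq_omega1 UNIV fin_one Fin2_nat J) \<and>
      (extendable_to_P_plus J \<longleftrightarrow> \<not> preceq_omega1 UNIV UNIV Fin2_nat J)) \<and>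
     (CH \<longrightarrow>
        (extendable_to_P_plus J \<longleftrightarrow> (\<exists>U. P_point U \<and> \<not> J_point J U)) \<and>
        (extendable_to_P_plus J \<longleftrightarrow> (\<exists>U. P_point U \<and> \<not> weak_J_ultrafilter J U)) \<and>
        (extendable_to_P_plus J \<longleftrightarrow> (\<exists>U. P_point U \<and> \<not> J_ultrafilter J U))) \<and>
     (borel_family J \<and> p_eq_c \<longrightarrow>
        (extendable_to_P_plus J \<longleftrightarrow> (\<exists>U. P_point U \<and> \<not> J_point J U)) \<and>
        (extendable_to_P_plus J \<longleftrightarrow> (\<exists>U. P_point U \<and> \<not> weak_J_ultrafilter J U)) \<and>
        (extendable_to_P_plus J \<longleftrightarrow> (\<exists>U. P_point U \<and> \<not> J_ultrafilter J U))) \<and>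
     (borel_family J \<longrightarrow>
       (\<forall>c. is_borel_code c \<and> coded_family c = J \<and> (\<exists>E l r. ctm_with_code c E l r) \<longrightarrow>
          (consistent_with_ZFC set_structure.P_point_not_J_point c \<longleftrightarrow>
             (CH \<longrightarrow> (\<exists>U. P_point U \<and> \<not> J_point J U)) \<and>
             CH_implies_in_models set_structure.P_point_not_J_point c) \<and>
          (consistent_with_ZFC set_structure.P_point_not_weak_J_ultrafilter c \<longleftrightarrow>
             (CH \<longrightarrow> (\<exists>U. P_point U \<and> \<not> weak_J_ultrafilter J U)) \<and>
             CH_implies_in_models set_structure.P_point_not_weak_J_ultrafilter c) \<and>
          (consistent_with_ZFC set_structure.P_point_not_J_ultrafilter c \<longleftrightarrow>
             (CH \<longrightarrow> (\<exists>U. P_point U \<and> \<not> J_ultrafilter J U)) \<and>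
             CH_implies_in_models set_structure.P_point_not_J_ultrafilter c)))"
proof (intro conjI impI)
  note J = assms
  show "extendable_to_P_plus J \<longleftrightarrow> \<not> preceq_omega1 UNIV one_one Fin2_nat J"
    "extendable_to_P_plus J \<longleftrightarrow> \<not> preceq_omega1 UNIV fin_one Fin2_nat J"
    "extendable_to_P_plus J \<longleftrightarrow> \<not> preceq_omega1 UNIV UNIV Fin2_nat J"
    by (rule extendable_iff_not_preceq[OF J])+
next
  assume CH
  note * = P_point_equivalences[OF assms CH_P_point[OF this]]
  show "extendable_to_P_plus J \<longleftrightarrow> (\<exists>U. P_point U \<and> \<not> J_point J U)"
    "extendable_to_P_plus J \<longleftrightarrow> (\<exists>U. P_point U \<and> \<not> weak_J_ultrafilter J U)"
    "extendable_to_P_plus J \<longleftrightarrow> (\<exists>U. P_point U \<and> \<not> J_ultrafilter J U)"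
    using * by blast+
next
  assume p: "borel_family J \<and> p_eq_c"
  note * = P_point_equivalences[OF assms p_eq_c_P_point[OF conjunct2[OF p] conjunct1[OF p] assms]]
  show "extendable_to_P_plus J \<longleftrightarrow> (\<exists>U. P_point U \<and> \<not> J_point J U)"
    "extendable_to_P_plus J \<longleftrightarrow> (\<exists>U. P_point U \<and> \<not> weak_J_ultrafilter J U)"
    "extendable_to_P_plus J \<longleftrightarrow> (\<exists>U. P_point U \<and> \<not> J_ultrafilter J U)"
    using * by blast+
next
  show "\<forall>c. is_borel_code c \<and> coded_family c = J \<and> (\<exists>E l r. ctm_with_code c E l r) \<longrightarrow>
          (consistent_with_ZFC set_structure.P_point_not_J_point c \<longleftrightarrow>
             (CH \<longrightarrow> (\<exists>U. P_point U \<and> \<not> J_point J U)) \<and>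
             CH_implies_in_models set_structure.P_point_not_J_point c) \<and>
          (consistent_with_ZFC set_structure.P_point_not_weak_J_ultrafilter c \<longleftrightarrow>
             (CH \<longrightarrow> (\<exists>U. P_point U \<and> \<not> weak_J_ultrafilter J U)) \<and>
             CH_implies_in_models set_structure.P_point_not_weak_J_ultrafilter c) \<and>
          (consistent_with_ZFC set_structure.P_point_not_J_ultrafilter c \<longleftrightarrow>
             (CH \<longrightarrow> (\<exists>U. P_point U \<and> \<not> J_ultrafilter J U)) \<and>
             CH_implies_in_models set_structure.P_point_not_J_ultrafilter c)"
  proof (intro allI impI)
    fix c assume c: "is_borel_code c \<and> coded_family c = J \<and> (\<exists>E l r. ctm_with_code c E l r)"
    then have ci: "coded_ideal c" using assms by unfold_locales simp_all
    have J: "coded_family c = J" and ctm: "\<exists>E l r. ctm_with_code c E l r" using c by simp_all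
    note m = zfc_model.P_point_not_J_cases[OF ctm_zfc_model]
    note v = not_J_point_cases(1,2)[where J = J]
    show "(consistent_with_ZFC set_structure.P_point_not_J_point c \<longleftrightarrow>
             (CH \<longrightarrow> (\<exists>U. P_point U \<and> \<not> J_point J U)) \<and>
             CH_implies_in_models set_structure.P_point_not_J_point c) \<and>
          (consistent_with_ZFC set_structure.P_point_not_weak_J_ultrafilter c \<longleftrightarrow>
             (CH \<longrightarrow> (\<exists>U. P_point U \<and> \<not> weak_J_ultrafilter J U)) \<and>
             CH_implies_in_models set_structure.P_point_not_weak_J_ultrafilter c) \<and>
          (consistent_with_ZFC set_structure.P_point_not_J_ultrafilter c \<longleftrightarrow>
             (CH \<longrightarrow> (\<exists>U. P_point U \<and> \<not> J_ultrafilter J U)) \<and>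
             CH_implies_in_models set_structure.P_point_not_J_ultrafilter c)"
    proof (intro conjI)
      show "consistent_with_ZFC set_structure.P_point_not_J_point c \<longleftrightarrow>
             (CH \<longrightarrow> (\<exists>U. P_point U \<and> \<not> J_point J U)) \<and>
             CH_implies_in_models set_structure.P_point_not_J_point c"
        by (rule consistent_iff_CH_implies[OF ci ctm]) (use m in \<open>auto simp: J\<close>)
      show "consistent_with_ZFC set_structure.P_point_not_weak_J_ultrafilter c \<longleftrightarrow>
             (CH \<longrightarrow> (\<exists>U. P_point U \<and> \<not> weak_J_ultrafilter J U)) \<and>
             CH_implies_in_models set_structure.P_point_not_weak_J_ultrafilter c"
        by (rule consistent_iff_CH_implies[OF ci ctm]) (use m v(1) in \<open>auto simp: J\<close>)
      show "consistent_with_ZFC set_structure.P_point_not_J_ultrafilter c \<longleftrightarrow>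
             (CH \<longrightarrow> (\<exists>U. P_point U \<and> \<not> J_ultrafilter J U)) \<and>
             CH_implies_in_models set_structure.P_point_not_J_ultrafilter c"
        by (rule consistent_iff_CH_implies[OF ci ctm]) (use m v in \<open>auto simp: J\<close>)
    qed
  qed
qed

end
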